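(* The fragment of $\mathbf{C}^2$ with cardinality constraints and a single bipartite axiom $bipartite(R)$ is domain-liftable.
   Context: $\mathbf{C}^2$: function-free first-order logic with at most two variables plus counting quantifiers $\exists_{=k},\exists_{\le k},\exists_{\ge k}$. A possible world over $[n]=\{1,\dots,n\}$ assigns truth values to all ground atoms; its weight $W(\mu,w,\overline{w})$ under real weighting functions $w,\overline{w}$ on predicates is the product of $w(P)$ over true ground atoms of $P$ and $\overline{w}(P)$ over false ones; $\mathrm{WFOMC}(\Psi,n,w,\overline{w})$ is the sum of the weights of the models of $\Psi$ over $[n]$. "$\mathbf{C}^2$ with cardinality constraints" means sentences $\Phi\wedge\Gamma$ with $\Phi\in\mathbf{C}^2$ and $\Gamma$ a conjunction of cardinality constraints $|P|\bowtie m$ (restricting the number of true ground atoms of $P$) and ground unary literals $P(a)$, $\neg P(a)$. For a binary predicate $R$, $G(R)$ is the graph on the domain with edge $a\to b$ iff $R(a,b)$; $\mathrm{WFOMC}(\Psi\wedge ax(R),n,w,\overline{w})$ sums weights of models of $\Psi$ whose $R$ satisfies the axiom $ax$. The axiom $bipartite(R)$ requires $R$ to be symmetric and irreflexive and the simple undirected graph $G(R)$ to be bipartite. Domain-liftable: for every fixed $\Phi\in\mathbf{C}^2$, fixed $w,\overline{w}$, fixed $R$, $\mathrm{WFOMC}(\Phi\wedge\Gamma\wedge ax(R),n,w,\overline{w})$ is computable in time polynomial in $n$ ($n$ in unary, $\Gamma$ part of the input in binary, possibly depending on $n$). *)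

theory Defs
  imports Complex_Main "HOL-Library.Log_Nat" "HOL-Computational_Algebra.Polynomial"
begin

section \<open>The two-variable fragment with counting\<close>

text \<open>A finite relational vocabulary is a list of arities: its predicate symbols are the
  \<open>p < length ar\<close>, and \<open>p\<close> has arity \<open>ar ! p\<close> (any arity, including 0, is allowed).\<close>

type_synonym vocab = "nat list"

datatype var = X | Y

datatype fm =
    Atom nat "var list"
  | Eq var var
  | Neg fm
  | Conj fm fm
  | Disj fm fm
  | All var fm
  | Ex var fm
  | ExEq nat var fm  \<comment> \<open>exactly \<open>k\<close>\<close>
  | ExLe nat var fm  \<comment> \<open>at most \<open>k\<close>\<close>
  | ExGe nat var fm  \<comment> \<open>at least \<open>k\<close>\<close>

fun free_vars :: "fm \<Rightarrow> var set" where
  "free_vars (Atom p vs) = set vs"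
| "free_vars (Eq u v) = {u, v}"
| "free_vars (Neg \<phi>) = free_vars \<phi>"
| "free_vars (Conj \<phi> \<psi>) = free_vars \<phi> \<union> free_vars \<psi>"
| "free_vars (Disj \<phi> \<psi>) = free_vars \<phi> \<union> free_vars \<psi>"
| "free_vars (All v \<phi>) = free_vars \<phi> - {v}"
| "free_vars (Ex v \<phi>) = free_vars \<phi> - {v}"
| "free_vars (ExEq k v \<phi>) = free_vars \<phi> - {v}"
| "free_vars (ExLe k v \<phi>) = free_vars \<phi> - {v}"
| "free_vars (ExGe k v \<phi>) = free_vars \<phi> - {v}"

fun well_formed :: "vocab \<Rightarrow> fm \<Rightarrow> bool" where
  "well_formed ar (Atom p vs) \<longleftrightarrow> p < length ar \<and> length vs = ar ! p"
| "well_formed ar (Eq u v) \<longleftrightarrow> True"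
| "well_formed ar (Neg \<phi>) \<longleftrightarrow> well_formed ar \<phi>"
| "well_formed ar (Conj \<phi> \<psi>) \<longleftrightarrow> well_formed ar \<phi> \<and> well_formed ar \<psi>"
| "well_formed ar (Disj \<phi> \<psi>) \<longleftrightarrow> well_formed ar \<phi> \<and> well_formed ar \<psi>"
| "well_formed ar (All v \<phi>) \<longleftrightarrow> well_formed ar \<phi>"
| "well_formed ar (Ex v \<phi>) \<longleftrightarrow> well_formed ar \<phi>"
| "well_formed ar (ExEq k v \<phi>) \<longleftrightarrow> well_formed ar \<phi>"
| "well_formed ar (ExLe k v \<phi>) \<longleftrightarrow> well_formed ar \<phi>"
| "well_formed ar (ExGe k v \<phi>) \<longleftrightarrow> well_formed ar \<phi>"

definition C2_sentence :: "vocab \<Rightarrow> fm \<Rightarrow> bool" where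
  "C2_sentence ar \<phi> \<longleftrightarrow> well_formed ar \<phi> \<and> free_vars \<phi> = {}"


section \<open>Possible worlds and weighted model counting\<close>

type_synonym gatom = "nat \<times> nat list"

type_synonym world = "gatom set"  \<comment> \<open>the set of true ground atoms\<close>

definition ground_atoms :: "vocab \<Rightarrow> nat \<Rightarrow> gatom set" where
  "ground_atoms ar n = {(p, as). p < length ar \<and> length as = ar ! p \<and> set as \<subseteq> {1..n}}"

definition worlds :: "vocab \<Rightarrow> nat \<Rightarrow> world set" where
  "worlds ar n = Pow (ground_atoms ar n)"

fun sat :: "nat \<Rightarrow> world \<Rightarrow> (var \<Rightarrow> nat) \<Rightarrow> fm \<Rightarrow> bool" where
  "sat n \<mu> e (Atom p vs) \<longleftrightarrow> (p, map e vs) \<in> \<mu>"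
| "sat n \<mu> e (Eq u v) \<longleftrightarrow> e u = e v"
| "sat n \<mu> e (Neg \<phi>) \<longleftrightarrow> \<not> sat n \<mu> e \<phi>"
| "sat n \<mu> e (Conj \<phi> \<psi>) \<longleftrightarrow> sat n \<mu> e \<phi> \<and> sat n \<mu> e \<psi>"
| "sat n \<mu> e (Disj \<phi> \<psi>) \<longleftrightarrow> sat n \<mu> e \<phi> \<or> sat n \<mu> e \<psi>"
| "sat n \<mu> e (All v \<phi>) \<longleftrightarrow> (\<forall>a\<in>{1..n}. sat n \<mu> (e(v := a)) \<phi>)"
| "sat n \<mu> e (Ex v \<phi>) \<longleftrightarrow> (\<exists>a\<in>{1..n}. sat n \<mu> (e(v := a)) \<phi>)"
| "sat n \<mu> e (ExEq k v \<phi>) \<longleftrightarrow> card {a\<in>{1..n}. sat n \<mu> (e(v := a)) \<phi>} = k"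
| "sat n \<mu> e (ExLe k v \<phi>) \<longleftrightarrow> card {a\<in>{1..n}. sat n \<mu> (e(v := a)) \<phi>} \<le> k"
| "sat n \<mu> e (ExGe k v \<phi>) \<longleftrightarrow> card {a\<in>{1..n}. sat n \<mu> (e(v := a)) \<phi>} \<ge> k"

text \<open>Used for sentences only, for which the choice of environment is irrelevant.\<close>

definition is_model :: "nat \<Rightarrow> world \<Rightarrow> fm \<Rightarrow> bool" where
  "is_model n \<mu> \<phi> \<longleftrightarrow> sat n \<mu> (\<lambda>_. 1) \<phi>"

definition weight :: "vocab \<Rightarrow> nat \<Rightarrow> (nat \<Rightarrow> real) \<Rightarrow> (nat \<Rightarrow> real) \<Rightarrow> world \<Rightarrow> real" where
  "weight ar n w wbar \<mu> =
     (\<Prod>a\<in>ground_atoms ar n. if a \<in> \<mu> then w (fst a) else wbar (fst a))"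

text \<open>The weighted model count of an arbitrary property \<open>\<Psi>\<close> of possible worlds.\<close>

definition wfomc ::
  "vocab \<Rightarrow> (world \<Rightarrow> bool) \<Rightarrow> nat \<Rightarrow> (nat \<Rightarrow> real) \<Rightarrow> (nat \<Rightarrow> real) \<Rightarrow> real" where
  "wfomc ar \<Psi> n w wbar = (\<Sum>\<mu>\<in>{\<mu>\<in>worlds ar n. \<Psi> \<mu>}. weight ar n w wbar \<mu>)"


section \<open>Cardinality constraints and ground unary literals\<close>

datatype cmp = CLt | CLe | CEq | CGe | CGt

fun cmp_holds :: "cmp \<Rightarrow> nat \<Rightarrow> nat \<Rightarrow> bool" where
  "cmp_holds CLt a b \<longleftrightarrow> a < b"
| "cmp_holds CLe a b \<longleftrightarrow> a \<le> b"
| "cmp_holds CEq a b \<longleftrightarrow> a = b"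
| "cmp_holds CGe a b \<longleftrightarrow> a \<ge> b"
| "cmp_holds CGt a b \<longleftrightarrow> a > b"

datatype constr =
    Card nat cmp nat
  | PosLit nat nat
  | NegLit nat nat

fun constr_ok :: "vocab \<Rightarrow> nat \<Rightarrow> constr \<Rightarrow> bool" where
  "constr_ok ar n (Card p r m) \<longleftrightarrow> p < length ar"
| "constr_ok ar n (PosLit p a) \<longleftrightarrow> p < length ar \<and> ar ! p = 1 \<and> a \<in> {1..n}"
| "constr_ok ar n (NegLit p a) \<longleftrightarrow> p < length ar \<and> ar ! p = 1 \<and> a \<in> {1..n}"

fun constr_holds :: "world \<Rightarrow> constr \<Rightarrow> bool" where
  "constr_holds \<mu> (Card p r m) \<longleftrightarrow> cmp_holds r (card {as. (p, as) \<in> \<mu>}) m"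
| "constr_holds \<mu> (PosLit p a) \<longleftrightarrow> (p, [a]) \<in> \<mu>"
| "constr_holds \<mu> (NegLit p a) \<longleftrightarrow> (p, [a]) \<notin> \<mu>"

text \<open>A conjunction \<open>\<Gamma>\<close> of constraints is a \<^typ>\<open>constr list\<close>.\<close>


section \<open>Graph axioms\<close>

definition graph_of :: "world \<Rightarrow> nat \<Rightarrow> (nat \<times> nat) set" where
  "graph_of \<mu> R = {(a, b). (R, [a, b]) \<in> \<mu>}"

text \<open>An axiom is a property of a vertex set and an edge relation on it.\<close>

type_synonym graph_axiom = "nat set \<Rightarrow> (nat \<times> nat) set \<Rightarrow> bool"

definition bipartite_graph :: "nat set \<Rightarrow> (nat \<times> nat) set \<Rightarrow> bool" where
  "bipartite_graph V E \<longleftrightarrow> (\<exists>A B. A \<union> B = V \<and> A \<inter> B = {} \<and> E \<subseteq> A \<times> B \<union> B \<times> A)"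

definition bipartite :: graph_axiom where
  "bipartite V E \<longleftrightarrow> sym E \<and> irrefl E \<and> bipartite_graph V E"

definition conj_with_axiom ::
  "fm \<Rightarrow> constr list \<Rightarrow> graph_axiom \<Rightarrow> nat \<Rightarrow> nat \<Rightarrow> world \<Rightarrow> bool" where
  "conj_with_axiom \<Phi> \<Gamma> ax R n \<mu> \<longleftrightarrow>
     is_model n \<mu> \<Phi> \<and> (\<forall>c\<in>set \<Gamma>. constr_holds \<mu> c) \<and> ax {1..n} (graph_of \<mu> R)"


section \<open>The machine model\<close>

text \<open>
  A random access machine with logarithmic cost, given as a structured programming language.
  Integer cells hold integers in binary; every integer operation costs the bit lengths of the
  values and addresses involved.

  As the weights are arbitrary real numbers, there are also number cells that hold reals. On
  these a program can only do exact ring arithmetic, starting from integers and from the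
  weights (the only real constants it has); it cannot inspect their contents. Each number
  carries a formal size, which is charged whenever the number is computed or read: the bit
  length for an integer, 1 for a weight, the maximum plus one for a sum or difference, and the
  sum for a product. Hence unit-cost tricks such as writing down \<open>2 ^ (2 ^ n)\<close> by repeated
  squaring are not available. If the weights are rational, a number of size \<open>s\<close> is an integer
  divided by \<open>D ^ s\<close> and has absolute value at most \<open>C ^ s\<close>, for constants \<open>C\<close> and \<open>D\<close>
  that depend on the weights only. It then has a binary representation of length \<open>O(s)\<close>, so
  polynomial time in this model is polynomial time in the usual bit model.
\<close>

datatype iexp =
    Const int
  | Cell iexp  \<comment> \<open>content of the integer cell with the given address\<close>
  | Add iexp iexp
  | Sub iexp iexp
  | Mul iexp iexp
  | Div iexp iexp
  | Mod iexp iexp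

datatype nexp =
    OfInt iexp
  | Wt nat  \<comment> \<open>the weight \<open>w p\<close>\<close>
  | WtBar nat  \<comment> \<open>the weight \<open>wbar p\<close>\<close>
  | NCell iexp  \<comment> \<open>content of the number cell with the given address\<close>
  | NAdd nexp nexp
  | NSub nexp nexp
  | NMul nexp nexp

datatype com =
    Skip
  | ISet iexp iexp  \<comment> \<open>address, value\<close>
  | NSet iexp nexp  \<comment> \<open>address, value\<close>
  | Seq com com
  | IfPos iexp com com
  | WhilePos iexp com

type_synonym imem = "int \<Rightarrow> int"
type_synonym nmem = "int \<Rightarrow> real \<times> nat"  \<comment> \<open>value and formal size\<close>

text \<open>Bit length, with one extra bit for the sign.\<close>

definition len :: "int \<Rightarrow> nat" where
  "len i = Suc (nat (bitlen \<bar>i\<bar>))"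

fun ival :: "imem \<Rightarrow> iexp \<Rightarrow> int" where
  "ival m (Const i) = i"
| "ival m (Cell e) = m (ival m e)"
| "ival m (Add e f) = ival m e + ival m f"
| "ival m (Sub e f) = ival m e - ival m f"
| "ival m (Mul e f) = ival m e * ival m f"
| "ival m (Div e f) = ival m e div ival m f"
| "ival m (Mod e f) = ival m e mod ival m f"

fun icost :: "imem \<Rightarrow> iexp \<Rightarrow> nat" where
  "icost m (Const i) = len i"
| "icost m (Cell e) = icost m e + len (m (ival m e))"
| "icost m (Add e f) = icost m e + icost m f + len (ival m (Add e f))"
| "icost m (Sub e f) = icost m e + icost m f + len (ival m (Sub e f))"
| "icost m (Mul e f) = icost m e + icost m f + len (ival m (Mul e f))"
| "icost m (Div e f) = icost m e + icost m f + len (ival m (Div e f))"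
| "icost m (Mod e f) = icost m e + icost m f + len (ival m (Mod e f))"

context
  fixes w wbar :: "nat \<Rightarrow> real"
begin

fun nval :: "imem \<Rightarrow> nmem \<Rightarrow> nexp \<Rightarrow> real" where
  "nval m r (OfInt e) = of_int (ival m e)"
| "nval m r (Wt p) = w p"
| "nval m r (WtBar p) = wbar p"
| "nval m r (NCell e) = fst (r (ival m e))"
| "nval m r (NAdd e f) = nval m r e + nval m r f"
| "nval m r (NSub e f) = nval m r e - nval m r f"
| "nval m r (NMul e f) = nval m r e * nval m r f"

fun nsize :: "imem \<Rightarrow> nmem \<Rightarrow> nexp \<Rightarrow> nat" where
  "nsize m r (OfInt e) = len (ival m e)"
| "nsize m r (Wt p) = 1"
| "nsize m r (WtBar p) = 1"
| "nsize m r (NCell e) = snd (r (ival m e))"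
| "nsize m r (NAdd e f) = Suc (max (nsize m r e) (nsize m r f))"
| "nsize m r (NSub e f) = Suc (max (nsize m r e) (nsize m r f))"
| "nsize m r (NMul e f) = nsize m r e + nsize m r f"

fun ncost :: "imem \<Rightarrow> nmem \<Rightarrow> nexp \<Rightarrow> nat" where
  "ncost m r (OfInt e) = icost m e + len (ival m e)"
| "ncost m r (Wt p) = 1"
| "ncost m r (WtBar p) = 1"
| "ncost m r (NCell e) = icost m e + snd (r (ival m e))"
| "ncost m r (NAdd e f) = ncost m r e + ncost m r f + nsize m r (NAdd e f)"
| "ncost m r (NSub e f) = ncost m r e + ncost m r f + nsize m r (NSub e f)"
| "ncost m r (NMul e f) = ncost m r e + ncost m r f + nsize m r (NMul e f)"

text \<open>\<open>exec c s t s'\<close>: started in \<open>s\<close>, the program \<open>c\<close> halts in \<open>s'\<close> after time \<open>t\<close>.\<close>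

inductive exec :: "com \<Rightarrow> imem \<times> nmem \<Rightarrow> nat \<Rightarrow> imem \<times> nmem \<Rightarrow> bool" where
  Skip: "exec Skip s 1 s"
| ISet: "exec (ISet a e) (m, r) (icost m a + icost m e) (m(ival m a := ival m e), r)"
| NSet: "exec (NSet a e) (m, r) (icost m a + ncost m r e)
           (m, r(ival m a := (nval m r e, nsize m r e)))"
| Seq: "exec c s t s' \<Longrightarrow> exec d s' t' s'' \<Longrightarrow> exec (Seq c d) s (t + t') s''"
| IfPos: "ival (fst s) e > 0 \<Longrightarrow> exec c s t s' \<Longrightarrow>
           exec (IfPos e c d) s (icost (fst s) e + t) s'"
| IfNotPos: "ival (fst s) e \<le> 0 \<Longrightarrow> exec d s t s' \<Longrightarrow>
           exec (IfPos e c d) s (icost (fst s) e + t) s'"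
| WhilePos: "ival (fst s) e > 0 \<Longrightarrow> exec c s t s' \<Longrightarrow> exec (WhilePos e c) s' t' s'' \<Longrightarrow>
           exec (WhilePos e c) s (icost (fst s) e + t + t') s''"
| WhileNotPos: "ival (fst s) e \<le> 0 \<Longrightarrow> exec (WhilePos e c) s (icost (fst s) e) s"

end

text \<open>Programs are deterministic, so halting, running time and output are well-defined.\<close>

lemma exec_deterministic:
  "exec w wbar c s t s' \<Longrightarrow> exec w wbar c s u s'' \<Longrightarrow> t = u \<and> s' = s''"
proof (induction arbitrary: u s'' rule: exec.induct)
  case (Skip s)
  then show ?case by cases auto
next
  case (ISet a e m r)
  then show ?case by cases auto
next
  case (NSet a e m r)
  then show ?case by cases auto
next
  case (Seq c s t s1 d t' s2)
  from Seq.prems show ?case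
    by cases (metis Seq.IH)
next
  case outer: (IfPos s e c t s1 d)
  from outer.prems show ?case
  proof cases
    case (IfPos t1)
    then show ?thesis using outer.IH by blast
  next
    case IfNotPos
    then show ?thesis using outer.hyps by linarith
  qed
next
  case outer: (IfNotPos s e d t s1 c)
  from outer.prems show ?case
  proof cases
    case IfPos
    then show ?thesis using outer.hyps by linarith
  next
    case (IfNotPos t1)
    then show ?thesis using outer.IH by blast
  qed
next
  case outer: (WhilePos s e c t s1 t' s2)
  from outer.prems show ?case
  proof cases
    case (WhilePos v s3 v')
    then show ?thesis using outer.IH by blast
  next
    case WhileNotPos
    then show ?thesis using outer.hyps by linarith
  qed
next
  case outer: (WhileNotPos s e c)
  from outer.prems show ?case
  proof cases
    case WhilePos
    then show ?thesis using outer.hyps by linarith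
  qed auto
qed


section \<open>Inputs and domain-liftability\<close>

fun cmp_code :: "cmp \<Rightarrow> int" where
  "cmp_code CLt = 0"
| "cmp_code CLe = 1"
| "cmp_code CEq = 2"
| "cmp_code CGe = 3"
| "cmp_code CGt = 4"

fun constr_code :: "constr \<Rightarrow> int list" where
  "constr_code (Card p r m) = [cmp_code r, int p, int m]"
| "constr_code (PosLit p a) = [5, int p, int a]"
| "constr_code (NegLit p a) = [6, int p, int a]"

definition input_code :: "nat \<Rightarrow> constr list \<Rightarrow> int list" where
  "input_code n \<Gamma> = int n # int (length \<Gamma>) # concat (map constr_code \<Gamma>)"

definition initial_state :: "int list \<Rightarrow> imem \<times> nmem" where
  "initial_state xs =
     ((\<lambda>i. if 0 \<le> i \<and> i < int (length xs) then xs ! nat i else 0), (\<lambda>_. (0, 1)))"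

text \<open>The length of the input, with \<open>n\<close> counted in unary and \<open>\<Gamma>\<close> in binary.\<close>

definition input_size :: "nat \<Rightarrow> constr list \<Rightarrow> nat" where
  "input_size n \<Gamma> = n + sum_list (map len (concat (map constr_code \<Gamma>)))"

text \<open>The program may depend on everything that is fixed, including the weights. It leaves its
  result in number cell 0.\<close>

definition domain_liftable_with_axiom :: "graph_axiom \<Rightarrow> bool" where
  "domain_liftable_with_axiom ax \<longleftrightarrow>
     (\<forall>(ar :: vocab) (\<Phi> :: fm) (w :: nat \<Rightarrow> real) (wbar :: nat \<Rightarrow> real) (R :: nat).
        C2_sentence ar \<Phi> \<longrightarrow> R < length ar \<longrightarrow> ar ! R = 2 \<longrightarrow>
        (\<exists>(c :: com) (q :: nat poly). \<forall>(n :: nat) (\<Gamma> :: constr list).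
           (\<forall>\<gamma>\<in>set \<Gamma>. constr_ok ar n \<gamma>) \<longrightarrow>
           (\<exists>t m r. exec w wbar c (initial_state (input_code n \<Gamma>)) t (m, r) \<and>
              t \<le> poly q (input_size n \<Gamma>) \<and>
              fst (r 0) = wfomc ar (conj_with_axiom \<Phi> \<Gamma> ax R n) n w wbar)))"

end

theory Submission
  imports Defs "HOL-Library.FuncSet"
begin

text \<open>
  A world is a choice of true 0-ary atoms, of one-types for the elements, of two-types for the
  pairs, and of atoms with at least three distinct arguments, which \<open>\<Phi>\<close> does not see.
  Guessing for each element which quantified subformulas hold there makes \<open>\<Phi>\<close> a conjunction of
  conditions on the number of witnesses of each element. Such a degree condition is the leading
  coefficient in \<open>x\<close> of a combination of powers \<open>c ^ d\<close> of the degree \<open>d\<close> (surjection numbers,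
  up to \<open>K!\<close>), so choosing one base \<open>c\<close> per element and quantifier turns the condition into a
  product over pairs of elements. Elements then carry labels from a fixed finite set, and what
  remains is a sum over bipartite graphs of a product of weights of edges and non-edges that
  depend only on the labels.

  For such weights, a sum over proper two-colourings counts every bipartite graph once for every
  union of its components, which gives a recursion for the sum over bipartite graphs:
  \<open>\<Sum>\<^sub>C (coloured weight of C) = \<Sum>\<^sub>U bip U * bip (V - U) * (non-edges between U and V - U)\<close>.
  Both sides depend only on how often each label occurs, so a table of polynomial size suffices.

  Generating functions are evaluated at large integers (Kronecker substitution), and
  coefficients are read off as digits. In particular the weights of the predicates are replaced by powers
  of a large integer, and the cardinality constraints are tested on the digits; only then the
  real weights enter. Ground unary literals restrict the labels of single elements.
\<close>

text \<open>Two features of the setting shape the proof. A program cannot look into a number cell,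
  while cardinality constraints select worlds by their counts; so all selection has to happen among
  integers. And every intermediate integer needs polynomially many bits, including table entries for
  codes that no labelling of \<open>n\<close> elements has. Such entries count nothing, so no number
  of graphs bounds them, and their size is estimated from the recursion alone.

  The recursion determines the value at \<open>V\<close> because the terms for \<open>U = {}\<close>
  and \<open>U = V\<close> both equal it, whence a division by 2.

  The factor \<open>K!\<close> appears because a set of \<open>d\<close> elements has
  \<open>d!\<close> surjections onto one of the same size; scaling by
  \<open>fact K div fact k\<close> gives all conditions one common integral factor. The variable
  \<open>x\<close> may be a concrete integer because the wanted coefficient is nonnegative and known
  to be smaller than it.

  A closed sentence is decided at an arbitrary element of the domain, so the empty domain needs a
  separate treatment.\<close>

section \<open>Polynomially bounded functions\<close>

text \<open>With a base of at least 2, one exponent absorbs constants, and the sum of two powers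
  costs just one more factor. This makes the closure properties below suitable as simplification
  rules.\<close>

definition pow_bounded :: "(nat \<Rightarrow> nat) \<Rightarrow> bool" where
  "pow_bounded f \<longleftrightarrow> (\<exists>c. \<forall>N. f N \<le> (N + 2) ^ c)"

lemma pow_boundedI: "(\<And>N. f N \<le> (N + 2) ^ c) \<Longrightarrow> pow_bounded f"
  unfolding pow_bounded_def by blast

lemma pow_bounded_const [simp]: "pow_bounded (\<lambda>_. k)"
proof (rule pow_boundedI)
  fix N :: nat
  have "k \<le> 2 ^ k" by (simp add: less_imp_le)
  also have "\<dots> \<le> (N + 2) ^ k" by (rule power_mono) auto
  finally show "k \<le> (N + 2) ^ k" .
qed

lemma pow_bounded_id [simp]: "pow_bounded (\<lambda>N. N)"
  by (rule pow_boundedI[where c = 1]) auto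

lemma pow_bounded_mult [simp]:
  assumes "pow_bounded f" "pow_bounded g"
  shows "pow_bounded (\<lambda>N. f N * g N)"
proof -
  obtain c d where "\<forall>N. f N \<le> (N + 2) ^ c" "\<forall>N. g N \<le> (N + 2) ^ d"
    using assms unfolding pow_bounded_def by blast
  then show ?thesis
    by (intro pow_boundedI[where c = "c + d"]) (auto simp: power_add intro!: mult_mono)
qed

lemma pow_bounded_add [simp]:
  assumes "pow_bounded f" "pow_bounded g"
  shows "pow_bounded (\<lambda>N. f N + g N)"
proof -
  obtain c d where c: "\<forall>N. f N \<le> (N + 2) ^ c" and d: "\<forall>N. g N \<le> (N + 2) ^ d"
    using assms unfolding pow_bounded_def by blast
  show ?thesis
  proof (rule pow_boundedI[where c = "Suc (max c d)"])
    fix N :: nat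
    have "(N + 2) ^ c \<le> (N + 2) ^ max c d" "(N + 2) ^ d \<le> (N + 2) ^ max c d"
      by (auto intro: power_increasing)
    then have "f N + g N \<le> 2 * (N + 2) ^ max c d"
      using c[rule_format, of N] d[rule_format, of N] by linarith
    also have "\<dots> \<le> (N + 2) ^ Suc (max c d)" by simp
    finally show "f N + g N \<le> (N + 2) ^ Suc (max c d)" .
  qed
qed

lemma pow_bounded_Suc [simp]: "pow_bounded f \<Longrightarrow> pow_bounded (\<lambda>N. Suc (f N))"
  using pow_bounded_add[of f "\<lambda>_. 1"] by simp

lemma pow_bounded_power [simp]: "pow_bounded f \<Longrightarrow> pow_bounded (\<lambda>N. f N ^ k)"
  by (induction k) auto

lemma pow_bounded_sum_list [simp]:
  "(\<And>x. x \<in> set xs \<Longrightarrow> pow_bounded (f x)) \<Longrightarrow> pow_bounded (\<lambda>N. \<Sum>x\<leftarrow>xs. f x N)"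
  by (induction xs) auto

lemma pow_bounded_le: "pow_bounded g \<Longrightarrow> (\<And>N. f N \<le> g N) \<Longrightarrow> pow_bounded f"
  unfolding pow_bounded_def by (meson order_trans)

lemma pow_bounded_compose:
  assumes "pow_bounded f" "pow_bounded g"
  shows "pow_bounded (\<lambda>N. f (g N))"
proof -
  obtain c where "\<forall>N. f N \<le> (N + 2) ^ c" using assms(1) unfolding pow_bounded_def by blast
  then have "\<And>N. f (g N) \<le> (g N + 2) ^ c" by blast
  moreover have "pow_bounded (\<lambda>N. (g N + 2) ^ c)" using assms(2) by auto
  ultimately show ?thesis by (rule pow_bounded_le[rotated])
qed

lemma pow_bounded_poly:
  assumes "pow_bounded f"
  shows "\<exists>q :: nat poly. \<forall>N. f N \<le> poly q N"
proof -
  obtain c where "\<forall>N. f N \<le> (N + 2) ^ c" using assms unfolding pow_bounded_def by blast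
  then have "\<forall>N. f N \<le> poly ([:2, 1:] ^ c) N" by (simp add: poly_power add.commute)
  then show ?thesis by blast
qed

section \<open>An expression language with bounded sums and products\<close>

text \<open>An intermediate language between the mathematics and the machine. Loop bounds are
  evaluated before the loop starts, so every expression has a value. Recursion is absent; recursive
  quantities are read from a table with \<open>ETab\<close>.\<close>

datatype ex =
    ELit int
  | EVar nat
  | EInp ex
  | ETab ex
  | EAdd ex ex
  | ESub ex ex
  | EMul ex ex
  | EDiv ex ex
  | EMod ex ex
  | EPow ex ex
  | EIf ex ex ex
  | ESum nat ex ex
  | EProd nat ex ex

text \<open>Reads at negative positions give 0, because the negative addresses of the machine hold
  variables, temporaries and the table. Negative exponents and loop bounds count as 0 through
  \<open>nat\<close>.\<close>

fun eval :: "(int \<Rightarrow> int) \<Rightarrow> (int \<Rightarrow> int) \<Rightarrow> (nat \<Rightarrow> int) \<Rightarrow> ex \<Rightarrow> int" where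
  "eval I T v (ELit i) = i"
| "eval I T v (EVar x) = v x"
| "eval I T v (EInp e) = (if eval I T v e \<ge> 0 then I (eval I T v e) else 0)"
| "eval I T v (ETab e) = (if eval I T v e \<ge> 0 then T (eval I T v e) else 0)"
| "eval I T v (EAdd e f) = eval I T v e + eval I T v f"
| "eval I T v (ESub e f) = eval I T v e - eval I T v f"
| "eval I T v (EMul e f) = eval I T v e * eval I T v f"
| "eval I T v (EDiv e f) = eval I T v e div eval I T v f"
| "eval I T v (EMod e f) = eval I T v e mod eval I T v f"
| "eval I T v (EPow e f) = eval I T v e ^ nat (eval I T v f)"
| "eval I T v (EIf e f g) = (if eval I T v e > 0 then eval I T v f else eval I T v g)"
| "eval I T v (ESum x e f) = (\<Sum>k<nat (eval I T v e). eval I T (v(x := int k)) f)"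
| "eval I T v (EProd x e f) = (\<Prod>k<nat (eval I T v e). eval I T (v(x := int k)) f)"

abbreviation fits :: "nat \<Rightarrow> int \<Rightarrow> bool" where
  "fits M z \<equiv> \<bar>z\<bar> < 2 ^ M"

text \<open>All intermediate results fit into \<open>M\<close> bits, and all loops run at most \<open>M\<close> times.\<close>

fun bnd :: "nat \<Rightarrow> (int \<Rightarrow> int) \<Rightarrow> (int \<Rightarrow> int) \<Rightarrow> (nat \<Rightarrow> int) \<Rightarrow> ex \<Rightarrow> bool" where
  "bnd M I T v (ELit i) \<longleftrightarrow> fits M i"
| "bnd M I T v (EVar x) \<longleftrightarrow> fits M (v x)"
| "bnd M I T v (EInp e) \<longleftrightarrow> bnd M I T v e \<and> fits M (eval I T v (EInp e))"
| "bnd M I T v (ETab e) \<longleftrightarrow> bnd M I T v e \<and> fits M (eval I T v (ETab e))"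
| "bnd M I T v (EAdd e f) \<longleftrightarrow> bnd M I T v e \<and> bnd M I T v f \<and> fits M (eval I T v (EAdd e f))"
| "bnd M I T v (ESub e f) \<longleftrightarrow> bnd M I T v e \<and> bnd M I T v f \<and> fits M (eval I T v (ESub e f))"
| "bnd M I T v (EMul e f) \<longleftrightarrow> bnd M I T v e \<and> bnd M I T v f \<and> fits M (eval I T v (EMul e f))"
| "bnd M I T v (EDiv e f) \<longleftrightarrow> bnd M I T v e \<and> bnd M I T v f \<and> fits M (eval I T v (EDiv e f))"
| "bnd M I T v (EMod e f) \<longleftrightarrow> bnd M I T v e \<and> bnd M I T v f \<and> fits M (eval I T v (EMod e f))"
| "bnd M I T v (EPow e f) \<longleftrightarrow> bnd M I T v e \<and> bnd M I T v f \<and> nat (eval I T v f) \<le> M \<and>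
     (\<forall>k\<le>nat (eval I T v f). fits M (eval I T v e ^ k))"
| "bnd M I T v (EIf e f g) \<longleftrightarrow> bnd M I T v e \<and> bnd M I T v f \<and> bnd M I T v g"
| "bnd M I T v (ESum x e f) \<longleftrightarrow> bnd M I T v e \<and> fits M (v x) \<and> nat (eval I T v e) \<le> M \<and>
     (\<forall>k<nat (eval I T v e). bnd M I T (v(x := int k)) f) \<and>
     (\<forall>l\<le>nat (eval I T v e). fits M (\<Sum>k<l. eval I T (v(x := int k)) f))"
| "bnd M I T v (EProd x e f) \<longleftrightarrow> bnd M I T v e \<and> fits M (v x) \<and> nat (eval I T v e) \<le> M \<and>
     (\<forall>k<nat (eval I T v e). bnd M I T (v(x := int k)) f) \<and>
     (\<forall>l\<le>nat (eval I T v e). fits M (\<Prod>k<l. eval I T (v(x := int k)) f))"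

lemma bnd_fits: "bnd M I T v e \<Longrightarrow> fits M (eval I T v e)"
  by (induction e arbitrary: v) auto

lemma fits_mono: "fits M z \<Longrightarrow> M \<le> M' \<Longrightarrow> fits M' z"
  using power_increasing[of M M' "2 :: int"] by linarith

lemma bnd_mono: "bnd M I T v e \<Longrightarrow> M \<le> M' \<Longrightarrow> bnd M' I T v e"
  by (induction e arbitrary: v) (simp only: bnd.simps; blast intro: fits_mono order_trans)+

lemma len_le: "fits M z \<Longrightarrow> len z \<le> Suc M"
  by (auto simp: len_def bitlen_le_iff_power nat_le_iff)

section \<open>Compilation\<close>

text \<open>The input occupies the nonnegative addresses; the negative ones are split into three
  classes for the variables, the temporaries and the table.\<close>

definition va :: "nat \<Rightarrow> int" where "va x = - 1 - 3 * int x"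
definition ta :: "nat \<Rightarrow> int" where "ta t = - 2 - 3 * int t"
definition tb :: "int \<Rightarrow> int" where "tb i = - 3 - 3 * i"

lemma va_ta [simp]: "va x \<noteq> ta t" "ta t \<noteq> va x" unfolding va_def ta_def by presburger+
lemma va_tb [simp]: "va x \<noteq> tb i" "tb i \<noteq> va x" unfolding va_def tb_def by presburger+
lemma ta_tb [simp]: "ta t \<noteq> tb i" "tb i \<noteq> ta t" unfolding ta_def tb_def by presburger+
lemma va_inj [simp]: "va x = va y \<longleftrightarrow> x = y" unfolding va_def by presburger
lemma ta_inj [simp]: "ta x = ta y \<longleftrightarrow> x = y" unfolding ta_def by presburger
lemma tb_inj [simp]: "tb x = tb y \<longleftrightarrow> x = y" unfolding tb_def by presburger
lemma va_neg [simp]: "\<not> 0 \<le> va x" "0 \<le> a \<Longrightarrow> a \<noteq> va x" "0 \<le> a \<Longrightarrow> va x \<noteq> a"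
  unfolding va_def by presburger+
lemma ta_neg [simp]: "\<not> 0 \<le> ta x" "0 \<le> a \<Longrightarrow> a \<noteq> ta x" "0 \<le> a \<Longrightarrow> ta x \<noteq> a"
  unfolding ta_def by presburger+
lemma tb_neg [simp]: "0 \<le> i \<Longrightarrow> \<not> 0 \<le> tb i" "0 \<le> i \<Longrightarrow> 0 \<le> a \<Longrightarrow> a \<noteq> tb i"
  "0 \<le> i \<Longrightarrow> 0 \<le> a \<Longrightarrow> tb i \<noteq> a"
  unfolding tb_def by presburger+

abbreviation TC :: "nat \<Rightarrow> iexp" where "TC t \<equiv> Cell (Const (ta t))"
abbreviation VC :: "nat \<Rightarrow> iexp" where "VC x \<equiv> Cell (Const (va x))"
abbreviation TSet :: "nat \<Rightarrow> iexp \<Rightarrow> com" where "TSet t e \<equiv> ISet (Const (ta t)) e"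
abbreviation VSet :: "nat \<Rightarrow> iexp \<Rightarrow> com" where "VSet x e \<equiv> ISet (Const (va x)) e"

text \<open>The value of the expression ends up in temporary \<open>t\<close>, and only temporaries
  from \<open>t\<close> on are overwritten. A loop keeps its bound in \<open>t\<close>, the
  accumulator in \<open>t + 1\<close> and the former value of the loop variable in
  \<open>t + 2\<close>, so its body starts at \<open>t + 3\<close>.\<close>

fun compile :: "nat \<Rightarrow> ex \<Rightarrow> com" where
  "compile t (ELit i) = TSet t (Const i)"
| "compile t (EVar x) = TSet t (VC x)"
| "compile t (EInp e) = Seq (compile t e)
     (IfPos (Add (TC t) (Const 1)) (TSet t (Cell (TC t))) (TSet t (Const 0)))"
| "compile t (ETab e) = Seq (compile t e)
     (IfPos (Add (TC t) (Const 1)) (TSet t (Cell (Sub (Const (-3)) (Mul (Const 3) (TC t)))))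
       (TSet t (Const 0)))"
| "compile t (EAdd e f) = Seq (compile t e) (Seq (compile (Suc t) f) (TSet t (Add (TC t) (TC (Suc t)))))"
| "compile t (ESub e f) = Seq (compile t e) (Seq (compile (Suc t) f) (TSet t (Sub (TC t) (TC (Suc t)))))"
| "compile t (EMul e f) = Seq (compile t e) (Seq (compile (Suc t) f) (TSet t (Mul (TC t) (TC (Suc t)))))"
| "compile t (EDiv e f) = Seq (compile t e) (Seq (compile (Suc t) f) (TSet t (Div (TC t) (TC (Suc t)))))"
| "compile t (EMod e f) = Seq (compile t e) (Seq (compile (Suc t) f) (TSet t (Mod (TC t) (TC (Suc t)))))"
| "compile t (EPow e f) = Seq (compile t e) (Seq (compile (Suc t) f) (Seq (TSet (t + 2) (Const 1))
     (Seq (WhilePos (TC (Suc t)) (Seq (TSet (t + 2) (Mul (TC (t + 2)) (TC t)))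
                              (TSet (Suc t) (Sub (TC (Suc t)) (Const 1)))))
       (TSet t (TC (t + 2))))))"
| "compile t (EIf e f g) = Seq (compile t e) (IfPos (TC t) (compile t f) (compile t g))"
| "compile t (ESum x e f) = Seq (compile t e) (Seq (TSet (t + 1) (Const 0))
     (Seq (TSet (t + 2) (VC x)) (Seq (VSet x (Const 0))
     (Seq (WhilePos (Sub (TC t) (VC x)) (Seq (compile (t + 3) f)
            (Seq (TSet (t + 1) (Add (TC (t + 1)) (TC (t + 3)))) (VSet x (Add (VC x) (Const 1))))))
     (Seq (VSet x (TC (t + 2))) (TSet t (TC (t + 1))))))))"
| "compile t (EProd x e f) = Seq (compile t e) (Seq (TSet (t + 1) (Const 1))
     (Seq (TSet (t + 2) (VC x)) (Seq (VSet x (Const 0))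
     (Seq (WhilePos (Sub (TC t) (VC x)) (Seq (compile (t + 3) f)
            (Seq (TSet (t + 1) (Mul (TC (t + 1)) (TC (t + 3)))) (VSet x (Add (VC x) (Const 1))))))
     (Seq (VSet x (TC (t + 2))) (TSet t (TC (t + 1))))))))"

section \<open>Executions with an upper bound on the time\<close>

definition runs :: "(nat \<Rightarrow> real) \<Rightarrow> (nat \<Rightarrow> real) \<Rightarrow> com \<Rightarrow> imem \<times> nmem \<Rightarrow> nat \<Rightarrow> imem \<times> nmem \<Rightarrow> bool" where
  "runs w wbar c s B s' \<longleftrightarrow> (\<exists>t\<le>B. exec w wbar c s t s')"

lemma runs_mono: "runs w wbar c s B s' \<Longrightarrow> B \<le> B' \<Longrightarrow> runs w wbar c s B' s'"
  unfolding runs_def using order_trans by blast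

lemma runs_Seq:
  "runs w wbar c s B s' \<Longrightarrow> runs w wbar d s' B' s'' \<Longrightarrow> runs w wbar (Seq c d) s (B + B') s''"
  unfolding runs_def by (meson add_mono exec.Seq)

lemma runs_ISet:
  "icost m a + icost m e \<le> B \<Longrightarrow> runs w wbar (ISet a e) (m, r) B (m(ival m a := ival m e), r)"
  unfolding runs_def using exec.ISet by blast

lemma runs_NSet:
  "icost m a + ncost m r e \<le> B \<Longrightarrow>
   runs w wbar (NSet a e) (m, r) B (m, r(ival m a := (nval w wbar m r e, nsize m r e)))"
  unfolding runs_def using exec.NSet by blast

lemma runs_IfPos:
  assumes "ival m e > 0 \<Longrightarrow> runs w wbar c (m, r) B s'" "\<not> ival m e > 0 \<Longrightarrow> runs w wbar d (m, r) B s'"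
    "icost m e \<le> C"
  shows "runs w wbar (IfPos e c d) (m, r) (C + B) s'"
proof (cases "ival m e > 0")
  case True
  then obtain t where "t \<le> B" "exec w wbar c (m, r) t s'" using assms(1) unfolding runs_def by blast
  then show ?thesis unfolding runs_def using True assms(3)
    by (intro exI[of _ "icost m e + t"]) (auto intro: exec.IfPos[where s = "(m, r)", simplified])
next
  case False
  then obtain t where "t \<le> B" "exec w wbar d (m, r) t s'" using assms(2) unfolding runs_def by blast
  then show ?thesis unfolding runs_def using False assms(3)
    by (intro exI[of _ "icost m e + t"]) (auto intro: exec.IfNotPos[where s = "(m, r)", simplified])
qed

text \<open>The invariant is indexed by the number of finished iterations. The induction is on the
  number \<open>l\<close> of iterations still to come, with the state left arbitrary; the last test
  accounts for the additional \<open>C\<close>.\<close>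

lemma runs_WhilePos:
  assumes step: "\<And>k m r. k < n \<Longrightarrow> Q k m r \<Longrightarrow> ival m e > 0 \<and>
      (\<exists>m' r'. runs w wbar c (m, r) B (m', r') \<and> Q (Suc k) m' r')"
    and stop: "\<And>m r. Q n m r \<Longrightarrow> ival m e \<le> 0"
    and cost: "\<And>k m r. k \<le> n \<Longrightarrow> Q k m r \<Longrightarrow> icost m e \<le> C"
    and init: "Q 0 m r"
  shows "\<exists>m' r'. runs w wbar (WhilePos e c) (m, r) (n * (B + C) + C) (m', r') \<and> Q n m' r'"
proof -
  have "\<exists>m' r'. runs w wbar (WhilePos e c) (m, r) (l * (B + C) + C) (m', r') \<and> Q n m' r'"
    if "l \<le> n" "Q (n - l) m r" for l m r
    using that
  proof (induction l arbitrary: m r)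
    case 0
    then have "exec w wbar (WhilePos e c) (m, r) (icost m e) (m, r)"
      using exec.WhileNotPos[where s = "(m, r)"] stop by force
    moreover have "icost m e \<le> C" using cost[of n m r] 0 by simp
    ultimately show ?case using 0 unfolding runs_def by auto
  next
    case (Suc l)
    have lt: "n - Suc l < n" using Suc.prems by simp
    obtain m1 r1 where 1: "ival m e > 0" "runs w wbar c (m, r) B (m1, r1)" "Q (Suc (n - Suc l)) m1 r1"
      using step[OF lt Suc.prems(2)] by blast
    have "Suc (n - Suc l) = n - l" using Suc.prems(1) by simp
    then obtain m2 r2 where 2: "runs w wbar (WhilePos e c) (m1, r1) (l * (B + C) + C) (m2, r2)" "Q n m2 r2"
      using Suc.IH[of m1 r1] 1(3) Suc.prems(1) by auto
    obtain t1 where t1: "t1 \<le> B" "exec w wbar c (m, r) t1 (m1, r1)" using 1(2) unfolding runs_def by blast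
    obtain t2 where t2: "t2 \<le> l * (B + C) + C" "exec w wbar (WhilePos e c) (m1, r1) t2 (m2, r2)"
      using 2(1) unfolding runs_def by blast
    have "exec w wbar (WhilePos e c) (m, r) (icost m e + t1 + t2) (m2, r2)"
      using exec.WhilePos[where s = "(m, r)" and e = e, OF _ t1(2) t2(2)] 1(1) by simp
    moreover have "icost m e \<le> C" using cost[of "n - Suc l" m r] Suc.prems by simp
    ultimately have "runs w wbar (WhilePos e c) (m, r) (Suc l * (B + C) + C) (m2, r2)"
      unfolding runs_def using t1(1) t2(1) by (intro exI[of _ "icost m e + t1 + t2"]) auto
    then show ?case using 2(2) by blast
  qed
  from this[of n m r] init show ?thesis by simp
qed

section \<open>Input, table and variables as views of the memory\<close>

text \<open>The views are cut off at negative positions so that they depend on their own cells only.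
  Then unchanged cells give equal functions, and evaluations can be rewritten with
  \<open>same_below_of\<close>.\<close>

definition inp_of :: "imem \<Rightarrow> int \<Rightarrow> int" where "inp_of m = (\<lambda>i. if i \<ge> 0 then m i else 0)"
definition tab_of :: "imem \<Rightarrow> int \<Rightarrow> int" where "tab_of m = (\<lambda>i. if i \<ge> 0 then m (tb i) else 0)"
definition env_of :: "imem \<Rightarrow> nat \<Rightarrow> int" where "env_of m = (\<lambda>x. m (va x))"

abbreviation evm :: "imem \<Rightarrow> ex \<Rightarrow> int" where
  "evm m e \<equiv> eval (inp_of m) (tab_of m) (env_of m) e"

abbreviation bdm :: "nat \<Rightarrow> imem \<Rightarrow> ex \<Rightarrow> bool" where
  "bdm M m e \<equiv> bnd M (inp_of m) (tab_of m) (env_of m) e"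

text \<open>This frame condition lets the first operand, kept in temporary \<open>t\<close>, survive
  the evaluation of the second one from \<open>Suc t\<close> on.\<close>

definition same_below :: "nat \<Rightarrow> imem \<Rightarrow> imem \<Rightarrow> bool" where
  "same_below t m m' \<longleftrightarrow> (\<forall>a. (\<forall>s\<ge>t. a \<noteq> ta s) \<longrightarrow> m' a = m a)"

lemma same_below_refl [simp]: "same_below t m m"
  by (simp add: same_below_def)

lemma same_below_upd [simp]: "t \<le> s \<Longrightarrow> same_below t m (m'(ta s := z)) \<longleftrightarrow> same_below t m m'"
  by (auto simp: same_below_def)

lemma same_below_trans: "same_below t m m' \<Longrightarrow> same_below t' m' m'' \<Longrightarrow> t \<le> t' \<Longrightarrow> same_below t m m''"
  by (simp add: same_below_def)

lemma same_below_ta: "same_below t m m' \<Longrightarrow> s < t \<Longrightarrow> m' (ta s) = m (ta s)"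
  by (auto simp: same_below_def)

lemma same_below_of:
  assumes "same_below t m m'"
  shows "inp_of m' = inp_of m" "tab_of m' = tab_of m" "env_of m' = env_of m"
  using assms unfolding same_below_def inp_of_def tab_of_def env_of_def fun_eq_iff by auto

lemma of_upd [simp]:
  "inp_of (m(va x := z)) = inp_of m" "tab_of (m(va x := z)) = tab_of m"
  "env_of (m(va x := z)) = (env_of m)(x := z)"
  "inp_of (m(ta s := z)) = inp_of m" "tab_of (m(ta s := z)) = tab_of m"
  "env_of (m(ta s := z)) = env_of m"
  unfolding inp_of_def tab_of_def env_of_def fun_eq_iff by auto

text \<open>The time bound is chosen before the state and depends only on the size parameter
  \<open>M\<close> of \<open>bnd\<close>. Hence polynomial time follows once \<open>bnd\<close>
  holds with a polynomial \<open>M\<close>. The number cells are left alone.\<close>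

definition computes :: "(nat \<Rightarrow> real) \<Rightarrow> (nat \<Rightarrow> real) \<Rightarrow> nat \<Rightarrow> ex \<Rightarrow> com \<Rightarrow> bool" where
  "computes w wbar t e c \<longleftrightarrow> (\<exists>B. pow_bounded B \<and> (\<forall>M m r. bdm M m e \<longrightarrow>
     (\<exists>m'. runs w wbar c (m, r) (B M) (m', r) \<and> m' (ta t) = evm m e \<and> same_below t m m')))"

lemma computesI:
  assumes "pow_bounded B" "\<And>M m r. bdm M m e \<Longrightarrow>
     \<exists>m'. runs w wbar c (m, r) (B M) (m', r) \<and> m' (ta t) = evm m e \<and> same_below t m m'"
  shows "computes w wbar t e c"
  using assms unfolding computes_def by blast

text \<open>One proof for the five arithmetic operators: \<open>iop\<close> is the machine
  operation, \<open>g\<close> its meaning and \<open>h\<close> the compound expression.\<close>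

lemma computes_bin:
  assumes e: "computes w wbar t e ce" and f: "computes w wbar (Suc t) f cf"
    and op: "\<And>m a b. ival m (iop a b) = g (ival m a) (ival m b)"
      "\<And>m a b. icost m (iop a b) = icost m a + icost m b + len (g (ival m a) (ival m b))"
    and sem: "\<And>I T v. eval I T v h = g (eval I T v e) (eval I T v f)"
      "\<And>M I T v. bnd M I T v h \<Longrightarrow> bnd M I T v e \<and> bnd M I T v f"
  shows "computes w wbar t h (Seq ce (Seq cf (TSet t (iop (TC t) (TC (Suc t))))))"
proof -
  obtain B1 where B1: "pow_bounded B1" "\<And>M m r. bdm M m e \<Longrightarrow>
     \<exists>m'. runs w wbar ce (m, r) (B1 M) (m', r) \<and> m' (ta t) = evm m e \<and> same_below t m m'"
    using e unfolding computes_def by blast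
  obtain B2 where B2: "pow_bounded B2" "\<And>M m r. bdm M m f \<Longrightarrow>
     \<exists>m'. runs w wbar cf (m, r) (B2 M) (m', r) \<and> m' (ta (Suc t)) = evm m f \<and> same_below (Suc t) m m'"
    using f unfolding computes_def by blast
  let ?C = "\<lambda>M. 2 * len (ta t) + len (ta (Suc t)) + 3 * Suc M"
  show ?thesis
  proof (rule computesI[where B = "\<lambda>M. B1 M + (B2 M + ?C M)"])
    show "pow_bounded (\<lambda>M. B1 M + (B2 M + ?C M))" using B1(1) B2(1) by auto
    fix M m r assume b: "bdm M m h"
    obtain m1 where m1: "runs w wbar ce (m, r) (B1 M) (m1, r)" "m1 (ta t) = evm m e" "same_below t m m1"
      using B1(2) sem(2)[OF b] by blast
    have "bdm M m1 f" using sem(2)[OF b] by (simp add: same_below_of[OF m1(3)])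
    then obtain m2 where m2: "runs w wbar cf (m1, r) (B2 M) (m2, r)" "m2 (ta (Suc t)) = evm m1 f"
      "same_below (Suc t) m1 m2" using B2(2) by blast
    have v1: "m2 (ta t) = evm m e" using same_below_ta[OF m2(3)] m1(2) by simp
    have v2: "m2 (ta (Suc t)) = evm m f" using m2(2) by (simp add: same_below_of[OF m1(3)])
    have l: "len (evm m e) \<le> Suc M" "len (evm m f) \<le> Suc M" "len (g (evm m e) (evm m f)) \<le> Suc M"
      using bnd_fits[of M _ _ _ e] bnd_fits[of M _ _ _ f] bnd_fits[OF b] sem(2)[OF b]
      by (auto intro: len_le simp: sem(1))
    have "runs w wbar (TSet t (iop (TC t) (TC (Suc t)))) (m2, r) (?C M)
        (m2(ival m2 (Const (ta t)) := ival m2 (iop (TC t) (TC (Suc t)))), r)"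
      by (rule runs_ISet) (use l in \<open>simp add: op v1 v2\<close>)
    then have "runs w wbar (Seq ce (Seq cf (TSet t (iop (TC t) (TC (Suc t)))))) (m, r) (B1 M + (B2 M + ?C M))
        (m2(ta t := evm m h), r)"
      by (intro runs_Seq[OF m1(1)] runs_Seq[OF m2(1)]) (simp add: op v1 v2 sem(1))
    moreover have "same_below t m m2" using same_below_trans[OF m1(3) m2(3)] by simp
    ultimately show "\<exists>m'. runs w wbar (Seq ce (Seq cf (TSet t (iop (TC t) (TC (Suc t)))))) (m, r)
        (B1 M + (B2 M + ?C M)) (m', r) \<and> m' (ta t) = evm m h \<and> same_below t m m'"
      by (intro exI[of _ "m2(ta t := evm m h)"]) simp
  qed
qed

text \<open>One proof for sums and products: \<open>F\<close> is the partial fold, \<open>z\<close>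
  its start value and \<open>g\<close> the combining operation. The bound on \<open>v x\<close>
  required by \<open>bnd\<close> pays for saving and restoring the loop variable.\<close>

lemma computes_fold:
  assumes e: "computes w wbar t e ce" and f: "computes w wbar (t + 3) f cf"
    and op: "\<And>m a b. ival m (iop a b) = g (ival m a) (ival m b)"
      "\<And>m a b. icost m (iop a b) = icost m a + icost m b + len (g (ival m a) (ival m b))"
    and sem: "\<And>I T v. eval I T v h = F I T v (nat (eval I T v e))"
      "\<And>I T v. F I T v 0 = z"
      "\<And>I T v k. F I T v (Suc k) = g (F I T v k) (eval I T (v(x := int k)) f)"
      "\<And>M I T v. bnd M I T v h \<Longrightarrow> bnd M I T v e \<and> fits M (v x) \<and> nat (eval I T v e) \<le> M \<and>
          (\<forall>k<nat (eval I T v e). bnd M I T (v(x := int k)) f) \<and>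
          (\<forall>k\<le>nat (eval I T v e). fits M (F I T v k))"
  shows "computes w wbar t h (Seq ce (Seq (TSet (t + 1) (Const z))
     (Seq (TSet (t + 2) (VC x)) (Seq (VSet x (Const 0))
     (Seq (WhilePos (Sub (TC t) (VC x)) (Seq cf
            (Seq (TSet (t + 1) (iop (TC (t + 1)) (TC (t + 3)))) (VSet x (Add (VC x) (Const 1))))))
     (Seq (VSet x (TC (t + 2))) (TSet t (TC (t + 1)))))))))"
proof -
  obtain B1 where B1: "pow_bounded B1" "\<And>M m r. bdm M m e \<Longrightarrow>
     \<exists>m'. runs w wbar ce (m, r) (B1 M) (m', r) \<and> m' (ta t) = evm m e \<and> same_below t m m'"
    using e unfolding computes_def by blast
  obtain B2 where B2: "pow_bounded B2" "\<And>M m r. bdm M m f \<Longrightarrow>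
     \<exists>m'. runs w wbar cf (m, r) (B2 M) (m', r) \<and> m' (ta (t + 3)) = evm m f \<and> same_below (t + 3) m m'"
    using f unfolding computes_def by blast
  define L where "L = len (ta t) + len (ta (t + 1)) + len (ta (t + 2)) + len (ta (t + 3)) + len (va x)
     + len z + len 0 + len 1"
  let ?C = "\<lambda>M. 2 * L + 3 * Suc M"
  let ?D = "\<lambda>M. B2 M + (?C M + ?C M)"
  let ?B = "\<lambda>M. B1 M + (?C M + (?C M + (?C M + ((M * (?D M + ?C M) + ?C M) + (?C M + ?C M)))))"
  let ?body = "Seq cf (Seq (TSet (t + 1) (iop (TC (t + 1)) (TC (t + 3)))) (VSet x (Add (VC x) (Const 1))))"
  show ?thesis
  proof (rule computesI[where B = ?B])
    show "pow_bounded ?B" using B1(1) B2(1) by auto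
    fix M m r assume b: "bdm M m h"
    note b' = sem(4)[OF b]
    define n where "n = nat (evm m e)"
    let ?F = "F (inp_of m) (tab_of m) (env_of m)"
    obtain m1 where m1: "runs w wbar ce (m, r) (B1 M) (m1, r)" "m1 (ta t) = evm m e" "same_below t m m1"
      using B1(2) b' by blast
    have m1x: "m1 (va x) = m (va x)" using same_below_of(3)[OF m1(3)] by (metis env_of_def)
    have lx: "len (m (va x)) \<le> Suc M" using b' by (auto intro: len_le simp: env_of_def)
    have le: "len (evm m e) \<le> Suc M" using b' by (auto intro: len_le bnd_fits)
    have lF: "len (?F k) \<le> Suc M" if "k \<le> n" for k using b' that unfolding n_def by (auto intro: len_le)
    have nM: "n \<le> M" using b' unfolding n_def by blast
    have lk: "len (int k) \<le> Suc M" if "k \<le> n" for k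
    proof (rule len_le)
      have "int k < 2 ^ k" by (metis of_nat_less_two_power)
      also have "(2::int) ^ k \<le> 2 ^ M" using that nM by (intro power_increasing) auto
      finally show "fits M (int k)" by simp
    qed
    have l0: "len z \<le> L" "len 0 \<le> L" "len 1 \<le> L" "len (ta t) \<le> L" "len (va x) \<le> L"
      "len (ta (t + 1)) + len (ta t) \<le> L" "len (ta (t + 2)) + len (va x) \<le> L"
      "len (ta (t + 1)) + len z \<le> L" "len (va x) + len 0 \<le> L"
      "len (ta (t + 1)) + len (ta (t + 3)) + len 1 \<le> L" "len (va x) + len 1 \<le> L"
      "len (ta t) + len (va x) \<le> L"
      by (simp_all add: L_def)
    define m2 where "m2 = m1(ta (t + 1) := z)"
    define m3 where "m3 = m2(ta (t + 2) := m (va x))"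
    define m4 where "m4 = m3(va x := 0)"
    have r2: "runs w wbar (TSet (t + 1) (Const z)) (m1, r) (?C M) (m2, r)"
      using runs_ISet[of m1 "Const (ta (t + 1))" "Const z" "?C M"] l0 by (simp add: m2_def)
    have r3: "runs w wbar (TSet (t + 2) (VC x)) (m2, r) (?C M) (m3, r)"
      using runs_ISet[of m2 "Const (ta (t + 2))" "VC x" "?C M"] l0 lx by (simp add: m2_def m3_def m1x)
    have r4: "runs w wbar (VSet x (Const 0)) (m3, r) (?C M) (m4, r)"
      using runs_ISet[of m3 "Const (va x)" "Const 0" "?C M"] l0 by (simp add: m4_def)
    \<comment> \<open>The frame condition is relative to the memory with \<open>x\<close> set to
      \<open>k\<close>, since the loop variable is the only cell besides the temporaries that the
      loop changes.\<close>
    define Q where "Q = (\<lambda>k m' r'. r' = r \<and> m' (ta t) = evm m e \<and> m' (ta (t + 1)) = ?F k \<and>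
        m' (ta (t + 2)) = m (va x) \<and> same_below t (m(va x := int k)) m')"
    have Q0: "Q 0 m4 r"
      using m1(2,3) by (auto simp: Q_def m4_def m3_def m2_def sem(2) same_below_def)
    have Qx: "m' (va x) = int k" if "Q k m' r'" for k m' r'
      using that same_below_of(3)[of t "m(va x := int k)" m'] unfolding Q_def env_of_def fun_eq_iff by auto
    have "\<exists>m' r'. runs w wbar (WhilePos (Sub (TC t) (VC x)) ?body) (m4, r)
        (n * (?D M + ?C M) + ?C M) (m', r') \<and> Q n m' r'"
    proof (rule runs_WhilePos[where Q = Q, OF _ _ _ Q0])
      fix k m' r' assume k: "k < n" and q: "Q k m' r'"
      have pos: "ival m' (Sub (TC t) (VC x)) > 0"
        using q Qx[OF q] k by (auto simp: Q_def n_def)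
      have sb: "same_below t (m(va x := int k)) m'" using q by (simp add: Q_def)
      have "bdm M m' f" using b' k by (simp add: same_below_of[OF sb] n_def)
      then obtain m5 where m5: "runs w wbar cf (m', r) (B2 M) (m5, r)" "m5 (ta (t + 3)) = evm m' f"
        "same_below (t + 3) m' m5" using B2(2) by blast
      have v5: "m5 (ta t) = evm m e" "m5 (ta (t + 1)) = ?F k" "m5 (ta (t + 2)) = m (va x)"
        using same_below_ta[OF m5(3)] q unfolding Q_def by simp_all
      have x5: "m5 (va x) = int k" using Qx[OF q] same_below_of(3)[OF m5(3)] by (metis env_of_def)
      have y5: "m5 (ta (t + 3)) = eval (inp_of m) (tab_of m) ((env_of m)(x := int k)) f"
        using m5(2) by (simp add: same_below_of[OF sb])
      have ly5: "len (m5 (ta (t + 3))) \<le> Suc M"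
        unfolding y5 using b' k by (intro len_le bnd_fits) (auto simp: n_def)
      define m6 where "m6 = m5(ta (t + 1) := ?F (Suc k))"
      define m7 where "m7 = m6(va x := int (Suc k))"
      have "runs w wbar (TSet (t + 1) (iop (TC (t + 1)) (TC (t + 3)))) (m5, r) (?C M) (m6, r)"
        using runs_ISet[of m5 "Const (ta (t + 1))" "iop (TC (t + 1)) (TC (t + 3))" "?C M"]
          l0 lF[of k] lF[of "Suc k"] ly5 k v5
        by (simp add: m6_def op sem(3)[symmetric] y5[symmetric]) (simp add: op sem(3) y5)
      moreover have "runs w wbar (VSet x (Add (VC x) (Const 1))) (m6, r) (?C M) (m7, r)"
        using runs_ISet[of m6 "Const (va x)" "Add (VC x) (Const 1)" "?C M"] l0 lk[of k] lk[of "Suc k"] k x5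
        by (simp add: m6_def m7_def algebra_simps)
      ultimately have "runs w wbar ?body (m', r') (?D M) (m7, r)"
        using m5(1) q by (intro runs_Seq) (auto simp: Q_def)
      moreover have "Q (Suc k) m7 r"
      proof -
        have "same_below t (m(va x := int k)) m5" using same_below_trans[OF sb m5(3)] by simp
        then show ?thesis using v5 by (auto simp: Q_def m7_def m6_def same_below_def)
      qed
      ultimately show "ival m' (Sub (TC t) (VC x)) > 0 \<and>
          (\<exists>m'' r''. runs w wbar ?body (m', r') (?D M) (m'', r'') \<and> Q (Suc k) m'' r'')"
        using pos by blast
    next
      fix m' r' assume q: "Q n m' r'"
      show "ival m' (Sub (TC t) (VC x)) \<le> 0"
        using q Qx[OF q] by (auto simp: Q_def n_def)
    next
      fix k m' r' assume k: "k \<le> n" and q: "Q k m' r'"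
      \<comment> \<open>If the loop bound is negative, then \<open>n = 0\<close> and therefore
        \<open>k = 0\<close>; otherwise the difference only shrinks.\<close>
      have "\<bar>evm m e - int k\<bar> \<le> \<bar>evm m e\<bar>" using k by (auto simp: n_def)
      then have "len (evm m e - int k) \<le> Suc M" using b' bnd_fits[of M _ _ _ e]
        by (intro len_le) (meson le_less_trans)
      then show "icost m' (Sub (TC t) (VC x)) \<le> ?C M"
        using q Qx[OF q] le lk[OF k] l0 by (auto simp: Q_def)
    qed
    then obtain m8 where m8: "runs w wbar (WhilePos (Sub (TC t) (VC x)) ?body) (m4, r)
        (n * (?D M + ?C M) + ?C M) (m8, r)" "Q n m8 r" unfolding Q_def by blast
    have r8: "runs w wbar (WhilePos (Sub (TC t) (VC x)) ?body) (m4, r) (M * (?D M + ?C M) + ?C M) (m8, r)"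
      by (rule runs_mono[OF m8(1)]) (use nM in \<open>auto intro!: add_mono mult_right_mono\<close>)
    define m9 where "m9 = m8(va x := m (va x))"
    define m10 where "m10 = m9(ta t := ?F n)"
    have r9: "runs w wbar (VSet x (TC (t + 2))) (m8, r) (?C M) (m9, r)"
      using runs_ISet[of m8 "Const (va x)" "TC (t + 2)" "?C M"] l0 lx m8(2) by (simp add: m9_def Q_def)
    have r10: "runs w wbar (TSet t (TC (t + 1))) (m9, r) (?C M) (m10, r)"
      using runs_ISet[of m9 "Const (ta t)" "TC (t + 1)" "?C M"] l0 lF[of n] m8(2)
      by (simp add: m9_def m10_def Q_def)
    have "same_below t m m10" using m8(2) unfolding Q_def m10_def m9_def same_below_def by auto
    moreover have "m10 (ta t) = evm m h" by (simp add: m10_def sem(1) n_def)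
    ultimately show "\<exists>m'. runs w wbar (Seq ce (Seq (TSet (t + 1) (Const z))
     (Seq (TSet (t + 2) (VC x)) (Seq (VSet x (Const 0))
     (Seq (WhilePos (Sub (TC t) (VC x)) ?body) (Seq (VSet x (TC (t + 2))) (TSet t (TC (t + 1)))))))))
       (m, r) (?B M) (m', r) \<and> m' (ta t) = evm m h \<and> same_below t m m'"
      by (intro exI[of _ m10] conjI runs_Seq[OF m1(1)] runs_Seq[OF r2] runs_Seq[OF r3] runs_Seq[OF r4]
          runs_Seq[OF r8] runs_Seq[OF r9 r10]) auto
  qed
qed

text \<open>For operators that replace the value in temporary \<open>t\<close> on the spot, namely
  the two kinds of memory access.\<close>

lemma computes_upd:
  assumes e: "computes w wbar t e ce"
    and B: "pow_bounded B"
    and step: "\<And>M m m' r. bdm M m h \<Longrightarrow> same_below t m m' \<Longrightarrow> m' (ta t) = evm m e \<Longrightarrow>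
        len (evm m e) \<le> Suc M \<Longrightarrow> len (evm m h) \<le> Suc M \<Longrightarrow>
        runs w wbar c (m', r) (B M) (m'(ta t := evm m h), r)"
    and sem: "\<And>M I T v. bnd M I T v h \<Longrightarrow> bnd M I T v e"
  shows "computes w wbar t h (Seq ce c)"
proof -
  obtain B1 where B1: "pow_bounded B1" "\<And>M m r. bdm M m e \<Longrightarrow>
     \<exists>m'. runs w wbar ce (m, r) (B1 M) (m', r) \<and> m' (ta t) = evm m e \<and> same_below t m m'"
    using e unfolding computes_def by blast
  show ?thesis
  proof (rule computesI[where B = "\<lambda>M. B1 M + B M"])
    show "pow_bounded (\<lambda>M. B1 M + B M)" using B1(1) B by auto
    fix M m r assume b: "bdm M m h"
    obtain m1 where m1: "runs w wbar ce (m, r) (B1 M) (m1, r)" "m1 (ta t) = evm m e" "same_below t m m1"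
      using B1(2) sem[OF b] by blast
    have "len (evm m e) \<le> Suc M" "len (evm m h) \<le> Suc M"
      using bnd_fits[OF b] bnd_fits[OF sem[OF b]] by (auto intro: len_le)
    from runs_Seq[OF m1(1) step[OF b m1(3,2) this]] m1(3)
    show "\<exists>m'. runs w wbar (Seq ce c) (m, r) (B1 M + B M) (m', r) \<and> m' (ta t) = evm m h \<and> same_below t m m'"
      by (intro exI[of _ "m1(ta t := evm m h)"]) simp
  qed
qed

lemma computes_pow:
  assumes e: "computes w wbar t e ce" and f: "computes w wbar (Suc t) f cf"
  shows "computes w wbar t (EPow e f) (Seq ce (Seq cf (Seq (TSet (t + 2) (Const 1))
     (Seq (WhilePos (TC (Suc t)) (Seq (TSet (t + 2) (Mul (TC (t + 2)) (TC t)))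
                              (TSet (Suc t) (Sub (TC (Suc t)) (Const 1)))))
       (TSet t (TC (t + 2)))))))"
proof -
  obtain B1 where B1: "pow_bounded B1" "\<And>M m r. bdm M m e \<Longrightarrow>
     \<exists>m'. runs w wbar ce (m, r) (B1 M) (m', r) \<and> m' (ta t) = evm m e \<and> same_below t m m'"
    using e unfolding computes_def by blast
  obtain B2 where B2: "pow_bounded B2" "\<And>M m r. bdm M m f \<Longrightarrow>
     \<exists>m'. runs w wbar cf (m, r) (B2 M) (m', r) \<and> m' (ta (Suc t)) = evm m f \<and> same_below (Suc t) m m'"
    using f unfolding computes_def by blast
  define L where "L = len (ta t) + len (ta (Suc t)) + len (ta (t + 2)) + len 1"
  let ?C = "\<lambda>M. 2 * L + 3 * Suc M"
  let ?B = "\<lambda>M. B1 M + (B2 M + (?C M + ((M * ((?C M + ?C M) + ?C M) + ?C M) + ?C M)))"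
  let ?body = "Seq (TSet (t + 2) (Mul (TC (t + 2)) (TC t))) (TSet (Suc t) (Sub (TC (Suc t)) (Const 1)))"
  show ?thesis
  proof (rule computesI[where B = ?B])
    show "pow_bounded ?B" using B1(1) B2(1) by auto
    fix M m r assume b: "bdm M m (EPow e f)"
    obtain m1 where m1: "runs w wbar ce (m, r) (B1 M) (m1, r)" "m1 (ta t) = evm m e" "same_below t m m1"
      using B1(2) b by fastforce
    have "bdm M m1 f" using b by (simp add: same_below_of[OF m1(3)])
    then obtain m2 where m2: "runs w wbar cf (m1, r) (B2 M) (m2, r)" "m2 (ta (Suc t)) = evm m1 f"
      "same_below (Suc t) m1 m2" using B2(2) by blast
    have v2: "m2 (ta t) = evm m e" "m2 (ta (Suc t)) = evm m f"
      using same_below_ta[OF m2(3)] m1(2) m2(2) by (simp_all add: same_below_of[OF m1(3)])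
    have s2: "same_below t m m2" using same_below_trans[OF m1(3) m2(3)] by simp
    define n where "n = nat (evm m f)"
    have nM: "n \<le> M" using b by (simp add: n_def)
    have l: "len (evm m e) \<le> Suc M" "len (evm m f) \<le> Suc M"
      using b by (auto intro!: len_le bnd_fits)
    have lF: "len (evm m e ^ k) \<le> Suc M" if "k \<le> n" for k
      using b that by (intro len_le) (simp add: n_def)
    have lk: "len (evm m f - int k) \<le> Suc M" if "k \<le> n" for k
    proof -
      have "\<bar>evm m f - int k\<bar> \<le> \<bar>evm m f\<bar>" using that by (auto simp: n_def)
      then show ?thesis using b bnd_fits[of M _ _ _ f] by (intro len_le) (auto intro: le_less_trans)
    qed
    have l0: "len (ta t) + len (ta (t + 2)) \<le> L" "len (ta (t + 2)) + len 1 \<le> L"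
       "len (ta (Suc t)) + len 1 \<le> L" "len (ta (Suc t)) \<le> L" "len (ta t) \<le> L" "len (ta (t + 2)) \<le> L"
      by (simp_all add: L_def)
    have r3: "runs w wbar (TSet (t + 2) (Const 1)) (m2, r) (?C M) (m2(ta (t + 2) := 1), r)"
      using runs_ISet[of m2 "Const (ta (t + 2))" "Const 1" "?C M"] l0 by simp
    define Q where "Q = (\<lambda>k m' r'. r' = r \<and> m' (ta t) = evm m e \<and> m' (ta (Suc t)) = evm m f - int k \<and>
        m' (ta (t + 2)) = evm m e ^ k \<and> same_below t m m')"
    have "\<exists>m' r'. runs w wbar (WhilePos (TC (Suc t)) ?body) (m2(ta (t + 2) := 1), r)
        (n * ((?C M + ?C M) + ?C M) + ?C M) (m', r') \<and> Q n m' r'"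
    proof (rule runs_WhilePos[where Q = Q])
      show "Q 0 (m2(ta (t + 2) := 1)) r" using v2 s2 by (simp add: Q_def)
    next
      fix k m' r' assume k: "k < n" and q: "Q k m' r'"
      define m5 where "m5 = m'(ta (t + 2) := evm m e ^ Suc k)"
      define m6 where "m6 = m5(ta (Suc t) := evm m f - int (Suc k))"
      have "runs w wbar (TSet (t + 2) (Mul (TC (t + 2)) (TC t))) (m', r) (?C M) (m5, r)"
        using runs_ISet[of m' "Const (ta (t + 2))" "Mul (TC (t + 2)) (TC t)" "?C M"] l0 l(1) lF[of k] lF[of "Suc k"] k q
        by (simp add: m5_def Q_def mult.commute)
      moreover have "runs w wbar (TSet (Suc t) (Sub (TC (Suc t)) (Const 1))) (m5, r) (?C M) (m6, r)"
        using runs_ISet[of m5 "Const (ta (Suc t))" "Sub (TC (Suc t)) (Const 1)" "?C M"] l0 lk[of k] lk[of "Suc k"] k q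
        by (simp add: m5_def m6_def Q_def diff_diff_eq add.commute)
      ultimately have "runs w wbar ?body (m', r') (?C M + ?C M) (m6, r)"
        using q by (intro runs_Seq) (auto simp: Q_def)
      moreover have "Q (Suc k) m6 r" using q by (simp add: Q_def m5_def m6_def)
      moreover have "ival m' (TC (Suc t)) > 0" using q k by (auto simp: Q_def n_def)
      ultimately show "ival m' (TC (Suc t)) > 0 \<and>
          (\<exists>m'' r''. runs w wbar ?body (m', r') (?C M + ?C M) (m'', r'') \<and> Q (Suc k) m'' r'')" by blast
    next
      fix m' r' assume "Q n m' r'"
      then show "ival m' (TC (Suc t)) \<le> 0" by (auto simp: Q_def n_def)
    next
      fix k m' r' assume "k \<le> n" "Q k m' r'"
      then show "icost m' (TC (Suc t)) \<le> ?C M" using lk[of k] l0 by (simp add: Q_def)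
    qed
    then obtain m8 where m8: "runs w wbar (WhilePos (TC (Suc t)) ?body) (m2(ta (t + 2) := 1), r)
        (n * ((?C M + ?C M) + ?C M) + ?C M) (m8, r)" "Q n m8 r" unfolding Q_def by blast
    have r8: "runs w wbar (WhilePos (TC (Suc t)) ?body) (m2(ta (t + 2) := 1), r)
       (M * ((?C M + ?C M) + ?C M) + ?C M) (m8, r)"
      by (rule runs_mono[OF m8(1)]) (use nM in \<open>auto intro!: add_mono mult_right_mono\<close>)
    have r9: "runs w wbar (TSet t (TC (t + 2))) (m8, r) (?C M) (m8(ta t := evm m e ^ n), r)"
      using runs_ISet[of m8 "Const (ta t)" "TC (t + 2)" "?C M"] l0 lF[of n] m8(2) by (simp add: Q_def)
    show "\<exists>m'. runs w wbar (Seq ce (Seq cf (Seq (TSet (t + 2) (Const 1))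
     (Seq (WhilePos (TC (Suc t)) ?body) (TSet t (TC (t + 2))))))) (m, r) (?B M) (m', r) \<and>
       m' (ta t) = evm m (EPow e f) \<and> same_below t m m'"
      by (intro exI[of _ "m8(ta t := evm m e ^ n)"] conjI runs_Seq[OF m1(1)] runs_Seq[OF m2(1)] runs_Seq[OF r3]
          runs_Seq[OF r8 r9]) (use m8(2) in \<open>auto simp: Q_def n_def\<close>)
  qed
qed

lemma computes_if:
  assumes e: "computes w wbar t e ce" and f: "computes w wbar t f cf" and g: "computes w wbar t g cg"
  shows "computes w wbar t (EIf e f g) (Seq ce (IfPos (TC t) cf cg))"
proof -
  obtain B1 where B1: "pow_bounded B1" "\<And>M m r. bdm M m e \<Longrightarrow>
     \<exists>m'. runs w wbar ce (m, r) (B1 M) (m', r) \<and> m' (ta t) = evm m e \<and> same_below t m m'"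
    using e unfolding computes_def by blast
  obtain B2 where B2: "pow_bounded B2" "\<And>M m r. bdm M m f \<Longrightarrow>
     \<exists>m'. runs w wbar cf (m, r) (B2 M) (m', r) \<and> m' (ta t) = evm m f \<and> same_below t m m'"
    using f unfolding computes_def by blast
  obtain B3 where B3: "pow_bounded B3" "\<And>M m r. bdm M m g \<Longrightarrow>
     \<exists>m'. runs w wbar cg (m, r) (B3 M) (m', r) \<and> m' (ta t) = evm m g \<and> same_below t m m'"
    using g unfolding computes_def by blast
  let ?B = "\<lambda>M. B1 M + ((len (ta t) + Suc M) + (B2 M + B3 M))"
  show ?thesis
  proof (rule computesI[where B = ?B])
    show "pow_bounded ?B" using B1(1) B2(1) B3(1) by auto
    fix M m r assume b: "bdm M m (EIf e f g)"
    obtain m1 where m1: "runs w wbar ce (m, r) (B1 M) (m1, r)" "m1 (ta t) = evm m e" "same_below t m m1"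
      using B1(2) b by fastforce
    note sb = same_below_of[OF m1(3)]
    have l: "icost m1 (TC t) \<le> len (ta t) + Suc M" using b m1(2) by (auto intro!: len_le bnd_fits)
    obtain m2 where m2: "if evm m e > 0 then runs w wbar cf (m1, r) (B2 M) (m2, r) \<and> m2 (ta t) = evm m f
      else runs w wbar cg (m1, r) (B3 M) (m2, r) \<and> m2 (ta t) = evm m g" "same_below t m1 m2"
    proof (cases "evm m e > 0")
      case True
      then show thesis using B2(2)[of M m1 r] b that by (auto simp: sb)
    next
      case False
      then show thesis using B3(2)[of M m1 r] b that by (auto simp: sb)
    qed
    have "runs w wbar (IfPos (TC t) cf cg) (m1, r) ((len (ta t) + Suc M) + (B2 M + B3 M)) (m2, r)"
      by (rule runs_IfPos[OF _ _ l]) (use m2 m1(2) in \<open>auto split: if_splits intro: runs_mono\<close>)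
    moreover have "m2 (ta t) = evm m (EIf e f g)" using m2 by (auto split: if_splits)
    moreover have "same_below t m m2" using same_below_trans[OF m1(3) m2(2)] by simp
    ultimately show "\<exists>m'. runs w wbar (Seq ce (IfPos (TC t) cf cg)) (m, r) (?B M) (m', r) \<and>
       m' (ta t) = evm m (EIf e f g) \<and> same_below t m m'"
      using runs_Seq[OF m1(1)] by blast
  qed
qed

theorem compile_correct: "computes w wbar t e (compile t e)"
proof (induction e arbitrary: t)
  case (ELit i)
  show ?case
    by (rule computesI[where B = "\<lambda>M. len (ta t) + len i"])
      (auto intro!: exI[of _ "_(ta t := i)"] runs_ISet[where a = "Const (ta t)" and e = "Const i", simplified])
next
  case (EVar x)
  show ?case
  proof (rule computesI[where B = "\<lambda>M. len (ta t) + (len (va x) + Suc M)"])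
    fix M m r assume "bdm M m (EVar x)"
    then have "len (m (va x)) \<le> Suc M" by (intro len_le) (simp add: env_of_def)
    then show "\<exists>m'. runs w wbar (compile t (EVar x)) (m, r) (len (ta t) + (len (va x) + Suc M)) (m', r) \<and>
       m' (ta t) = evm m (EVar x) \<and> same_below t m m'"
      using runs_ISet[of m "Const (ta t)" "VC x" "len (ta t) + (len (va x) + Suc M)"]
      by (intro exI[of _ "m(ta t := m (va x))"]) (auto simp: env_of_def)
  qed auto
next
  case (EInp e)
  let ?c = "IfPos (Add (TC t) (Const 1)) (TSet t (Cell (TC t))) (TSet t (Const 0))"
  let ?B = "\<lambda>M. (len (ta t) + len 1 + 2 * Suc (Suc M)) + (2 * len (ta t) + len 0 + 2 * Suc M)"
  show ?case unfolding compile.simps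
  proof (rule computes_upd[OF EInp.IH, where B = ?B])
    fix M m m' r
    assume b: "bdm M m (EInp e)" and sb: "same_below t m m'" and v: "m' (ta t) = evm m e"
      and l: "len (evm m e) \<le> Suc M" "len (evm m (EInp e)) \<le> Suc M"
    have f: "fits M (evm m e)" using b by (auto intro: bnd_fits)
    \<comment> \<open>The machine can only test for positivity, so nonnegativity is tested on the
      value plus one, at the price of one more bit.\<close>
    then have "len (evm m e + 1) \<le> Suc (Suc M)" by (intro len_le) simp
    moreover have "m' (evm m e) = evm m (EInp e)" if "evm m e \<ge> 0"
      using that same_below_of(1)[OF sb] unfolding inp_of_def fun_eq_iff by (auto split: if_splits)
    ultimately show "runs w wbar ?c (m', r) (?B M) (m'(ta t := evm m (EInp e)), r)"
      using l v runs_ISet[of m' "Const (ta t)" "Cell (TC t)" "2 * len (ta t) + len 0 + 2 * Suc M" w wbar r]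
        runs_ISet[of m' "Const (ta t)" "Const 0" "2 * len (ta t) + len 0 + 2 * Suc M" w wbar r]
      by (intro runs_IfPos) auto
  qed auto
next
  case (ETab e)
  let ?a = "Sub (Const (-3)) (Mul (Const 3) (TC t))"
  let ?c = "IfPos (Add (TC t) (Const 1)) (TSet t (Cell ?a)) (TSet t (Const 0))"
  let ?D = "\<lambda>M. 2 * len (ta t) + len 0 + len (-3) + len 3 + 4 * Suc (M + 4)"
  let ?B = "\<lambda>M. (len (ta t) + len 1 + 2 * Suc (Suc M)) + ?D M"
  show ?case unfolding compile.simps
  proof (rule computes_upd[OF ETab.IH, where B = ?B])
    fix M m m' r
    assume b: "bdm M m (ETab e)" and sb: "same_below t m m'" and v: "m' (ta t) = evm m e"
      and l: "len (evm m e) \<le> Suc M" "len (evm m (ETab e)) \<le> Suc M"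
    have f: "fits M (evm m e)" using b by (auto intro: bnd_fits)
    \<comment> \<open>The table address has absolute value at most three times that of the index,
      plus 3, so four more bits are ample.\<close>
    have "(2::int) ^ (M + 4) = 16 * 2 ^ M" "(1::int) \<le> 2 ^ M" by (simp_all add: power_add)
    then have f4: "fits (M + 4) (3 * evm m e)" "fits (M + 4) (- 3 - 3 * evm m e)" using f by simp_all
    have l2: "len (3 * evm m e) \<le> Suc (M + 4)" "len (- 3 - 3 * evm m e) \<le> Suc (M + 4)"
      using len_le[OF f4(1)] len_le[OF f4(2)] by simp_all
    have l1: "len (evm m e + 1) \<le> Suc (Suc M)" using f by (intro len_le) simp
    have v2: "m' (- 3 - 3 * evm m e) = evm m (ETab e)" if "evm m e \<ge> 0"
    proof -
      have "m' (- 3 - 3 * evm m e) = tab_of m' (evm m e)" using that by (simp only: tab_of_def tb_def if_True)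
      also have "\<dots> = evm m (ETab e)" using that by (simp add: same_below_of(2)[OF sb])
      finally show ?thesis .
    qed
    show "runs w wbar ?c (m', r) (?B M) (m'(ta t := evm m (ETab e)), r)"
    proof (rule runs_IfPos)
      assume "ival m' (Add (TC t) (Const 1)) > 0"
      then have "evm m e \<ge> 0" using v by simp
      then show "runs w wbar (TSet t (Cell ?a)) (m', r) (?D M) (m'(ta t := evm m (ETab e)), r)"
        using l v v2 l2 runs_ISet[of m' "Const (ta t)" "Cell ?a" "?D M" w wbar r] by simp
    next
      assume "\<not> ival m' (Add (TC t) (Const 1)) > 0"
      then show "runs w wbar (TSet t (Const 0)) (m', r) (?D M) (m'(ta t := evm m (ETab e)), r)"
        using v runs_ISet[of m' "Const (ta t)" "Const 0" "?D M" w wbar r] by simp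
    qed (use l1 v l in simp)
  qed auto
next
  case (EAdd e f)
  show ?case unfolding compile.simps
    by (rule computes_bin[OF EAdd.IH, where iop = Add and g = "(+)"]) auto
next
  case (ESub e f)
  show ?case unfolding compile.simps
    by (rule computes_bin[OF ESub.IH, where iop = Sub and g = "(-)"]) auto
next
  case (EMul e f)
  show ?case unfolding compile.simps
    by (rule computes_bin[OF EMul.IH, where iop = Mul and g = "(*)"]) auto
next
  case (EDiv e f)
  show ?case unfolding compile.simps
    by (rule computes_bin[OF EDiv.IH, where iop = Div and g = "(div)"]) auto
next
  case (EMod e f)
  show ?case unfolding compile.simps
    by (rule computes_bin[OF EMod.IH, where iop = Mod and g = "(mod)"]) auto
next
  case (EPow e f)
  show ?case unfolding compile.simps by (rule computes_pow[OF EPow.IH])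
next
  case (EIf e f g)
  show ?case unfolding compile.simps by (rule computes_if[OF EIf.IH])
next
  case (ESum x e f)
  show ?case unfolding compile.simps
    by (rule computes_fold[OF ESum.IH, where iop = Add and g = "(+)" and
        F = "\<lambda>I T v l. \<Sum>k<l. eval I T (v(x := int k)) f"]) auto
next
  case (EProd x e f)
  show ?case unfolding compile.simps
    by (rule computes_fold[OF EProd.IH, where iop = Mul and g = "(*)" and
        F = "\<lambda>I T v l. \<Prod>k<l. eval I T (v(x := int k)) f"]) auto
qed

section \<open>A syntactic criterion for polynomial running time\<close>

text \<open>\<open>small_ex A e\<close>: the value of \<open>e\<close> is polynomially bounded if those of the variables in \<open>A\<close>
  are. \<open>safe_ex A e\<close>: in addition to the sizes of the intermediate results, the loop bounds are
  polynomial. The input cells 0 and 1 hold \<open>n\<close> and the number of constraints.\<close>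

fun small_ex :: "nat set \<Rightarrow> ex \<Rightarrow> bool" where
  "small_ex A (ELit i) \<longleftrightarrow> True"
| "small_ex A (EVar x) \<longleftrightarrow> x \<in> A"
| "small_ex A (EInp e) \<longleftrightarrow> e = ELit 0 \<or> e = ELit 1"
| "small_ex A (ETab e) \<longleftrightarrow> False"
| "small_ex A (EAdd e f) \<longleftrightarrow> small_ex A e \<and> small_ex A f"
| "small_ex A (ESub e f) \<longleftrightarrow> small_ex A e \<and> small_ex A f"
| "small_ex A (EMul e f) \<longleftrightarrow> small_ex A e \<and> small_ex A f"
| "small_ex A (EDiv e f) \<longleftrightarrow> small_ex A e"
| "small_ex A (EMod e f) \<longleftrightarrow> small_ex A e \<and> small_ex A f"
| "small_ex A (EPow e f) \<longleftrightarrow> small_ex A e \<and> (\<exists>k. f = ELit k)"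
| "small_ex A (EIf e f g) \<longleftrightarrow> small_ex A f \<and> small_ex A g"
| "small_ex A (ESum x e f) \<longleftrightarrow> small_ex A e \<and> small_ex (insert x A) f"
| "small_ex A (EProd x e f) \<longleftrightarrow> False"

fun safe_ex :: "nat set \<Rightarrow> ex \<Rightarrow> bool" where
  "safe_ex A (ELit i) \<longleftrightarrow> True"
| "safe_ex A (EVar x) \<longleftrightarrow> True"
| "safe_ex A (EInp e) \<longleftrightarrow> safe_ex A e"
| "safe_ex A (ETab e) \<longleftrightarrow> safe_ex A e"
| "safe_ex A (EAdd e f) \<longleftrightarrow> safe_ex A e \<and> safe_ex A f"
| "safe_ex A (ESub e f) \<longleftrightarrow> safe_ex A e \<and> safe_ex A f"
| "safe_ex A (EMul e f) \<longleftrightarrow> safe_ex A e \<and> safe_ex A f"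
| "safe_ex A (EDiv e f) \<longleftrightarrow> safe_ex A e \<and> safe_ex A f"
| "safe_ex A (EMod e f) \<longleftrightarrow> safe_ex A e \<and> safe_ex A f"
| "safe_ex A (EPow e f) \<longleftrightarrow> safe_ex A e \<and> safe_ex A f \<and> small_ex A f"
| "safe_ex A (EIf e f g) \<longleftrightarrow> safe_ex A e \<and> safe_ex A f \<and> safe_ex A g"
| "safe_ex A (ESum x e f) \<longleftrightarrow> safe_ex A e \<and> small_ex A e \<and> safe_ex (insert x A) f"
| "safe_ex A (EProd x e f) \<longleftrightarrow> safe_ex A e \<and> small_ex A e \<and> safe_ex (insert x A) f"

section \<open>Families of evaluation contexts with uniform bounds\<close>

text \<open>The first component is the input size. Bounds have to be uniform over all contexts of
  equal size, so soundness is stated for a whole set of contexts at once.\<close>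

type_synonym ctxt = "nat \<times> (int \<Rightarrow> int) \<times> (int \<Rightarrow> int) \<times> (nat \<Rightarrow> int)"

definition poly_small :: "ctxt set \<Rightarrow> ((int \<Rightarrow> int) \<Rightarrow> (int \<Rightarrow> int) \<Rightarrow> (nat \<Rightarrow> int) \<Rightarrow> int) \<Rightarrow> bool" where
  "poly_small S F \<longleftrightarrow> (\<exists>B. pow_bounded B \<and> (\<forall>(N, I, T, v)\<in>S. \<bar>F I T v\<bar> \<le> int (B N)))"

definition poly_fits :: "ctxt set \<Rightarrow> ((int \<Rightarrow> int) \<Rightarrow> (int \<Rightarrow> int) \<Rightarrow> (nat \<Rightarrow> int) \<Rightarrow> int) \<Rightarrow> bool" where
  "poly_fits S F \<longleftrightarrow> (\<exists>B. pow_bounded B \<and> (\<forall>(N, I, T, v)\<in>S. fits (B N) (F I T v)))"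

text \<open>Small absolute values are demanded only of input cells 0 and 1 and of the variables in
  \<open>A\<close>. Everything else that an expression can read needs merely a small bit length; in
  particular the thresholds of cardinality constraints are given in binary.\<close>

definition base_ok :: "nat set \<Rightarrow> ctxt set \<Rightarrow> bool" where
  "base_ok A S \<longleftrightarrow> (\<exists>B. pow_bounded B \<and> (\<forall>(N, I, T, v)\<in>S.
      \<bar>I 0\<bar> \<le> int (B N) \<and> \<bar>I 1\<bar> \<le> int (B N) \<and> (\<forall>a\<ge>0. fits (B N) (I a)) \<and>
      (\<forall>i\<ge>0. fits (B N) (T i)) \<and> (\<forall>x. fits (B N) (v x)) \<and> (\<forall>x\<in>A. \<bar>v x\<bar> \<le> int (B N))))"

text \<open>The contexts in which a loop body is evaluated. The induction hypothesis for the body is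
  used for this family, with the loop variable added to the small ones.\<close>

definition loop_ctxts :: "ctxt set \<Rightarrow> nat \<Rightarrow> ex \<Rightarrow> ctxt set" where
  "loop_ctxts S x e = {(N, I, T, v(x := int k)) | N I T v k. (N, I, T, v) \<in> S \<and> k < nat (eval I T v e)}"

lemma abs_div_le: "\<bar>a div b\<bar> \<le> \<bar>a :: int\<bar>"
proof -
  have pos: "\<bar>a div b\<bar> \<le> \<bar>a\<bar>" if "b > 0" for a b :: int
  proof (cases "a \<ge> 0")
    case True
    then show ?thesis using that zdiv_mono2[of a 1 b] pos_imp_zdiv_nonneg_iff[of b a] by auto
  next
    case False
    then show ?thesis using that zdiv_mono2_neg[of a 1 b] pos_imp_zdiv_neg_iff[of b a] by auto
  qed
  consider "b > 0" | "b = 0" | "b < 0" by linarith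
  then show ?thesis
  proof cases
    case 3
    have "a div b = (- a) div (- b)" by simp
    then show ?thesis using pos[of "- b" "- a"] 3 by simp
  qed (use pos in auto)
qed

lemma abs_mod_le: "\<bar>a mod b\<bar> \<le> \<bar>a :: int\<bar> + \<bar>b\<bar>"
  using abs_mod_less[of b a] by (cases "b = 0") auto

lemma poly_smallI:
  "pow_bounded B \<Longrightarrow> (\<And>N I T v. (N, I, T, v) \<in> S \<Longrightarrow> \<bar>F I T v\<bar> \<le> int (B N)) \<Longrightarrow> poly_small S F"
  unfolding poly_small_def by (intro exI[of _ B]) auto

lemma poly_smallE:
  assumes "poly_small S F"
  obtains B where "pow_bounded B" "\<And>N I T v. (N, I, T, v) \<in> S \<Longrightarrow> \<bar>F I T v\<bar> \<le> int (B N)"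
proof -
  obtain B where "pow_bounded B" "\<forall>(N, I, T, v)\<in>S. \<bar>F I T v\<bar> \<le> int (B N)"
    using assms unfolding poly_small_def by (elim exE conjE)
  then show thesis by (intro that[of B]) auto
qed

lemma poly_small2:
  assumes "poly_small S F" "poly_small S G" "\<And>a b. pow_bounded a \<Longrightarrow> pow_bounded b \<Longrightarrow> pow_bounded (\<lambda>N. g (a N) (b N))"
    "\<And>x y a b. \<bar>x\<bar> \<le> int a \<Longrightarrow> \<bar>y\<bar> \<le> int b \<Longrightarrow> \<bar>h x y\<bar> \<le> int (g a b)"
  shows "poly_small S (\<lambda>I T v. h (F I T v) (G I T v))"
proof -
  obtain a where a: "pow_bounded a" "\<And>N I T v. (N, I, T, v) \<in> S \<Longrightarrow> \<bar>F I T v\<bar> \<le> int (a N)"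
    by (rule poly_smallE[OF assms(1)]) (blast intro: that)
  obtain b where b: "pow_bounded b" "\<And>N I T v. (N, I, T, v) \<in> S \<Longrightarrow> \<bar>G I T v\<bar> \<le> int (b N)"
    by (rule poly_smallE[OF assms(2)]) (blast intro: that)
  show ?thesis
    by (rule poly_smallI[OF assms(3)[OF a(1) b(1)]]) (intro assms(4) a(2) b(2))
qed

lemma le_fits: "\<bar>z\<bar> \<le> int k \<Longrightarrow> fits k z"
  using of_nat_less_two_power[of k, where 'a = int] by linarith

lemma base_okE:
  assumes "base_ok A S"
  obtains B where "pow_bounded B" "\<And>N I T v. (N, I, T, v) \<in> S \<Longrightarrow>
      \<bar>I 0\<bar> \<le> int (B N) \<and> \<bar>I 1\<bar> \<le> int (B N) \<and> (\<forall>a\<ge>0. fits (B N) (I a)) \<and>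
      (\<forall>i\<ge>0. fits (B N) (T i)) \<and> (\<forall>x. fits (B N) (v x)) \<and> (\<forall>x\<in>A. \<bar>v x\<bar> \<le> int (B N))"
proof -
  obtain B where "pow_bounded B" "\<forall>(N, I, T, v)\<in>S.
      \<bar>I 0\<bar> \<le> int (B N) \<and> \<bar>I 1\<bar> \<le> int (B N) \<and> (\<forall>a\<ge>0. fits (B N) (I a)) \<and>
      (\<forall>i\<ge>0. fits (B N) (T i)) \<and> (\<forall>x. fits (B N) (v x)) \<and> (\<forall>x\<in>A. \<bar>v x\<bar> \<le> int (B N))"
    using assms unfolding base_ok_def by (elim exE conjE)
  then show thesis by (intro that[of B]) auto
qed

lemma base_ok_loop:
  assumes b: "base_ok A S" and e: "poly_small S (\<lambda>I T v. eval I T v e)"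
  shows "base_ok (insert x A) (loop_ctxts S x e)"
proof -
  obtain B where B: "pow_bounded B" "\<And>N I T v. (N, I, T, v) \<in> S \<Longrightarrow>
      \<bar>I 0\<bar> \<le> int (B N) \<and> \<bar>I 1\<bar> \<le> int (B N) \<and> (\<forall>a\<ge>0. fits (B N) (I a)) \<and>
      (\<forall>i\<ge>0. fits (B N) (T i)) \<and> (\<forall>x. fits (B N) (v x)) \<and> (\<forall>x\<in>A. \<bar>v x\<bar> \<le> int (B N))"
    by (rule base_okE[OF b]) (blast intro: that)
  obtain B' where B': "pow_bounded B'" "\<And>N I T v. (N, I, T, v) \<in> S \<Longrightarrow> \<bar>eval I T v e\<bar> \<le> int (B' N)"
    by (rule poly_smallE[OF e]) (blast intro: that)
  show ?thesis unfolding base_ok_def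
  proof (intro exI[of _ "\<lambda>N. B N + B' N"] conjI ballI)
    show "pow_bounded (\<lambda>N. B N + B' N)" using B B' by auto
    fix c assume "c \<in> loop_ctxts S x e"
    then obtain N I T v k where c: "c = (N, I, T, v(x := int k))" "(N, I, T, v) \<in> S" "k < nat (eval I T v e)"
      unfolding loop_ctxts_def by blast
    have k: "\<bar>int k\<bar> \<le> int (B N + B' N)" using c(3) B'(2)[OF c(2)] by linarith
    have "fits (B N + B' N) z" if "fits (B N) z" for z using that by (rule fits_mono) simp
    then show "case c of (N, I, T, v) \<Rightarrow> \<bar>I 0\<bar> \<le> int (B N + B' N) \<and> \<bar>I 1\<bar> \<le> int (B N + B' N) \<and>
        (\<forall>a\<ge>0. fits (B N + B' N) (I a)) \<and> (\<forall>i\<ge>0. fits (B N + B' N) (T i)) \<and>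
        (\<forall>x. fits (B N + B' N) (v x)) \<and> (\<forall>x\<in>insert x A. \<bar>v x\<bar> \<le> int (B N + B' N))"
      unfolding c(1) prod.case using B(2)[OF c(2)] le_fits[OF k] k by fastforce
  qed
qed

text \<open>A sum multiplies the bound on its length with the bound on its summands. General
  products and table entries are excluded because they may be exponentially large.\<close>

theorem small_ex_sound:
  "base_ok A S \<Longrightarrow> small_ex A e \<Longrightarrow> poly_small S (\<lambda>I T v. eval I T v e)"
proof (induction e arbitrary: A S)
  case (ELit i)
  show ?case by (rule poly_smallI[where B = "\<lambda>_. nat \<bar>i\<bar>"]) auto
next
  case (EVar x)
  obtain B where B: "pow_bounded B" "\<And>N I T v. (N, I, T, v) \<in> S \<Longrightarrow>
      \<bar>I 0\<bar> \<le> int (B N) \<and> \<bar>I 1\<bar> \<le> int (B N) \<and> (\<forall>a\<ge>0. fits (B N) (I a)) \<and>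
      (\<forall>i\<ge>0. fits (B N) (T i)) \<and> (\<forall>x. fits (B N) (v x)) \<and> (\<forall>x\<in>A. \<bar>v x\<bar> \<le> int (B N))" by (rule base_okE[OF EVar.prems(1)]) (blast intro: that)
  show ?case
  proof (rule poly_smallI[OF B(1)])
    fix N I T v assume "(N, I, T, v) \<in> S"
    from B(2)[OF this] show "\<bar>eval I T v (EVar x)\<bar> \<le> int (B N)" using EVar.prems(2) by simp
  qed
next
  case (EInp e)
  obtain B where B: "pow_bounded B" "\<And>N I T v. (N, I, T, v) \<in> S \<Longrightarrow>
      \<bar>I 0\<bar> \<le> int (B N) \<and> \<bar>I 1\<bar> \<le> int (B N) \<and> (\<forall>a\<ge>0. fits (B N) (I a)) \<and>
      (\<forall>i\<ge>0. fits (B N) (T i)) \<and> (\<forall>x. fits (B N) (v x)) \<and> (\<forall>x\<in>A. \<bar>v x\<bar> \<le> int (B N))" by (rule base_okE[OF EInp.prems(1)]) (blast intro: that)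
  show ?case
  proof (rule poly_smallI[OF B(1)])
    fix N I T v assume "(N, I, T, v) \<in> S"
    from B(2)[OF this] show "\<bar>eval I T v (EInp e)\<bar> \<le> int (B N)" using EInp.prems(2) by auto
  qed
next
  case (EAdd e f)
  then have "poly_small S (\<lambda>I T v. eval I T v e)" "poly_small S (\<lambda>I T v. eval I T v f)" by simp_all
  then show ?case unfolding eval.simps
    by (rule poly_small2[where g = "(+)" and h = "(+)"]) (auto)
next
  case (ESub e f)
  then have "poly_small S (\<lambda>I T v. eval I T v e)" "poly_small S (\<lambda>I T v. eval I T v f)" by simp_all
  then show ?case unfolding eval.simps
    by (rule poly_small2[where g = "(+)" and h = "(-)"]) (auto)
next
  case (EMul e f)
  then have "poly_small S (\<lambda>I T v. eval I T v e)" "poly_small S (\<lambda>I T v. eval I T v f)" by simp_all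
  then show ?case unfolding eval.simps
    by (rule poly_small2[where g = "(*)" and h = "(*)"]) (auto simp: abs_mult intro!: mult_mono)
next
  case (EDiv e f)
  then have "poly_small S (\<lambda>I T v. eval I T v e)" by simp
  then obtain B where B: "pow_bounded B" "\<And>N I T v. (N, I, T, v) \<in> S \<Longrightarrow> \<bar>eval I T v e\<bar> \<le> int (B N)"
    by (rule poly_smallE) (blast intro: that)
  show ?case
  proof (rule poly_smallI[OF B(1)])
    fix N I T v assume "(N, I, T, v) \<in> S"
    from B(2)[OF this] show "\<bar>eval I T v (EDiv e f)\<bar> \<le> int (B N)"
      using abs_div_le[of "eval I T v e" "eval I T v f"] by simp
  qed
next
  case (EMod e f)
  have "\<bar>x mod y\<bar> \<le> int (a + b)" if "\<bar>x\<bar> \<le> int a" "\<bar>y\<bar> \<le> int b" for x y a b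
    using abs_mod_le[of x y] that by linarith
  moreover have "poly_small S (\<lambda>I T v. eval I T v e)" "poly_small S (\<lambda>I T v. eval I T v f)" using EMod by simp_all
  ultimately show ?case unfolding eval.simps
    by (intro poly_small2[where g = "(+)" and h = "(mod)"]) auto
next
  case (EPow e f)
  then obtain k where k: "f = ELit k" by auto
  obtain B where B: "pow_bounded B" "\<And>N I T v. (N, I, T, v) \<in> S \<Longrightarrow> \<bar>eval I T v e\<bar> \<le> int (B N)"
    by (rule poly_smallE[OF EPow.IH(1)[OF EPow.prems(1)]]) (use EPow.prems in simp, blast intro: that)
  show ?case
  proof (rule poly_smallI[where B = "\<lambda>N. B N ^ nat k"])
    fix N I T v assume "(N, I, T, v) \<in> S"
    from B(2)[OF this] show "\<bar>eval I T v (EPow e f)\<bar> \<le> int (B N ^ nat k)"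
      by (simp add: k power_abs power_mono)
  qed (use B in auto)
next
  case (EIf e f g)
  have "poly_small S (\<lambda>I T v. eval I T v f)" "poly_small S (\<lambda>I T v. eval I T v g)"
    using EIf.IH(2,3)[OF EIf.prems(1)] EIf.prems(2) by auto
  then have "poly_small S (\<lambda>I T v. max \<bar>eval I T v f\<bar> \<bar>eval I T v g\<bar>)"
    by (rule poly_small2[where g = "(+)"]) auto
  then obtain B where B: "pow_bounded B"
    "\<And>N I T v. (N, I, T, v) \<in> S \<Longrightarrow> \<bar>max \<bar>eval I T v f\<bar> \<bar>eval I T v g\<bar>\<bar> \<le> int (B N)"
    by (rule poly_smallE) (blast intro: that)
  show ?case
  proof (rule poly_smallI[OF B(1)])
    fix N I T v assume "(N, I, T, v) \<in> S"
    from B(2)[OF this] show "\<bar>eval I T v (EIf e f g)\<bar> \<le> int (B N)" by auto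
  qed
next
  case (ESum x e f)
  have e: "poly_small S (\<lambda>I T v. eval I T v e)" using ESum by auto
  then obtain B where B: "pow_bounded B" "\<And>N I T v. (N, I, T, v) \<in> S \<Longrightarrow> \<bar>eval I T v e\<bar> \<le> int (B N)"
    by (rule poly_smallE) (blast intro: that)
  obtain B' where B': "pow_bounded B'" "\<And>N I T v. (N, I, T, v) \<in> loop_ctxts S x e \<Longrightarrow> \<bar>eval I T v f\<bar> \<le> int (B' N)"
    by (rule poly_smallE[OF ESum.IH(2)[OF base_ok_loop[OF ESum.prems(1) e, of x]]]) (use ESum.prems in simp, rule that, assumption, blast)
  show ?case
  proof (rule poly_smallI[where B = "\<lambda>N. B N * B' N"])
    fix N I T v assume S: "(N, I, T, v) \<in> S"
    let ?n = "nat (eval I T v e)"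
    have n: "?n \<le> B N" using B(2)[OF S] by linarith
    have "\<bar>\<Sum>k<?n. eval I T (v(x := int k)) f\<bar> \<le> (\<Sum>k<?n. \<bar>eval I T (v(x := int k)) f\<bar>)" by (rule sum_abs)
    also have "\<dots> \<le> (\<Sum>k<?n. int (B' N))"
      using S by (intro sum_mono B'(2)) (auto simp: loop_ctxts_def)
    also have "\<dots> = int (?n * B' N)" by simp
    also have "\<dots> \<le> int (B N * B' N)" using n by (intro of_nat_mono mult_right_mono) auto
    finally show "\<bar>eval I T v (ESum x e f)\<bar> \<le> int (B N * B' N)" by simp
  qed (use B B' in auto)
qed auto

lemma safe_exE:
  assumes "\<exists>B. pow_bounded B \<and> (\<forall>(N, I, T, v)\<in>S. bnd (B N) I T v e)"
  obtains B where "pow_bounded B" "\<And>N I T v. (N, I, T, v) \<in> S \<Longrightarrow> bnd (B N) I T v e"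
proof -
  obtain B where "pow_bounded B" "\<forall>(N, I, T, v)\<in>S. bnd (B N) I T v e"
    using assms by (elim exE conjE)
  then show thesis by (intro that[of B]) auto
qed

lemma safe_exI:
  "pow_bounded B \<Longrightarrow> (\<And>N I T v. (N, I, T, v) \<in> S \<Longrightarrow> bnd (B N) I T v e) \<Longrightarrow>
   \<exists>B. pow_bounded B \<and> (\<forall>(N, I, T, v)\<in>S. bnd (B N) I T v e)"
  by (intro exI[of _ B]) auto

lemma safe_bin:
  assumes e: "\<exists>B. pow_bounded B \<and> (\<forall>(N, I, T, v)\<in>S. bnd (B N) I T v e)"
    and f: "\<exists>B. pow_bounded B \<and> (\<forall>(N, I, T, v)\<in>S. bnd (B N) I T v f)"
    and op: "\<And>M I T v. bnd M I T v h \<longleftrightarrow> bnd M I T v e \<and> bnd M I T v f \<and> fits M (g (eval I T v e) (eval I T v f))"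
    and g: "\<And>a b x y. fits a x \<Longrightarrow> fits b y \<Longrightarrow> fits (a + b + 1) (g x y)"
  shows "\<exists>B. pow_bounded B \<and> (\<forall>(N, I, T, v)\<in>S. bnd (B N) I T v h)"
proof -
  obtain B where B: "pow_bounded B" "\<And>N I T v. (N, I, T, v) \<in> S \<Longrightarrow> bnd (B N) I T v e"
    by (rule safe_exE[OF e]) (blast intro: that)
  obtain B' where B': "pow_bounded B'" "\<And>N I T v. (N, I, T, v) \<in> S \<Longrightarrow> bnd (B' N) I T v f"
    by (rule safe_exE[OF f]) (blast intro: that)
  show ?thesis
  proof (intro exI[of _ "\<lambda>N. B N + B' N + 1"] conjI ballI, goal_cases)
    case (2 c)
    obtain N I T v where c: "c = (N, I, T, v)" by (metis prod_cases4)
    have S: "(N, I, T, v) \<in> S" using 2 c by simp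
    have "bnd (B N + B' N + 1) I T v e" by (rule bnd_mono[OF B(2)[OF S]]) simp
    moreover have "bnd (B N + B' N + 1) I T v f" by (rule bnd_mono[OF B'(2)[OF S]]) simp
    moreover have "fits (B N + B' N + 1) (g (eval I T v e) (eval I T v f))"
      by (rule g[OF bnd_fits[OF B(2)[OF S]] bnd_fits[OF B'(2)[OF S]]])
    ultimately show ?case unfolding c prod.case op by blast
  qed (use B B' in auto)
qed

lemma fits_add_sub:
  assumes "fits a x" "fits b y"
  shows "fits (a + b + 1) (x + y)" "fits (a + b + 1) (x - y)"
proof -
  have "(2::int) ^ a \<le> 2 ^ (a + b)" "(2::int) ^ b \<le> 2 ^ (a + b)" "(2::int) ^ (a + b + 1) = 2 * 2 ^ (a + b)"
    by (auto intro: power_increasing)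
  then show "fits (a + b + 1) (x + y)" "fits (a + b + 1) (x - y)" using assms by linarith+
qed

lemma fits_mult: "fits a x \<Longrightarrow> fits b y \<Longrightarrow> fits (a + b) (x * y)"
  unfolding power_add abs_mult by (intro mult_strict_mono) auto

lemma fits_1: "fits (Suc a) 1"
proof -
  have "(1::int) \<le> 2 ^ a" by simp
  then show ?thesis unfolding power_Suc by linarith
qed

text \<open>The additional bit is for the empty product: 1 does not fit into 0 bits. The same holds
  for \<open>fits_prod_le\<close>.\<close>

lemma fits_power_le: "fits a x \<Longrightarrow> k \<le> n \<Longrightarrow> fits (n * a + 1) (x ^ k)"
proof (induction k arbitrary: n)
  case 0
  show ?case using fits_1[of "n * a"] by simp
next
  case (Suc k)
  then obtain n' where n': "n = Suc n'" "k \<le> n'" by (cases n) auto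
  have "fits (a + (n' * a + 1)) (x * x ^ k)" using Suc n' by (intro fits_mult) auto
  then show ?case by (simp add: n' add.commute add.left_commute)
qed

text \<open>The crude estimate of the number of terms by \<open>2 ^ n\<close> suffices, since
  \<open>n\<close> is going to be polynomial.\<close>

lemma fits_sum_le:
  assumes "\<And>k. k < n \<Longrightarrow> fits a (F k)" "l \<le> n"
  shows "fits (n + a) (\<Sum>k<l. F k :: int)"
proof -
  have "\<bar>\<Sum>k<l. F k\<bar> \<le> (\<Sum>k<l. \<bar>F k\<bar>)" by (rule sum_abs)
  also have "\<dots> \<le> (\<Sum>k<l. 2 ^ a)" using assms by (intro sum_mono) (auto simp: less_imp_le)
  also have "\<dots> = int l * 2 ^ a" by simp
  also have "\<dots> < 2 ^ n * 2 ^ a"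
  proof (rule mult_strict_right_mono)
    have "int l \<le> int n" "int n < 2 ^ n" using assms by (auto simp: of_nat_less_two_power)
    then show "int l < 2 ^ n" by linarith
  qed auto
  finally show ?thesis by (simp add: power_add)
qed

lemma fits_prod_le:
  assumes "\<And>k. k < n \<Longrightarrow> fits a (F k)" "l \<le> n"
  shows "fits (n * a + 1) (\<Prod>k<l. F k :: int)"
  using assms(2)
proof (induction l)
  case 0
  show ?case using fits_1[of "n * a"] by simp
next
  case (Suc l)
  have "\<bar>\<Prod>k<Suc l. F k\<bar> = (\<Prod>k<Suc l. \<bar>F k\<bar>)" by (rule abs_prod)
  also have "\<dots> \<le> (\<Prod>k<Suc l. 2 ^ a)"
    using assms(1) Suc.prems by (intro prod_mono) (auto simp: less_imp_le)
  also have "\<dots> = 2 ^ (Suc l * a)" by (simp add: power_mult[symmetric] power_add mult.commute)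
  also have "\<dots> \<le> 2 ^ (n * a)" using mult_le_mono1[OF Suc.prems, of a] by (intro power_increasing) auto
  also have "\<dots> < 2 ^ (n * a + 1)" by simp
  finally show ?case .
qed

text \<open>Bit lengths add up under the arithmetic operations. In powers and products they are
  multiplied with the number of factors, which stays polynomial because exponents and loop bounds
  satisfy \<open>small_ex\<close>.\<close>

theorem safe_ex_sound:
  "base_ok A S \<Longrightarrow> safe_ex A e \<Longrightarrow> \<exists>B. pow_bounded B \<and> (\<forall>(N, I, T, v)\<in>S. bnd (B N) I T v e)"
proof (induction e arbitrary: A S)
  case (ELit i)
  show ?case by (rule exI[of _ "\<lambda>_. nat \<bar>i\<bar>"]) (auto intro: le_fits)
next
  case (EVar x)
  obtain B where B: "pow_bounded B" "\<And>N I T v. (N, I, T, v) \<in> S \<Longrightarrow>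
      \<bar>I 0\<bar> \<le> int (B N) \<and> \<bar>I 1\<bar> \<le> int (B N) \<and> (\<forall>a\<ge>0. fits (B N) (I a)) \<and>
      (\<forall>i\<ge>0. fits (B N) (T i)) \<and> (\<forall>x. fits (B N) (v x)) \<and> (\<forall>x\<in>A. \<bar>v x\<bar> \<le> int (B N))" by (rule base_okE[OF EVar.prems(1)]) (blast intro: that)
  show ?case using B by (intro exI[of _ B]) auto
next
  case (EInp e)
  obtain B where B: "pow_bounded B" "\<And>N I T v. (N, I, T, v) \<in> S \<Longrightarrow> bnd (B N) I T v e"
    by (rule safe_exE[OF EInp.IH[OF EInp.prems(1)]]) (use EInp.prems in simp, blast intro: that)
  obtain B' where B': "pow_bounded B'" "\<And>N I T v. (N, I, T, v) \<in> S \<Longrightarrow>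
      \<bar>I 0\<bar> \<le> int (B' N) \<and> \<bar>I 1\<bar> \<le> int (B' N) \<and> (\<forall>a\<ge>0. fits (B' N) (I a)) \<and>
      (\<forall>i\<ge>0. fits (B' N) (T i)) \<and> (\<forall>x. fits (B' N) (v x)) \<and> (\<forall>x\<in>A. \<bar>v x\<bar> \<le> int (B' N))" by (rule base_okE[OF EInp.prems(1)]) (blast intro: that)
  show ?case
  proof (rule safe_exI[where B = "\<lambda>N. B N + B' N"])
    fix N I T v assume S: "(N, I, T, v) \<in> S"
    have "bnd (B N + B' N) I T v e" by (rule bnd_mono[OF B(2)[OF S]]) simp
    moreover have "fits (B N + B' N) (eval I T v (EInp e))"
      by (rule fits_mono[where M = "B' N"]) (use B'(2)[OF S] in \<open>auto intro: zero_less_power\<close>)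
    ultimately show "bnd (B N + B' N) I T v (EInp e)" unfolding bnd.simps by blast
  qed (use B B' in simp)
next
  case (ETab e)
  obtain B where B: "pow_bounded B" "\<And>N I T v. (N, I, T, v) \<in> S \<Longrightarrow> bnd (B N) I T v e"
    by (rule safe_exE[OF ETab.IH[OF ETab.prems(1)]]) (use ETab.prems in simp, blast intro: that)
  obtain B' where B': "pow_bounded B'" "\<And>N I T v. (N, I, T, v) \<in> S \<Longrightarrow>
      \<bar>I 0\<bar> \<le> int (B' N) \<and> \<bar>I 1\<bar> \<le> int (B' N) \<and> (\<forall>a\<ge>0. fits (B' N) (I a)) \<and>
      (\<forall>i\<ge>0. fits (B' N) (T i)) \<and> (\<forall>x. fits (B' N) (v x)) \<and> (\<forall>x\<in>A. \<bar>v x\<bar> \<le> int (B' N))" by (rule base_okE[OF ETab.prems(1)]) (blast intro: that)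
  show ?case
  proof (rule safe_exI[where B = "\<lambda>N. B N + B' N"])
    fix N I T v assume S: "(N, I, T, v) \<in> S"
    have "bnd (B N + B' N) I T v e" by (rule bnd_mono[OF B(2)[OF S]]) simp
    moreover have "fits (B N + B' N) (eval I T v (ETab e))"
      by (rule fits_mono[where M = "B' N"]) (use B'(2)[OF S] in \<open>auto intro: zero_less_power\<close>)
    ultimately show "bnd (B N + B' N) I T v (ETab e)" unfolding bnd.simps by blast
  qed (use B B' in simp)
next
  case (EAdd e f)
  show ?case by (rule safe_bin[of _ e f, where g = "(+)"]) (use EAdd in \<open>auto intro: fits_add_sub[simplified]\<close>)
next
  case (ESub e f)
  show ?case by (rule safe_bin[of _ e f, where g = "(-)"]) (use ESub in \<open>auto intro: fits_add_sub[simplified]\<close>)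
next
  case (EMul e f)
  show ?case
  proof (rule safe_bin[of _ e f, where g = "(*)"])
    show "fits (a + b + 1) (x * y)" if "fits a x" "fits b y" for a b x y
      using fits_mult[OF that] by (rule fits_mono) simp
  qed (use EMul in auto)
next
  case (EDiv e f)
  show ?case
  proof (rule safe_bin[of _ e f, where g = "(div)"])
    show "fits (a + b + 1) (x div y)" if "fits a x" "fits b y" for a b x y
    proof (rule fits_mono)
      show "fits a (x div y)" using abs_div_le[of x y] that by linarith
    qed simp
  qed (use EDiv in auto)
next
  case (EMod e f)
  show ?case
  proof (rule safe_bin[of _ e f, where g = "(mod)"])
    show "fits (a + b + 1) (x mod y)" if "fits a x" "fits b y" for a b x y
      using abs_mod_le[of x y] fits_add_sub(1)[where a = a and x = "\<bar>x\<bar>" and b = b and y = "\<bar>y\<bar>"] that by simp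
  qed (use EMod in auto)
next
  case (EPow e f)
  obtain B where B: "pow_bounded B" "\<And>N I T v. (N, I, T, v) \<in> S \<Longrightarrow> bnd (B N) I T v e"
    by (rule safe_exE[OF EPow.IH(1)[OF EPow.prems(1)]]) (use EPow.prems in simp, blast intro: that)
  obtain B' where B': "pow_bounded B'" "\<And>N I T v. (N, I, T, v) \<in> S \<Longrightarrow> bnd (B' N) I T v f"
    by (rule safe_exE[OF EPow.IH(2)[OF EPow.prems(1)]]) (use EPow.prems in simp, blast intro: that)
  obtain C where C: "pow_bounded C" "\<And>N I T v. (N, I, T, v) \<in> S \<Longrightarrow> \<bar>eval I T v f\<bar> \<le> int (C N)"
    by (rule poly_smallE[OF small_ex_sound[OF EPow.prems(1), of f]]) (use EPow.prems in simp, blast intro: that)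
  let ?B = "\<lambda>N. B N + B' N + C N + (C N * B N + 1)"
  show ?case
  proof (intro exI[of _ ?B] conjI ballI, goal_cases)
    case (2 c)
    obtain N I T v where c: "c = (N, I, T, v)" by (metis prod_cases4)
    have S: "(N, I, T, v) \<in> S" using 2 c by simp
    have n: "nat (eval I T v f) \<le> C N" using C(2)[OF S] by linarith
    have "fits (?B N) (eval I T v e ^ k)" if "k \<le> nat (eval I T v f)" for k
      by (rule fits_mono[OF fits_power_le[OF bnd_fits[OF B(2)[OF S]], of k "C N"]]) (use that n in auto)
    then show ?case using n bnd_mono[OF B(2)[OF S], of "?B N"] bnd_mono[OF B'(2)[OF S], of "?B N"] by (auto simp: c)
  qed (use B B' C in auto)
next
  case (EIf e f g)
  obtain B where B: "pow_bounded B" "\<And>N I T v. (N, I, T, v) \<in> S \<Longrightarrow> bnd (B N) I T v e"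
    by (rule safe_exE[OF EIf.IH(1)[OF EIf.prems(1)]]) (use EIf.prems in simp, blast intro: that)
  obtain B' where B': "pow_bounded B'" "\<And>N I T v. (N, I, T, v) \<in> S \<Longrightarrow> bnd (B' N) I T v f"
    by (rule safe_exE[OF EIf.IH(2)[OF EIf.prems(1)]]) (use EIf.prems in simp, blast intro: that)
  obtain C where C: "pow_bounded C" "\<And>N I T v. (N, I, T, v) \<in> S \<Longrightarrow> bnd (C N) I T v g"
    by (rule safe_exE[OF EIf.IH(3)[OF EIf.prems(1)]]) (use EIf.prems in simp, blast intro: that)
  show ?case
  proof (rule safe_exI[where B = "\<lambda>N. B N + B' N + C N"])
    fix N I T v assume S: "(N, I, T, v) \<in> S"
    show "bnd (B N + B' N + C N) I T v (EIf e f g)"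
      using bnd_mono[OF B(2)[OF S], of "B N + B' N + C N"] bnd_mono[OF B'(2)[OF S], of "B N + B' N + C N"]
        bnd_mono[OF C(2)[OF S], of "B N + B' N + C N"] by simp
  qed (use B B' C in simp)
next
  case (ESum x e f)
  obtain B where B: "pow_bounded B" "\<And>N I T v. (N, I, T, v) \<in> S \<Longrightarrow> bnd (B N) I T v e"
    by (rule safe_exE[OF ESum.IH(1)[OF ESum.prems(1)]]) (use ESum.prems in simp, blast intro: that)
  have e: "poly_small S (\<lambda>I T v. eval I T v e)" using ESum.prems small_ex_sound by auto
  then obtain C where C: "pow_bounded C" "\<And>N I T v. (N, I, T, v) \<in> S \<Longrightarrow> \<bar>eval I T v e\<bar> \<le> int (C N)"
    by (rule poly_smallE) (blast intro: that)
  obtain B' where B': "pow_bounded B'" "\<And>N I T v. (N, I, T, v) \<in> loop_ctxts S x e \<Longrightarrow> bnd (B' N) I T v f"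
    by (rule safe_exE[OF ESum.IH(2)[OF base_ok_loop[OF ESum.prems(1) e, of x]]]) (use ESum.prems in simp, blast intro: that)
  obtain D where D: "pow_bounded D" "\<And>N I T v. (N, I, T, v) \<in> S \<Longrightarrow>
      \<bar>I 0\<bar> \<le> int (D N) \<and> \<bar>I 1\<bar> \<le> int (D N) \<and> (\<forall>a\<ge>0. fits (D N) (I a)) \<and>
      (\<forall>i\<ge>0. fits (D N) (T i)) \<and> (\<forall>x. fits (D N) (v x)) \<and> (\<forall>x\<in>A. \<bar>v x\<bar> \<le> int (D N))" by (rule base_okE[OF ESum.prems(1)]) (blast intro: that)
  let ?B = "\<lambda>N. B N + B' N + C N + D N"
  show ?case
  proof (intro exI[of _ ?B] conjI ballI, goal_cases)
    case (2 c)
    obtain N I T v where c: "c = (N, I, T, v)" by (metis prod_cases4)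
    have S: "(N, I, T, v) \<in> S" using 2 c by simp
    have n: "nat (eval I T v e) \<le> C N" using C(2)[OF S] by linarith
    have b: "bnd (B' N) I T (v(x := int k)) f" if "k < nat (eval I T v e)" for k
      using S that by (intro B'(2)) (auto simp: loop_ctxts_def)
    have "fits (?B N) (\<Sum>k<l. eval I T (v(x := int k)) f)" if "l \<le> nat (eval I T v e)" for l
      by (rule fits_mono[OF fits_sum_le[OF bnd_fits[OF b] that]]) (use n in auto)
    moreover have "fits (?B N) (v x)" by (rule fits_mono[OF D(2)[OF S, THEN conjunct2, THEN conjunct2, THEN conjunct2, THEN conjunct2, THEN conjunct1, rule_format]]) simp
    ultimately show ?case using n bnd_mono[OF B(2)[OF S], of "?B N"] bnd_mono[OF b, of _ "?B N"] by (auto simp: c)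
  qed (use B B' C D in auto)
next
  case (EProd x e f)
  obtain B where B: "pow_bounded B" "\<And>N I T v. (N, I, T, v) \<in> S \<Longrightarrow> bnd (B N) I T v e"
    by (rule safe_exE[OF EProd.IH(1)[OF EProd.prems(1)]]) (use EProd.prems in simp, blast intro: that)
  have e: "poly_small S (\<lambda>I T v. eval I T v e)" using EProd.prems small_ex_sound by auto
  then obtain C where C: "pow_bounded C" "\<And>N I T v. (N, I, T, v) \<in> S \<Longrightarrow> \<bar>eval I T v e\<bar> \<le> int (C N)"
    by (rule poly_smallE) (blast intro: that)
  obtain B' where B': "pow_bounded B'" "\<And>N I T v. (N, I, T, v) \<in> loop_ctxts S x e \<Longrightarrow> bnd (B' N) I T v f"
    by (rule safe_exE[OF EProd.IH(2)[OF base_ok_loop[OF EProd.prems(1) e, of x]]]) (use EProd.prems in simp, blast intro: that)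
  obtain D where D: "pow_bounded D" "\<And>N I T v. (N, I, T, v) \<in> S \<Longrightarrow>
      \<bar>I 0\<bar> \<le> int (D N) \<and> \<bar>I 1\<bar> \<le> int (D N) \<and> (\<forall>a\<ge>0. fits (D N) (I a)) \<and>
      (\<forall>i\<ge>0. fits (D N) (T i)) \<and> (\<forall>x. fits (D N) (v x)) \<and> (\<forall>x\<in>A. \<bar>v x\<bar> \<le> int (D N))" by (rule base_okE[OF EProd.prems(1)]) (blast intro: that)
  let ?B = "\<lambda>N. B N + B' N + C N + D N + (C N * B' N + 1)"
  show ?case
  proof (intro exI[of _ ?B] conjI ballI, goal_cases)
    case (2 c)
    obtain N I T v where c: "c = (N, I, T, v)" by (metis prod_cases4)
    have S: "(N, I, T, v) \<in> S" using 2 c by simp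
    have n: "nat (eval I T v e) \<le> C N" using C(2)[OF S] by linarith
    have b: "bnd (B' N) I T (v(x := int k)) f" if "k < nat (eval I T v e)" for k
      using S that by (intro B'(2)) (auto simp: loop_ctxts_def)
    have "fits (?B N) (\<Prod>k<l. eval I T (v(x := int k)) f)" if "l \<le> nat (eval I T v e)" for l
      by (rule fits_mono[OF fits_prod_le[OF bnd_fits[OF b] that]])
        (use mult_right_mono[OF n, of "B' N"] in linarith)+
    moreover have "fits (?B N) (v x)" by (rule fits_mono[OF D(2)[OF S, THEN conjunct2, THEN conjunct2, THEN conjunct2, THEN conjunct2, THEN conjunct1, rule_format]]) simp
    ultimately show ?case using n bnd_mono[OF B(2)[OF S], of "?B N"] bnd_mono[OF b, of _ "?B N"] by (auto simp: c)
  qed (use B B' C D in auto)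
qed

section \<open>Positional number systems\<close>

definition digit :: "nat \<Rightarrow> nat \<Rightarrow> nat \<Rightarrow> nat" where
  "digit B e i = e div B ^ i mod B"

lemma digit_less: "B > 0 \<Longrightarrow> digit B e i < B"
  by (simp add: digit_def)

text \<open>One division by the base removes the lowest digit and shifts the others.\<close>

lemma digit_sum:
  assumes "\<And>i. i < m \<Longrightarrow> c i < B" "e < m"
  shows "digit B (\<Sum>i<m. c i * B ^ i) e = c e"
  using assms
proof (induction e arbitrary: c m)
  case 0
  then obtain m' where m: "m = Suc m'" by (cases m) auto
  have "(\<Sum>i<m. c i * B ^ i) = c 0 + (\<Sum>i<m'. c (Suc i) * B ^ i) * B"
    unfolding m by (subst sum.lessThan_Suc_shift) (simp add: sum_distrib_left mult_ac)
  then show ?case using 0(1)[of 0] m by (simp add: digit_def)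
next
  case (Suc e)
  then obtain m' where m: "m = Suc m'" by (cases m) auto
  have s: "(\<Sum>i<m. c i * B ^ i) = c 0 + (\<Sum>i<m'. c (Suc i) * B ^ i) * B"
    unfolding m by (subst sum.lessThan_Suc_shift) (simp add: sum_distrib_left mult_ac)
  have c0: "c 0 < B" using Suc.prems m by auto
  have "(\<Sum>i<m. c i * B ^ i) div B = (\<Sum>i<m'. c (Suc i) * B ^ i)"
    unfolding s using c0 by simp
  then have "digit B (\<Sum>i<m. c i * B ^ i) (Suc e) = digit B (\<Sum>i<m'. c (Suc i) * B ^ i) e"
    by (simp add: digit_def div_mult2_eq)
  also have "\<dots> = c (Suc e)" using Suc.prems m by (intro Suc.IH) auto
  finally show ?case .
qed

lemma sum_digits_less:
  assumes "\<And>i. i < m \<Longrightarrow> c i < (B :: nat)"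
  shows "(\<Sum>i<m. c i * B ^ i) < B ^ m"
  using assms
proof (induction m)
  case (Suc m)
  then have "c m < B" "(\<Sum>i<m. c i * B ^ i) < B ^ m" by auto
  moreover from this have "c m * B ^ m + B ^ m \<le> B * B ^ m"
    by (metis Suc_leI add.commute mult_Suc mult_le_mono1)
  ultimately show ?case by simp
qed simp

text \<open>Kronecker substitution: as \<open>Q\<close> exceeds every coefficient, there are no carries.\<close>

lemma digit_gen_fun:
  assumes "finite S" "\<And>x. x \<in> S \<Longrightarrow> f x < m" "card S < Q" "e < m"
  shows "digit Q (\<Sum>x\<in>S. Q ^ f x) e = card {x\<in>S. f x = e}"
proof -
  have "(\<Sum>x\<in>S. Q ^ f x) = (\<Sum>i<m. \<Sum>x\<in>{x\<in>S. f x = i}. Q ^ f x)"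
    by (rule sum.group[symmetric]) (use assms in auto)
  also have "\<dots> = (\<Sum>i<m. card {x\<in>S. f x = i} * Q ^ i)"
    by (intro sum.cong) auto
  finally have s: "(\<Sum>x\<in>S. Q ^ f x) = (\<Sum>i<m. card {x\<in>S. f x = i} * Q ^ i)" .
  have "card {x\<in>S. f x = i} < Q" for i
    using card_mono[OF assms(1), of "{x\<in>S. f x = i}"] assms(3) by auto
  then show ?thesis unfolding s using assms(4) by (intro digit_sum) auto
qed

section \<open>Bipartite graphs and coloured graphs\<close>

text \<open>Unordered pairs, written with the smaller element first. A simple graph on
  \<open>V\<close> is a subset of \<open>prs V\<close>.\<close>

definition prs :: "nat set \<Rightarrow> (nat \<times> nat) set" where
  "prs V = {(v, w). v \<in> V \<and> w \<in> V \<and> v < w}"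

definition crosses :: "nat set \<Rightarrow> nat \<times> nat \<Rightarrow> bool" where
  "crosses C p \<longleftrightarrow> (fst p \<in> C) \<noteq> (snd p \<in> C)"

definition two_colourable :: "nat set \<Rightarrow> (nat \<times> nat) set \<Rightarrow> bool" where
  "two_colourable V E \<longleftrightarrow> (\<exists>C\<subseteq>V. \<forall>p\<in>E. crosses C p)"

definition graph_weight :: "(nat \<times> nat \<Rightarrow> int) \<Rightarrow> (nat \<times> nat \<Rightarrow> int) \<Rightarrow> nat set \<Rightarrow> (nat \<times> nat) set \<Rightarrow> int" where
  "graph_weight a b V E = (\<Prod>p\<in>prs V. if p \<in> E then b p else a p)"

definition bip_weight :: "(nat \<times> nat \<Rightarrow> int) \<Rightarrow> (nat \<times> nat \<Rightarrow> int) \<Rightarrow> nat set \<Rightarrow> int" where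
  "bip_weight a b V = (\<Sum>E\<in>{E. E \<subseteq> prs V \<and> two_colourable V E}. graph_weight a b V E)"

lemma finite_prs [simp]: "finite V \<Longrightarrow> finite (prs V)"
  by (rule finite_subset[of _ "V \<times> V"]) (auto simp: prs_def)

lemma prs_empty [simp]: "prs {} = {}"
  by (simp add: prs_def)

lemma bip_weight_empty [simp]: "bip_weight a b {} = 1"
proof -
  have "{E :: (nat \<times> nat) set. E \<subseteq> {} \<and> two_colourable {} E} = {{}}"
    by (auto simp: two_colourable_def)
  then show ?thesis by (simp add: bip_weight_def graph_weight_def)
qed

lemma graph_weight_eq:
  assumes "finite V" "E \<subseteq> prs V"
  shows "graph_weight a b V E = (\<Prod>p\<in>E. b p) * (\<Prod>p\<in>prs V - E. a p)"
proof -
  have "graph_weight a b V E = (\<Prod>p\<in>prs V \<inter> E. b p) * (\<Prod>p\<in>prs V \<inter> - E. a p)"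
    unfolding graph_weight_def by (subst prod.If_cases) (use assms in \<open>auto simp: Collect_mem_eq\<close>)
  moreover have "prs V \<inter> E = E" "prs V \<inter> - E = prs V - E" using assms by auto
  ultimately show ?thesis by simp
qed

lemma sum_restrict_swap:
  fixes f :: "'b \<Rightarrow> int"
  assumes "finite A" "finite B"
  shows "(\<Sum>x\<in>A. \<Sum>y\<in>{y\<in>B. P x y}. f y) = (\<Sum>y\<in>B. int (card {x\<in>A. P x y}) * f y)"
  by (subst sum.swap_restrict[OF assms]) simp

text \<open>Two proper colourings differ by a set of vertices that no edge leaves.\<close>

lemma card_colourings:
  assumes "finite V" "E \<subseteq> prs V" "two_colourable V E"
  shows "card {C\<in>Pow V. \<forall>p\<in>E. crosses C p} = card {U\<in>Pow V. \<forall>p\<in>E. \<not> crosses U p}"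
proof -
  obtain C0 where C0: "C0 \<subseteq> V" "\<forall>p\<in>E. crosses C0 p" using assms(3) unfolding two_colourable_def by blast
  \<comment> \<open>Symmetric difference with a fixed proper colouring is an involution. A pair that
    crosses both \<open>C\<close> and \<open>C0\<close> does not cross their difference, and
    conversely.\<close>
  let ?d = "\<lambda>C. (C - C0) \<union> (C0 - C)"
  have "bij_betw ?d {C\<in>Pow V. \<forall>p\<in>E. crosses C p} {U\<in>Pow V. \<forall>p\<in>E. \<not> crosses U p}"
    by (rule bij_betw_byWitness[where f' = ?d]) (use C0 in \<open>auto simp: crosses_def\<close>)
  then show ?thesis by (rule bij_betw_same_card)
qed

text \<open>Multiplying out \<open>a p + b p\<close> at all crossing pairs chooses a set of edges
  properly coloured by \<open>C\<close>. Exchanging the sums collects the colourings of each edge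
  set.\<close>

lemma sum_coloured:
  assumes "finite V"
  shows "(\<Sum>C\<in>Pow V. \<Prod>p\<in>prs V. if crosses C p then a p + b p else a p) =
    (\<Sum>E\<in>Pow (prs V). int (card {C\<in>Pow V. \<forall>p\<in>E. crosses C p}) * graph_weight a b V E)"
proof -
  have "(\<Prod>p\<in>prs V. if crosses C p then a p + b p else a p) =
     (\<Sum>E\<in>{E\<in>Pow (prs V). \<forall>p\<in>E. crosses C p}. graph_weight a b V E)" for C
  proof -
    \<comment> \<open>Pairs that do not cross get the summand 0 instead of \<open>b p\<close>, so
      that a single expansion covers all pairs; edge sets containing such a pair then
      vanish.\<close>
    have "(\<Prod>p\<in>prs V. if crosses C p then a p + b p else a p) =
      (\<Prod>p\<in>prs V. (if crosses C p then b p else 0) + a p)" by (intro prod.cong) auto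
    also have "\<dots> = (\<Sum>E\<in>Pow (prs V). (\<Prod>p\<in>E. if crosses C p then b p else 0) * (\<Prod>p\<in>prs V - E. a p))"
      by (rule prod_add) (use assms in simp)
    also have "\<dots> = (\<Sum>E\<in>{E\<in>Pow (prs V). \<forall>p\<in>E. crosses C p}.
        (\<Prod>p\<in>E. if crosses C p then b p else 0) * (\<Prod>p\<in>prs V - E. a p))"
      using assms by (intro sum.mono_neutral_right) (auto intro!: prod_zero finite_subset[OF _ finite_prs])
    also have "\<dots> = (\<Sum>E\<in>{E\<in>Pow (prs V). \<forall>p\<in>E. crosses C p}. graph_weight a b V E)"
      by (intro sum.cong) (use assms in \<open>auto simp: graph_weight_eq\<close>)
    finally show ?thesis .
  qed
  then show ?thesis by (simp only:) (rule sum_restrict_swap, use assms in auto)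
qed

lemma prs_split:
  assumes "U \<subseteq> V"
  shows "prs V = prs U \<union> prs (V - U) \<union> {p\<in>prs V. crosses U p}"
    "prs U \<inter> prs (V - U) = {}" "(prs U \<union> prs (V - U)) \<inter> {p\<in>prs V. crosses U p} = {}"
  using assms by (auto simp: prs_def crosses_def)

text \<open>A graph without edges leaving \<open>U\<close> is a graph on \<open>U\<close> together
  with one on \<open>V - U\<close>. It is bipartite iff both parts are: colourings of the parts
  unite, and a colouring of the whole restricts. The remaining factor pays for the absent edges in
  between.\<close>

lemma bip_weight_mult:
  assumes "finite V" "U \<subseteq> V"
  shows "bip_weight a b U * bip_weight a b (V - U) * (\<Prod>p\<in>{p\<in>prs V. crosses U p}. a p) =
    (\<Sum>E\<in>{E\<in>{E\<in>Pow (prs V). two_colourable V E}. \<forall>p\<in>E. \<not> crosses U p}. graph_weight a b V E)"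
proof -
  let ?G = "\<lambda>W. {E. E \<subseteq> prs W \<and> two_colourable W E}"
  let ?c = "\<Prod>p\<in>{p\<in>prs V. crosses U p}. a p"
  have fin: "finite U" "finite (V - U)" using assms finite_subset by auto
  have fG: "finite (?G W)" if "finite W" for W
    by (rule finite_subset[of _ "Pow (prs W)"]) (use that in auto)
  have "bip_weight a b U * bip_weight a b (V - U) * ?c =
    (\<Sum>(E1, E2)\<in>?G U \<times> ?G (V - U). graph_weight a b U E1 * graph_weight a b (V - U) E2 * ?c)"
  proof -
    have "bip_weight a b U * bip_weight a b (V - U) =
      (\<Sum>(E1, E2)\<in>?G U \<times> ?G (V - U). graph_weight a b U E1 * graph_weight a b (V - U) E2)"
      unfolding bip_weight_def sum_product sum.cartesian_product by simp
    then show ?thesis by (simp add: sum_distrib_right split_def)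
  qed
  also have "\<dots> = (\<Sum>E\<in>{E\<in>{E\<in>Pow (prs V). two_colourable V E}. \<forall>p\<in>E. \<not> crosses U p}. graph_weight a b V E)"
  proof (rule sum.reindex_bij_witness[where i = "\<lambda>E. (E \<inter> prs U, E \<inter> prs (V - U))" and j = "\<lambda>(E1, E2). E1 \<union> E2"],
      goal_cases)
    case (1 x)
    then obtain E1 E2 where x: "x = (E1, E2)" "E1 \<subseteq> prs U" "E2 \<subseteq> prs (V - U)" by auto
    then show ?case using prs_split(2)[OF assms(2)] by auto
  next
    case (2 x)
    then obtain E1 E2 where x: "x = (E1, E2)" "E1 \<subseteq> prs U" "E2 \<subseteq> prs (V - U)"
      "two_colourable U E1" "two_colourable (V - U) E2" by auto
    obtain C1 C2 where C: "C1 \<subseteq> U" "\<forall>p\<in>E1. crosses C1 p" "C2 \<subseteq> V - U" "\<forall>p\<in>E2. crosses C2 p"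
      using x(4,5) unfolding two_colourable_def by blast
    have "two_colourable V (E1 \<union> E2)" unfolding two_colourable_def
    proof (intro exI[of _ "C1 \<union> C2"] conjI ballI)
      fix p assume "p \<in> E1 \<union> E2"
      then show "crosses (C1 \<union> C2) p"
      proof
        assume p: "p \<in> E1"
        then have "fst p \<in> U" "snd p \<in> U" using x(2) by (auto simp: prs_def)
        moreover have "crosses C1 p" using p C by blast
        ultimately show ?thesis using C(3) unfolding crosses_def by blast
      next
        assume p: "p \<in> E2"
        then have "fst p \<notin> U" "snd p \<notin> U" using x(3) by (auto simp: prs_def)
        moreover have "crosses C2 p" using p C by blast
        ultimately show ?thesis using C(1) unfolding crosses_def by blast
      qed
    qed (use C assms in auto)
    moreover have "\<forall>p\<in>E1 \<union> E2. \<not> crosses U p" using x(2,3) by (auto simp: prs_def crosses_def)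
    moreover have "E1 \<union> E2 \<subseteq> prs V" using x(2,3) assms by (auto simp: prs_def)
    ultimately show ?case using x(1) by auto
  next
    case (3 E)
    then show ?case by (auto simp: prs_def crosses_def subset_iff)
  next
    case (4 E)
    then obtain C where C: "C \<subseteq> V" "\<forall>p\<in>E. crosses C p" by (auto simp: two_colourable_def)
    have "two_colourable U (E \<inter> prs U)" unfolding two_colourable_def
      by (rule exI[of _ "C \<inter> U"]) (use C in \<open>auto simp: crosses_def prs_def\<close>)
    moreover have "two_colourable (V - U) (E \<inter> prs (V - U))" unfolding two_colourable_def
      by (rule exI[of _ "C \<inter> (V - U)"]) (use C in \<open>auto simp: crosses_def prs_def\<close>)
    ultimately show ?case by auto
  next
    case (5 x)
    then obtain E1 E2 where x: "x = (E1, E2)" "E1 \<subseteq> prs U" "E2 \<subseteq> prs (V - U)" by auto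
    note sp = prs_split[OF assms(2)]
    let ?f = "\<lambda>p. if p \<in> E1 \<union> E2 then b p else a p"
    have "graph_weight a b V (E1 \<union> E2) = prod ?f (prs U \<union> prs (V - U) \<union> {p\<in>prs V. crosses U p})"
      unfolding graph_weight_def using sp(1) by simp
    also have "\<dots> = prod ?f (prs U) * prod ?f (prs (V - U)) * prod ?f {p\<in>prs V. crosses U p}"
      using sp(2,3) fin assms by (simp add: prod.union_disjoint)
    also have "prod ?f (prs U) = graph_weight a b U E1" unfolding graph_weight_def
      using x sp(2) by (intro prod.cong) auto
    also have "prod ?f (prs (V - U)) = graph_weight a b (V - U) E2" unfolding graph_weight_def
      using x sp(2) by (intro prod.cong) auto
    also have "prod ?f {p\<in>prs V. crosses U p} = ?c"
      using x sp(3) by (intro prod.cong) auto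
    finally show ?case using x by simp
  qed
  finally show ?thesis .
qed

theorem coloured_bipartite:
  assumes "finite V"
  shows "(\<Sum>C\<in>Pow V. \<Prod>p\<in>prs V. if crosses C p then a p + b p else a p) =
    (\<Sum>U\<in>Pow V. bip_weight a b U * bip_weight a b (V - U) * (\<Prod>p\<in>{p\<in>prs V. crosses U p}. a p))"
proof -
  have "(\<Sum>U\<in>Pow V. bip_weight a b U * bip_weight a b (V - U) * (\<Prod>p\<in>{p\<in>prs V. crosses U p}. a p)) =
    (\<Sum>E\<in>{E\<in>Pow (prs V). two_colourable V E}. int (card {U\<in>Pow V. \<forall>p\<in>E. \<not> crosses U p}) * graph_weight a b V E)"
    by (subst sum_restrict_swap[symmetric]) (use assms bip_weight_mult in \<open>auto intro!: sum.cong\<close>)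
  also have "\<dots> = (\<Sum>E\<in>{E\<in>Pow (prs V). two_colourable V E}. int (card {C\<in>Pow V. \<forall>p\<in>E. crosses C p}) * graph_weight a b V E)"
    using card_colourings[OF assms] by (intro sum.cong refl) fastforce
  \<comment> \<open>A graph that is not bipartite has no proper colouring, so it may be added with
    coefficient 0.\<close>
  also have "\<dots> = (\<Sum>E\<in>Pow (prs V). int (card {C\<in>Pow V. \<forall>p\<in>E. crosses C p}) * graph_weight a b V E)"
  proof (intro sum.mono_neutral_left ballI)
    fix E assume "E \<in> Pow (prs V) - {E \<in> Pow (prs V). two_colourable V E}"
    then have "{C\<in>Pow V. \<forall>p\<in>E. crosses C p} = {}" by (auto simp: two_colourable_def)
    then show "int (card {C\<in>Pow V. \<forall>p\<in>E. crosses C p}) * graph_weight a b V E = 0"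
      by (simp only: card.empty of_nat_0 mult_zero_left)
  qed (use assms in auto)
  finally show ?thesis using sum_coloured[OF assms] by simp
qed

section \<open>Lifting: weights depend on label counts only\<close>

text \<open>The vector of label counts written as a number in base \<open>B\<close>; the counts are
  its digits as soon as \<open>card V < B\<close>. Codes are additive in \<open>V\<close>, so that
  complements become differences.\<close>

definition code :: "nat \<Rightarrow> (nat \<Rightarrow> nat) \<Rightarrow> nat set \<Rightarrow> nat" where
  "code B l V = (\<Sum>v\<in>V. B ^ l v)"

lemma code_eq_sum:
  assumes "finite V" "l ` V \<subseteq> {..<L}"
  shows "code B l V = (\<Sum>i<L. card {v\<in>V. l v = i} * B ^ i)"
proof -
  have "code B l V = (\<Sum>i<L. \<Sum>v\<in>{v\<in>V. l v = i}. B ^ l v)"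
    unfolding code_def by (rule sum.group[symmetric]) (use assms in auto)
  also have "\<dots> = (\<Sum>i<L. card {v\<in>V. l v = i} * B ^ i)" by (intro sum.cong) auto
  finally show ?thesis .
qed

lemma card_label_less:
  assumes "finite V" "card V < B"
  shows "card {v\<in>V. l v = i} < B"
  using card_mono[OF assms(1), of "{v\<in>V. l v = i}"] assms(2) by auto

lemma digit_code:
  assumes "finite V" "l ` V \<subseteq> {..<L}" "card V < B" "i < L"
  shows "digit B (code B l V) i = card {v\<in>V. l v = i}"
  unfolding code_eq_sum[OF assms(1,2)] by (rule digit_sum) (use assms card_label_less in auto)

lemma code_less:
  assumes "finite V" "l ` V \<subseteq> {..<L}" "card V < B"
  shows "code B l V < B ^ L"
  unfolding code_eq_sum[OF assms(1,2)] by (rule sum_digits_less) (use assms card_label_less in auto)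

lemma code_diff:
  "finite V \<Longrightarrow> U \<subseteq> V \<Longrightarrow> code B l (V - U) = code B l V - code B l U"
  unfolding code_def using sum.subset_diff[of U V "\<lambda>v. B ^ l v"] by simp

lemma code_mono: "finite V \<Longrightarrow> U \<subseteq> V \<Longrightarrow> code B l U \<le> code B l V"
  unfolding code_def by (rule sum_mono2) auto

lemma code_pos: "finite V \<Longrightarrow> V \<noteq> {} \<Longrightarrow> B > 0 \<Longrightarrow> code B l V > 0"
  unfolding code_def by (rule sum_pos) auto

lemma code_empty [simp]: "code B l {} = 0"
  by (simp add: code_def)

lemma prod_by_label:
  fixes g :: "nat \<Rightarrow> 'a :: comm_monoid_mult"
  assumes "finite V" "l ` V \<subseteq> {..<L}"
  shows "(\<Prod>v\<in>V. g (l v)) = (\<Prod>i<L. g i ^ card {v\<in>V. l v = i})"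
proof -
  have "(\<Prod>v\<in>V. g (l v)) = (\<Prod>i<L. \<Prod>v\<in>{v\<in>V. l v = i}. g (l v))"
    by (rule prod.group[symmetric]) (use assms in auto)
  also have "\<dots> = (\<Prod>i<L. g i ^ card {v\<in>V. l v = i})" by (intro prod.cong) auto
  finally show ?thesis .
qed

lemma prod_by_code:
  fixes g :: "nat \<Rightarrow> 'a :: comm_monoid_mult"
  assumes "finite V" "l ` V \<subseteq> {..<L}" "card V < B"
  shows "(\<Prod>v\<in>V. g (l v)) = (\<Prod>i<L. g i ^ digit B (code B l V) i)"
  unfolding prod_by_label[OF assms(1,2)] using digit_code[OF assms] by (intro prod.cong) auto

text \<open>The product of the pair weights between two disjoint sets whose label counts are coded
  by \<open>e\<close> and \<open>e'\<close>.\<close>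

definition cross_code :: "nat \<Rightarrow> nat \<Rightarrow> (nat \<Rightarrow> nat \<Rightarrow> int) \<Rightarrow> nat \<Rightarrow> nat \<Rightarrow> int" where
  "cross_code B L A e e' = (\<Prod>i<L. \<Prod>j<L. A i j ^ (digit B e i * digit B e' j))"

text \<open>The product of the pair weights inside a set with code \<open>e\<close>: for a label
  with count \<open>d\<close> there are \<open>d * (d - 1) div 2\<close> pairs within the class, and
  different classes are paired once, with \<open>j < i\<close>.\<close>

definition inner_code :: "nat \<Rightarrow> nat \<Rightarrow> (nat \<Rightarrow> nat \<Rightarrow> int) \<Rightarrow> nat \<Rightarrow> int" where
  "inner_code B L A e = (\<Prod>i<L. A i i ^ (digit B e i * (digit B e i - 1) div 2) *
     (\<Prod>j<i. A i j ^ (digit B e i * digit B e j)))"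

text \<open>The number of subsets with code \<open>e'\<close> of a set with code \<open>e\<close>,
  as a coefficient of the generating function in which every element of label \<open>i\<close>
  contributes \<open>1 + Q ^ B ^ i\<close>.\<close>

definition sub_code :: "nat \<Rightarrow> nat \<Rightarrow> nat \<Rightarrow> nat \<Rightarrow> nat \<Rightarrow> nat" where
  "sub_code B L Q e e' = digit Q (\<Prod>i<L. (1 + Q ^ B ^ i) ^ digit B e i) e'"

definition lab_pair :: "(nat \<Rightarrow> nat \<Rightarrow> int) \<Rightarrow> (nat \<Rightarrow> nat) \<Rightarrow> nat \<times> nat \<Rightarrow> int" where
  "lab_pair A l p = A (l (fst p)) (l (snd p))"

lemma cross_prod:
  assumes "finite U" "finite W" "l ` U \<subseteq> {..<L}" "l ` W \<subseteq> {..<L}" "card U < B" "card W < B"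
  shows "(\<Prod>u\<in>U. \<Prod>w\<in>W. A (l u) (l w)) = cross_code B L A (code B l U) (code B l W)"
proof -
  have "(\<Prod>u\<in>U. \<Prod>w\<in>W. A (l u) (l w)) = (\<Prod>u\<in>U. \<Prod>j<L. A (l u) j ^ digit B (code B l W) j)"
    by (intro prod.cong prod_by_code) (use assms in auto)
  also have "\<dots> = (\<Prod>i<L. (\<Prod>j<L. A i j ^ digit B (code B l W) j) ^ digit B (code B l U) i)"
    by (rule prod_by_code) (use assms in auto)
  finally show ?thesis
    unfolding cross_code_def by (simp add: prod_power_distrib power_mult[symmetric] mult.commute)
qed

text \<open>Each pair across is listed once with its smaller element first. Symmetry of
  \<open>A\<close> makes it irrelevant which end lies in \<open>U\<close>.\<close>

lemma prod_prs_cross: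
  assumes "finite V" "U \<subseteq> V" "\<And>i j. A i j = A j i"
  shows "(\<Prod>p\<in>{p\<in>prs V. crosses U p}. lab_pair A l p) = (\<Prod>u\<in>U. \<Prod>w\<in>V - U. A (l u) (l w))"
proof -
  have fin: "finite U" "finite (V - U)" using assms finite_subset by auto
  have "(\<Prod>u\<in>U. \<Prod>w\<in>V - U. A (l u) (l w)) = (\<Prod>(u, w)\<in>U \<times> (V - U). A (l u) (l w))"
    by (rule prod.cartesian_product)
  also have "\<dots> = (\<Prod>p\<in>{p\<in>prs V. crosses U p}. lab_pair A l p)"
  proof (rule prod.reindex_bij_witness[where j = "\<lambda>(u, w). (min u w, max u w)" and
        i = "\<lambda>(u, w). if u \<in> U then (u, w) else (w, u)"], goal_cases)
    case (1 x)
    then show ?case using assms(2) by (cases x) (auto simp: min_def max_def)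
  next
    case (2 x)
    then obtain u w where x: "x = (u, w)" "u \<in> U" "w \<in> V" "w \<notin> U" by auto
    then have "u < w \<or> w < u" by (metis linorder_neqE_nat)
    then show ?case using x assms(2) by (auto simp: prs_def crosses_def)
  next
    case (3 x)
    then show ?case by (cases x) (auto simp: prs_def crosses_def)
  next
    case (4 x)
    then show ?case by (cases x) (auto simp: prs_def crosses_def)
  next
    case (5 x)
    then show ?case using assms(3) by (cases x) (auto simp: lab_pair_def min_def max_def)
  qed
  finally show ?thesis ..
qed

lemma card_prs: "finite V \<Longrightarrow> card (prs V) = card V * (card V - 1) div 2"
proof (induction V rule: finite_linorder_max_induct)
  case (insert b V)
  have "prs (insert b V) = prs V \<union> (\<lambda>v. (v, b)) ` V"
    using insert by (auto simp: prs_def)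
  moreover have "card (prs V \<union> (\<lambda>v. (v, b)) ` V) = card (prs V) + card ((\<lambda>v. (v, b)) ` V)"
  proof (rule card_Un_disjoint)
    show "finite (prs V)" using insert by simp
    show "prs V \<inter> (\<lambda>v. (v, b)) ` V = {}" using insert(2) by (auto simp: prs_def)
  qed (use insert in simp)
  moreover have "card ((\<lambda>v. (v, b)) ` V) = card V" by (rule card_image) (auto simp: inj_on_def)
  ultimately have "card (prs (insert b V)) = card V * (card V - 1) div 2 + card V"
    using insert by simp
  also have "\<dots> = card (insert b V) * (card (insert b V) - 1) div 2"
    using insert by (cases "card V") (auto simp: algebra_simps)
  finally show ?case .
qed simp

text \<open>Induction on the number of labels taken into account: the class of label
  \<open>k\<close> brings the pairs within it and the pairs to all smaller labels.\<close>

lemma prod_prs_code: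
  assumes "finite V" "l ` V \<subseteq> {..<L}" "card V < B" "\<And>i j. A i j = A j i"
  shows "(\<Prod>p\<in>prs V. lab_pair A l p) = inner_code B L A (code B l V)"
proof -
  let ?V = "\<lambda>k. {v\<in>V. l v < k}" and ?d = "digit B (code B l V)"
  have "(\<Prod>p\<in>prs (?V k). lab_pair A l p) = (\<Prod>i<k. A i i ^ (?d i * (?d i - 1) div 2) *
     (\<Prod>j<i. A i j ^ (?d i * ?d j)))" if "k \<le> L" for k
    using that
  proof (induction k)
    case (Suc k)
    let ?U = "{v\<in>V. l v = k}"
    have U: "?U \<subseteq> ?V (Suc k)" "?V (Suc k) - ?U = ?V k" by auto
    have dk: "?d i = card {v\<in>V. l v = i}" if "i \<le> k" for i
      using that Suc.prems assms by (intro digit_code) auto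
    have "(\<Prod>p\<in>prs (?V (Suc k)). lab_pair A l p) = (\<Prod>p\<in>prs ?U. lab_pair A l p) * (\<Prod>p\<in>prs (?V k). lab_pair A l p) *
      (\<Prod>p\<in>{p\<in>prs (?V (Suc k)). crosses ?U p}. lab_pair A l p)"
      using prs_split[OF U(1)] assms(1) unfolding U(2)
      by (subst prs_split(1)[OF U(1)], unfold U(2), subst prod.union_disjoint) (auto simp: prod.union_disjoint)
    also have "(\<Prod>p\<in>prs ?U. lab_pair A l p) = (\<Prod>p\<in>prs ?U. A k k)"
      by (intro prod.cong) (auto simp: prs_def lab_pair_def)
    also have "\<dots> = A k k ^ (?d k * (?d k - 1) div 2)" using assms(1) by (simp add: card_prs dk)
    also have "(\<Prod>p\<in>{p\<in>prs (?V (Suc k)). crosses ?U p}. lab_pair A l p) = (\<Prod>u\<in>?U. \<Prod>w\<in>?V k. A (l u) (l w))"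
      using prod_prs_cross[OF _ U(1) assms(4)] assms(1) unfolding U(2) by simp
    also have "\<dots> = (\<Prod>u\<in>?U. \<Prod>w\<in>?V k. A k (l w))" by (intro prod.cong) auto
    also have "\<dots> = (\<Prod>w\<in>?V k. A k (l w)) ^ ?d k" by (simp add: dk)
    also have "(\<Prod>w\<in>?V k. A k (l w)) = (\<Prod>j<k. A k j ^ card {v\<in>?V k. l v = j})"
      by (rule prod_by_label) (use assms in auto)
    also have "\<dots> = (\<Prod>j<k. A k j ^ ?d j)"
      by (intro prod.cong) (auto simp: dk intro!: arg_cong[where f = card] arg_cong2[where f = power])
    finally show ?case using Suc by (simp add: prod_power_distrib power_mult[symmetric] mult_ac)
  qed (simp add: prs_def)
  from this[of L] have "(\<Prod>p\<in>prs (?V L). lab_pair A l p) = inner_code B L A (code B l V)"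
    unfolding inner_code_def by simp
  moreover have "?V L = V" using assms(2) by auto
  ultimately show ?thesis by simp
qed

text \<open>Multiplying out over the elements chooses a subset \<open>U\<close> and yields
  \<open>Q ^ code B l U\<close>; with \<open>Q\<close> above the number of subsets the digits are
  the coefficients.\<close>

lemma sub_code_card:
  assumes "finite V" "l ` V \<subseteq> {..<L}" "card V < B" "2 ^ card V < Q" "e \<le> code B l V"
  shows "sub_code B L Q (code B l V) e = card {U\<in>Pow V. code B l U = e}"
proof -
  have "(\<Prod>i<L. (1 + Q ^ B ^ i) ^ digit B (code B l V) i) = (\<Prod>v\<in>V. 1 + Q ^ B ^ l v)"
    by (rule prod_by_code[symmetric, where g = "\<lambda>i. 1 + Q ^ B ^ i"]) (use assms in auto)
  also have "\<dots> = (\<Prod>v\<in>V. Q ^ B ^ l v + 1)" by (simp add: add.commute)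
  also have "\<dots> = (\<Sum>U\<in>Pow V. Q ^ code B l U)"
    by (subst prod_add[OF assms(1)]) (auto simp: code_def power_sum)
  finally show ?thesis unfolding sub_code_def
    using digit_gen_fun[of "Pow V" "code B l" "Suc (code B l V)" Q e] assms
    by (simp add: code_mono card_Pow less_Suc_eq_le)
qed

lemma sum_subsets_code:
  fixes g :: "nat \<Rightarrow> int"
  assumes "finite V" "l ` V \<subseteq> {..<L}" "card V < B" "2 ^ card V < Q"
  shows "(\<Sum>U\<in>Pow V. g (code B l U)) = (\<Sum>e\<le>code B l V. int (sub_code B L Q (code B l V) e) * g e)"
proof -
  have "(\<Sum>U\<in>Pow V. g (code B l U)) = (\<Sum>e\<le>code B l V. \<Sum>U\<in>{U\<in>Pow V. code B l U = e}. g (code B l U))"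
    by (rule sum.group[symmetric]) (use assms in \<open>auto intro: code_mono\<close>)
  also have "\<dots> = (\<Sum>e\<le>code B l V. int (sub_code B L Q (code B l V) e) * g e)"
    by (intro sum.cong) (use assms sub_code_card in auto)
  finally show ?thesis .
qed

text \<open>Only the proper nonempty subsets enter the recursion; the terms for the empty and the full
  set are twice the result. The summand 1 makes the value at 0 equal to 1.\<close>

function bip_code :: "nat \<Rightarrow> nat \<Rightarrow> nat \<Rightarrow> (nat \<Rightarrow> nat \<Rightarrow> int) \<Rightarrow> (nat \<Rightarrow> nat \<Rightarrow> int) \<Rightarrow> nat \<Rightarrow> int" where
  "bip_code B L Q a b e =
    ((\<Sum>k<Suc e. int (sub_code B L Q e k) * inner_code B L a k * inner_code B L a (e - k) *
        cross_code B L (\<lambda>i j. a i j + b i j) k (e - k))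
     - (\<Sum>k<e - 1. int (sub_code B L Q e (Suc k)) * bip_code B L Q a b (Suc k) * bip_code B L Q a b (e - Suc k) *
        cross_code B L a (Suc k) (e - Suc k)) + 1) div 2"
  by pat_completeness auto
termination by (relation "measure (\<lambda>(B, L, Q, a, b, e). e)") auto

declare bip_code.simps [simp del]

lemma bip_code_0: "Q > 1 \<Longrightarrow> bip_code B L Q a b 0 = 1"
  by (subst bip_code.simps) (simp add: sub_code_def inner_code_def cross_code_def digit_def)

text \<open>Both sides of \<open>coloured_bipartite\<close> are grouped by the codes of the subsets.
  Proper nonempty subsets are smaller and fall under the induction hypothesis.\<close>

theorem bip_weight_code:
  assumes "finite V" "l ` V \<subseteq> {..<L}" "card V < B" "2 ^ card V < Q"
    and sym: "\<And>i j. a i j = a j i" "\<And>i j. b i j = b j i"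
  shows "bip_weight (lab_pair a l) (lab_pair b l) V = bip_code B L Q a b (code B l V)"
  using assms(1-4)
proof (induction "card V" arbitrary: V rule: less_induct)
  case less
  note V = less.prems
  let ?e = "code B l V" and ?W = "bip_weight (lab_pair a l) (lab_pair b l)" and ?T = "bip_code B L Q a b"
  let ?ab = "\<lambda>i j. a i j + b i j"
  have sub: "finite U" "l ` U \<subseteq> {..<L}" "card U < B" "2 ^ card U < Q" if "U \<subseteq> V" for U
  proof -
    have c: "card U \<le> card V" using that V(1) by (rule card_mono[rotated])
    show "finite U" "l ` U \<subseteq> {..<L}" using that V finite_subset by auto
    show "card U < B" using c V(3) by simp
    have "(2::nat) ^ card U \<le> 2 ^ card V" using c by (intro power_increasing) auto
    then show "2 ^ card U < Q" using V(4) by linarith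
  qed
  have S1: "(\<Sum>C\<in>Pow V. \<Prod>p\<in>prs V. if crosses C p then lab_pair a l p + lab_pair b l p else lab_pair a l p) =
     (\<Sum>k\<le>?e. int (sub_code B L Q ?e k) * (inner_code B L a k * inner_code B L a (?e - k) * cross_code B L ?ab k (?e - k)))"
  proof (subst sum_subsets_code[OF V, symmetric], rule sum.cong[OF refl])
    fix C assume C: "C \<in> Pow V"
    then have CV: "C \<subseteq> V" by simp
    note sp = prs_split[OF CV]
    let ?f = "\<lambda>p. if crosses C p then lab_pair a l p + lab_pair b l p else lab_pair a l p"
    have "prod ?f (prs V) = prod ?f (prs C \<union> prs (V - C) \<union> {p\<in>prs V. crosses C p})" using sp(1) by simp
    also have "\<dots> = prod ?f (prs C) * prod ?f (prs (V - C)) * prod ?f {p\<in>prs V. crosses C p}"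
      using sp(2,3) sub[of C] sub[of "V - C"] V CV by (simp add: prod.union_disjoint)
    also have "prod ?f (prs C) = prod (lab_pair a l) (prs C)"
      by (intro prod.cong) (auto simp: prs_def crosses_def)
    also have "\<dots> = inner_code B L a (code B l C)" by (rule prod_prs_code) (use sub[OF CV] sym in auto)
    also have "prod ?f (prs (V - C)) = prod (lab_pair a l) (prs (V - C))"
      by (intro prod.cong) (auto simp: prs_def crosses_def)
    also have "\<dots> = inner_code B L a (code B l (V - C))" by (rule prod_prs_code) (use sub[of "V - C"] sym in auto)
    also have "prod ?f {p\<in>prs V. crosses C p} = (\<Prod>p\<in>{p\<in>prs V. crosses C p}. lab_pair ?ab l p)"
      by (intro prod.cong) (auto simp: lab_pair_def)
    also have "\<dots> = (\<Prod>u\<in>C. \<Prod>w\<in>V - C. ?ab (l u) (l w))"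
      by (rule prod_prs_cross[OF V(1) CV]) (subst sym(1), subst sym(2), rule refl)
    also have "\<dots> = cross_code B L ?ab (code B l C) (code B l (V - C))"
      by (rule cross_prod) (use sub[OF CV] sub[of "V - C"] in auto)
    finally show "prod ?f (prs V) = inner_code B L a (code B l C) * inner_code B L a (?e - code B l C) *
        cross_code B L ?ab (code B l C) (?e - code B l C)"
      by (simp add: code_diff[OF V(1) CV])
  qed
  show ?case
  proof (cases "V = {}")
    case True
    then show ?thesis
      using V by (simp add: bip_code_0)
  next
    case False
    have e0: "?e > 0" using False V by (intro code_pos) auto
    define G where "G = (\<lambda>U. ?W U * ?W (V - U) * (\<Prod>p\<in>{p\<in>prs V. crosses U p}. lab_pair a l p))"
    \<comment> \<open>Zero at both ends, so that the sum over all subsets can be grouped by code.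
      Nonempty sets have positive codes, hence only the two trivial subsets are affected.\<close>
    define H where "H = (\<lambda>k. (if k = 0 \<or> k = ?e then 0 else ?T k * ?T (?e - k) * cross_code B L a k (?e - k)))"
    have G: "G U = H (code B l U)" if U: "U \<subseteq> V" "U \<noteq> {}" "U \<noteq> V" for U
    proof -
      have VU: "V - U \<subseteq> V" "V - U \<noteq> {}" "card U < card V" "card (V - U) < card V"
        using U V(1) by (auto intro!: psubset_card_mono)
      have p: "code B l U > 0" "code B l (V - U) > 0" "code B l U \<le> ?e"
        using code_pos[of U B l] code_pos[of "V - U" B l] code_mono[OF V(1) U(1)] U(2) VU(2)
          sub(1)[OF U(1)] V(1,3) by auto
      then have "H (code B l U) = ?T (code B l U) * ?T (code B l (V - U)) * cross_code B L a (code B l U) (code B l (V - U))"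
        using code_diff[OF V(1) U(1)] by (auto simp: H_def)
      moreover have "?W U = ?T (code B l U)" using sub[OF U(1)] VU by (intro less.hyps) auto
      moreover have "?W (V - U) = ?T (code B l (V - U))" using sub[OF VU(1)] VU by (intro less.hyps) auto
      moreover have "(\<Prod>p\<in>{p\<in>prs V. crosses U p}. lab_pair a l p) = cross_code B L a (code B l U) (code B l (V - U))"
        unfolding prod_prs_cross[OF V(1) U(1) sym(1)]
        by (rule cross_prod) (use sub[OF U(1)] sub[OF VU(1)] in auto)
      ultimately show ?thesis by (simp add: G_def)
    qed
    \<comment> \<open>The two trivial subsets contribute the unknown value itself, since the empty
      set has weight 1 and no pair crosses.\<close>
    have G0: "G {} = ?W V" "G V = ?W V" by (auto simp: G_def crosses_def prs_def intro!: prod.neutral)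
    have "(\<Sum>U\<in>Pow V. G U) = (\<Sum>U\<in>Pow V. H (code B l U) + (if U = {} then ?W V else 0) + (if U = V then ?W V else 0))"
      using False G G0 by (intro sum.cong) (auto simp: H_def)
    also have "\<dots> = (\<Sum>U\<in>Pow V. H (code B l U)) + 2 * ?W V"
      using V(1) by (simp add: sum.distrib)
    also have "(\<Sum>U\<in>Pow V. H (code B l U)) = (\<Sum>k\<le>?e. int (sub_code B L Q ?e k) * H k)"
      by (rule sum_subsets_code[OF V])
    also have "\<dots> = (\<Sum>k\<in>Suc ` {..<?e - 1}. int (sub_code B L Q ?e k) * H k)"
    proof (rule sum.mono_neutral_right)
      show "\<forall>k\<in>{..?e} - Suc ` {..<?e - 1}. int (sub_code B L Q ?e k) * H k = 0"
      proof
        fix k assume k: "k \<in> {..?e} - Suc ` {..<?e - 1}"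
        then have "k = 0 \<or> k = ?e" by (cases k) auto
        then show "int (sub_code B L Q ?e k) * H k = 0" by (auto simp: H_def)
      qed
    qed auto
    also have "\<dots> = (\<Sum>k<?e - 1. int (sub_code B L Q ?e (Suc k)) * H (Suc k))"
      by (subst sum.reindex) auto
    also have "\<dots> = (\<Sum>k<?e - 1. int (sub_code B L Q ?e (Suc k)) * ?T (Suc k) * ?T (?e - Suc k) * cross_code B L a (Suc k) (?e - Suc k))"
      by (intro sum.cong) (auto simp: H_def mult_ac)
    finally have "(\<Sum>k\<le>?e. int (sub_code B L Q ?e k) * (inner_code B L a k * inner_code B L a (?e - k) * cross_code B L ?ab k (?e - k)))
      = (\<Sum>k<?e - 1. int (sub_code B L Q ?e (Suc k)) * ?T (Suc k) * ?T (?e - Suc k) * cross_code B L a (Suc k) (?e - Suc k)) + 2 * ?W V"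
      using S1 coloured_bipartite[OF V(1), of "lab_pair a l" "lab_pair b l"] unfolding G_def by simp
    then have "2 * ?W V = (\<Sum>k<Suc ?e. int (sub_code B L Q ?e k) * inner_code B L a k * inner_code B L a (?e - k) * cross_code B L ?ab k (?e - k))
      - (\<Sum>k<?e - 1. int (sub_code B L Q ?e (Suc k)) * ?T (Suc k) * ?T (?e - Suc k) * cross_code B L a (Suc k) (?e - Suc k))"
      by (simp add: lessThan_Suc_atMost mult_ac)
    \<comment> \<open>The difference of the two sums is \<open>2 * ?W V\<close>; the additional 1
      disappears under \<open>div 2\<close>.\<close>
    then show ?thesis by (subst bip_code.simps) linarith
  qed
qed

section \<open>Local evaluation of formulas\<close>

fun qsubs :: "fm \<Rightarrow> fm set" where
  "qsubs (Atom p vs) = {}"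
| "qsubs (Eq u v) = {}"
| "qsubs (Neg \<phi>) = qsubs \<phi>"
| "qsubs (Conj \<phi> \<psi>) = qsubs \<phi> \<union> qsubs \<psi>"
| "qsubs (Disj \<phi> \<psi>) = qsubs \<phi> \<union> qsubs \<psi>"
| "qsubs (All v \<phi>) = insert (All v \<phi>) (qsubs \<phi>)"
| "qsubs (Ex v \<phi>) = insert (Ex v \<phi>) (qsubs \<phi>)"
| "qsubs (ExEq k v \<phi>) = insert (ExEq k v \<phi>) (qsubs \<phi>)"
| "qsubs (ExLe k v \<phi>) = insert (ExLe k v \<phi>) (qsubs \<phi>)"
| "qsubs (ExGe k v \<phi>) = insert (ExGe k v \<phi>) (qsubs \<phi>)"

text \<open>Every quantifier is read as a counting quantifier: \<open>Q\<close> asks whether the number of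
  values of \<open>qvar Q\<close> satisfying \<open>qbody Q\<close> has the property \<open>qholds Q\<close>.\<close>

fun qvar :: "fm \<Rightarrow> var" where
  "qvar (All v \<phi>) = v"
| "qvar (Ex v \<phi>) = v"
| "qvar (ExEq k v \<phi>) = v"
| "qvar (ExLe k v \<phi>) = v"
| "qvar (ExGe k v \<phi>) = v"
| "qvar _ = X"

fun qbody :: "fm \<Rightarrow> fm" where
  "qbody (All v \<phi>) = Neg \<phi>"
| "qbody (Ex v \<phi>) = \<phi>"
| "qbody (ExEq k v \<phi>) = \<phi>"
| "qbody (ExLe k v \<phi>) = \<phi>"
| "qbody (ExGe k v \<phi>) = \<phi>"
| "qbody \<phi> = \<phi>"

fun qholds :: "fm \<Rightarrow> nat \<Rightarrow> bool" where
  "qholds (All v \<phi>) c \<longleftrightarrow> c = 0"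
| "qholds (Ex v \<phi>) c \<longleftrightarrow> c \<ge> 1"
| "qholds (ExEq k v \<phi>) c \<longleftrightarrow> c = k"
| "qholds (ExLe k v \<phi>) c \<longleftrightarrow> c \<le> k"
| "qholds (ExGe k v \<phi>) c \<longleftrightarrow> c \<ge> k"
| "qholds _ c \<longleftrightarrow> False"

fun qbound :: "fm \<Rightarrow> nat" where
  "qbound (ExEq k v \<phi>) = k"
| "qbound (ExLe k v \<phi>) = k"
| "qbound (ExGe k v \<phi>) = k"
| "qbound _ = 1"

text \<open>Conditions on a count become constant beyond a threshold. This finiteness makes
  \<open>lead_degree\<close> applicable.\<close>

lemma qholds_bound: "c > qbound Q \<Longrightarrow> d > qbound Q \<Longrightarrow> qholds Q c \<longleftrightarrow> qholds Q d"
  by (cases Q) auto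

lemma finite_qsubs [simp]: "finite (qsubs \<phi>)"
  by (induction \<phi>) auto

lemma qsubs_body: "Q \<in> qsubs \<phi> \<Longrightarrow> qsubs (qbody Q) \<subseteq> qsubs \<phi>"
  by (induction \<phi>) auto

lemma qsubs_size: "Q' \<in> qsubs \<phi> \<Longrightarrow> size Q' \<le> size \<phi>"
  by (induction \<phi>) auto

text \<open>The ranking for \<open>guess_correct\<close>: evaluating the body of \<open>Q\<close>
  consults guesses only for smaller formulas. The negation added by \<open>qbody\<close> for
  \<open>All\<close> introduces no quantified subformula.\<close>

lemma qsubs_body_size: "Q \<in> qsubs \<phi> \<Longrightarrow> Q' \<in> qsubs (qbody Q) \<Longrightarrow> size Q' < size Q"
  by (induction \<phi>) (auto simp: less_Suc_eq_le intro: qsubs_size)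

lemma well_formed_body: "Q \<in> qsubs \<phi> \<Longrightarrow> well_formed ar \<phi> \<Longrightarrow> well_formed ar (qbody Q)"
  by (induction \<phi>) auto

lemma card_0_iff_none: "card {b\<in>{1..n :: nat}. P b} = 0 \<longleftrightarrow> (\<forall>b\<in>{1..n}. \<not> P b)"
  by (subst card_0_eq) auto

lemma card_ge_1_iff_some: "1 \<le> card {b\<in>{1..n :: nat}. P b} \<longleftrightarrow> (\<exists>b\<in>{1..n}. P b)"
  using card_0_iff_none[of n P] by (auto simp: Suc_le_eq simp del: card_0_eq)

lemma sat_quant:
  assumes "Q \<in> qsubs \<phi>"
  shows "sat n \<mu> e Q \<longleftrightarrow> qholds Q (card {b\<in>{1..n}. sat n \<mu> (e(qvar Q := b)) (qbody Q)})"
proof -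
  have "Q = All v \<psi> \<or> Q = Ex v \<psi> \<or> (\<exists>k. Q = ExEq k v \<psi> \<or> Q = ExLe k v \<psi> \<or> Q = ExGe k v \<psi>) \<Longrightarrow> ?thesis" for v \<psi>
    by (elim disjE exE; simp only: sat.simps qholds.simps qvar.simps qbody.simps
        card_0_iff_none card_ge_1_iff_some not_not)
  moreover have "\<exists>v \<psi>. Q = All v \<psi> \<or> Q = Ex v \<psi> \<or> (\<exists>k. Q = ExEq k v \<psi> \<or> Q = ExLe k v \<psi> \<or> Q = ExGe k v \<psi>)"
    using assms by (induction \<phi>) auto
  ultimately show ?thesis by blast
qed

lemma sat_cong: "(\<And>v. v \<in> free_vars \<phi> \<Longrightarrow> e v = e' v) \<Longrightarrow> sat n \<mu> e \<phi> = sat n \<mu> e' \<phi>"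
proof (induction \<phi> arbitrary: e e')
  case (Atom p vs)
  have "map e vs = map e' vs" using Atom by (intro map_cong) auto
  then show ?case by (simp only: sat.simps)
next
  case (Conj \<phi> \<psi>)
  then show ?case by (metis Un_iff free_vars.simps(4) sat.simps(4))
next
  case (Disj \<phi> \<psi>)
  then show ?case by (metis Un_iff free_vars.simps(5) sat.simps(5))
next
  case (Neg \<phi>)
  then show ?case by (metis free_vars.simps(3) sat.simps(3))
next
  case (All v \<phi>)
  have "sat n \<mu> (e(v := a)) \<phi> = sat n \<mu> (e'(v := a)) \<phi>" for a by (rule All.IH) (use All.prems in auto)
  then show ?case by simp
next
  case (Ex v \<phi>)
  have "sat n \<mu> (e(v := a)) \<phi> = sat n \<mu> (e'(v := a)) \<phi>" for a by (rule Ex.IH) (use Ex.prems in auto)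
  then show ?case by simp
next
  case (ExEq k v \<phi>)
  have "sat n \<mu> (e(v := a)) \<phi> = sat n \<mu> (e'(v := a)) \<phi>" for a by (rule ExEq.IH) (use ExEq.prems in auto)
  then show ?case by simp
next
  case (ExLe k v \<phi>)
  have "sat n \<mu> (e(v := a)) \<phi> = sat n \<mu> (e'(v := a)) \<phi>" for a by (rule ExLe.IH) (use ExLe.prems in auto)
  then show ?case by simp
next
  case (ExGe k v \<phi>)
  have "sat n \<mu> (e(v := a)) \<phi> = sat n \<mu> (e'(v := a)) \<phi>" for a by (rule ExGe.IH) (use ExGe.prems in auto)
  then show ?case by simp
qed auto

fun other :: "var \<Rightarrow> var" where
  "other X = Y"
| "other Y = X"

fun vpair :: "'a \<Rightarrow> 'a \<Rightarrow> var \<Rightarrow> 'a" where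
  "vpair a b X = a"
| "vpair a b Y = b"

type_synonym two_type = "(nat \<times> var list) set"

text \<open>Truth of a formula on a pair of elements, named \<open>X\<close> and \<open>Y\<close>, given the true 0-ary
  predicates, the one-types of the elements, the sets of quantified formulas true at them, and
  their two-type.\<close>

fun lsat :: "nat set \<Rightarrow> (var \<Rightarrow> nat set) \<Rightarrow> (var \<Rightarrow> fm set) \<Rightarrow> two_type \<Rightarrow> (var \<Rightarrow> var) \<Rightarrow> fm \<Rightarrow> bool" where
  "lsat \<omega> \<tau> g t e (Atom p vs) \<longleftrightarrow> (if vs = [] then p \<in> \<omega>
     else if e ` set vs = {X} then p \<in> \<tau> X else if e ` set vs = {Y} then p \<in> \<tau> Y else (p, map e vs) \<in> t)"
| "lsat \<omega> \<tau> g t e (Eq u v) \<longleftrightarrow> e u = e v"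
| "lsat \<omega> \<tau> g t e (Neg \<phi>) \<longleftrightarrow> \<not> lsat \<omega> \<tau> g t e \<phi>"
| "lsat \<omega> \<tau> g t e (Conj \<phi> \<psi>) \<longleftrightarrow> lsat \<omega> \<tau> g t e \<phi> \<and> lsat \<omega> \<tau> g t e \<psi>"
| "lsat \<omega> \<tau> g t e (Disj \<phi> \<psi>) \<longleftrightarrow> lsat \<omega> \<tau> g t e \<phi> \<or> lsat \<omega> \<tau> g t e \<psi>"
| "lsat \<omega> \<tau> g t e Q \<longleftrightarrow> Q \<in> g (e (other (qvar Q)))"

definition nullary_of :: "vocab \<Rightarrow> world \<Rightarrow> nat set" where
  "nullary_of ar \<mu> = {p. p < length ar \<and> ar ! p = 0 \<and> (p, []) \<in> \<mu>}"

definition one_type :: "vocab \<Rightarrow> world \<Rightarrow> nat \<Rightarrow> nat set" where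
  "one_type ar \<mu> a = {p. p < length ar \<and> ar ! p > 0 \<and> (p, replicate (ar ! p) a) \<in> \<mu>}"

definition two_type :: "vocab \<Rightarrow> world \<Rightarrow> nat \<Rightarrow> nat \<Rightarrow> two_type" where
  "two_type ar \<mu> a b =
     {(p, vs). p < length ar \<and> length vs = ar ! p \<and> set vs = {X, Y} \<and> (p, map (vpair a b) vs) \<in> \<mu>}"

lemma map_const_on: "(\<And>v. v \<in> set vs \<Longrightarrow> f v = c) \<Longrightarrow> map f vs = replicate (length vs) c"
  by (induction vs) auto

lemma var_in: "(v :: var) \<in> {X, Y}"
  by (cases v) auto

lemma vpair_eq: "vpair (\<rho> X) (\<rho> Y) = \<rho>"
proof
  show "vpair (\<rho> X) (\<rho> Y) x = \<rho> x" for x by (cases x) auto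
qed

text \<open>With two variables, a quantified formula depends on at most the value of
  \<open>other (qvar Q)\<close>, so its truth is a property of one element and can be looked up in a
  guessed set. The two-type matters only if \<open>e\<close> uses both names.\<close>

lemma lsat_correct:
  assumes "well_formed ar \<phi>" "\<And>v Q. Q \<in> qsubs \<phi> \<Longrightarrow> Q \<in> g v \<longleftrightarrow> sat n \<mu> (\<lambda>_. \<rho> v) Q"
    and e: "(\<exists>c. e = (\<lambda>_. c)) \<or> \<rho> X \<noteq> \<rho> Y \<and> t = two_type ar \<mu> (\<rho> X) (\<rho> Y)"
  shows "sat n \<mu> (\<rho> \<circ> e) \<phi> \<longleftrightarrow> lsat (nullary_of ar \<mu>) (\<lambda>v. one_type ar \<mu> (\<rho> v)) g t e \<phi>"
proof -
  \<comment> \<open>Binding \<open>v\<close> forgets its value, so the environment may as well be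
    constant.\<close>
  have upd: "(\<rho> \<circ> e)(v := a) = (\<lambda>_. \<rho> (e (other v)))(v := a)" for v a
  proof
    fix x show "((\<rho> \<circ> e)(v := a)) x = ((\<lambda>_. \<rho> (e (other v)))(v := a)) x" by (cases x; cases v) auto
  qed
  show ?thesis using assms(1,2)
  proof (induction \<phi>)
    case (Atom p vs)
    then have p: "p < length ar" "length vs = ar ! p" by auto
    consider "vs = []" | c where "vs \<noteq> []" "e ` set vs = {c}" | "e ` set vs = {X, Y}"
    proof -
      have sub: "e ` set vs \<subseteq> {X, Y}" by (rule subsetI) (rule var_in)
      show thesis
      proof (cases "vs = []")
        case False
        then have ne: "e ` set vs \<noteq> {}" by simp
        show thesis
        proof (cases "X \<in> e ` set vs \<and> Y \<in> e ` set vs")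
          case True
          then have "e ` set vs = {X, Y}" using sub by (intro equalityI) auto
          then show thesis by (rule that(3))
        next
          case nxy: False
          then have "e ` set vs \<subseteq> {X} \<or> e ` set vs \<subseteq> {Y}" using sub by (metis subset_insert insert_commute)
          then have "e ` set vs = {X} \<or> e ` set vs = {Y}" using ne by (metis subset_singletonD)
          then show thesis using that(2) False by blast
        qed
      qed (rule that(1))
    qed
    then show ?case
    proof cases
      case 1
      then show ?thesis using p by (auto simp: nullary_of_def)
    next
      case 2
      then have "map (\<lambda>v. \<rho> (e v)) vs = replicate (length vs) (\<rho> c)" by (intro map_const_on) auto
      then show ?thesis using 2 p by (cases c) (auto simp: one_type_def comp_def)
    next
      case 3
      then have "\<not> (\<exists>c. e = (\<lambda>_. c))" by (auto simp: image_constant_conv split: if_splits)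
      then have t: "t = two_type ar \<mu> (\<rho> X) (\<rho> Y)" using e by blast
      have "vs \<noteq> []" "e ` set vs \<noteq> {X}" "e ` set vs \<noteq> {Y}" using 3 by auto
      then have "lsat (nullary_of ar \<mu>) (\<lambda>v. one_type ar \<mu> (\<rho> v)) g t e (Atom p vs) \<longleftrightarrow> (p, map e vs) \<in> t" by simp
      also have "\<dots> \<longleftrightarrow> (p, map \<rho> (map e vs)) \<in> \<mu>" using p 3 by (simp add: t two_type_def vpair_eq)
      finally show ?thesis by (simp only: sat.simps map_map)
    qed
  next
    case (Eq u v)
    then show ?case using e by (cases "e u"; cases "e v") auto
  next
    case (All v \<phi>)
    show ?case using All.prems(2)[of "All v \<phi>" "e (other v)"]
      by (simp only: sat.simps lsat.simps qvar.simps upd qsubs.simps insertI1 simp_thms)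
  next
    case (Ex v \<phi>)
    show ?case using Ex.prems(2)[of "Ex v \<phi>" "e (other v)"]
      by (simp only: sat.simps lsat.simps qvar.simps upd qsubs.simps insertI1 simp_thms)
  next
    case (ExEq k v \<phi>)
    show ?case using ExEq.prems(2)[of "ExEq k v \<phi>" "e (other v)"]
      by (simp only: sat.simps lsat.simps qvar.simps upd qsubs.simps insertI1 simp_thms)
  next
    case (ExLe k v \<phi>)
    show ?case using ExLe.prems(2)[of "ExLe k v \<phi>" "e (other v)"]
      by (simp only: sat.simps lsat.simps qvar.simps upd qsubs.simps insertI1 simp_thms)
  next
    case (ExGe k v \<phi>)
    show ?case using ExGe.prems(2)[of "ExGe k v \<phi>" "e (other v)"]
      by (simp only: sat.simps lsat.simps qvar.simps upd qsubs.simps insertI1 simp_thms)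
  qed auto
qed

text \<open>\<open>edge \<omega> \<tau> g t Q d\<close>: in a pair with two-type \<open>t\<close>, the element named \<open>other d\<close> is a witness
  for \<open>Q\<close> at the element named \<open>d\<close>.\<close>

definition edge :: "nat set \<Rightarrow> (var \<Rightarrow> nat set) \<Rightarrow> (var \<Rightarrow> fm set) \<Rightarrow> two_type \<Rightarrow> fm \<Rightarrow> var \<Rightarrow> bool" where
  "edge \<omega> \<tau> g t Q d \<longleftrightarrow> lsat \<omega> \<tau> g t ((\<lambda>_. d)(qvar Q := other d)) (qbody Q)"

text \<open>Both names denote the same element. The environment is constant, so the empty two-type
  is never consulted.\<close>

definition loop :: "nat set \<Rightarrow> nat set \<Rightarrow> fm set \<Rightarrow> fm \<Rightarrow> bool" where
  "loop \<omega> \<tau> g \<phi> \<longleftrightarrow> lsat \<omega> (\<lambda>_. \<tau>) (\<lambda>_. g) {} (\<lambda>_. X) \<phi>"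

text \<open>Two-types are stored only for pairs with the smaller element first. The last argument of
  \<open>edge\<close> tells which end asks for a witness.\<close>

definition wit :: "nat set \<Rightarrow> (nat \<Rightarrow> nat set) \<Rightarrow> (nat \<Rightarrow> fm set) \<Rightarrow> (nat \<times> nat \<Rightarrow> two_type) \<Rightarrow> fm \<Rightarrow> nat \<Rightarrow> nat \<Rightarrow> bool" where
  "wit \<omega> \<tau> g t Q a b \<longleftrightarrow> (if a < b then edge \<omega> (vpair (\<tau> a) (\<tau> b)) (vpair (g a) (g b)) (t (a, b)) Q X
     else edge \<omega> (vpair (\<tau> b) (\<tau> a)) (vpair (g b) (g a)) (t (b, a)) Q Y)"

definition deg :: "nat set \<Rightarrow> nat set \<Rightarrow> (nat \<Rightarrow> nat set) \<Rightarrow> (nat \<Rightarrow> fm set) \<Rightarrow> (nat \<times> nat \<Rightarrow> two_type) \<Rightarrow> fm \<Rightarrow> nat \<Rightarrow> nat" where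
  "deg V \<omega> \<tau> g t Q a = card {b\<in>V - {a}. wit \<omega> \<tau> g t Q a b}"

text \<open>The condition on the number \<open>d\<close> of witnesses different from the element itself.\<close>

definition deg_ok :: "nat set \<Rightarrow> nat set \<Rightarrow> fm set \<Rightarrow> fm \<Rightarrow> nat \<Rightarrow> bool" where
  "deg_ok \<omega> \<tau> g Q d \<longleftrightarrow> (Q \<in> g \<longleftrightarrow> qholds Q (d + (if loop \<omega> \<tau> g (qbody Q) then 1 else 0)))"

lemma vpair_comp: "(\<lambda>v. f (vpair a b v)) = vpair (f a) (f b)"
proof
  show "f (vpair a b v) = vpair (f a) (f b) v" for v by (cases v) auto
qed

lemma upd_comp: "(\<lambda>_. \<rho> d)(v := \<rho> c) = \<rho> \<circ> ((\<lambda>_. d)(v := c))"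
  by auto

context
  fixes ar :: vocab and \<Phi> :: fm and \<mu> :: world and n :: nat
    and \<omega> :: "nat set" and \<tau> :: "nat \<Rightarrow> nat set" and t :: "nat \<times> nat \<Rightarrow> two_type"
  assumes wf: "well_formed ar \<Phi>"
    and om: "\<omega> = nullary_of ar \<mu>"
    and ty1: "\<And>a. a \<in> {1..n} \<Longrightarrow> \<tau> a = one_type ar \<mu> a"
    and ty2: "\<And>p. p \<in> prs {1..n} \<Longrightarrow> t p = two_type ar \<mu> (fst p) (snd p)"
begin

lemma wit_correct:
  assumes Q: "Q \<in> qsubs \<Phi>" and ab: "a \<in> {1..n}" "b \<in> {1..n}" "a \<noteq> b"
    and g: "\<And>c Q'. c \<in> {1..n} \<Longrightarrow> Q' \<in> qsubs (qbody Q) \<Longrightarrow> Q' \<in> g c \<longleftrightarrow> sat n \<mu> (\<lambda>_. c) Q'"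
  shows "sat n \<mu> ((\<lambda>_. a)(qvar Q := b)) (qbody Q) \<longleftrightarrow> wit \<omega> \<tau> g t Q a b"
proof (cases "a < b")
  case True
  have "(\<lambda>_. a)(qvar Q := b) = vpair a b \<circ> ((\<lambda>_. X)(qvar Q := Y))"
    using upd_comp[of "vpair a b" X "qvar Q" Y] by simp
  moreover have "sat n \<mu> (vpair a b \<circ> ((\<lambda>_. X)(qvar Q := Y))) (qbody Q) \<longleftrightarrow>
    lsat (nullary_of ar \<mu>) (\<lambda>v. one_type ar \<mu> (vpair a b v)) (vpair (g a) (g b)) (t (a, b))
      ((\<lambda>_. X)(qvar Q := Y)) (qbody Q)"
  proof (rule lsat_correct[OF well_formed_body[OF Q wf]])
    show "Q' \<in> vpair (g a) (g b) v \<longleftrightarrow> sat n \<mu> (\<lambda>_. vpair a b v) Q'" if "Q' \<in> qsubs (qbody Q)" for v Q'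
      using g ab that by (cases v) auto
  qed (use True ab ty2[of "(a, b)"] in \<open>auto simp: prs_def\<close>)
  ultimately show ?thesis using True ab by (simp add: wit_def edge_def om vpair_comp ty1)
next
  case False
  have "(\<lambda>_. a)(qvar Q := b) = vpair b a \<circ> ((\<lambda>_. Y)(qvar Q := X))"
    using upd_comp[of "vpair b a" Y "qvar Q" X] by simp
  moreover have "sat n \<mu> (vpair b a \<circ> ((\<lambda>_. Y)(qvar Q := X))) (qbody Q) \<longleftrightarrow>
    lsat (nullary_of ar \<mu>) (\<lambda>v. one_type ar \<mu> (vpair b a v)) (vpair (g b) (g a)) (t (b, a))
      ((\<lambda>_. Y)(qvar Q := X)) (qbody Q)"
  proof (rule lsat_correct[OF well_formed_body[OF Q wf]])
    show "Q' \<in> vpair (g b) (g a) v \<longleftrightarrow> sat n \<mu> (\<lambda>_. vpair b a v) Q'" if "Q' \<in> qsubs (qbody Q)" for v Q'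
      using g ab that by (cases v) auto
  qed (use False ab ty2[of "(b, a)"] in \<open>auto simp: prs_def\<close>)
  ultimately show ?thesis using False ab by (simp add: wit_def edge_def om vpair_comp ty1)
qed

lemma loop_correct:
  assumes wf': "well_formed ar \<phi>" and a: "a \<in> {1..n}"
    and g: "\<And>Q'. Q' \<in> qsubs \<phi> \<Longrightarrow> Q' \<in> g a \<longleftrightarrow> sat n \<mu> (\<lambda>_. a) Q'"
  shows "sat n \<mu> (\<lambda>_. a) \<phi> \<longleftrightarrow> loop \<omega> (\<tau> a) (g a) \<phi>"
  using lsat_correct[OF wf', of "\<lambda>_. g a" n \<mu> "\<lambda>_. a" "\<lambda>_. X" "{}"] g a
  by (auto simp: loop_def om ty1 comp_def)

text \<open>The witnesses are those different from \<open>a\<close>, counted by \<open>deg\<close>,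
  and possibly \<open>a\<close> itself, which \<open>deg_ok\<close> adds through
  \<open>loop\<close>.\<close>

lemma quant_correct:
  assumes Q: "Q \<in> qsubs \<Phi>" and a: "a \<in> {1..n}"
    and g: "\<And>c Q'. c \<in> {1..n} \<Longrightarrow> Q' \<in> qsubs (qbody Q) \<Longrightarrow> Q' \<in> g c \<longleftrightarrow> sat n \<mu> (\<lambda>_. c) Q'"
  shows "deg_ok \<omega> (\<tau> a) (g a) Q (deg {1..n} \<omega> \<tau> g t Q a) \<longleftrightarrow> (Q \<in> g a \<longleftrightarrow> sat n \<mu> (\<lambda>_. a) Q)"
proof -
  let ?S = "{b\<in>{1..n}. sat n \<mu> ((\<lambda>_. a)(qvar Q := b)) (qbody Q)}"
  have "sat n \<mu> ((\<lambda>_. a)(qvar Q := a)) (qbody Q) \<longleftrightarrow> loop \<omega> (\<tau> a) (g a) (qbody Q)"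
    using loop_correct[of "qbody Q" a g, OF well_formed_body[OF Q wf] a] g[OF a] by (simp add: fun_upd_idem)
  then have "?S = {b\<in>{1..n} - {a}. wit \<omega> \<tau> g t Q a b} \<union> (if loop \<omega> (\<tau> a) (g a) (qbody Q) then {a} else {})"
    using wit_correct[OF Q a _ _ g] a by auto
  then have "card ?S = deg {1..n} \<omega> \<tau> g t Q a + (if loop \<omega> (\<tau> a) (g a) (qbody Q) then 1 else 0)"
    unfolding deg_def by (auto simp: card_insert_if)
  then show ?thesis unfolding deg_ok_def using sat_quant[OF Q, of n \<mu> "\<lambda>_. a"] by simp
qed

text \<open>The degree conditions pin the guess down. By induction on the size of \<open>Q\<close>,
  the witnesses of \<open>Q\<close> are computed from guesses already known to be right, and then
  the condition for \<open>Q\<close> fixes its own guess.\<close>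

lemma guess_correct:
  "(\<forall>a\<in>{1..n}. \<forall>Q\<in>qsubs \<Phi>. deg_ok \<omega> (\<tau> a) (g a) Q (deg {1..n} \<omega> \<tau> g t Q a)) \<longleftrightarrow>
   (\<forall>a\<in>{1..n}. \<forall>Q\<in>qsubs \<Phi>. Q \<in> g a \<longleftrightarrow> sat n \<mu> (\<lambda>_. a) Q)" (is "?L \<longleftrightarrow> ?R")
proof
  assume L: ?L
  have "Q \<in> qsubs \<Phi> \<Longrightarrow> \<forall>a\<in>{1..n}. Q \<in> g a \<longleftrightarrow> sat n \<mu> (\<lambda>_. a) Q" for Q
  proof (induction "size Q" arbitrary: Q rule: less_induct)
    case less
    have "Q' \<in> g c \<longleftrightarrow> sat n \<mu> (\<lambda>_. c) Q'" if "c \<in> {1..n}" "Q' \<in> qsubs (qbody Q)" for c Q'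
      using less.hyps[OF qsubs_body_size[OF less.prems that(2)]] qsubs_body[OF less.prems] that by blast
    then show ?case using quant_correct[OF less.prems] L less.prems by blast
  qed
  then show ?R by blast
next
  assume R: ?R
  show ?L
  proof (intro ballI)
    fix a Q assume "a \<in> {1..n}" "Q \<in> qsubs \<Phi>"
    then show "deg_ok \<omega> (\<tau> a) (g a) Q (deg {1..n} \<omega> \<tau> g t Q a)"
      using quant_correct[of Q a g] R qsubs_body[of Q \<Phi>] by blast
  qed
qed

end

section \<open>Counting conditions as leading coefficients\<close>

text \<open>A polynomial with lowest term \<open>b * x ^ k\<close>, evaluated at an integer
  \<open>x\<close>: \<open>x ^ k\<close> divides \<open>a\<close>, and the quotient is congruent to
  \<open>b\<close> modulo \<open>x\<close>. No sign or size of the remaining part is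
  recorded.\<close>

definition lead :: "int \<Rightarrow> nat \<Rightarrow> int \<Rightarrow> int \<Rightarrow> bool" where
  "lead x k a b \<longleftrightarrow> (\<exists>c. a = x ^ k * (b + x * c))"

lemma leadI: "a = x ^ k * (b + x * c) \<Longrightarrow> lead x k a b"
  unfolding lead_def by blast

lemma lead_mult:
  assumes "lead x k a b" "lead x l a' b'"
  shows "lead x (k + l) (a * a') (b * b')"
proof -
  obtain c c' where "a = x ^ k * (b + x * c)" "a' = x ^ l * (b' + x * c')"
    using assms unfolding lead_def by blast
  then have "a * a' = x ^ (k + l) * (b * b' + x * (c * b' + b * c' + x * c * c'))"
    by (simp add: power_add algebra_simps)
  then show ?thesis by (rule leadI)
qed

lemma lead_self: "lead x 0 a a"
  by (rule leadI[where c = 0]) simp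

lemma lead_0: "lead x k 0 0"
  by (rule leadI[where c = 0]) simp

lemma lead_cmult: "lead x k a b \<Longrightarrow> lead x k (c * a) (c * b)"
  using lead_mult[OF lead_self[of x c]] by fastforce

lemma lead_add:
  assumes "lead x k a b" "lead x k a' b'"
  shows "lead x k (a + a') (b + b')"
proof -
  obtain c c' where "a = x ^ k * (b + x * c)" "a' = x ^ k * (b' + x * c')"
    using assms unfolding lead_def by blast
  then have "a + a' = x ^ k * (b + b' + x * (c + c'))" by (simp add: algebra_simps)
  then show ?thesis by (rule leadI)
qed

lemma lead_sum: "(\<And>i. i \<in> A \<Longrightarrow> lead x k (a i) (b i)) \<Longrightarrow> lead x k (\<Sum>i\<in>A. a i) (\<Sum>i\<in>A. b i)"
  by (induction A rule: infinite_finite_induct) (auto intro: lead_add lead_0)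

lemma lead_prod: "(\<And>i. i \<in> A \<Longrightarrow> lead x k (a i) (b i)) \<Longrightarrow> lead x (card A * k) (\<Prod>i\<in>A. a i) (\<Prod>i\<in>A. b i)"
  by (induction A rule: infinite_finite_induct) (auto intro: lead_self lead_mult)

text \<open>The cofactor \<open>c\<close> may be negative; the remainder modulo a positive number is
  \<open>b\<close> all the same.\<close>

lemma lead_digit:
  assumes "lead x k a b" "0 \<le> b" "b < x"
  shows "a div x ^ k mod x = b"
proof -
  obtain c where c: "a = x ^ k * (b + x * c)" using assms(1) unfolding lead_def by blast
  have "x > 0" using assms by linarith
  then have "a div x ^ k = b + x * c" unfolding c by simp
  then show ?thesis using assms by simp
qed

text \<open>The number of surjections from a set with \<open>d\<close> elements onto one with \<open>k\<close> elements.\<close>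

definition surj_count :: "nat \<Rightarrow> nat \<Rightarrow> int" where
  "surj_count d k = (\<Sum>j\<le>k. (- 1) ^ (k - j) * int (k choose j) * int j ^ d)"

lemma surj_count_0: "surj_count 0 k = (if k = 0 then 1 else 0)"
proof -
  have "surj_count 0 k = (1 + (- 1)) ^ k"
    unfolding surj_count_def binomial_ring by (intro sum.cong) auto
  then show ?thesis by simp
qed

text \<open>One additional element has \<open>Suc k\<close> possible images, and the others map onto
  everything or onto everything else. Algebraically, this is the absorption identity followed by
  Pascal's rule.\<close>

lemma surj_count_Suc: "surj_count (Suc d) (Suc k) = int (Suc k) * (surj_count d (Suc k) + surj_count d k)"
proof -
  have 1: "surj_count (Suc d) (Suc k) = (\<Sum>i\<le>k. (- 1) ^ (k - i) * (int (Suc k) * int (k choose i)) * int (Suc i) ^ d)"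
  proof -
    have "surj_count (Suc d) (Suc k) = (\<Sum>i\<le>k. (- 1) ^ (k - i) * int (Suc k choose Suc i) * int (Suc i) ^ Suc d)"
      unfolding surj_count_def by (subst sum.atMost_Suc_shift) simp
    also have "\<dots> = (\<Sum>i\<le>k. (- 1) ^ (k - i) * (int (Suc k) * int (k choose i)) * int (Suc i) ^ d)"
    proof (intro sum.cong refl)
      fix i
      have "int (Suc i) * int (Suc k choose Suc i) = int (Suc k) * int (k choose i)"
        by (metis Suc_times_binomial of_nat_mult)
      then have "(- 1) ^ (k - i) * (int (Suc i) * int (Suc k choose Suc i)) * int (Suc i) ^ d =
        (- 1) ^ (k - i) * (int (Suc k) * int (k choose i)) * int (Suc i) ^ d" by (simp only:)
      then show "(- 1) ^ (k - i) * int (Suc k choose Suc i) * int (Suc i) ^ Suc d =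
        (- 1) ^ (k - i) * (int (Suc k) * int (k choose i)) * int (Suc i) ^ d"
        by (simp only: power_Suc mult_ac)
    qed
    finally show ?thesis .
  qed
  have "surj_count d (Suc k) = (- 1) ^ Suc k * int 0 ^ d + (\<Sum>i\<le>k. (- 1) ^ (k - i) * int (Suc k choose Suc i) * int (Suc i) ^ d)"
    unfolding surj_count_def by (subst sum.atMost_Suc_shift) simp
  also have "(\<Sum>i\<le>k. (- 1) ^ (k - i) * int (Suc k choose Suc i) * int (Suc i) ^ d) =
     (\<Sum>i\<le>k. (- 1) ^ (k - i) * int (k choose i) * int (Suc i) ^ d) +
     (\<Sum>i\<le>k. (- 1) ^ (k - i) * int (k choose Suc i) * int (Suc i) ^ d)"
    by (simp add: sum.distrib[symmetric] algebra_simps)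
  also have "(- 1) ^ Suc k * int 0 ^ d + ((\<Sum>i\<le>k. (- 1) ^ (k - i) * int (k choose i) * int (Suc i) ^ d) +
     (\<Sum>i\<le>k. (- 1) ^ (k - i) * int (k choose Suc i) * int (Suc i) ^ d)) =
     (\<Sum>i\<le>k. (- 1) ^ (k - i) * int (k choose i) * int (Suc i) ^ d) - surj_count d k"
  proof -
    have "surj_count d k = - (\<Sum>j\<le>Suc k. (- 1) ^ (Suc k - j) * int (k choose j) * int j ^ d)"
      unfolding surj_count_def by (simp add: sum_negf[symmetric] Suc_diff_le)
    also have "(\<Sum>j\<le>Suc k. (- 1) ^ (Suc k - j) * int (k choose j) * int j ^ d) =
       (- 1) ^ Suc k * int 0 ^ d + (\<Sum>i\<le>k. (- 1) ^ (k - i) * int (k choose Suc i) * int (Suc i) ^ d)"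
      by (subst sum.atMost_Suc_shift) simp
    finally show ?thesis by simp
  qed
  finally show ?thesis unfolding 1 by (simp add: sum_distrib_left mult_ac)
qed

text \<open>A smaller set has no surjection, and between sets of equal size the surjections are the
  \<open>d!\<close> bijections. These two cases are all that a lowest coefficient can see.\<close>

lemma surj_count_le: "d \<le> k \<Longrightarrow> surj_count d k = (if d = k then fact d else 0)"
proof (induction d arbitrary: k)
  case 0
  then show ?case by (auto simp: surj_count_0)
next
  case (Suc d)
  then obtain k' where k: "k = Suc k'" "d \<le> k'" by (cases k) auto
  then show ?case using Suc.IH[of k'] Suc.IH[of k] by (auto simp: surj_count_Suc)
qed

text \<open>A condition \<open>f\<close> on a degree \<open>d\<close> that is constant beyond \<open>K\<close> becomes a combination of
  \<open>d\<close>-th powers, so that products over edges appear.\<close>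

definition base_wt :: "nat \<Rightarrow> int \<Rightarrow> nat \<Rightarrow> int" where
  "base_wt K x j = (if j \<le> K then int j * x else 1)"

text \<open>Write \<open>f d\<close> as \<open>f (Suc K)\<close> plus the sum over
  \<open>k \<le> K\<close> of the indicator of \<open>d = k\<close> times
  \<open>f k - f (Suc K)\<close>. That indicator is the coefficient at \<open>x ^ K\<close> of
  \<open>x ^ (K - k) * x ^ d * surj_count d k\<close> divided by \<open>k!\<close>. The bases
  \<open>j * x\<close> with \<open>j \<le> K\<close> produce the surjection numbers, and index
  \<open>Suc K\<close>, with base 1, carries the constant term. Everything is multiplied by
  \<open>K!\<close> to stay integral.\<close>

definition coeff_wt :: "nat \<Rightarrow> int \<Rightarrow> (nat \<Rightarrow> bool) \<Rightarrow> nat \<Rightarrow> int" where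
  "coeff_wt K x f j = (if j \<le> K then \<Sum>k\<in>{j..K}. (of_bool (f k) - of_bool (f (Suc K))) *
       (fact K div fact k) * ((- 1) ^ (k - j) * int (k choose j)) * x ^ (K - k)
     else fact K * of_bool (f (Suc K)) * x ^ K)"

text \<open>The term for \<open>k\<close> vanishes if \<open>d < k\<close>, equals its contribution
  times \<open>x ^ K\<close> if \<open>d = k\<close>, and has a surplus factor \<open>x\<close> if
  \<open>d > k\<close>.\<close>

lemma lead_degree:
  assumes "\<And>d. d > K \<Longrightarrow> f d = f (Suc K)"
  shows "lead x K (\<Sum>j\<le>Suc K. coeff_wt K x f j * base_wt K x j ^ d) (fact K * of_bool (f d))"
proof -
  define C where "C = (\<lambda>k. (of_bool (f k) - of_bool (f (Suc K))) * (fact K div fact k) :: int)"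
  have "(\<Sum>j\<le>K. coeff_wt K x f j * base_wt K x j ^ d) =
    (\<Sum>j\<le>K. \<Sum>k\<in>{j..K}. C k * ((- 1) ^ (k - j) * int (k choose j)) * x ^ (K - k) * (int j * x) ^ d)"
    by (intro sum.cong) (auto simp: coeff_wt_def base_wt_def C_def sum_distrib_right)
  also have "\<dots> = (\<Sum>k\<le>K. \<Sum>j\<le>k. C k * ((- 1) ^ (k - j) * int (k choose j)) * x ^ (K - k) * (int j * x) ^ d)"
  proof -
    have "(\<Sum>j\<le>K. \<Sum>k\<in>{k\<in>{..K}. j \<le> k}. G j k) = (\<Sum>k\<le>K. \<Sum>j\<in>{j\<in>{..K}. j \<le> k}. G j k)" for G :: "nat \<Rightarrow> nat \<Rightarrow> int"
      by (rule sum.swap_restrict) auto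
    moreover have "{k\<in>{..K}. j \<le> k} = {j..K}" for j by auto
    moreover have "(\<Sum>k\<le>K. \<Sum>j\<in>{j\<in>{..K}. j \<le> k}. G j k) = (\<Sum>k\<le>K. \<Sum>j\<le>k. G j k)" for G :: "nat \<Rightarrow> nat \<Rightarrow> int"
      by (intro sum.cong) auto
    ultimately show ?thesis by simp
  qed
  also have "\<dots> = (\<Sum>k\<le>K. C k * x ^ (K - k) * x ^ d * surj_count d k)"
    unfolding surj_count_def by (simp add: sum_distrib_left power_mult_distrib mult_ac)
  finally have s: "(\<Sum>j\<le>K. coeff_wt K x f j * base_wt K x j ^ d) = (\<Sum>k\<le>K. C k * x ^ (K - k) * x ^ d * surj_count d k)" .
  have "lead x K (C k * x ^ (K - k) * x ^ d * surj_count d k) (if k = d then fact K * (of_bool (f k) - of_bool (f (Suc K))) else 0)"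
    if "k \<le> K" for k
  proof -
    consider "d < k" | "d = k" | "d > k" by linarith
    then show ?thesis
    proof cases
      case 1
      then show ?thesis using surj_count_le[of d k] by (simp add: lead_0)
    next
      case 2
      have "(fact K div fact k :: int) * fact k = fact K"
        using that by (intro dvd_div_mult_self fact_dvd)
      moreover have "x ^ (K - k) * x ^ d = x ^ K" using 2 that by (simp add: power_add[symmetric])
      moreover have "C k * x ^ (K - k) * x ^ d * surj_count d k = (x ^ (K - k) * x ^ d) *
          (((fact K div fact k) * fact k) * (of_bool (f k) - of_bool (f (Suc K))))"
        using surj_count_le[of d k] 2 by (simp add: C_def mult_ac)
      ultimately have "C k * x ^ (K - k) * x ^ d * surj_count d k = x ^ K * (fact K * (of_bool (f k) - of_bool (f (Suc K))))"
        by (simp only:)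
      then show ?thesis using 2 by (intro leadI[where c = 0]) simp
    next
      case 3
      then obtain e where e: "d = k + Suc e" using less_iff_Suc_add by auto
      have "x ^ (K - k) * x ^ d = x ^ K * x ^ Suc e"
        using that by (simp add: e power_add[symmetric])
      moreover have "C k * x ^ (K - k) * x ^ d * surj_count d k = (x ^ (K - k) * x ^ d) * (C k * surj_count d k)"
        by (simp only: mult_ac)
      ultimately have "C k * x ^ (K - k) * x ^ d * surj_count d k = x ^ K * (0 + x * (x ^ e * C k * surj_count d k))"
        by (simp only: power_Suc add_0 mult_ac)
      then have "lead x K (C k * x ^ (K - k) * x ^ d * surj_count d k) 0" by (rule leadI)
      then show ?thesis using 3 by simp
    qed
  qed
  then have "lead x K (\<Sum>k\<le>K. C k * x ^ (K - k) * x ^ d * surj_count d k)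
     (\<Sum>k\<le>K. if k = d then fact K * (of_bool (f k) - of_bool (f (Suc K))) else 0)"
    by (intro lead_sum) auto
  moreover have "lead x K (coeff_wt K x f (Suc K) * base_wt K x (Suc K) ^ d) (fact K * of_bool (f (Suc K)))"
    by (rule leadI[where c = 0]) (simp add: coeff_wt_def base_wt_def)
  ultimately have "lead x K ((\<Sum>j\<le>K. coeff_wt K x f j * base_wt K x j ^ d) + coeff_wt K x f (Suc K) * base_wt K x (Suc K) ^ d)
     ((\<Sum>k\<le>K. if k = d then fact K * (of_bool (f k) - of_bool (f (Suc K))) else 0) + fact K * of_bool (f (Suc K)))"
    unfolding s by (rule lead_add)
  moreover have "(\<Sum>k\<le>K. if k = d then fact K * (of_bool (f k) - of_bool (f (Suc K))) else 0) + fact K * of_bool (f (Suc K))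
     = (fact K * of_bool (f d) :: int)"
    using assms[of d] by (simp add: right_diff_distrib)
  ultimately show ?thesis by simp
qed

section \<open>Products over pairs\<close>

lemma prod_prs_both:
  assumes "finite V"
  shows "(\<Prod>p\<in>prs V. F (fst p) (snd p) * F (snd p) (fst p)) = (\<Prod>a\<in>V. \<Prod>b\<in>V - {a}. F a b)"
proof -
  have "(\<Prod>a\<in>V. \<Prod>b\<in>V - {a}. F a b) = (\<Prod>(a, b)\<in>Sigma V (\<lambda>a. V - {a}). F a b)"
    by (rule prod.Sigma) (use assms in auto)
  also have "Sigma V (\<lambda>a. V - {a}) = prs V \<union> prod.swap ` prs V"
    by (auto simp: prs_def image_iff)
  also have "(\<Prod>(a, b)\<in>prs V \<union> prod.swap ` prs V. F a b) = (\<Prod>(a, b)\<in>prs V. F a b) * (\<Prod>(a, b)\<in>prod.swap ` prs V. F a b)"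
  proof (rule prod.union_disjoint)
    show "prs V \<inter> prod.swap ` prs V = {}" by (auto simp: prs_def)
  qed (use assms in simp_all)
  also have "(\<Prod>(a, b)\<in>prod.swap ` prs V. F a b) = (\<Prod>p\<in>prs V. F (snd p) (fst p))"
    by (subst prod.reindex) (auto simp: split_def)
  finally show ?thesis by (simp add: prod.distrib split_def)
qed

text \<open>Choosing a type in \<open>T0\<close> or \<open>T1\<close> for each pair chooses the
  graph as well: since the sets are disjoint, the edges are the pairs with a type in
  \<open>T1\<close>. Distributivity over pairs does the rest.\<close>

lemma bip_weight_sum:
  assumes "finite V" "finite T0" "finite T1" "T0 \<inter> T1 = {}"
  shows "bip_weight (\<lambda>p. \<Sum>s\<in>T0. h p s) (\<lambda>p. \<Sum>s\<in>T1. h p s) V =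
    (\<Sum>t\<in>{t\<in>PiE (prs V) (\<lambda>_. T0 \<union> T1). two_colourable V {p\<in>prs V. t p \<in> T1}}. \<Prod>p\<in>prs V. h p (t p))"
proof -
  let ?E = "\<lambda>t. {p\<in>prs V. t p \<in> T1}" and ?D = "{E. E \<subseteq> prs V \<and> two_colourable V E}"
  let ?T = "{t\<in>PiE (prs V) (\<lambda>_. T0 \<union> T1). two_colourable V (?E t)}"
  have "finite (PiE (prs V) (\<lambda>_. T0 \<union> T1))" using assms by (intro finite_PiE) auto
  then have fin: "finite ?T" by simp
  have finD: "finite ?D" by (rule finite_subset[of _ "Pow (prs V)"]) (use assms in auto)
  have "(\<Sum>t\<in>?T. \<Prod>p\<in>prs V. h p (t p)) = (\<Sum>E\<in>?D. \<Sum>t\<in>{t\<in>?T. ?E t = E}. \<Prod>p\<in>prs V. h p (t p))"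
    by (rule sum.group[symmetric]) (use fin finD in auto)
  also have "\<dots> = (\<Sum>E\<in>?D. graph_weight (\<lambda>p. \<Sum>s\<in>T0. h p s) (\<lambda>p. \<Sum>s\<in>T1. h p s) V E)"
  proof (rule sum.cong[OF refl])
    fix E assume E: "E \<in> ?D"
    have "{t\<in>?T. ?E t = E} = PiE (prs V) (\<lambda>p. if p \<in> E then T1 else T0)"
    proof (intro equalityI subsetI)
      fix t assume t: "t \<in> {t\<in>?T. ?E t = E}"
      then have t1: "t \<in> PiE (prs V) (\<lambda>_. T0 \<union> T1)" "?E t = E" by auto
      show "t \<in> PiE (prs V) (\<lambda>p. if p \<in> E then T1 else T0)"
        by (rule PiE_I) (use t1 PiE_mem[OF t1(1)] PiE_arb[OF t1(1)] in auto)
    next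
      fix t assume t: "t \<in> PiE (prs V) (\<lambda>p. if p \<in> E then T1 else T0)"
      have tp: "t p \<in> (if p \<in> E then T1 else T0)" if "p \<in> prs V" for p using PiE_mem[OF t that] .
      have "t p \<in> T1 \<longleftrightarrow> p \<in> E" if "p \<in> prs V" for p
        using tp[OF that] assms(4) by (cases "p \<in> E") auto
      then have "?E t = E" using E by blast
      moreover have "t \<in> PiE (prs V) (\<lambda>_. T0 \<union> T1)"
      proof (rule PiE_I)
        show "t p \<in> T0 \<union> T1" if "p \<in> prs V" for p using tp[OF that] by (cases "p \<in> E") auto
      qed (use PiE_arb[OF t] in auto)
      ultimately show "t \<in> {t\<in>?T. ?E t = E}" using E by auto
    qed
    then have "(\<Sum>t\<in>{t\<in>?T. ?E t = E}. \<Prod>p\<in>prs V. h p (t p)) = (\<Prod>p\<in>prs V. \<Sum>s\<in>(if p \<in> E then T1 else T0). h p s)"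
      using assms by (simp add: prod_sum_PiE)
    also have "\<dots> = graph_weight (\<lambda>p. \<Sum>s\<in>T0. h p s) (\<lambda>p. \<Sum>s\<in>T1. h p s) V E"
      unfolding graph_weight_def by (intro prod.cong) auto
    finally show "(\<Sum>t\<in>{t\<in>?T. ?E t = E}. \<Prod>p\<in>prs V. h p (t p)) = \<dots>" .
  qed
  finally show ?thesis unfolding bip_weight_def ..
qed

lemma sum_PiE_Times:
  assumes "finite V" "\<And>v. v \<in> V \<Longrightarrow> finite (A v)" "\<And>v. v \<in> V \<Longrightarrow> finite (B v)"
  shows "(\<Sum>f\<in>PiE V (\<lambda>v. A v \<times> B v). G f) = (\<Sum>\<sigma>\<in>PiE V A. \<Sum>j\<in>PiE V B. G (\<lambda>v\<in>V. (\<sigma> v, j v)))"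
proof -
  have "(\<Sum>f\<in>PiE V (\<lambda>v. A v \<times> B v). G f) = (\<Sum>(\<sigma>, j)\<in>PiE V A \<times> PiE V B. G (\<lambda>v\<in>V. (\<sigma> v, j v)))"
  proof (rule sum.reindex_bij_witness[where j = "\<lambda>f. (\<lambda>v\<in>V. fst (f v), \<lambda>v\<in>V. snd (f v))" and
        i = "\<lambda>(\<sigma>, j). \<lambda>v\<in>V. (\<sigma> v, j v)"], goal_cases)
    case (1 f)
    then show ?case by (auto simp: fun_eq_iff PiE_def extensional_def)
  next
    case (2 f)
    then show ?case by (auto simp: PiE_iff mem_Times_iff)
  next
    case (3 q)
    then show ?case by (auto simp: fun_eq_iff PiE_def extensional_def)
  next
    case (4 q)
    then show ?case by (auto simp: PiE_iff)
  next
    case (5 f)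
    then have "(\<lambda>v\<in>V. ((\<lambda>v\<in>V. fst (f v)) v, (\<lambda>v\<in>V. snd (f v)) v)) = f"
      by (auto simp: fun_eq_iff PiE_def extensional_def)
    then show ?case by simp
  qed
  then show ?thesis by (simp add: sum.cartesian_product)
qed

section \<open>Worlds as configurations of types\<close>

definition preds1 :: "vocab \<Rightarrow> nat set" where
  "preds1 ar = {p. p < length ar \<and> ar ! p > 0}"

definition atoms2 :: "vocab \<Rightarrow> two_type" where
  "atoms2 ar = {(p, vs). p < length ar \<and> length vs = ar ! p \<and> set vs = {X, Y}}"

definition free_atoms :: "vocab \<Rightarrow> nat \<Rightarrow> gatom set" where
  "free_atoms ar n = {ga\<in>ground_atoms ar n. card (set (snd ga)) \<ge> 3}"

text \<open>Ground atoms are sorted by their number of distinct arguments. An atom with exactly two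
  is a pattern over \<open>X\<close> and \<open>Y\<close>, where \<open>X\<close> stands for the
  smaller element.\<close>

definition atoms_of ::
  "vocab \<Rightarrow> nat \<Rightarrow> nat set \<Rightarrow> (nat \<Rightarrow> nat set) \<Rightarrow> (nat \<times> nat \<Rightarrow> two_type) \<Rightarrow> gatom set \<Rightarrow> world" where
  "atoms_of ar n \<omega> \<tau> t F = (\<lambda>p. (p, [])) ` \<omega> \<union> (\<Union>a\<in>{1..n}. (\<lambda>p. (p, replicate (ar ! p) a)) ` \<tau> a) \<union>
     (\<Union>q\<in>prs {1..n}. (\<lambda>(p, vs). (p, map (vpair (fst q) (snd q)) vs)) ` t q) \<union> F"

lemma finite_ground_atoms [simp]: "finite (ground_atoms ar n)"
proof (rule finite_subset)
  show "ground_atoms ar n \<subseteq> {..<length ar} \<times> (\<Union>k\<in>set ar. {as. set as \<subseteq> {1..n} \<and> length as = k})"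
    unfolding ground_atoms_def by auto
qed (auto intro: finite_lists_length_eq)

lemma finite_preds1 [simp]: "finite (preds1 ar)"
  by (simp add: preds1_def)

lemma finite_atoms2 [simp]: "finite (atoms2 ar)"
proof (rule finite_subset)
  show "atoms2 ar \<subseteq> {..<length ar} \<times> (\<Union>k\<in>set ar. {vs. set vs \<subseteq> {X, Y} \<and> length vs = k})"
    unfolding atoms2_def by auto
qed (auto intro: finite_lists_length_eq)

lemma finite_free_atoms [simp]: "finite (free_atoms ar n)"
  by (simp add: free_atoms_def)

lemma inj_vpair: "a \<noteq> b \<Longrightarrow> inj (vpair a b)"
proof (rule injI)
  fix x y assume "a \<noteq> b" "vpair a b x = vpair a b y"
  then show "x = y" by (cases x; cases y) auto
qed

lemma vpair_image: "set vs = {X, Y} \<Longrightarrow> set (map (vpair a b) vs) = {a, b}"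
  by auto

lemma disjoint_by_rank:
  fixes f :: "'a \<Rightarrow> nat"
  shows "(\<And>x. x \<in> A \<Longrightarrow> f x < k) \<Longrightarrow> (\<And>x. x \<in> B \<Longrightarrow> k \<le> f x) \<Longrightarrow> A \<inter> B = {}"
  by (auto simp: not_less[symmetric])

locale types =
  fixes ar :: vocab and n :: nat and \<omega> :: "nat set" and \<tau> :: "nat \<Rightarrow> nat set"
    and t :: "nat \<times> nat \<Rightarrow> two_type" and F :: "gatom set"
  assumes om: "\<omega> \<subseteq> {p. p < length ar \<and> ar ! p = 0}"
    and ty1: "\<And>a. a \<in> {1..n} \<Longrightarrow> \<tau> a \<subseteq> preds1 ar"
    and ty2: "\<And>q. q \<in> prs {1..n} \<Longrightarrow> t q \<subseteq> atoms2 ar"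
    and fr: "F \<subseteq> free_atoms ar n"
begin

abbreviation "\<mu> \<equiv> atoms_of ar n \<omega> \<tau> t F"

abbreviation "part1 a \<equiv> (\<lambda>p. (p, replicate (ar ! p) a)) ` \<tau> a"
abbreviation "part2 q \<equiv> (\<lambda>(p, vs). (p, map (vpair (fst q) (snd q)) vs)) ` t q"

lemma set_parts:
  "ga \<in> (\<lambda>p. (p, [])) ` \<omega> \<Longrightarrow> set (snd ga) = {}"
  "a \<in> {1..n} \<Longrightarrow> ga \<in> part1 a \<Longrightarrow> set (snd ga) = {a}"
  "q \<in> prs {1..n} \<Longrightarrow> ga \<in> part2 q \<Longrightarrow> set (snd ga) = {fst q, snd q}"
  "ga \<in> F \<Longrightarrow> card (set (snd ga)) \<ge> 3"
proof -
  show "ga \<in> (\<lambda>p. (p, [])) ` \<omega> \<Longrightarrow> set (snd ga) = {}" by auto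
  show "set (snd ga) = {a}" if a: "a \<in> {1..n}" "ga \<in> part1 a"
    using ty1[OF a(1)] a(2) by (auto simp: preds1_def)
  show "set (snd ga) = {fst q, snd q}" if q: "q \<in> prs {1..n}" "ga \<in> part2 q"
  proof -
    obtain p vs where "(p, vs) \<in> t q" "ga = (p, map (vpair (fst q) (snd q)) vs)" using q(2) by auto
    moreover from this have "set vs = {X, Y}" using ty2[OF q(1)] by (auto simp: atoms2_def)
    ultimately show ?thesis by (simp only: snd_conv vpair_image)
  qed
  show "ga \<in> F \<Longrightarrow> card (set (snd ga)) \<ge> 3" using fr by (auto simp: free_atoms_def)
qed

lemma mem_cases:
  assumes "ga \<in> \<mu>"
  obtains "ga \<in> (\<lambda>p. (p, [])) ` \<omega>" | a where "a \<in> {1..n}" "ga \<in> part1 a"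
    | q where "q \<in> prs {1..n}" "ga \<in> part2 q" | "ga \<in> F"
  using assms unfolding atoms_of_def by blast

lemma prs_ne: "q \<in> prs V \<Longrightarrow> fst q < snd q"
  by (auto simp: prs_def)

lemma card_part2: "q \<in> prs {1..n} \<Longrightarrow> ga \<in> part2 q \<Longrightarrow> card (set (snd ga)) = 2"
  using set_parts(3)[of q ga] prs_ne[of q "{1..n}"] by simp

lemma mem0: "(p, []) \<in> \<mu> \<longleftrightarrow> p \<in> \<omega>"
proof
  assume "(p, []) \<in> \<mu>"
  then show "p \<in> \<omega>"
  proof (cases rule: mem_cases)
    case (2 a)
    then show ?thesis using set_parts(2)[OF 2] by simp
  next
    case (3 q)
    then show ?thesis using set_parts(3)[OF 3] by simp
  next
    case 4
    then show ?thesis using set_parts(4)[OF 4] by simp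
  qed auto
qed (auto simp: atoms_of_def)

lemma mem1:
  assumes "a \<in> {1..n}" "ar ! p > 0"
  shows "(p, replicate (ar ! p) a) \<in> \<mu> \<longleftrightarrow> p \<in> \<tau> a"
proof
  assume "(p, replicate (ar ! p) a) \<in> \<mu>"
  then show "p \<in> \<tau> a"
  proof (cases rule: mem_cases)
    case 1
    then show ?thesis using set_parts(1)[OF 1] assms by simp
  next
    case (2 b)
    then show ?thesis using set_parts(2)[OF 2] assms by auto
  next
    case (3 q)
    then show ?thesis using card_part2[OF 3] assms by simp
  next
    case 4
    then show ?thesis using set_parts(4)[OF 4] assms by simp
  qed
qed (use assms in \<open>auto simp: atoms_of_def\<close>)

lemma mem2:
  assumes "q \<in> prs {1..n}" "set vs = {X, Y}"
  shows "(p, map (vpair (fst q) (snd q)) vs) \<in> \<mu> \<longleftrightarrow> (p, vs) \<in> t q"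
proof
  note ne = prs_ne[OF assms(1)]
  have s: "set (map (vpair (fst q) (snd q)) vs) = {fst q, snd q}" by (rule vpair_image[OF assms(2)])
  assume "(p, map (vpair (fst q) (snd q)) vs) \<in> \<mu>"
  then show "(p, vs) \<in> t q"
  proof (cases rule: mem_cases)
    case 1
    then show ?thesis using set_parts(1)[OF 1] s by simp
  next
    case (2 b)
    have "{fst q, snd q} = {b}" using set_parts(2)[OF 2] unfolding snd_conv s .
    then show ?thesis using ne by auto
  next
    case (3 q')
    have "{fst q, snd q} = {fst q', snd q'}" using set_parts(3)[OF 3] unfolding snd_conv s .
    then have q: "q' = q" using ne prs_ne[OF 3(1)] by (auto simp: doubleton_eq_iff prod_eq_iff)
    obtain vs' where "(p, vs') \<in> t q" "map (vpair (fst q) (snd q)) vs' = map (vpair (fst q) (snd q)) vs"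
      using 3(2) unfolding q by auto
    moreover have "inj (map (vpair (fst q) (snd q)))" using ne by (intro inj_mapI inj_vpair) simp
    ultimately show ?thesis by (auto dest: injD)
  next
    case 4
    have "card {fst q, snd q} \<ge> 3" using set_parts(4)[OF 4] unfolding snd_conv s .
    then show ?thesis using ne by simp
  qed
next
  assume "(p, vs) \<in> t q"
  then have "(p, map (vpair (fst q) (snd q)) vs) \<in> part2 q" by (auto intro: rev_image_eqI)
  then show "(p, map (vpair (fst q) (snd q)) vs) \<in> \<mu>" unfolding atoms_of_def using assms(1) by blast
qed

lemma mem3:
  assumes "card (set (snd ga)) \<ge> 3"
  shows "ga \<in> \<mu> \<longleftrightarrow> ga \<in> F"
proof
  assume "ga \<in> \<mu>"
  then show "ga \<in> F"
  proof (cases rule: mem_cases)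
    case 1
    then show ?thesis using set_parts(1)[OF 1] assms by simp
  next
    case (2 a)
    then show ?thesis using set_parts(2)[OF 2] assms by simp
  next
    case (3 q)
    then show ?thesis using card_part2[OF 3] assms by simp
  qed
qed (auto simp: atoms_of_def)

lemma atoms_of_worlds: "\<mu> \<in> worlds ar n"
proof -
  have "ga \<in> ground_atoms ar n" if "ga \<in> \<mu>" for ga
    using that
  proof (cases rule: mem_cases)
    case 1
    then show ?thesis using om by (auto simp: ground_atoms_def)
  next
    case (2 a)
    then show ?thesis using ty1[OF 2(1)] set_parts(2)[OF 2] by (auto simp: ground_atoms_def preds1_def)
  next
    case (3 q)
    then obtain p vs where pv: "(p, vs) \<in> t q" "ga = (p, map (vpair (fst q) (snd q)) vs)" by auto
    then have "p < length ar" "length vs = ar ! p" using ty2[OF 3(1)] by (auto simp: atoms2_def)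
    moreover have "set (snd ga) \<subseteq> {1..n}" unfolding set_parts(3)[OF 3] using 3(1) by (auto simp: prs_def)
    ultimately show ?thesis using pv by (auto simp: ground_atoms_def)
  next
    case 4
    then show ?thesis using fr by (auto simp: free_atoms_def)
  qed
  then show ?thesis unfolding worlds_def by blast
qed

lemma nullary_atoms_of: "nullary_of ar \<mu> = \<omega>"
  using om by (auto simp: nullary_of_def mem0)

lemma one_type_atoms_of:
  assumes a: "a \<in> {1..n}"
  shows "one_type ar \<mu> a = \<tau> a"
  using ty1[OF a] mem1[OF a] unfolding one_type_def preds1_def by blast

lemma two_type_atoms_of:
  assumes q: "q \<in> prs {1..n}"
  shows "two_type ar \<mu> (fst q) (snd q) = t q"
  using ty2[OF q] mem2[OF q] unfolding two_type_def atoms2_def by auto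

lemma free_atoms_of: "\<mu> \<inter> free_atoms ar n = F"
  using mem3 fr by (auto simp: free_atoms_def)

text \<open>The four parts are disjoint because their atoms have 0, 1, 2 and at least 3 distinct
  arguments; inside the second and third part, the set of arguments identifies the element or
  pair.\<close>

lemma prod_atoms_of:
  fixes u :: "nat \<Rightarrow> int"
  shows "(\<Prod>ga\<in>\<mu>. u (fst ga)) = (\<Prod>p\<in>\<omega>. u p) * (\<Prod>a\<in>{1..n}. \<Prod>p\<in>\<tau> a. u p) *
    (\<Prod>q\<in>prs {1..n}. \<Prod>s\<in>t q. u (fst s)) * (\<Prod>ga\<in>F. u (fst ga))"
proof -
  let ?A = "(\<lambda>p. (p, [] :: nat list)) ` \<omega>" and ?B = "\<Union>a\<in>{1..n}. part1 a" and ?C = "\<Union>q\<in>prs {1..n}. part2 q"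
  have fin: "finite (\<tau> a)" if "a \<in> {1..n}" for a
    using ty1[OF that] by (rule finite_subset) simp
  have fin2: "finite (t q)" if "q \<in> prs {1..n}" for q
    using ty2[OF that] by (rule finite_subset) simp
  have fin3: "finite F" using fr by (rule finite_subset) simp
  have "finite \<omega>" using om by (rule finite_subset) simp
  then have fA: "finite ?A" by simp
  have fB: "finite ?B"
  proof (rule finite_UN_I)
    show "finite (part1 a)" if "a \<in> {1..n}" for a using fin[OF that] by (rule finite_imageI)
  qed simp
  have fC: "finite ?C"
  proof (rule finite_UN_I)
    show "finite (part2 q)" if "q \<in> prs {1..n}" for q using fin2[OF that] by (rule finite_imageI)
  qed simp
  note fin' = fA fB fC
  let ?c = "\<lambda>ga. card (set (snd ga))"
  have card0: "?c ga = 0" if "ga \<in> ?A" for ga unfolding set_parts(1)[OF that] by simp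
  have card1: "?c ga = 1" if "ga \<in> ?B" for ga
    using that by (rule UN_E) (simp only: set_parts(2), simp)
  have card2: "?c ga = 2" if "ga \<in> ?C" for ga
    using that by (rule UN_E) (rule card_part2)
  have d1: "?A \<inter> ?B = {}"
    by (rule disjoint_by_rank[where f = ?c and k = 1]) (simp_all only: card0 card1)
  have d2: "(?A \<union> ?B) \<inter> ?C = {}"
    by (rule disjoint_by_rank[where f = ?c and k = 2], erule UnE, simp_all only: card0 card1 card2)
  have d3: "(?A \<union> ?B \<union> ?C) \<inter> F = {}"
    by (rule disjoint_by_rank[where f = ?c and k = 3], elim UnE, simp_all only: card0 card1 card2 set_parts(4))
  have pA: "(\<Prod>ga\<in>?A. u (fst ga)) = (\<Prod>p\<in>\<omega>. u p)"
    by (subst prod.reindex) (auto simp: inj_on_def)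
  have pB: "(\<Prod>ga\<in>?B. u (fst ga)) = (\<Prod>a\<in>{1..n}. \<Prod>p\<in>\<tau> a. u p)"
  proof -
    have "(\<Prod>ga\<in>?B. u (fst ga)) = (\<Prod>a\<in>{1..n}. \<Prod>ga\<in>part1 a. u (fst ga))"
    proof (rule prod.UNION_disjoint)
      show "\<forall>a\<in>{1..n}. \<forall>b\<in>{1..n}. a \<noteq> b \<longrightarrow> part1 a \<inter> part1 b = {}"
      proof (intro ballI impI)
        fix a b assume ab: "a \<in> {1..n}" "b \<in> {1..n}" "a \<noteq> b"
        show "part1 a \<inter> part1 b = {}"
        proof (rule equals0I)
          fix ga assume ga: "ga \<in> part1 a \<inter> part1 b"
          have "{a} = {b}" using set_parts(2)[OF ab(1) IntD1[OF ga]] set_parts(2)[OF ab(2) IntD2[OF ga]]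
            by (rule trans[OF sym])
          then show False using ab(3) by simp
        qed
      qed
    qed (simp, intro ballI finite_imageI fin)
    also have "\<dots> = (\<Prod>a\<in>{1..n}. \<Prod>p\<in>\<tau> a. u p)"
    proof (rule prod.cong[OF refl])
      show "(\<Prod>ga\<in>part1 a. u (fst ga)) = (\<Prod>p\<in>\<tau> a. u p)" for a
        by (subst prod.reindex) (simp_all add: inj_on_def)
    qed
    finally show ?thesis .
  qed
  have pC: "(\<Prod>ga\<in>?C. u (fst ga)) = (\<Prod>q\<in>prs {1..n}. \<Prod>s\<in>t q. u (fst s))"
  proof -
    have "(\<Prod>ga\<in>?C. u (fst ga)) = (\<Prod>q\<in>prs {1..n}. \<Prod>ga\<in>part2 q. u (fst ga))"
    proof (rule prod.UNION_disjoint)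
      show "\<forall>q\<in>prs {1..n}. \<forall>q'\<in>prs {1..n}. q \<noteq> q' \<longrightarrow> part2 q \<inter> part2 q' = {}"
      proof (intro ballI impI)
        fix q q' assume ab: "q \<in> prs {1..n}" "q' \<in> prs {1..n}" "q \<noteq> q'"
        show "part2 q \<inter> part2 q' = {}"
        proof (rule equals0I)
          fix ga assume ga: "ga \<in> part2 q \<inter> part2 q'"
          have "{fst q, snd q} = {fst q', snd q'}"
            using set_parts(3)[OF ab(1) IntD1[OF ga]] set_parts(3)[OF ab(2) IntD2[OF ga]] by (rule trans[OF sym])
          then show False using ab(3) prs_ne[OF ab(1)] prs_ne[OF ab(2)] by (auto simp: doubleton_eq_iff prod_eq_iff)
        qed
      qed
    qed (simp, intro ballI finite_imageI fin2)
    also have "\<dots> = (\<Prod>q\<in>prs {1..n}. \<Prod>s\<in>t q. u (fst s))"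
    proof (rule prod.cong[OF refl])
      fix q assume q: "q \<in> prs {1..n}"
      have "inj (map (vpair (fst q) (snd q)))" using prs_ne[OF q] by (intro inj_mapI inj_vpair) simp
      then have "inj_on (map_prod (\<lambda>p. p) (map (vpair (fst q) (snd q)))) (t q)"
        by (intro inj_on_subset[OF map_prod_inj_on[where A = UNIV and B = UNIV]]) (auto simp: inj_on_def)
      then have "inj_on (\<lambda>(p, vs). (p, map (vpair (fst q) (snd q)) vs)) (t q)"
        by (simp only: map_prod_def)
      then show "(\<Prod>ga\<in>part2 q. u (fst ga)) = (\<Prod>s\<in>t q. u (fst s))"
        by (subst prod.reindex) (auto simp: split_def)
    qed
    finally show ?thesis .
  qed
  have "(\<Prod>ga\<in>\<mu>. u (fst ga)) = (\<Prod>ga\<in>?A \<union> ?B \<union> ?C \<union> F. u (fst ga))" by (simp only: atoms_of_def)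
  also have "\<dots> = (\<Prod>ga\<in>?A. u (fst ga)) * (\<Prod>ga\<in>?B. u (fst ga)) * (\<Prod>ga\<in>?C. u (fst ga)) * (\<Prod>ga\<in>F. u (fst ga))"
    by (simp only: prod.union_disjoint[OF finite_UnI[OF finite_UnI[OF fA fB] fC] fin3 d3]
        prod.union_disjoint[OF finite_UnI[OF fA fB] fC d2] prod.union_disjoint[OF fA fB d1])
  finally show ?thesis unfolding pA pB pC .
qed

end

lemma types_of_world:
  assumes "\<mu> \<in> worlds ar n"
  shows "types ar n (nullary_of ar \<mu>) (one_type ar \<mu>) (\<lambda>q. two_type ar \<mu> (fst q) (snd q)) (\<mu> \<inter> free_atoms ar n)"
  by unfold_locales (auto simp: nullary_of_def one_type_def two_type_def preds1_def atoms2_def)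

lemma atoms_of_cong:
  assumes "\<And>a. a \<in> {1..n} \<Longrightarrow> \<tau> a = \<tau>' a" "\<And>q. q \<in> prs {1..n} \<Longrightarrow> t q = t' q"
  shows "atoms_of ar n \<omega> \<tau> t F = atoms_of ar n \<omega> \<tau>' t' F"
  using assms unfolding atoms_of_def by auto

lemma atoms_of_types:
  assumes "\<mu> \<in> worlds ar n"
  shows "atoms_of ar n (nullary_of ar \<mu>) (one_type ar \<mu>) (\<lambda>q. two_type ar \<mu> (fst q) (snd q)) (\<mu> \<inter> free_atoms ar n) = \<mu>"
    (is "?\<nu> = \<mu>")
proof -
  interpret types ar n "nullary_of ar \<mu>" "one_type ar \<mu>" "\<lambda>q. two_type ar \<mu> (fst q) (snd q)" "\<mu> \<inter> free_atoms ar n"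
    by (rule types_of_world[OF assms])
  have "(p, as) \<in> ?\<nu> \<longleftrightarrow> (p, as) \<in> \<mu>" if g: "(p, as) \<in> ground_atoms ar n" for p as
  proof -
    have p: "p < length ar" "length as = ar ! p" "set as \<subseteq> {1..n}" using g by (auto simp: ground_atoms_def)
    consider "card (set as) = 0" | "card (set as) = 1" | "card (set as) = 2" | "card (set as) \<ge> 3" by linarith
    then show ?thesis
    proof cases
      case 1
      then have as: "as = []" by simp
      have "p \<in> nullary_of ar \<mu> \<longleftrightarrow> (p, []) \<in> \<mu>" using p as by (auto simp: nullary_of_def)
      then show ?thesis using mem0[of p] as by simp
    next
      case 2
      then obtain a where a: "set as = {a}" by (auto simp: card_Suc_eq)
      then have as: "as = replicate (ar ! p) a" using p(2) map_const_on[of as "\<lambda>v. v" a] by auto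
      have pos: "ar ! p > 0" using a p(2) by (cases as) auto
      have "p \<in> one_type ar \<mu> a \<longleftrightarrow> (p, replicate (ar ! p) a) \<in> \<mu>" using p pos by (auto simp: one_type_def)
      moreover have "a \<in> {1..n}" using a p by auto
      ultimately show ?thesis using mem1[of a p] pos as by (simp only:)
    next
      case 3
      then obtain a b where ab': "set as = {a, b}" "a \<noteq> b" by (auto simp: card_2_iff)
      \<comment> \<open>The two arguments are ordered to obtain the pair under which their two-type
        is stored.\<close>
      define c where "c = min a b"
      define d where "d = max a b"
      have ab: "set as = {c, d}" "c < d" using ab' by (auto simp: c_def d_def min_def max_def)
      define vs where "vs = map (\<lambda>x. if x = c then X else Y) as"
      have vs: "map (vpair c d) vs = as" unfolding vs_def map_map by (rule map_idI) (use ab in auto)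
      have XY: "set vs = {X, Y}" using ab by (auto simp: vs_def)
      moreover have "(c, d) \<in> prs {1..n}" using ab p(3) by (auto simp: prs_def)
      moreover have "length vs = ar ! p" using p by (simp add: vs_def)
      ultimately have "(p, vs) \<in> two_type ar \<mu> c d \<longleftrightarrow> (p, as) \<in> \<mu>" "(c, d) \<in> prs {1..n}"
        using p vs by (auto simp: two_type_def)
      then show ?thesis using mem2[of "(c, d)" vs p] XY vs by simp
    next
      case 4
      then show ?thesis using mem3[of "(p, as)"] g by (auto simp: free_atoms_def)
    qed
  qed
  note iff = this
  have sub: "?\<nu> \<subseteq> ground_atoms ar n" "\<mu> \<subseteq> ground_atoms ar n"
    using atoms_of_worlds assms unfolding worlds_def by (simp_all only: Pow_iff)
  show ?thesis
  proof (rule set_eqI)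
    fix ga show "ga \<in> ?\<nu> \<longleftrightarrow> ga \<in> \<mu>"
    proof (cases "ga \<in> ground_atoms ar n")
      case True
      then show ?thesis using iff[of "fst ga" "snd ga"] by (simp only: prod.collapse)
    next
      case False
      then show ?thesis using subsetD[OF sub(1)] subsetD[OF sub(2)] by blast
    qed
  qed
qed

section \<open>The bipartite axiom on types\<close>

text \<open>Two-types with \<open>R\<close> in exactly one direction belong neither here nor to
  \<open>types_edge\<close>; leaving them out imposes symmetry.\<close>

definition types_no_edge :: "vocab \<Rightarrow> nat \<Rightarrow> two_type set" where
  "types_no_edge ar R = {s\<in>Pow (atoms2 ar). (R, [X, Y]) \<notin> s \<and> (R, [Y, X]) \<notin> s}"

definition types_edge :: "vocab \<Rightarrow> nat \<Rightarrow> two_type set" where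
  "types_edge ar R = {s\<in>Pow (atoms2 ar). (R, [X, Y]) \<in> s \<and> (R, [Y, X]) \<in> s}"

lemma types_edge_disjoint: "types_no_edge ar R \<inter> types_edge ar R = {}"
  by (auto simp: types_no_edge_def types_edge_def)

lemma finite_types_edge [simp]: "finite (types_no_edge ar R)" "finite (types_edge ar R)"
  by (auto simp: types_no_edge_def types_edge_def)

text \<open>Irreflexivity constrains one-types and symmetry constrains two-types, so both are local.
  Only two-colourability remains as a global condition.\<close>

lemma bipartite_types:
  assumes R: "R < length ar" "ar ! R = 2" and \<mu>: "\<mu> \<in> worlds ar n"
  shows "bipartite {1..n} (graph_of \<mu> R) \<longleftrightarrow> (\<forall>a\<in>{1..n}. R \<notin> one_type ar \<mu> a) \<and>
    (\<forall>q\<in>prs {1..n}. two_type ar \<mu> (fst q) (snd q) \<in> types_no_edge ar R \<union> types_edge ar R) \<and>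
    two_colourable {1..n} {q\<in>prs {1..n}. two_type ar \<mu> (fst q) (snd q) \<in> types_edge ar R}"
    (is "?L \<longleftrightarrow> ?A \<and> ?B \<and> ?C")
proof -
  let ?G = "graph_of \<mu> R"
  have G: "(a, b) \<in> ?G \<Longrightarrow> a \<in> {1..n} \<and> b \<in> {1..n}" for a b
    using \<mu> by (auto simp: graph_of_def worlds_def ground_atoms_def)
  have 1: "R \<in> one_type ar \<mu> a \<longleftrightarrow> (a, a) \<in> ?G" for a
    using R by (auto simp: one_type_def graph_of_def numeral_2_eq_2)
  have e2: "(R, [X, Y]) \<in> two_type ar \<mu> a b \<longleftrightarrow> (a, b) \<in> ?G" "(R, [Y, X]) \<in> two_type ar \<mu> a b \<longleftrightarrow> (b, a) \<in> ?G" for a b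
    using R by (auto simp: two_type_def graph_of_def)
  have sub: "two_type ar \<mu> a b \<subseteq> atoms2 ar" for a b by (auto simp: two_type_def atoms2_def)
  have A: "?A \<longleftrightarrow> irrefl ?G" unfolding irrefl_def 1 using G by blast
  have B: "?B \<longleftrightarrow> sym ?G"
  proof
    assume B: ?B
    show "sym ?G"
    proof (rule symI)
      fix a b assume ab: "(a, b) \<in> ?G"
      consider "a = b" | "a < b" | "b < a" by linarith
      then show "(b, a) \<in> ?G"
      proof cases
        case 2
        then have "(a, b) \<in> prs {1..n}" using G[OF ab] by (auto simp: prs_def)
        then have "two_type ar \<mu> a b \<in> types_no_edge ar R \<union> types_edge ar R" using B by force
        then show ?thesis using ab by (auto simp: types_no_edge_def types_edge_def e2)
      next
        case 3
        then have "(b, a) \<in> prs {1..n}" using G[OF ab] by (auto simp: prs_def)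
        then have "two_type ar \<mu> b a \<in> types_no_edge ar R \<union> types_edge ar R" using B by force
        then show ?thesis using ab by (auto simp: types_no_edge_def types_edge_def e2)
      qed (use ab in simp)
    qed
  next
    assume s: "sym ?G"
    have "(a, b) \<in> ?G \<longleftrightarrow> (b, a) \<in> ?G" for a b using s by (auto dest: symD)
    then show ?B using sub by (auto simp: types_no_edge_def types_edge_def e2)
  qed
  have C: "?C \<longleftrightarrow> bipartite_graph {1..n} ?G" if s: "sym ?G" and i: "irrefl ?G"
  proof -
    have E: "two_type ar \<mu> (fst q) (snd q) \<in> types_edge ar R \<longleftrightarrow> q \<in> ?G" for q
      using s sub[of "fst q" "snd q"] by (cases q) (auto simp: types_edge_def e2 dest: symD)
    show ?thesis unfolding E
    proof
      assume "two_colourable {1..n} {q\<in>prs {1..n}. q \<in> ?G}"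
      then obtain C where C: "C \<subseteq> {1..n}" "\<forall>q\<in>{q\<in>prs {1..n}. q \<in> ?G}. crosses C q"
        unfolding two_colourable_def by blast
      have "(a, b) \<in> C \<times> ({1..n} - C) \<union> ({1..n} - C) \<times> C" if ab: "(a, b) \<in> ?G" for a b
      proof -
        consider "a = b" | "a < b" | "b < a" by linarith
        then have "crosses C (a, b)"
        proof cases
          case 1
          then show ?thesis using ab i by (auto simp: irrefl_def)
        next
          case 2
          then show ?thesis using ab C G[OF ab] by (auto simp: prs_def)
        next
          case 3
          then have "crosses C (b, a)" using symD[OF s ab] C G[OF ab] by (auto simp: prs_def)
          then show ?thesis by (auto simp: crosses_def)
        qed
        then show ?thesis using G[OF ab] by (auto simp: crosses_def)
      qed
      then have "?G \<subseteq> C \<times> ({1..n} - C) \<union> ({1..n} - C) \<times> C" by (intro subrelI)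
      then show "bipartite_graph {1..n} ?G" unfolding bipartite_graph_def using C(1)
        by (intro exI[of _ C] exI[of _ "{1..n} - C"]) auto
    next
      assume "bipartite_graph {1..n} ?G"
      then obtain A B where "A \<union> B = {1..n}" "A \<inter> B = {}" "?G \<subseteq> A \<times> B \<union> B \<times> A"
        unfolding bipartite_graph_def by blast
      then show "two_colourable {1..n} {q\<in>prs {1..n}. q \<in> ?G}"
        unfolding two_colourable_def by (intro exI[of _ A]) (auto simp: crosses_def)
    qed
  qed
  show ?thesis unfolding bipartite_def using A B C by blast
qed

section \<open>From worlds to labellings\<close>

text \<open>A one-type together with a guess. The condition
  \<open>loop \<omega> \<tau> g \<Phi>\<close> imposes the sentence at each element separately, and
  \<open>R \<notin> \<tau>\<close> is irreflexivity.\<close>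

definition vlabs :: "vocab \<Rightarrow> fm \<Rightarrow> nat \<Rightarrow> nat set \<Rightarrow> (nat set \<times> fm set) set" where
  "vlabs ar \<Phi> R \<omega> = {(\<tau>, g). \<tau> \<subseteq> preds1 ar \<and> R \<notin> \<tau> \<and> g \<subseteq> qsubs \<Phi> \<and> loop \<omega> \<tau> g \<Phi>}"

text \<open>The parameter \<open>al\<close> stands for the ground unary literals, as a restriction
  of the one-type of each element. Cardinality constraints are left out here; they are tested on
  count vectors at the very end.\<close>

definition good :: "vocab \<Rightarrow> fm \<Rightarrow> nat \<Rightarrow> (nat \<Rightarrow> nat set \<Rightarrow> bool) \<Rightarrow> nat \<Rightarrow> world \<Rightarrow> bool" where
  "good ar \<Phi> R al n \<mu> \<longleftrightarrow> is_model n \<mu> \<Phi> \<and> (\<forall>a\<in>{1..n}. al a (one_type ar \<mu> a)) \<and>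
     bipartite {1..n} (graph_of \<mu> R)"

definition configs :: "vocab \<Rightarrow> fm \<Rightarrow> nat \<Rightarrow> (nat \<Rightarrow> nat set \<Rightarrow> bool) \<Rightarrow> nat \<Rightarrow> nat set \<Rightarrow>
    ((nat \<Rightarrow> nat set \<times> fm set) \<times> (nat \<times> nat \<Rightarrow> two_type)) set" where
  "configs ar \<Phi> R al n \<omega> = {(\<sigma>, t).
     \<sigma> \<in> PiE {1..n} (\<lambda>v. {l\<in>vlabs ar \<Phi> R \<omega>. al v (fst l)}) \<and>
     t \<in> PiE (prs {1..n}) (\<lambda>_. types_no_edge ar R \<union> types_edge ar R) \<and>
     two_colourable {1..n} {q\<in>prs {1..n}. t q \<in> types_edge ar R} \<and>
     (\<forall>v\<in>{1..n}. \<forall>Q\<in>qsubs \<Phi>. deg_ok \<omega> (fst (\<sigma> v)) (snd (\<sigma> v)) Q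
        (deg {1..n} \<omega> (\<lambda>v. fst (\<sigma> v)) (\<lambda>v. snd (\<sigma> v)) t Q v))}"

definition world_of_config :: "vocab \<Rightarrow> nat \<Rightarrow> nat set \<Rightarrow>
    ((nat \<Rightarrow> nat set \<times> fm set) \<times> (nat \<times> nat \<Rightarrow> two_type)) \<times> gatom set \<Rightarrow> world" where
  "world_of_config ar n \<omega> c = atoms_of ar n \<omega> (\<lambda>v. fst (fst (fst c) v)) (snd (fst c)) (snd c)"

definition config_of_world :: "vocab \<Rightarrow> fm \<Rightarrow> nat \<Rightarrow> world \<Rightarrow>
    ((nat \<Rightarrow> nat set \<times> fm set) \<times> (nat \<times> nat \<Rightarrow> two_type)) \<times> gatom set" where
  "config_of_world ar \<Phi> n \<mu> = ((\<lambda>v\<in>{1..n}. (one_type ar \<mu> v, {Q\<in>qsubs \<Phi>. sat n \<mu> (\<lambda>_. v) Q}),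
     \<lambda>q\<in>prs {1..n}. two_type ar \<mu> (fst q) (snd q)), \<mu> \<inter> free_atoms ar n)"

lemma finite_vlabs [simp]: "finite (vlabs ar \<Phi> R \<omega>)"
  by (rule finite_subset[of _ "Pow (preds1 ar) \<times> Pow (qsubs \<Phi>)"]) (auto simp: vlabs_def)

lemma finite_configs [simp]: "finite (configs ar \<Phi> R al n \<omega>)"
proof (rule finite_subset)
  show "configs ar \<Phi> R al n \<omega> \<subseteq> PiE {1..n} (\<lambda>v. {l\<in>vlabs ar \<Phi> R \<omega>. al v (fst l)}) \<times>
     PiE (prs {1..n}) (\<lambda>_. types_no_edge ar R \<union> types_edge ar R)" unfolding configs_def by blast
qed (auto intro!: finite_cartesian_product finite_PiE)

text \<open>The set of true 0-ary atoms is fixed, as it enters all local evaluations. A nonempty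
  domain is required so that some label imposes the sentence.\<close>

locale setting =
  fixes ar :: vocab and \<Phi> :: fm and R :: nat and al :: "nat \<Rightarrow> nat set \<Rightarrow> bool" and n :: nat and \<omega> :: "nat set"
  assumes wf: "well_formed ar \<Phi>" and closed: "free_vars \<Phi> = {}" and R: "R < length ar" "ar ! R = 2"
    and n: "n \<ge> 1" and om: "\<omega> \<subseteq> {p. p < length ar \<and> ar ! p = 0}"
begin

abbreviation "V \<equiv> {1..n}"
abbreviation "CF \<equiv> configs ar \<Phi> R al n \<omega>"
abbreviation "WS \<equiv> {\<mu>\<in>worlds ar n. good ar \<Phi> R al n \<mu> \<and> nullary_of ar \<mu> = \<omega>}"

text \<open>A sentence does not depend on the environment, so it may be evaluated with both
  variables at \<open>a\<close>.\<close>

lemma model_local: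
  assumes "\<omega> = nullary_of ar \<mu>"
    "\<And>a. a \<in> V \<Longrightarrow> \<tau> a = one_type ar \<mu> a"
    "\<And>a Q. a \<in> V \<Longrightarrow> Q \<in> qsubs \<Phi> \<Longrightarrow> Q \<in> g a \<longleftrightarrow> sat n \<mu> (\<lambda>_. a) Q"
    and a: "a \<in> V"
  shows "is_model n \<mu> \<Phi> \<longleftrightarrow> loop \<omega> (\<tau> a) (g a) \<Phi>"
proof -
  have "is_model n \<mu> \<Phi> \<longleftrightarrow> sat n \<mu> (\<lambda>_. a) \<Phi>" unfolding is_model_def by (rule sat_cong) (simp add: closed)
  also have "\<dots> \<longleftrightarrow> loop \<omega> (\<tau> a) (g a) \<Phi>"
    using loop_correct[OF wf assms(1), of n \<tau> "\<lambda>q. two_type ar \<mu> (fst q) (snd q)" \<Phi> a g] wf assms by simp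
  finally show ?thesis .
qed

lemma config_types:
  assumes "(\<sigma>, t) \<in> CF" "F \<subseteq> free_atoms ar n"
  shows "types ar n \<omega> (\<lambda>v. fst (\<sigma> v)) t F"
proof
  have s: "\<sigma> \<in> PiE V (\<lambda>v. {l\<in>vlabs ar \<Phi> R \<omega>. al v (fst l)})" "t \<in> PiE (prs V) (\<lambda>_. types_no_edge ar R \<union> types_edge ar R)"
    using assms(1) unfolding configs_def by blast+
  show "fst (\<sigma> a) \<subseteq> preds1 ar" if "a \<in> V" for a
    using PiE_mem[OF s(1) that] by (auto simp: vlabs_def)
  show "t q \<subseteq> atoms2 ar" if "q \<in> prs V" for q
    using PiE_mem[OF s(2) that] by (auto simp: types_no_edge_def types_edge_def)
qed (use om assms in auto)

text \<open>The guess in a configuration is forced by the world it describes. Hence distinct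
  configurations give distinct worlds and nothing is counted twice.\<close>

lemma config_guess:
  assumes c: "(\<sigma>, t) \<in> CF" "F \<subseteq> free_atoms ar n" and a: "a \<in> V"
  shows "snd (\<sigma> a) = {Q\<in>qsubs \<Phi>. sat n (atoms_of ar n \<omega> (\<lambda>v. fst (\<sigma> v)) t F) (\<lambda>_. a) Q}"
proof -
  interpret types ar n \<omega> "\<lambda>v. fst (\<sigma> v)" t F by (rule config_types[OF c])
  have "\<forall>a\<in>V. \<forall>Q\<in>qsubs \<Phi>. deg_ok \<omega> (fst (\<sigma> a)) (snd (\<sigma> a)) Q (deg V \<omega> (\<lambda>v. fst (\<sigma> v)) (\<lambda>v. snd (\<sigma> v)) t Q a)"
    using c(1) unfolding configs_def by blast
  then have "\<forall>a\<in>V. \<forall>Q\<in>qsubs \<Phi>. Q \<in> snd (\<sigma> a) \<longleftrightarrow> sat n \<mu> (\<lambda>_. a) Q"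
    using guess_correct[OF wf, of \<omega> \<mu> n "\<lambda>v. fst (\<sigma> v)" t "\<lambda>v. snd (\<sigma> v)"]
    by (simp add: nullary_atoms_of one_type_atoms_of two_type_atoms_of)
  moreover have "snd (\<sigma> a) \<subseteq> qsubs \<Phi>"
  proof -
    have "\<sigma> a \<in> {l\<in>vlabs ar \<Phi> R \<omega>. al a (fst l)}"
      using c(1) a unfolding configs_def by (blast dest: PiE_mem)
    then show ?thesis by (auto simp: vlabs_def)
  qed
  ultimately show ?thesis using a by auto
qed

lemma config_of_world_of_config:
  assumes c: "(\<sigma>, t) \<in> CF" "F \<subseteq> free_atoms ar n"
  shows "config_of_world ar \<Phi> n (world_of_config ar n \<omega> ((\<sigma>, t), F)) = ((\<sigma>, t), F)"
proof -
  interpret types ar n \<omega> "\<lambda>v. fst (\<sigma> v)" t F by (rule config_types[OF c])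
  have s: "\<sigma> \<in> extensional V" "t \<in> extensional (prs V)"
    using c(1) unfolding configs_def by (auto simp: PiE_def)
  have "(\<lambda>v\<in>V. (one_type ar \<mu> v, {Q\<in>qsubs \<Phi>. sat n \<mu> (\<lambda>_. v) Q})) = \<sigma>"
    by (rule extensionalityI[of _ V]) (use s config_guess[OF c] one_type_atoms_of in \<open>auto simp: prod_eq_iff\<close>)
  moreover have "(\<lambda>q\<in>prs V. two_type ar \<mu> (fst q) (snd q)) = t"
    by (rule extensionalityI[of _ "prs V"]) (use s two_type_atoms_of in auto)
  ultimately show ?thesis by (simp add: config_of_world_def world_of_config_def free_atoms_of)
qed

lemma world_of_config_in:
  assumes c: "(\<sigma>, t) \<in> CF" "F \<subseteq> free_atoms ar n"
  shows "world_of_config ar n \<omega> ((\<sigma>, t), F) \<in> WS"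
proof -
  interpret types ar n \<omega> "\<lambda>v. fst (\<sigma> v)" t F by (rule config_types[OF c])
  have s: "\<sigma> \<in> PiE V (\<lambda>v. {l\<in>vlabs ar \<Phi> R \<omega>. al v (fst l)})"
    "t \<in> PiE (prs V) (\<lambda>_. types_no_edge ar R \<union> types_edge ar R)"
    "two_colourable V {q\<in>prs V. t q \<in> types_edge ar R}"
    using c(1) unfolding configs_def by blast+
  have sv: "loop \<omega> (fst (\<sigma> v)) (snd (\<sigma> v)) \<Phi>" "R \<notin> fst (\<sigma> v)" "al v (fst (\<sigma> v))" if "v \<in> V" for v
    using PiE_mem[OF s(1) that] by (auto simp: vlabs_def)
  have n1: "1 \<in> V" using n by simp
  have "is_model n \<mu> \<Phi>"
    using model_local[of \<mu> "\<lambda>v. fst (\<sigma> v)" "\<lambda>v. snd (\<sigma> v)", OF _ _ _ n1] sv(1)[OF n1] config_guess[OF c]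
    by (simp add: nullary_atoms_of one_type_atoms_of)
  moreover have "{q\<in>prs V. two_type ar \<mu> (fst q) (snd q) \<in> types_edge ar R} = {q\<in>prs V. t q \<in> types_edge ar R}"
    using two_type_atoms_of by auto
  then have "bipartite V (graph_of \<mu> R)"
    unfolding bipartite_types[OF R atoms_of_worlds]
  proof (intro conjI ballI)
    show "R \<notin> one_type ar \<mu> a" if "a \<in> V" for a using one_type_atoms_of[OF that] sv(2)[OF that] by simp
    show "two_type ar \<mu> (fst q) (snd q) \<in> types_no_edge ar R \<union> types_edge ar R" if "q \<in> prs V" for q
      using PiE_mem[OF s(2) that] unfolding two_type_atoms_of[OF that] .
  qed (use s(3) in simp)
  moreover have "\<forall>a\<in>V. al a (one_type ar \<mu> a)"
  proof
    show "al a (one_type ar \<mu> a)" if "a \<in> V" for a using one_type_atoms_of[OF that] sv(3)[OF that] by simp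
  qed
  ultimately show ?thesis
    using atoms_of_worlds nullary_atoms_of by (simp add: world_of_config_def good_def)
qed

lemma world_of_config_of_world:
  assumes "\<mu> \<in> WS"
  shows "world_of_config ar n \<omega> (config_of_world ar \<Phi> n \<mu>) = \<mu>"
proof -
  have "world_of_config ar n \<omega> (config_of_world ar \<Phi> n \<mu>) =
    atoms_of ar n (nullary_of ar \<mu>) (one_type ar \<mu>) (\<lambda>q. two_type ar \<mu> (fst q) (snd q)) (\<mu> \<inter> free_atoms ar n)"
    using assms unfolding world_of_config_def config_of_world_def fst_conv snd_conv
    by (auto intro!: atoms_of_cong)
  then show ?thesis using assms atoms_of_types[of \<mu> ar n] by simp
qed

lemma config_of_world_in:
  assumes m: "\<mu> \<in> WS"
  shows "fst (config_of_world ar \<Phi> n \<mu>) \<in> CF" "snd (config_of_world ar \<Phi> n \<mu>) \<subseteq> free_atoms ar n"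
proof -
  have mw: "\<mu> \<in> worlds ar n" "nullary_of ar \<mu> = \<omega>" "is_model n \<mu> \<Phi>" "\<And>a. a \<in> V \<Longrightarrow> al a (one_type ar \<mu> a)"
    "bipartite V (graph_of \<mu> R)" using m unfolding good_def by auto
  note bip = mw(5)[unfolded bipartite_types[OF R mw(1)]]
  define \<sigma> where "\<sigma> = (\<lambda>v\<in>V. (one_type ar \<mu> v, {Q\<in>qsubs \<Phi>. sat n \<mu> (\<lambda>_. v) Q}))"
  define t where "t = (\<lambda>q\<in>prs V. two_type ar \<mu> (fst q) (snd q))"
  have s: "fst (\<sigma> v) = one_type ar \<mu> v" "snd (\<sigma> v) = {Q\<in>qsubs \<Phi>. sat n \<mu> (\<lambda>_. v) Q}" if "v \<in> V" for v
    using that by (auto simp: \<sigma>_def)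
  have "\<sigma> \<in> PiE V (\<lambda>v. {l\<in>vlabs ar \<Phi> R \<omega>. al v (fst l)})"
  proof (rule PiE_I)
    fix v assume v: "v \<in> V"
    have "loop \<omega> (fst (\<sigma> v)) (snd (\<sigma> v)) \<Phi>"
      using model_local[of \<mu> "\<lambda>v. fst (\<sigma> v)" "\<lambda>v. snd (\<sigma> v)", OF _ _ _ v] mw s by simp
    moreover have "R \<notin> fst (\<sigma> v)" using bip v s by simp
    ultimately show "\<sigma> v \<in> {l\<in>vlabs ar \<Phi> R \<omega>. al v (fst l)}"
      using s[OF v] mw(4)[OF v] by (cases "\<sigma> v") (auto simp: vlabs_def one_type_def preds1_def)
  qed (simp add: \<sigma>_def del: atLeastAtMost_iff)
  moreover have "t \<in> PiE (prs V) (\<lambda>_. types_no_edge ar R \<union> types_edge ar R)"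
    by (rule PiE_I) (use bip in \<open>auto simp: t_def\<close>)
  moreover have "{q\<in>prs V. t q \<in> types_edge ar R} = {q\<in>prs V. two_type ar \<mu> (fst q) (snd q) \<in> types_edge ar R}"
    by (auto simp: t_def)
  then have "two_colourable V {q\<in>prs V. t q \<in> types_edge ar R}" using bip by (simp only:)
  moreover have "\<forall>v\<in>V. \<forall>Q\<in>qsubs \<Phi>. deg_ok \<omega> (fst (\<sigma> v)) (snd (\<sigma> v)) Q (deg V \<omega> (\<lambda>v. fst (\<sigma> v)) (\<lambda>v. snd (\<sigma> v)) t Q v)"
    using guess_correct[OF wf, of \<omega> \<mu> n "\<lambda>v. fst (\<sigma> v)" t "\<lambda>v. snd (\<sigma> v)"] mw(2) s by (simp add: t_def)
  ultimately have "(\<sigma>, t) \<in> CF" unfolding configs_def by blast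
  then show "fst (config_of_world ar \<Phi> n \<mu>) \<in> CF" by (simp add: config_of_world_def \<sigma>_def t_def)
  show "snd (config_of_world ar \<Phi> n \<mu>) \<subseteq> free_atoms ar n" by (simp add: config_of_world_def)
qed

text \<open>Atoms with three or more distinct arguments are chosen freely, each giving
  \<open>u + 1\<close> for being true or false. All others are encoded in the configuration.\<close>

lemma sum_worlds:
  fixes u :: "nat \<Rightarrow> int"
  shows "(\<Sum>\<mu>\<in>WS. \<Prod>ga\<in>\<mu>. u (fst ga)) = (\<Prod>p\<in>\<omega>. u p) * (\<Prod>ga\<in>free_atoms ar n. u (fst ga) + 1) *
    (\<Sum>(\<sigma>, t)\<in>CF. (\<Prod>v\<in>V. \<Prod>p\<in>fst (\<sigma> v). u p) * (\<Prod>q\<in>prs V. \<Prod>s\<in>t q. u (fst s)))"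
proof -
  have "(\<Sum>\<mu>\<in>WS. \<Prod>ga\<in>\<mu>. u (fst ga)) = (\<Sum>c\<in>CF \<times> Pow (free_atoms ar n). \<Prod>ga\<in>world_of_config ar n \<omega> c. u (fst ga))"
  proof (rule sum.reindex_bij_witness[where i = "world_of_config ar n \<omega>" and j = "config_of_world ar \<Phi> n"], goal_cases)
    case (1 \<mu>)
    then show ?case by (rule world_of_config_of_world)
  next
    case (2 \<mu>)
    then show ?case using config_of_world_in[OF 2] by (simp add: mem_Times_iff)
  next
    case (3 c)
    then show ?case by (cases c) (auto intro: config_of_world_of_config)
  next
    case (4 c)
    then obtain \<sigma> t F where c: "c = ((\<sigma>, t), F)" "(\<sigma>, t) \<in> CF" "F \<subseteq> free_atoms ar n"
      by (metis PowD SigmaE surj_pair)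
    show ?case unfolding c(1) by (rule world_of_config_in[OF c(2,3)])
  next
    case (5 \<mu>)
    then show ?case by (simp only: world_of_config_of_world)
  qed
  also have "\<dots> = (\<Sum>c\<in>CF. \<Sum>F\<in>Pow (free_atoms ar n). \<Prod>ga\<in>world_of_config ar n \<omega> (c, F). u (fst ga))"
    by (simp only: sum.cartesian_product split_def prod.collapse)
  also have "\<dots> = (\<Sum>c\<in>CF. \<Sum>F\<in>Pow (free_atoms ar n). (\<Prod>p\<in>\<omega>. u p) * (\<Prod>v\<in>V. \<Prod>p\<in>fst (fst c v). u p) *
    (\<Prod>q\<in>prs V. \<Prod>s\<in>snd c q. u (fst s)) * (\<Prod>ga\<in>F. u (fst ga)))"
  proof (intro sum.cong refl)
    fix c F assume c: "c \<in> CF" "F \<in> Pow (free_atoms ar n)"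
    interpret types ar n \<omega> "\<lambda>v. fst (fst c v)" "snd c" F
      by (rule config_types) (use c in auto)
    show "(\<Prod>ga\<in>world_of_config ar n \<omega> (c, F). u (fst ga)) = (\<Prod>p\<in>\<omega>. u p) * (\<Prod>v\<in>V. \<Prod>p\<in>fst (fst c v). u p) *
      (\<Prod>q\<in>prs V. \<Prod>s\<in>snd c q. u (fst s)) * (\<Prod>ga\<in>F. u (fst ga))"
      unfolding world_of_config_def fst_conv snd_conv by (rule prod_atoms_of)
  qed
  also have "\<dots> = (\<Sum>c\<in>CF. (\<Prod>p\<in>\<omega>. u p) * (\<Prod>v\<in>V. \<Prod>p\<in>fst (fst c v). u p) *
    (\<Prod>q\<in>prs V. \<Prod>s\<in>snd c q. u (fst s)) * (\<Prod>ga\<in>free_atoms ar n. u (fst ga) + 1))"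
    by (simp only: sum_distrib_left[symmetric] prod_add[OF finite_free_atoms] prod.neutral_const mult_1_right)
  finally show ?thesis by (simp add: sum_distrib_left split_def mult_ac)
qed

end

text \<open>The last component selects, for each quantified subformula, one summand in the expansion
  of its degree condition.\<close>

type_synonym lab = "(nat set \<times> fm set) \<times> (fm \<Rightarrow> nat)"

definition labs :: "vocab \<Rightarrow> fm \<Rightarrow> nat \<Rightarrow> nat \<Rightarrow> nat set \<Rightarrow> lab set" where
  "labs ar \<Phi> R K \<omega> = vlabs ar \<Phi> R \<omega> \<times> PiE (qsubs \<Phi>) (\<lambda>_. {..Suc K})"

definition lab_weight :: "nat \<Rightarrow> int \<Rightarrow> (nat \<Rightarrow> int) \<Rightarrow> fm \<Rightarrow> nat set \<Rightarrow> lab \<Rightarrow> int" where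
  "lab_weight K x u \<Phi> \<omega> l = (\<Prod>p\<in>fst (fst l). u p) *
     (\<Prod>Q\<in>qsubs \<Phi>. coeff_wt K x (deg_ok \<omega> (fst (fst l)) (snd (fst l)) Q) (snd l Q))"

text \<open>Here \<open>l\<close> is the label of the element named \<open>X\<close> and
  \<open>l'\<close> that of \<open>Y\<close>. Each end multiplies by its base once for every
  quantifier for which the other end is a witness; over all pairs these factors build the powers in
  \<open>lead_degree\<close>.\<close>

definition pair_weight :: "nat \<Rightarrow> int \<Rightarrow> (nat \<Rightarrow> int) \<Rightarrow> fm \<Rightarrow> nat set \<Rightarrow> lab \<Rightarrow> lab \<Rightarrow> two_type \<Rightarrow> int" where
  "pair_weight K x u \<Phi> \<omega> l l' s = (\<Prod>a\<in>s. u (fst a)) * (\<Prod>Q\<in>qsubs \<Phi>.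
     (if edge \<omega> (vpair (fst (fst l)) (fst (fst l'))) (vpair (snd (fst l)) (snd (fst l'))) s Q X
      then base_wt K x (snd l Q) else 1) *
     (if edge \<omega> (vpair (fst (fst l)) (fst (fst l'))) (vpair (snd (fst l)) (snd (fst l'))) s Q Y
      then base_wt K x (snd l' Q) else 1))"

definition types_weight :: "two_type set \<Rightarrow> nat \<Rightarrow> int \<Rightarrow> (nat \<Rightarrow> int) \<Rightarrow> fm \<Rightarrow> nat set \<Rightarrow> lab \<Rightarrow> lab \<Rightarrow> int" where
  "types_weight T K x u \<Phi> \<omega> l l' = (\<Sum>s\<in>T. pair_weight K x u \<Phi> \<omega> l l' s)"

lemma finite_labs [simp]: "finite (labs ar \<Phi> R K \<omega>)"
  by (auto simp: labs_def intro!: finite_cartesian_product finite_PiE)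

text \<open>Exchanging the names of the two elements. The lifted recursion needs weights symmetric
  in the labels, whereas a two-type refers to an ordered pair.\<close>

definition swap_type :: "two_type \<Rightarrow> two_type" where
  "swap_type s = (\<lambda>(p, vs). (p, map other vs)) ` s"

lemma other_other [simp]: "other (other v) = v"
  by (cases v) auto

lemma other_comp [simp]: "other \<circ> other = id"
  by auto

lemma swap_swap [simp]: "swap_type (swap_type s) = s"
  by (simp add: swap_type_def image_image split_def)

lemma inj_other: "inj (map other)"
  by (rule inj_on_inverseI[where g = "map other"]) simp

lemma inj_swap: "inj_on (\<lambda>(p, vs). (p, map other vs)) (s :: two_type)"
proof (rule inj_onI)
  fix a b :: "nat \<times> var list"
  assume "(case a of (p, vs) \<Rightarrow> (p, map other vs)) = (case b of (p, vs) \<Rightarrow> (p, map other vs))"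
  then have "fst a = fst b \<and> map other (snd a) = map other (snd b)"
    by (simp only: split_def prod.inject)
  then show "a = b" using injD[OF inj_other] by (simp add: prod_eq_iff)
qed

lemma mem_swap: "(p, map other vs) \<in> swap_type s \<longleftrightarrow> (p, vs) \<in> s"
proof
  assume "(p, map other vs) \<in> swap_type s"
  then obtain vs' where vs': "(p, vs') \<in> s" "map other vs = map other vs'" by (auto simp: swap_type_def)
  then show "(p, vs) \<in> s" using injD[OF inj_other vs'(2)] by simp
next
  assume "(p, vs) \<in> s"
  then show "(p, map other vs) \<in> swap_type s" unfolding swap_type_def by (rule rev_image_eqI) simp
qed

lemma lsat_swap:
  "lsat \<omega> (\<lambda>v. \<tau> (other v)) (\<lambda>v. g (other v)) (swap_type t) (\<lambda>v. other (e v)) \<phi> \<longleftrightarrow> lsat \<omega> \<tau> g t e \<phi>"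
proof (induction \<phi>)
  case (Atom p vs)
  have im: "(\<lambda>v. other (e v)) ` set vs = other ` e ` set vs" by auto
  have inv: "S = other ` T" if "other ` S = T" for S T :: "var set" using that[symmetric] by (simp add: image_image)
  have "other ` S = {X} \<longleftrightarrow> S = {Y}" "other ` S = {Y} \<longleftrightarrow> S = {X}" for S
    by (rule iffI, drule inv, simp, simp)+
  moreover have "map (\<lambda>v. other (e v)) vs = map other (map e vs)" by simp
  ultimately show ?case by (simp add: im mem_swap del: map_map)
next
  case (Eq u v)
  show ?case by (cases "e u"; cases "e v") auto
qed auto

lemma vpair_other: "(\<lambda>v. vpair a b (other v)) = vpair b a"
proof
  show "vpair a b (other v) = vpair b a v" for v by (cases v) auto
qed

lemma edge_swap:
  "edge \<omega> (vpair a b) (vpair c d) (swap_type s) Q v \<longleftrightarrow> edge \<omega> (vpair b a) (vpair d c) s Q (other v)"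
proof -
  have "(\<lambda>v'. other (((\<lambda>_. other v)(qvar Q := v)) v')) = (\<lambda>_. v)(qvar Q := other v)" by auto
  then show ?thesis
    using lsat_swap[of \<omega> "vpair b a" "vpair d c" s "(\<lambda>_. other v)(qvar Q := v)" "qbody Q"]
    by (simp add: edge_def vpair_other)
qed

lemma pair_weight_swap: "pair_weight K x u \<Phi> \<omega> l l' (swap_type s) = pair_weight K x u \<Phi> \<omega> l' l s"
proof -
  have "(\<Prod>a\<in>swap_type s. u (fst a)) = (\<Prod>a\<in>s. u (fst a))"
    unfolding swap_type_def by (subst prod.reindex[OF inj_swap]) (simp add: split_def)
  then show ?thesis by (simp add: pair_weight_def edge_swap mult.commute)
qed

lemma swap_atoms2: "s \<subseteq> atoms2 ar \<Longrightarrow> swap_type s \<subseteq> atoms2 ar"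
proof -
  have "(p, map other vs) \<in> atoms2 ar" if "(p, vs) \<in> atoms2 ar" for p vs
    using that by (auto simp: atoms2_def)
  then show "s \<subseteq> atoms2 ar \<Longrightarrow> swap_type s \<subseteq> atoms2 ar" by (auto simp: swap_type_def)
qed

text \<open>Swapping names permutes \<open>T\<close> and exchanges the roles of the labels. The sets
  of edge and non-edge types are closed under it because they treat both directions of
  \<open>R\<close> alike.\<close>

lemma types_weight_sym:
  assumes "\<And>s. s \<in> T \<Longrightarrow> swap_type s \<in> T"
  shows "types_weight T K x u \<Phi> \<omega> l l' = types_weight T K x u \<Phi> \<omega> l' l"
  unfolding types_weight_def
  by (rule sum.reindex_bij_witness[where i = swap_type and j = swap_type])
    (simp_all only: assms swap_swap pair_weight_swap)

lemma edge_atom_swap: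
  "(R, [X, Y]) \<in> swap_type s \<longleftrightarrow> (R, [Y, X]) \<in> s" "(R, [Y, X]) \<in> swap_type s \<longleftrightarrow> (R, [X, Y]) \<in> s"
  using mem_swap[of R "[Y, X]" s] mem_swap[of R "[X, Y]" s] by simp_all

lemma types_weight_no_edge_sym:
  "types_weight (types_no_edge ar R) K x u \<Phi> \<omega> l l' = types_weight (types_no_edge ar R) K x u \<Phi> \<omega> l' l"
  by (rule types_weight_sym) (simp add: types_no_edge_def edge_atom_swap swap_atoms2)

lemma types_weight_edge_sym:
  "types_weight (types_edge ar R) K x u \<Phi> \<omega> l l' = types_weight (types_edge ar R) K x u \<Phi> \<omega> l' l"
  by (rule types_weight_sym) (simp add: types_edge_def edge_atom_swap swap_atoms2)

lemma deg_ok_const: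
  assumes "qbound Q \<le> K" "d > K"
  shows "deg_ok \<omega> \<tau> g Q d = deg_ok \<omega> \<tau> g Q (Suc K)"
  unfolding deg_ok_def using assms by (intro arg_cong[where f = "\<lambda>b. _ = b"] qholds_bound) auto

context setting
begin

definition labelling_sum :: "nat \<Rightarrow> int \<Rightarrow> (nat \<Rightarrow> int) \<Rightarrow> int" where
  "labelling_sum K x u = (\<Sum>f\<in>PiE V (\<lambda>v. {l\<in>labs ar \<Phi> R K \<omega>. al v (fst (fst l))}).
     (\<Prod>v\<in>V. lab_weight K x u \<Phi> \<omega> (f v)) *
     bip_weight (\<lambda>q. types_weight (types_no_edge ar R) K x u \<Phi> \<omega> (f (fst q)) (f (snd q)))
       (\<lambda>q. types_weight (types_edge ar R) K x u \<Phi> \<omega> (f (fst q)) (f (snd q))) V)"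

abbreviation "VL \<equiv> PiE V (\<lambda>v. {l\<in>vlabs ar \<Phi> R \<omega>. al v (fst l)})"
abbreviation "TT \<equiv> {t\<in>PiE (prs V) (\<lambda>_. types_no_edge ar R \<union> types_edge ar R).
  two_colourable V {q\<in>prs V. t q \<in> types_edge ar R}}"
abbreviation "I \<equiv> qsubs \<Phi>"

text \<open>Every ordered pair \<open>(a, b)\<close> with \<open>b\<close> a witness at
  \<open>a\<close> contributes one base factor of \<open>a\<close>, so the exponents are the
  degrees.\<close>

lemma prod_pair_weight:
  assumes f: "\<And>v. v \<in> V \<Longrightarrow> f v = (\<sigma> v, j v)"
  shows "(\<Prod>q\<in>prs V. pair_weight K x u \<Phi> \<omega> (f (fst q)) (f (snd q)) (t q)) =
    (\<Prod>q\<in>prs V. \<Prod>s\<in>t q. u (fst s)) *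
    (\<Prod>v\<in>V. \<Prod>Q\<in>I. base_wt K x (j v Q) ^ deg V \<omega> (\<lambda>v. fst (\<sigma> v)) (\<lambda>v. snd (\<sigma> v)) t Q v)"
proof -
  let ?wit = "wit \<omega> (\<lambda>v. fst (\<sigma> v)) (\<lambda>v. snd (\<sigma> v)) t"
  define G where "G = (\<lambda>a b. \<Prod>Q\<in>I. if ?wit Q a b then base_wt K x (j a Q) else 1)"
  have "(\<Prod>q\<in>prs V. pair_weight K x u \<Phi> \<omega> (f (fst q)) (f (snd q)) (t q)) =
    (\<Prod>q\<in>prs V. (\<Prod>s\<in>t q. u (fst s)) * (G (fst q) (snd q) * G (snd q) (fst q)))"
  proof (rule prod.cong[OF refl])
    fix q assume "q \<in> prs V"
    then have q: "fst q \<in> V" "snd q \<in> V" "fst q < snd q" "\<not> snd q < fst q" by (auto simp: prs_def)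
    show "pair_weight K x u \<Phi> \<omega> (f (fst q)) (f (snd q)) (t q) =
      (\<Prod>s\<in>t q. u (fst s)) * (G (fst q) (snd q) * G (snd q) (fst q))"
      by (simp only: pair_weight_def f[OF q(1)] f[OF q(2)] fst_conv snd_conv G_def wit_def q(3,4) if_True if_False
          prod.collapse prod.distrib[symmetric])
  qed
  also have "\<dots> = (\<Prod>q\<in>prs V. \<Prod>s\<in>t q. u (fst s)) * (\<Prod>a\<in>V. \<Prod>b\<in>V - {a}. G a b)"
    by (simp only: prod.distrib[of _ _ "prs V"] prod_prs_both[OF finite_atLeastAtMost, symmetric])
  also have "(\<Prod>a\<in>V. \<Prod>b\<in>V - {a}. G a b) = (\<Prod>v\<in>V. \<Prod>Q\<in>I. base_wt K x (j v Q) ^ deg V \<omega> (\<lambda>v. fst (\<sigma> v)) (\<lambda>v. snd (\<sigma> v)) t Q v)"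
  proof (rule prod.cong[OF refl])
    fix a
    have "(\<Prod>b\<in>V - {a}. G a b) = (\<Prod>Q\<in>I. \<Prod>b\<in>V - {a}. if ?wit Q a b then base_wt K x (j a Q) else 1)"
      unfolding G_def by (rule prod.swap)
    also have "\<dots> = (\<Prod>Q\<in>I. base_wt K x (j a Q) ^ deg V \<omega> (\<lambda>v. fst (\<sigma> v)) (\<lambda>v. snd (\<sigma> v)) t Q a)"
    proof (rule prod.cong[OF refl])
      fix Q
      have "(\<Prod>b\<in>V - {a}. if ?wit Q a b then base_wt K x (j a Q) else 1) =
        (\<Prod>b\<in>{b\<in>V - {a}. ?wit Q a b}. base_wt K x (j a Q))"
        by (rule prod.inter_filter[symmetric]) simp
      then show "(\<Prod>b\<in>V - {a}. if ?wit Q a b then base_wt K x (j a Q) else 1) =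
        base_wt K x (j a Q) ^ deg V \<omega> (\<lambda>v. fst (\<sigma> v)) (\<lambda>v. snd (\<sigma> v)) t Q a"
        by (simp only: deg_def prod_constant)
    qed
    finally show "(\<Prod>b\<in>V - {a}. G a b) = \<dots>" .
  qed
  finally show ?thesis .
qed

text \<open>The labels split into type-and-guess and choice of bases. Summing over the latter first
  turns a product per element and quantifier back into the expansions of
  \<open>lead_degree\<close>.\<close>

lemma labelling_sum_eq:
  "labelling_sum K x u = (\<Sum>\<sigma>\<in>VL. \<Sum>t\<in>TT. ((\<Prod>v\<in>V. \<Prod>p\<in>fst (\<sigma> v). u p) * (\<Prod>q\<in>prs V. \<Prod>s\<in>t q. u (fst s))) *
     (\<Prod>v\<in>V. \<Prod>Q\<in>I. \<Sum>i\<le>Suc K. coeff_wt K x (deg_ok \<omega> (fst (\<sigma> v)) (snd (\<sigma> v)) Q) i *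
        base_wt K x i ^ deg V \<omega> (\<lambda>v. fst (\<sigma> v)) (\<lambda>v. snd (\<sigma> v)) t Q v))"
proof -
  let ?J = "PiE I (\<lambda>_. {..Suc K})"
  have finJ: "finite ?J" by (intro finite_PiE) auto
  have lab: "{l\<in>labs ar \<Phi> R K \<omega>. al v (fst (fst l))} = {l\<in>vlabs ar \<Phi> R \<omega>. al v (fst l)} \<times> ?J" for v
    by (auto simp: labs_def)
  have "labelling_sum K x u = (\<Sum>f\<in>PiE V (\<lambda>v. {l\<in>vlabs ar \<Phi> R \<omega>. al v (fst l)} \<times> ?J).
     (\<Prod>v\<in>V. lab_weight K x u \<Phi> \<omega> (f v)) * (\<Sum>t\<in>TT. \<Prod>q\<in>prs V. pair_weight K x u \<Phi> \<omega> (f (fst q)) (f (snd q)) (t q)))"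
    unfolding labelling_sum_def lab types_weight_def
    by (subst bip_weight_sum) (simp_all add: types_edge_disjoint)
  also have "\<dots> = (\<Sum>\<sigma>\<in>VL. \<Sum>j\<in>PiE V (\<lambda>_. ?J). (\<Prod>v\<in>V. lab_weight K x u \<Phi> \<omega> ((\<lambda>v\<in>V. (\<sigma> v, j v)) v)) *
     (\<Sum>t\<in>TT. \<Prod>q\<in>prs V. pair_weight K x u \<Phi> \<omega> ((\<lambda>v\<in>V. (\<sigma> v, j v)) (fst q)) ((\<lambda>v\<in>V. (\<sigma> v, j v)) (snd q)) (t q)))"
    by (rule sum_PiE_Times) (use finJ in auto)
  also have "\<dots> = (\<Sum>\<sigma>\<in>VL. \<Sum>j\<in>PiE V (\<lambda>_. ?J). \<Sum>t\<in>TT.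
     ((\<Prod>v\<in>V. \<Prod>p\<in>fst (\<sigma> v). u p) * (\<Prod>q\<in>prs V. \<Prod>s\<in>t q. u (fst s))) *
     (\<Prod>v\<in>V. \<Prod>Q\<in>I. coeff_wt K x (deg_ok \<omega> (fst (\<sigma> v)) (snd (\<sigma> v)) Q) (j v Q) *
        base_wt K x (j v Q) ^ deg V \<omega> (\<lambda>v. fst (\<sigma> v)) (\<lambda>v. snd (\<sigma> v)) t Q v))"
  proof (intro sum.cong refl)
    fix \<sigma> :: "nat \<Rightarrow> nat set \<times> fm set" and j :: "nat \<Rightarrow> fm \<Rightarrow> nat"
    let ?f = "\<lambda>v\<in>V. (\<sigma> v, j v)"
    have f: "?f v = (\<sigma> v, j v)" if "v \<in> V" for v using that by (simp only: restrict_apply if_True)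
    have 1: "(\<Prod>v\<in>V. lab_weight K x u \<Phi> \<omega> (?f v)) = (\<Prod>v\<in>V. \<Prod>p\<in>fst (\<sigma> v). u p) *
      (\<Prod>v\<in>V. \<Prod>Q\<in>I. coeff_wt K x (deg_ok \<omega> (fst (\<sigma> v)) (snd (\<sigma> v)) Q) (j v Q))"
      unfolding prod.distrib[symmetric] by (intro prod.cong refl) (simp only: f lab_weight_def fst_conv snd_conv)
    show "(\<Prod>v\<in>V. lab_weight K x u \<Phi> \<omega> (?f v)) * (\<Sum>t\<in>TT. \<Prod>q\<in>prs V. pair_weight K x u \<Phi> \<omega> (?f (fst q)) (?f (snd q)) (t q)) =
      (\<Sum>t\<in>TT. ((\<Prod>v\<in>V. \<Prod>p\<in>fst (\<sigma> v). u p) * (\<Prod>q\<in>prs V. \<Prod>s\<in>t q. u (fst s))) *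
       (\<Prod>v\<in>V. \<Prod>Q\<in>I. coeff_wt K x (deg_ok \<omega> (fst (\<sigma> v)) (snd (\<sigma> v)) Q) (j v Q) *
        base_wt K x (j v Q) ^ deg V \<omega> (\<lambda>v. fst (\<sigma> v)) (\<lambda>v. snd (\<sigma> v)) t Q v))"
      unfolding sum_distrib_left
    proof (rule sum.cong[OF refl])
      fix t
      have 2: "(\<Prod>q\<in>prs V. pair_weight K x u \<Phi> \<omega> (?f (fst q)) (?f (snd q)) (t q)) = (\<Prod>q\<in>prs V. \<Prod>s\<in>t q. u (fst s)) *
        (\<Prod>v\<in>V. \<Prod>Q\<in>I. base_wt K x (j v Q) ^ deg V \<omega> (\<lambda>v. fst (\<sigma> v)) (\<lambda>v. snd (\<sigma> v)) t Q v)"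
        by (rule prod_pair_weight[OF f])
      show "(\<Prod>v\<in>V. lab_weight K x u \<Phi> \<omega> (?f v)) * (\<Prod>q\<in>prs V. pair_weight K x u \<Phi> \<omega> (?f (fst q)) (?f (snd q)) (t q)) =
        ((\<Prod>v\<in>V. \<Prod>p\<in>fst (\<sigma> v). u p) * (\<Prod>q\<in>prs V. \<Prod>s\<in>t q. u (fst s))) *
        (\<Prod>v\<in>V. \<Prod>Q\<in>I. coeff_wt K x (deg_ok \<omega> (fst (\<sigma> v)) (snd (\<sigma> v)) Q) (j v Q) *
          base_wt K x (j v Q) ^ deg V \<omega> (\<lambda>v. fst (\<sigma> v)) (\<lambda>v. snd (\<sigma> v)) t Q v)"
        unfolding 1 2 prod.distrib by (simp only: mult_ac)
    qed
  qed
  also have "\<dots> = (\<Sum>\<sigma>\<in>VL. \<Sum>t\<in>TT. \<Sum>j\<in>PiE V (\<lambda>_. ?J).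
     ((\<Prod>v\<in>V. \<Prod>p\<in>fst (\<sigma> v). u p) * (\<Prod>q\<in>prs V. \<Prod>s\<in>t q. u (fst s))) *
     (\<Prod>v\<in>V. \<Prod>Q\<in>I. coeff_wt K x (deg_ok \<omega> (fst (\<sigma> v)) (snd (\<sigma> v)) Q) (j v Q) *
        base_wt K x (j v Q) ^ deg V \<omega> (\<lambda>v. fst (\<sigma> v)) (\<lambda>v. snd (\<sigma> v)) t Q v))"
    by (intro sum.cong refl sum.swap)
  also have "\<dots> = (\<Sum>\<sigma>\<in>VL. \<Sum>t\<in>TT.
     ((\<Prod>v\<in>V. \<Prod>p\<in>fst (\<sigma> v). u p) * (\<Prod>q\<in>prs V. \<Prod>s\<in>t q. u (fst s))) *
     (\<Prod>v\<in>V. \<Prod>Q\<in>I. \<Sum>i\<le>Suc K. coeff_wt K x (deg_ok \<omega> (fst (\<sigma> v)) (snd (\<sigma> v)) Q) i *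
        base_wt K x i ^ deg V \<omega> (\<lambda>v. fst (\<sigma> v)) (\<lambda>v. snd (\<sigma> v)) t Q v))"
    unfolding sum_distrib_left[symmetric]
    by (simp only: prod_sum_PiE[OF finite_qsubs finite_atMost] prod_sum_PiE[OF finite_atLeastAtMost finJ])
  finally show ?thesis .
qed

lemma sum_configs:
  "(\<Sum>\<sigma>\<in>VL. \<Sum>t\<in>TT. H \<sigma> t * of_bool (\<forall>v\<in>V. \<forall>Q\<in>I. deg_ok \<omega> (fst (\<sigma> v)) (snd (\<sigma> v)) Q
        (deg V \<omega> (\<lambda>v. fst (\<sigma> v)) (\<lambda>v. snd (\<sigma> v)) t Q v))) = (\<Sum>(\<sigma>, t)\<in>CF. H \<sigma> t :: int)"
proof -
  have fin: "finite (VL \<times> TT)"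
    by (intro finite_cartesian_product finite_Collect_conjI disjI1 finite_PiE) (auto intro!: finite_PiE)
  have CF: "CF = {c\<in>VL \<times> TT. \<forall>v\<in>V. \<forall>Q\<in>I. deg_ok \<omega> (fst (fst c v)) (snd (fst c v)) Q
        (deg V \<omega> (\<lambda>v. fst (fst c v)) (\<lambda>v. snd (fst c v)) (snd c) Q v)}"
    unfolding configs_def by (auto simp del: atLeastAtMost_iff)
  show ?thesis unfolding CF sum.cartesian_product sum.inter_filter[OF fin]
    by (intro sum.cong refl) (simp only: split_def of_bool_def if_distrib[where f = "\<lambda>z. _ * z"] mult_1_right mult_zero_right)
qed

text \<open>One application of \<open>lead_degree\<close> for each element and quantified
  subformula: orders add up to \<open>n * (card I * K)\<close>, and each brings a factor
  \<open>K!\<close>.\<close>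

theorem lead_labelling_sum:
  assumes K: "\<And>Q. Q \<in> I \<Longrightarrow> qbound Q \<le> K"
  shows "lead x (n * (card I * K)) (labelling_sum K x u) (fact K ^ (n * card I) *
    (\<Sum>(\<sigma>, t)\<in>CF. (\<Prod>v\<in>V. \<Prod>p\<in>fst (\<sigma> v). u p) * (\<Prod>q\<in>prs V. \<Prod>s\<in>t q. u (fst s))))"
proof -
  let ?H = "\<lambda>\<sigma> t. (\<Prod>v\<in>V. \<Prod>p\<in>fst (\<sigma> v). u p) * (\<Prod>q\<in>prs V. \<Prod>s\<in>t q. u (fst s))"
  let ?ok = "\<lambda>\<sigma> t v Q. deg_ok \<omega> (fst (\<sigma> v)) (snd (\<sigma> v)) Q (deg V \<omega> (\<lambda>v. fst (\<sigma> v)) (\<lambda>v. snd (\<sigma> v)) t Q v)"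
  have "lead x (n * (card I * K)) (labelling_sum K x u)
     (\<Sum>\<sigma>\<in>VL. \<Sum>t\<in>TT. ?H \<sigma> t * (\<Prod>v\<in>V. \<Prod>Q\<in>I. fact K * of_bool (?ok \<sigma> t v Q)))"
    unfolding labelling_sum_eq
  proof (intro lead_sum lead_cmult)
    fix \<sigma> t
    have "lead x (card V * (card I * K)) (\<Prod>v\<in>V. \<Prod>Q\<in>I. \<Sum>i\<le>Suc K. coeff_wt K x (deg_ok \<omega> (fst (\<sigma> v)) (snd (\<sigma> v)) Q) i *
        base_wt K x i ^ deg V \<omega> (\<lambda>v. fst (\<sigma> v)) (\<lambda>v. snd (\<sigma> v)) t Q v)
        (\<Prod>v\<in>V. \<Prod>Q\<in>I. fact K * of_bool (?ok \<sigma> t v Q))"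
      by (intro lead_prod lead_degree deg_ok_const K)
    then show "lead x (n * (card I * K)) (\<Prod>v\<in>V. \<Prod>Q\<in>I. \<Sum>i\<le>Suc K. coeff_wt K x (deg_ok \<omega> (fst (\<sigma> v)) (snd (\<sigma> v)) Q) i *
        base_wt K x i ^ deg V \<omega> (\<lambda>v. fst (\<sigma> v)) (\<lambda>v. snd (\<sigma> v)) t Q v)
        (\<Prod>v\<in>V. \<Prod>Q\<in>I. fact K * of_bool (?ok \<sigma> t v Q))" by simp
  qed
  also have "(\<Sum>\<sigma>\<in>VL. \<Sum>t\<in>TT. ?H \<sigma> t * (\<Prod>v\<in>V. \<Prod>Q\<in>I. fact K * of_bool (?ok \<sigma> t v Q))) =
    fact K ^ (n * card I) * (\<Sum>\<sigma>\<in>VL. \<Sum>t\<in>TT. ?H \<sigma> t * of_bool (\<forall>v\<in>V. \<forall>Q\<in>I. ?ok \<sigma> t v Q))"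
  proof -
    have "(\<Prod>v\<in>V. \<Prod>Q\<in>I. fact K * of_bool (?ok \<sigma> t v Q)) = fact K ^ (n * card I) * (of_bool (\<forall>v\<in>V. \<forall>Q\<in>I. ?ok \<sigma> t v Q) :: int)" for \<sigma> t
    proof -
      have ob: "(\<Prod>i\<in>A. of_bool (P i)) = (of_bool (\<forall>i\<in>A. P i) :: int)" if "finite A" for A :: "'z set" and P
        using that by (induction A) auto
      show ?thesis by (simp add: prod.distrib ob power_mult mult.commute[of n])
    qed
    then show ?thesis by (simp only: sum_distrib_left mult_ac)
  qed
  finally show ?thesis unfolding sum_configs .
qed

end

section \<open>Running a program on the abstract state\<close>

definition state_is :: "(int \<Rightarrow> int) \<Rightarrow> (int \<Rightarrow> int) \<Rightarrow> (nat \<Rightarrow> int) \<Rightarrow> imem \<Rightarrow> bool" where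
  "state_is I T v m \<longleftrightarrow> inp_of m = I \<and> tab_of m = T \<and> env_of m = v"

type_synonym astate = "(int \<Rightarrow> int) \<times> (nat \<Rightarrow> int) \<times> nmem"

text \<open>Transitions of table, variables and number memory for a fixed input. The temporaries are
  hidden, so program pieces compose without reference to them.\<close>

definition moves :: "(nat \<Rightarrow> real) \<Rightarrow> (nat \<Rightarrow> real) \<Rightarrow> (int \<Rightarrow> int) \<Rightarrow> com \<Rightarrow> nat \<Rightarrow> astate \<Rightarrow> astate \<Rightarrow> bool" where
  "moves w wbar I c B s s' \<longleftrightarrow> (\<forall>m. state_is I (fst s) (fst (snd s)) m \<longrightarrow>
     (\<exists>m'. runs w wbar c (m, snd (snd s)) B (m', snd (snd s')) \<and> state_is I (fst s') (fst (snd s')) m'))"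

lemma moves_mono: "moves w wbar I c B s s' \<Longrightarrow> B \<le> B' \<Longrightarrow> moves w wbar I c B' s s'"
  unfolding moves_def by (meson runs_mono)

lemma moves_Seq: "moves w wbar I c B s s' \<Longrightarrow> moves w wbar I d B' s' s'' \<Longrightarrow> moves w wbar I (Seq c d) (B + B') s s''"
  unfolding moves_def by (meson runs_Seq)

lemma moves_Skip: "moves w wbar I Skip 1 s s"
  unfolding moves_def runs_def using exec.Skip by blast

lemma state_var: "state_is I T v m \<Longrightarrow> m (va x) = v x"
  by (auto simp: state_is_def env_of_def)

lemma moves_While:
  assumes step: "\<And>k. k < n \<Longrightarrow> moves w wbar I c B (s k) (s (Suc k))"
    and test: "\<And>k m. k \<le> n \<Longrightarrow> state_is I (fst (s k)) (fst (snd (s k))) m \<Longrightarrow>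
      (0 < ival m e \<longleftrightarrow> k < n) \<and> icost m e \<le> C"
  shows "moves w wbar I (WhilePos e c) (n * (B + C) + C) (s 0) (s n)"
  unfolding moves_def
proof (intro allI impI)
  fix m assume m: "state_is I (fst (s 0)) (fst (snd (s 0))) m"
  have "\<exists>m' r'. runs w wbar (WhilePos e c) (m, snd (snd (s 0))) (n * (B + C) + C) (m', r') \<and>
      state_is I (fst (s n)) (fst (snd (s n))) m' \<and> r' = snd (snd (s n))"
  proof (rule runs_WhilePos[where Q = "\<lambda>k m r. state_is I (fst (s k)) (fst (snd (s k))) m \<and> r = snd (snd (s k))"])
    fix k m r assume k: "k < n" and q: "state_is I (fst (s k)) (fst (snd (s k))) m \<and> r = snd (snd (s k))"
    have "\<exists>m'. runs w wbar c (m, r) B (m', snd (snd (s (Suc k)))) \<and> state_is I (fst (s (Suc k))) (fst (snd (s (Suc k)))) m'"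
      using step[OF k] q unfolding moves_def by blast
    moreover have "ival m e > 0" using test[of k m] k q by simp
    ultimately show "ival m e > 0 \<and> (\<exists>m' r'. runs w wbar c (m, r) B (m', r') \<and>
        state_is I (fst (s (Suc k))) (fst (snd (s (Suc k)))) m' \<and> r' = snd (snd (s (Suc k))))" by blast
  next
    fix m r assume "state_is I (fst (s n)) (fst (snd (s n))) m \<and> r = snd (snd (s n))"
    then show "ival m e \<le> 0" using test[of n m] by auto
  next
    fix k m r assume "k \<le> n" "state_is I (fst (s k)) (fst (snd (s k))) m \<and> r = snd (snd (s k))"
    then show "icost m e \<le> C" using test[of k m] by blast
  qed (use m in simp)
  then show "\<exists>m'. runs w wbar (WhilePos e c) (m, snd (snd (s 0))) (n * (B + C) + C) (m', snd (snd (s n))) \<and>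
      state_is I (fst (s n)) (fst (snd (s n))) m'" by blast
qed

lemma compile_run:
  obtains B where "pow_bounded B" "\<And>M I T v m r. state_is I T v m \<Longrightarrow> bnd M I T v e \<Longrightarrow>
    \<exists>m'. runs w wbar (compile 0 e) (m, r) (B M) (m', r) \<and> m' (ta 0) = eval I T v e \<and> state_is I T v m'"
proof -
  obtain B where B: "pow_bounded B" "\<forall>M m r. bdm M m e \<longrightarrow>
     (\<exists>m'. runs w wbar (compile 0 e) (m, r) (B M) (m', r) \<and> m' (ta 0) = evm m e \<and> same_below 0 m m')"
    using compile_correct[of w wbar 0 e] unfolding computes_def by (elim exE conjE)
  show thesis
  proof (rule that[OF B(1)])
    fix M I T v m r assume s: "state_is I T v m" and b: "bnd M I T v e"
    obtain m' where m': "runs w wbar (compile 0 e) (m, r) (B M) (m', r)" "m' (ta 0) = evm m e" "same_below 0 m m'"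
      using B(2) s b unfolding state_is_def by blast
    then show "\<exists>m'. runs w wbar (compile 0 e) (m, r) (B M) (m', r) \<and> m' (ta 0) = eval I T v e \<and> state_is I T v m'"
      using s same_below_of[OF m'(3)] unfolding state_is_def by (intro exI[of _ m']) simp
  qed
qed

lemma state_upd_va: "state_is I T v m \<Longrightarrow> state_is I T (v(x := z)) (m(va x := z))"
  by (simp add: state_is_def)

lemma state_upd_tb:
  assumes "state_is I T v m" "i \<ge> 0"
  shows "state_is I (T(i := z)) v (m(tb i := z))"
proof -
  have "inp_of (m(tb i := z)) = inp_of m" "tab_of (m(tb i := z)) = (tab_of m)(i := z)"
    "env_of (m(tb i := z)) = env_of m"
    using assms(2) by (auto simp: inp_of_def tab_of_def env_of_def fun_eq_iff)
  then show ?thesis using assms(1) by (simp add: state_is_def)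
qed

definition assign :: "nat \<Rightarrow> ex \<Rightarrow> com" where
  "assign x e = Seq (compile 0 e) (VSet x (TC 0))"

lemma moves_assign:
  obtains B where "pow_bounded B" "\<And>M I T v r. bnd M I T v e \<Longrightarrow>
    moves w wbar I (assign x e) (B M) (T, v, r) (T, v(x := eval I T v e), r)"
proof -
  obtain B where B: "pow_bounded B" "\<And>M I T v m r. state_is I T v m \<Longrightarrow> bnd M I T v e \<Longrightarrow>
    \<exists>m'. runs w wbar (compile 0 e) (m, r) (B M) (m', r) \<and> m' (ta 0) = eval I T v e \<and> state_is I T v m'"
    by (rule compile_run[of e w wbar]) (rule that, assumption, blast)
  let ?C = "\<lambda>M. len (va x) + len (ta 0) + Suc M"
  show thesis
  proof (rule that)
    show "pow_bounded (\<lambda>M. B M + ?C M)" using B(1) by simp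
    fix M I T v r assume b: "bnd M I T v e"
    show "moves w wbar I (assign x e) (B M + ?C M) (T, v, r) (T, v(x := eval I T v e), r)"
      unfolding moves_def fst_conv snd_conv
    proof (intro allI impI)
      fix m assume "state_is I T v m"
      then obtain m' where m': "runs w wbar (compile 0 e) (m, r) (B M) (m', r)" "m' (ta 0) = eval I T v e" "state_is I T v m'"
        using B(2) b by blast
      have "runs w wbar (VSet x (TC 0)) (m', r) (?C M) (m'(va x := eval I T v e), r)"
        using runs_ISet[of m' "Const (va x)" "TC 0" "?C M" w wbar r] len_le[OF bnd_fits[OF b]] by (simp add: m'(2))
      then show "\<exists>m'. runs w wbar (assign x e) (m, r) (B M + ?C M) (m', r) \<and> state_is I T (v(x := eval I T v e)) m'"
        unfolding assign_def using runs_Seq[OF m'(1)] state_upd_va[OF m'(3)] by blast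
    qed
  qed
qed

definition store :: "nat \<Rightarrow> ex \<Rightarrow> com" where
  "store x e = Seq (compile 0 e) (ISet (Sub (Const (-3)) (Mul (Const 3) (VC x))) (TC 0))"

lemma len_affine:
  assumes "fits M z"
  shows "len (3 * z) \<le> M + 5" "len (- 3 - 3 * z) \<le> M + 5" "len z \<le> M + 5"
proof -
  have p: "(2::int) ^ (M + 4) = 16 * 2 ^ M" "(1::int) \<le> 2 ^ M" by (simp_all add: power_add)
  have f4: "fits (M + 4) (3 * z)" "fits (M + 4) (- 3 - 3 * z)" using assms p by linarith+
  show "len (3 * z) \<le> M + 5" "len (- 3 - 3 * z) \<le> M + 5" "len z \<le> M + 5"
    using len_le[OF f4(1)] len_le[OF f4(2)] len_le[OF assms] by simp_all
qed

lemma moves_store: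
  obtains B where "pow_bounded B" "\<And>M I T v r. bnd M I T v e \<Longrightarrow> fits M (v x) \<Longrightarrow> v x \<ge> 0 \<Longrightarrow>
    moves w wbar I (store x e) (B M) (T, v, r) (T(v x := eval I T v e), v, r)"
proof -
  obtain B where B: "pow_bounded B" "\<And>M I T v m r. state_is I T v m \<Longrightarrow> bnd M I T v e \<Longrightarrow>
    \<exists>m'. runs w wbar (compile 0 e) (m, r) (B M) (m', r) \<and> m' (ta 0) = eval I T v e \<and> state_is I T v m'"
    by (rule compile_run[of e w wbar]) (rule that, assumption, blast)
  let ?a = "Sub (Const (-3)) (Mul (Const 3) (VC x))"
  let ?C = "\<lambda>M. len (va x) + len (ta 0) + len (-3) + len 3 + 4 * (M + 5)"
  show thesis
  proof (rule that)
    show "pow_bounded (\<lambda>M. B M + ?C M)" using B(1) by simp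
    fix M I T v r assume b: "bnd M I T v e" and x: "fits M (v x)" "v x \<ge> 0"
    show "moves w wbar I (store x e) (B M + ?C M) (T, v, r) (T(v x := eval I T v e), v, r)"
      unfolding moves_def fst_conv snd_conv
    proof (intro allI impI)
      fix m assume "state_is I T v m"
      then obtain m' where m': "runs w wbar (compile 0 e) (m, r) (B M) (m', r)" "m' (ta 0) = eval I T v e" "state_is I T v m'"
        using B(2) b by blast
      have vx: "m' (va x) = v x" by (rule state_var[OF m'(3)])
      have "ival m' ?a = tb (v x)" by (simp add: vx tb_def)
      moreover have "runs w wbar (ISet ?a (TC 0)) (m', r) (?C M) (m'(ival m' ?a := ival m' (TC 0)), r)"
        by (rule runs_ISet) (use len_affine[OF x(1)] len_affine(3)[OF bnd_fits[OF b]] in \<open>simp add: vx m'(2)\<close>)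
      ultimately have "runs w wbar (ISet ?a (TC 0)) (m', r) (?C M) (m'(tb (v x) := eval I T v e), r)"
        by (simp only: ival.simps m'(2))
      then show "\<exists>m'. runs w wbar (store x e) (m, r) (B M + ?C M) (m', r) \<and> state_is I (T(v x := eval I T v e)) v m'"
        unfolding store_def using runs_Seq[OF m'(1)] state_upd_tb[OF m'(3) x(2)] by blast
    qed
  qed
qed

text \<open>The bound sits in variable \<open>y\<close>, and the body has to preserve both loop
  variables.\<close>

definition for_loop :: "nat \<Rightarrow> nat \<Rightarrow> com \<Rightarrow> com" where
  "for_loop x y c = WhilePos (Sub (VC y) (VC x)) (Seq c (assign x (EAdd (EVar x) (ELit 1))))"

text \<open>The states are those at the head of the loop. The body reaches the next one except for
  the index, which is still \<open>k\<close> and incremented afterwards.\<close>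

lemma moves_for_loop:
  obtains B where "pow_bounded B" "\<And>M I C n T v r c. n \<le> M \<Longrightarrow>
    (\<And>k. k \<le> n \<Longrightarrow> v k x = int k \<and> v k y = int n) \<Longrightarrow>
    (\<And>k. k < n \<Longrightarrow> moves w wbar I c C (T k, v k, r k) (T (Suc k), (v (Suc k))(x := int k), r (Suc k))) \<Longrightarrow>
    moves w wbar I (for_loop x y c) (M * (C + B M) + B M) (T 0, v 0, r 0) (T n, v n, r n)"
proof -
  obtain B where B: "pow_bounded B" "\<And>M I T v r. bnd M I T v (EAdd (EVar x) (ELit 1)) \<Longrightarrow>
    moves w wbar I (assign x (EAdd (EVar x) (ELit 1))) (B M) (T, v, r) (T, v(x := eval I T v (EAdd (EVar x) (ELit 1))), r)"
    by (rule moves_assign[of "EAdd (EVar x) (ELit 1)" w wbar x]) (rule that, assumption, blast)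
  let ?t = "Sub (VC y) (VC x)"
  let ?C = "\<lambda>M. len (va x) + len (va y) + 3 * Suc M"
  have kf: "fits (Suc M) (int k)" if "k \<le> M" for k M
  proof -
    have "int k < 2 ^ k" by (rule of_nat_less_two_power)
    also have "(2::int) ^ k \<le> 2 ^ Suc M" using that by (intro power_increasing) auto
    finally show ?thesis by simp
  qed
  show thesis
  proof (rule that)
    show "pow_bounded (\<lambda>M. B (Suc M) + ?C (Suc M))" using B(1) pow_bounded_compose[OF B(1)] by simp
    fix M I C n and T :: "nat \<Rightarrow> int \<Rightarrow> int" and v :: "nat \<Rightarrow> nat \<Rightarrow> int" and r c
    assume n: "n \<le> M" and v: "\<And>k. k \<le> n \<Longrightarrow> v k x = int k \<and> v k y = int n"
      and step: "\<And>k. k < n \<Longrightarrow> moves w wbar I c C (T k, v k, r k) (T (Suc k), (v (Suc k))(x := int k), r (Suc k))"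
    define s where "s = (\<lambda>k. (T k, v k, r k))"
    have "moves w wbar I (for_loop x y c) (n * ((C + B (Suc M)) + ?C (Suc M)) + ?C (Suc M)) (s 0) (s n)"
      unfolding for_loop_def
    proof (rule moves_While)
      fix k assume k: "k < n"
      let ?v = "(v (Suc k))(x := int k)"
      have "bnd (Suc M) I (T (Suc k)) ?v (EAdd (EVar x) (ELit 1))"
        using kf[of k M] kf[of "Suc k" M] kf[of 1 M] k n by (simp add: add.commute)
      from B(2)[OF this, of "r (Suc k)"]
      have "moves w wbar I (assign x (EAdd (EVar x) (ELit 1))) (B (Suc M)) (T (Suc k), ?v, r (Suc k)) (T (Suc k), v (Suc k), r (Suc k))"
        using v[of "Suc k"] k by (simp add: fun_upd_idem add.commute)
      then show "moves w wbar I (Seq c (assign x (EAdd (EVar x) (ELit 1)))) (C + B (Suc M)) (s k) (s (Suc k))"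
        unfolding s_def by (rule moves_Seq[OF step[OF k]])
    next
      fix k m assume k: "k \<le> n" and st: "state_is I (fst (s k)) (fst (snd (s k))) m"
      have m: "m (va x) = int k" "m (va y) = int n"
        using state_var[OF st] v[OF k] by (simp_all add: s_def)
      have e: "int n - int k = int (n - k)" using k by simp
      have "len (int k) \<le> Suc (Suc M)" "len (int n) \<le> Suc (Suc M)" "len (int n - int k) \<le> Suc (Suc M)"
        unfolding e using kf[of k M] kf[of n M] kf[of "n - k" M] k n by (auto intro!: len_le)
      then show "(0 < ival m ?t \<longleftrightarrow> k < n) \<and> icost m ?t \<le> ?C (Suc M)"
        by (simp add: m)
    qed
    then show "moves w wbar I (for_loop x y c) (M * (C + (B (Suc M) + ?C (Suc M))) + (B (Suc M) + ?C (Suc M))) (T 0, v 0, r 0) (T n, v n, r n)"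
      unfolding s_def
      by (rule moves_mono) (use mult_le_mono1[OF n, of "(C + B (Suc M)) + ?C (Suc M)"] in \<open>simp add: algebra_simps\<close>)
  qed
qed

section \<open>Powers of the weights\<close>

text \<open>A weight has formal size 1, so every multiplication increases the size of number cell 1
  by exactly 1, and a power of polynomial exponent stays cheap.\<close>

definition mul_pow :: "nat \<Rightarrow> nexp \<Rightarrow> com" where
  "mul_pow y ne = WhilePos (VC y) (Seq (NSet (Const 1) (NMul (NCell (Const 1)) ne)) (assign y (ESub (EVar y) (ELit 1))))"

lemma moves_NSet:
  assumes "\<And>m. state_is I T v m \<Longrightarrow> icost m a + ncost m r e \<le> B \<and> ival m a = i \<and>
     nval w wbar m r e = x \<and> nsize m r e = z"
  shows "moves w wbar I (NSet a e) B (T, v, r) (T, v, r(i := (x, z)))"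
  unfolding moves_def fst_conv snd_conv
proof (intro allI impI)
  fix m assume s: "state_is I T v m"
  note c = assms[OF s]
  have "runs w wbar (NSet a e) (m, r) B (m, r(ival m a := (nval w wbar m r e, nsize m r e)))"
    by (rule runs_NSet) (use c in blast)
  then have "runs w wbar (NSet a e) (m, r) B (m, r(i := (x, z)))" using c by simp
  then show "\<exists>m'. runs w wbar (NSet a e) (m, r) B (m', r(i := (x, z))) \<and> state_is I T v m'"
    using s by blast
qed

lemma moves_mul_pow:
  assumes ne: "ne = Wt p \<and> a = w p \<or> ne = WtBar p \<and> a = wbar p"
  obtains B where "pow_bounded B" "\<And>M I T v r c s k. r 1 = (c, s) \<Longrightarrow> s + k \<le> M \<Longrightarrow>
    moves w wbar I (mul_pow y ne) (B M) (T, v(y := int k), r) (T, v(y := 0), r(1 := (c * a ^ k, s + k)))"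
proof -
  let ?e = "ESub (EVar y) (ELit 1)"
  obtain B where B: "pow_bounded B" "\<And>M I T v r. bnd M I T v ?e \<Longrightarrow>
    moves w wbar I (assign y ?e) (B M) (T, v, r) (T, v(y := eval I T v ?e), r)"
    by (rule moves_assign[of ?e w wbar y]) (rule that, assumption, blast)
  let ?C = "\<lambda>M. len (va y) + Suc (Suc M)" and ?D = "\<lambda>M. 2 * len 1 + 2 * M + 4"
  have nv: "nval w wbar m r ne = a" "nsize m r ne = 1" "ncost m r ne = 1" for m r using ne by auto
  have kf: "fits (Suc M) (int k)" if "k \<le> M" for k M
  proof -
    have "int k < 2 ^ k" by (rule of_nat_less_two_power)
    also have "(2::int) ^ k \<le> 2 ^ Suc M" using that by (intro power_increasing) auto
    finally show ?thesis by simp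
  qed
  show thesis
  proof (rule that)
    show "pow_bounded (\<lambda>M. M * ((?D M + B (Suc M)) + ?C M) + ?C M)" using pow_bounded_compose[OF B(1)] by simp
    fix M I T v and r :: nmem and c s k assume r: "r 1 = (c, s)" and k: "s + k \<le> M"
    define S where "S = (\<lambda>j. (T :: int \<Rightarrow> int, v(y := int (k - j)), r(1 := (c * a ^ j, s + j))))"
    have "moves w wbar I (mul_pow y ne) (k * ((?D M + B (Suc M)) + ?C M) + ?C M) (S 0) (S k)"
      unfolding mul_pow_def
    proof (rule moves_While)
      fix j assume j: "j < k"
      have 1: "moves w wbar I (NSet (Const 1) (NMul (NCell (Const 1)) ne)) (?D M) (S j)
         (T, v(y := int (k - j)), r(1 := (c * a ^ Suc j, s + Suc j)))"
        using moves_NSet[of I T "v(y := int (k - j))" "Const 1" "r(1 := (c * a ^ j, s + j))" "NMul (NCell (Const 1)) ne" "?D M" 1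
          w wbar "c * a ^ Suc j" "s + Suc j"] j k by (simp add: S_def nv mult_ac)
      have "bnd (Suc M) I T (v(y := int (k - j))) ?e"
      proof -
        have "int (k - j) - 1 = int (k - Suc j)" using j by simp
        then show ?thesis using kf[of "k - j" M] kf[of "k - Suc j" M] kf[of 1 M] j k
          by (simp del: of_nat_diff)
      qed
      from B(2)[OF this, of "r(1 := (c * a ^ Suc j, s + Suc j))"]
      have 2: "moves w wbar I (assign y ?e) (B (Suc M)) (T, v(y := int (k - j)), r(1 := (c * a ^ Suc j, s + Suc j))) (S (Suc j))"
        using j by (simp add: S_def of_nat_diff algebra_simps)
      show "moves w wbar I (Seq (NSet (Const 1) (NMul (NCell (Const 1)) ne)) (assign y ?e)) (?D M + B (Suc M)) (S j) (S (Suc j))"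
        by (rule moves_Seq[OF 1 2])
    next
      fix j m assume j: "j \<le> k" and st: "state_is I (fst (S j)) (fst (snd (S j))) m"
      have m: "m (va y) = int (k - j)" using state_var[OF st] by (simp add: S_def)
      have "len (int (k - j)) \<le> Suc (Suc M)" using kf[of "k - j" M] k by (intro len_le) simp
      then show "(0 < ival m (VC y) \<longleftrightarrow> j < k) \<and> icost m (VC y) \<le> ?C M" using j by (simp add: m)
    qed
    moreover have "S 0 = (T, v(y := int k), r)" using r by (simp add: S_def fun_upd_idem)
    moreover have "S k = (T, v(y := 0), r(1 := (c * a ^ k, s + k)))" by (simp add: S_def)
    ultimately have "moves w wbar I (mul_pow y ne) (k * ((?D M + B (Suc M)) + ?C M) + ?C M)
       (T, v(y := int k), r) (T, v(y := 0), r(1 := (c * a ^ k, s + k)))" by simp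
    then show "moves w wbar I (mul_pow y ne) (M * ((?D M + B (Suc M)) + ?C M) + ?C M)
       (T, v(y := int k), r) (T, v(y := 0), r(1 := (c * a ^ k, s + k)))"
      by (rule moves_mono) (use k in \<open>intro add_mono mult_le_mono1, simp_all\<close>)
  qed
qed

fun mul_all :: "nat \<Rightarrow> (nat \<Rightarrow> ex) \<Rightarrow> (nat \<Rightarrow> ex) \<Rightarrow> nat list \<Rightarrow> com" where
  "mul_all y ks Ks [] = Skip"
| "mul_all y ks Ks (p # ps) = Seq (Seq (assign y (ks p)) (mul_pow y (Wt p)))
     (Seq (Seq (assign y (Ks p)) (mul_pow y (WtBar p))) (mul_all y ks Ks ps))"

lemma moves_mul_all:
  "\<exists>B. pow_bounded B \<and> (\<forall>M I T v r c s kv Kv. r 1 = (c, s) \<longrightarrow> v y = 0 \<longrightarrow>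
     (\<forall>p\<in>set ps. bnd M I T v (ks p) \<and> bnd M I T v (Ks p) \<and> eval I T v (ks p) = int (kv p) \<and> eval I T v (Ks p) = int (Kv p)) \<longrightarrow>
     s + (\<Sum>p\<leftarrow>ps. kv p + Kv p) \<le> M \<longrightarrow>
     moves w wbar I (mul_all y ks Ks ps) (B M) (T, v, r)
       (T, v, r(1 := (c * (\<Prod>p\<leftarrow>ps. w p ^ kv p * wbar p ^ Kv p), s + (\<Sum>p\<leftarrow>ps. kv p + Kv p)))))"
proof (induction ps)
  case Nil
  show ?case by (intro exI[of _ "\<lambda>_. 1"]) (auto intro: moves_Skip[unfolded One_nat_def] simp: fun_upd_idem)
next
  case (Cons p ps)
  obtain B where B: "pow_bounded B" and B': "\<And>M I T v r c s kv Kv. r 1 = (c, s) \<Longrightarrow> v y = 0 \<Longrightarrow>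
     \<forall>p\<in>set ps. bnd M I T v (ks p) \<and> bnd M I T v (Ks p) \<and> eval I T v (ks p) = int (kv p) \<and> eval I T v (Ks p) = int (Kv p) \<Longrightarrow>
     s + (\<Sum>p\<leftarrow>ps. kv p + Kv p) \<le> M \<Longrightarrow>
     moves w wbar I (mul_all y ks Ks ps) (B M) (T, v, r)
       (T, v, r(1 := (c * (\<Prod>p\<leftarrow>ps. w p ^ kv p * wbar p ^ Kv p), s + (\<Sum>p\<leftarrow>ps. kv p + Kv p))))"
    using Cons.IH by (elim exE conjE) blast
  obtain B1 where B1: "pow_bounded B1" "\<And>M I T v r. bnd M I T v (ks p) \<Longrightarrow>
    moves w wbar I (assign y (ks p)) (B1 M) (T, v, r) (T, v(y := eval I T v (ks p)), r)"
    by (rule moves_assign[of "ks p" w wbar y]) (rule that, assumption, blast)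
  obtain B2 where B2: "pow_bounded B2" "\<And>M I T v r. bnd M I T v (Ks p) \<Longrightarrow>
    moves w wbar I (assign y (Ks p)) (B2 M) (T, v, r) (T, v(y := eval I T v (Ks p)), r)"
    by (rule moves_assign[of "Ks p" w wbar y]) (rule that, assumption, blast)
  obtain B3 where B3: "pow_bounded B3" "\<And>M I T v r c s k. r 1 = (c, s) \<Longrightarrow> s + k \<le> M \<Longrightarrow>
    moves w wbar I (mul_pow y (Wt p)) (B3 M) (T, v(y := int k), r) (T, v(y := 0), r(1 := (c * w p ^ k, s + k)))"
    by (rule moves_mul_pow[of "Wt p" p "w p" w wbar y]) (simp, rule that, assumption, blast)
  obtain B4 where B4: "pow_bounded B4" "\<And>M I T v r c s k. r 1 = (c, s) \<Longrightarrow> s + k \<le> M \<Longrightarrow>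
    moves w wbar I (mul_pow y (WtBar p)) (B4 M) (T, v(y := int k), r) (T, v(y := 0), r(1 := (c * wbar p ^ k, s + k)))"
    by (rule moves_mul_pow[of "WtBar p" p "wbar p" w wbar y]) (simp, rule that, assumption, blast)
  let ?B = "\<lambda>M. (B1 M + B3 M) + ((B2 M + B4 M) + B M)"
  show ?case
  proof (intro exI[of _ ?B] conjI allI impI)
    show "pow_bounded ?B" using B B1(1) B2(1) B3(1) B4(1) by simp
    fix M I T v and r :: nmem and c s and kv Kv :: "nat \<Rightarrow> nat"
    assume r: "r 1 = (c, s)" and y: "v y = 0"
      and e: "\<forall>q\<in>set (p # ps). bnd M I T v (ks q) \<and> bnd M I T v (Ks q) \<and> eval I T v (ks q) = int (kv q) \<and> eval I T v (Ks q) = int (Kv q)"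
      and s: "s + (\<Sum>q\<leftarrow>p # ps. kv q + Kv q) \<le> M"
    have vy: "v(y := 0) = v" using y by (simp add: fun_upd_idem)
    define r1 where "r1 = r(1 := (c * w p ^ kv p, s + kv p))"
    define r2 where "r2 = r1(1 := (c * w p ^ kv p * wbar p ^ Kv p, s + kv p + Kv p))"
    have 1: "moves w wbar I (Seq (assign y (ks p)) (mul_pow y (Wt p))) (B1 M + B3 M) (T, v, r) (T, v, r1)"
    proof (rule moves_Seq)
      show "moves w wbar I (assign y (ks p)) (B1 M) (T, v, r) (T, v(y := int (kv p)), r)"
        using B1(2)[of M I T v r] e by simp
      show "moves w wbar I (mul_pow y (Wt p)) (B3 M) (T, v(y := int (kv p)), r) (T, v, r1)"
        using B3(2)[of r c s "kv p" M I T v] r s by (simp add: vy r1_def)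
    qed
    have 2: "moves w wbar I (Seq (assign y (Ks p)) (mul_pow y (WtBar p))) (B2 M + B4 M) (T, v, r1) (T, v, r2)"
    proof (rule moves_Seq)
      show "moves w wbar I (assign y (Ks p)) (B2 M) (T, v, r1) (T, v(y := int (Kv p)), r1)"
        using B2(2)[of M I T v r1] e by simp
      show "moves w wbar I (mul_pow y (WtBar p)) (B4 M) (T, v(y := int (Kv p)), r1) (T, v, r2)"
        using B4(2)[of r1 "c * w p ^ kv p" "s + kv p" "Kv p" M I T v] s by (simp add: vy r1_def r2_def)
    qed
    have 3: "moves w wbar I (mul_all y ks Ks ps) (B M) (T, v, r2)
       (T, v, r2(1 := (c * w p ^ kv p * wbar p ^ Kv p * (\<Prod>p\<leftarrow>ps. w p ^ kv p * wbar p ^ Kv p),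
          s + kv p + Kv p + (\<Sum>p\<leftarrow>ps. kv p + Kv p))))"
      by (rule B') (use e s y in \<open>simp_all add: r2_def\<close>)
    show "moves w wbar I (mul_all y ks Ks (p # ps)) (?B M) (T, v, r)
       (T, v, r(1 := (c * (\<Prod>p\<leftarrow>p # ps. w p ^ kv p * wbar p ^ Kv p), s + (\<Sum>p\<leftarrow>p # ps. kv p + Kv p))))"
      using moves_Seq[OF 1 moves_Seq[OF 2 3]] by (simp add: r1_def r2_def mult_ac add_ac)
  qed
qed

section \<open>The overall program\<close>

text \<open>First the table is filled, then the main expression is evaluated, and finally the terms of
  the result are added up. Variables: 1 and 2 index and bound of the first loop, 3 the value of
  the main expression, 4 and 5 index and bound of the second loop, 6 an exponent.\<close>

definition term_prog :: "ex \<Rightarrow> (nat \<Rightarrow> ex) \<Rightarrow> (nat \<Rightarrow> ex) \<Rightarrow> nat \<Rightarrow> com" where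
  "term_prog Co ks Ks P = Seq (Seq (compile 0 Co) (NSet (Const 1) (OfInt (TC 0))))
     (Seq (mul_all 6 ks Ks [0..<P]) (NSet (Const 0) (NAdd (NCell (Const 0)) (NCell (Const 1)))))"

definition top_prog :: "ex \<Rightarrow> ex \<Rightarrow> ex \<Rightarrow> ex \<Rightarrow> ex \<Rightarrow> (nat \<Rightarrow> ex) \<Rightarrow> (nat \<Rightarrow> ex) \<Rightarrow> nat \<Rightarrow> com" where
  "top_prog Tb St Me Eb Co ks Ks P = Seq (assign 2 Tb) (Seq (for_loop 1 2 (store 1 St))
     (Seq (assign 3 Me) (Seq (assign 5 Eb) (for_loop 4 5 (term_prog Co ks Ks P)))))"

definition table_upto :: "(nat \<Rightarrow> int) \<Rightarrow> nat \<Rightarrow> int \<Rightarrow> int" where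
  "table_upto t i = (\<lambda>j. if 0 \<le> j \<and> j < int i then t (nat j) else 0)"

definition env1 :: "nat \<Rightarrow> nat \<Rightarrow> nat \<Rightarrow> int" where
  "env1 N i = (\<lambda>_. 0)(2 := int N, 1 := int i)"

definition env2 :: "nat \<Rightarrow> int \<Rightarrow> nat \<Rightarrow> nat \<Rightarrow> nat \<Rightarrow> int" where
  "env2 N z E e = (\<lambda>_. 0)(2 := int N, 1 := int N, 3 := z, 5 := int E, 4 := int e)"

definition add_term :: "real \<Rightarrow> nat \<Rightarrow> nmem \<Rightarrow> nmem" where
  "add_term x z r = r(1 := (x, z), 0 := (fst (r 0) + x, Suc (max (snd (r 0)) z)))"

lemma moves_term_prog:
  "\<exists>B. pow_bounded B \<and> (\<forall>M I T v r kv Kv a s. r 0 = (a, s) \<longrightarrow> v 6 = 0 \<longrightarrow> bnd M I T v Co \<longrightarrow>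
     (\<forall>p<P. bnd M I T v (ks p) \<and> bnd M I T v (Ks p) \<and> eval I T v (ks p) = int (kv p) \<and> eval I T v (Ks p) = int (Kv p)) \<longrightarrow>
     (\<Sum>p<P. kv p + Kv p) \<le> M \<longrightarrow> s \<le> M \<longrightarrow>
     moves w wbar I (term_prog Co ks Ks P) (B M) (T, v, r)
       (T, v, add_term (of_int (eval I T v Co) * (\<Prod>p<P. w p ^ kv p * wbar p ^ Kv p))
         (len (eval I T v Co) + (\<Sum>p<P. kv p + Kv p)) r))"
proof -
  obtain B where B: "pow_bounded B" "\<And>M I T v m r. state_is I T v m \<Longrightarrow> bnd M I T v Co \<Longrightarrow>
    \<exists>m'. runs w wbar (compile 0 Co) (m, r) (B M) (m', r) \<and> m' (ta 0) = eval I T v Co \<and> state_is I T v m'"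
    by (rule compile_run[of Co w wbar]) (rule that, assumption, blast)
  obtain B1 where B1: "pow_bounded B1" and B1': "\<And>M I T v r c s kv Kv. r 1 = (c, s) \<Longrightarrow> v 6 = 0 \<Longrightarrow>
     \<forall>p\<in>set [0..<P]. bnd M I T v (ks p) \<and> bnd M I T v (Ks p) \<and> eval I T v (ks p) = int (kv p) \<and> eval I T v (Ks p) = int (Kv p) \<Longrightarrow>
     s + (\<Sum>p\<leftarrow>[0..<P]. kv p + Kv p) \<le> M \<Longrightarrow>
     moves w wbar I (mul_all 6 ks Ks [0..<P]) (B1 M) (T, v, r)
       (T, v, r(1 := (c * (\<Prod>p\<leftarrow>[0..<P]. w p ^ kv p * wbar p ^ Kv p), s + (\<Sum>p\<leftarrow>[0..<P]. kv p + Kv p))))"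
    using moves_mul_all[where y = 6 and ps = "[0..<P]" and ks = ks and Ks = Ks and w = w and wbar = wbar] by (elim exE conjE) blast
  let ?C = "\<lambda>M. len 1 + len (ta 0) + 2 * Suc M" and ?D = "\<lambda>M. 2 * len 0 + len 1 + 10 * M + 10"
  let ?B = "\<lambda>M. (B M + ?C M) + (B1 (2 * M + 1) + ?D M)"
  show ?thesis
  proof (intro exI[of _ ?B] conjI allI impI)
    show "pow_bounded ?B" using B(1) pow_bounded_compose[OF B1, of "\<lambda>M. 2 * M + 1"] by simp
    fix M I T v and r :: nmem and kv Kv :: "nat \<Rightarrow> nat" and a s
    assume r: "r 0 = (a, s)" and v6: "v 6 = 0" and bC: "bnd M I T v Co"
      and bk: "\<forall>p<P. bnd M I T v (ks p) \<and> bnd M I T v (Ks p) \<and> eval I T v (ks p) = int (kv p) \<and> eval I T v (Ks p) = int (Kv p)"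
      and sk: "(\<Sum>p<P. kv p + Kv p) \<le> M" and s: "s \<le> M"
    let ?c = "eval I T v Co"
    have lc: "len ?c \<le> Suc M" by (rule len_le[OF bnd_fits[OF bC]])
    define r1 where "r1 = r(1 := (of_int ?c :: real, len ?c))"
    have 1: "moves w wbar I (Seq (compile 0 Co) (NSet (Const 1) (OfInt (TC 0)))) (B M + ?C M) (T, v, r) (T, v, r1)"
      unfolding moves_def fst_conv snd_conv
    proof (intro allI impI)
      fix m assume "state_is I T v m"
      then obtain m' where m': "runs w wbar (compile 0 Co) (m, r) (B M) (m', r)" "m' (ta 0) = ?c" "state_is I T v m'"
        using B(2) bC by blast
      have "runs w wbar (NSet (Const 1) (OfInt (TC 0))) (m', r) (?C M) (m', r1)"
        using runs_NSet[of m' "Const 1" r "OfInt (TC 0)" "?C M" w wbar] lc by (simp add: m'(2) r1_def)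
      then show "\<exists>m'. runs w wbar (Seq (compile 0 Co) (NSet (Const 1) (OfInt (TC 0)))) (m, r) (B M + ?C M) (m', r1) \<and> state_is I T v m'"
        using runs_Seq[OF m'(1)] m'(3) by blast
    qed
    have ls: "(\<Sum>p\<leftarrow>[0..<P]. kv p + Kv p) = (\<Sum>p<P. kv p + Kv p)"
      by (simp add: interv_sum_list_conv_sum_set_nat lessThan_atLeast0)
    have lp: "(\<Prod>p\<leftarrow>[0..<P]. w p ^ kv p * wbar p ^ Kv p) = (\<Prod>p<P. w p ^ kv p * wbar p ^ Kv p)"
      by (simp add: prod.distinct_set_conv_list[symmetric] lessThan_atLeast0)
    let ?z = "of_int ?c * (\<Prod>p<P. w p ^ kv p * wbar p ^ Kv p)" and ?s = "len ?c + (\<Sum>p<P. kv p + Kv p)"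
    define r2 where "r2 = r(1 := (?z, ?s))"
    have bk': "\<forall>p\<in>set [0..<P]. bnd (2 * M + 1) I T v (ks p) \<and> bnd (2 * M + 1) I T v (Ks p) \<and> eval I T v (ks p) = int (kv p) \<and> eval I T v (Ks p) = int (Kv p)"
      using bk by (auto intro: bnd_mono[where M = M])
    have 2: "moves w wbar I (mul_all 6 ks Ks [0..<P]) (B1 (2 * M + 1)) (T, v, r1) (T, v, r2)"
      using B1'[of r1 "of_int ?c" "len ?c" v "2 * M + 1" I T kv Kv] v6 bk' lc sk unfolding ls lp by (simp add: r1_def r2_def)
    define r3 where "r3 = r(1 := (?z, ?s), 0 := (a + ?z, Suc (max s ?s)))"
    have 3: "moves w wbar I (NSet (Const 0) (NAdd (NCell (Const 0)) (NCell (Const 1)))) (?D M) (T, v, r2) (T, v, r3)"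
      unfolding r3_def r2_def
      by (rule moves_NSet) (use r lc sk s in \<open>simp add: r2_def\<close>)
    have "moves w wbar I (term_prog Co ks Ks P) (?B M) (T, v, r) (T, v, r3)"
      unfolding term_prog_def by (rule moves_Seq[OF 1 moves_Seq[OF 2 3]])
    moreover have "r3 = add_term ?z ?s r" using r by (simp add: r3_def add_term_def)
    ultimately show "moves w wbar I (term_prog Co ks Ks P) (?B M) (T, v, r) (T, v, add_term ?z ?s r)" by simp
  qed
qed

text \<open>The expressions are parameters; all that is asked is that each is bounded by
  \<open>D\<close> and has the right value in precisely the contexts that occur. All intended values
  are functions of the input alone.\<close>

theorem top_prog_correct:
  fixes S :: "(nat \<times> (int \<Rightarrow> int)) set" and tbn eb :: "(int \<Rightarrow> int) \<Rightarrow> nat" and tbl :: "(int \<Rightarrow> int) \<Rightarrow> nat \<Rightarrow> int"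
    and me :: "(int \<Rightarrow> int) \<Rightarrow> int" and co :: "(int \<Rightarrow> int) \<Rightarrow> nat \<Rightarrow> int" and kv Kv :: "(int \<Rightarrow> int) \<Rightarrow> nat \<Rightarrow> nat \<Rightarrow> nat"
  assumes D: "pow_bounded D"
    and Tb: "\<And>N I. (N, I) \<in> S \<Longrightarrow> bnd (D N) I (\<lambda>_. 0) (\<lambda>_. 0) Tb \<and> eval I (\<lambda>_. 0) (\<lambda>_. 0) Tb = int (tbn I) \<and> tbn I \<le> D N"
    and St: "\<And>N I i. (N, I) \<in> S \<Longrightarrow> i < tbn I \<Longrightarrow> bnd (D N) I (table_upto (tbl I) i) (env1 (tbn I) i) St \<and>
      eval I (table_upto (tbl I) i) (env1 (tbn I) i) St = tbl I i"
    and Me: "\<And>N I. (N, I) \<in> S \<Longrightarrow> bnd (D N) I (table_upto (tbl I) (tbn I)) (env1 (tbn I) (tbn I)) Me \<and>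
      eval I (table_upto (tbl I) (tbn I)) (env1 (tbn I) (tbn I)) Me = me I"
    and Eb: "\<And>N I. (N, I) \<in> S \<Longrightarrow> bnd (D N) I (table_upto (tbl I) (tbn I)) (env2 (tbn I) (me I) 0 0) Eb \<and>
      eval I (table_upto (tbl I) (tbn I)) (env2 (tbn I) (me I) 0 0) Eb = int (eb I) \<and> eb I \<le> D N"
    and Co: "\<And>N I e. (N, I) \<in> S \<Longrightarrow> e < eb I \<Longrightarrow> bnd (D N) I (table_upto (tbl I) (tbn I)) (env2 (tbn I) (me I) (eb I) e) Co \<and>
      eval I (table_upto (tbl I) (tbn I)) (env2 (tbn I) (me I) (eb I) e) Co = co I e"
    and Ks: "\<And>N I e p. (N, I) \<in> S \<Longrightarrow> e < eb I \<Longrightarrow> p < P \<Longrightarrow>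
      bnd (D N) I (table_upto (tbl I) (tbn I)) (env2 (tbn I) (me I) (eb I) e) (ks p) \<and>
      eval I (table_upto (tbl I) (tbn I)) (env2 (tbn I) (me I) (eb I) e) (ks p) = int (kv I e p) \<and> kv I e p \<le> D N \<and>
      bnd (D N) I (table_upto (tbl I) (tbn I)) (env2 (tbn I) (me I) (eb I) e) (Ks p) \<and>
      eval I (table_upto (tbl I) (tbn I)) (env2 (tbn I) (me I) (eb I) e) (Ks p) = int (Kv I e p) \<and> Kv I e p \<le> D N"
  obtains B where "pow_bounded B" "\<And>N I m. (N, I) \<in> S \<Longrightarrow> inp_of m = I \<Longrightarrow> (\<And>a. a < 0 \<Longrightarrow> m a = 0) \<Longrightarrow>
    \<exists>m' r'. runs w wbar (top_prog Tb St Me Eb Co ks Ks P) (m, \<lambda>_. (0, 1)) (B N) (m', r') \<and>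
      fst (r' 0) = (\<Sum>e<eb I. of_int (co I e) * (\<Prod>p<P. w p ^ kv I e p * wbar p ^ Kv I e p))"
proof -
  obtain B1 where B1: "pow_bounded B1" "\<And>M I T v r. bnd M I T v Tb \<Longrightarrow>
    moves w wbar I (assign 2 Tb) (B1 M) (T, v, r) (T, v(2 := eval I T v Tb), r)"
    by (rule moves_assign[of Tb w wbar 2]) (rule that, assumption, blast)
  obtain B2 where B2: "pow_bounded B2" "\<And>M I T v r. bnd M I T v St \<Longrightarrow> fits M (v 1) \<Longrightarrow> v 1 \<ge> 0 \<Longrightarrow>
    moves w wbar I (store 1 St) (B2 M) (T, v, r) (T(v 1 := eval I T v St), v, r)"
    by (rule moves_store[of St 1 w wbar]) (rule that, assumption, blast)
  obtain B3 where B3: "pow_bounded B3" "\<And>M I C n T v r c. n \<le> M \<Longrightarrow>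
    (\<And>k. k \<le> n \<Longrightarrow> v k 1 = int k \<and> v k 2 = int n) \<Longrightarrow>
    (\<And>k. k < n \<Longrightarrow> moves w wbar I c C (T k, v k, r k) (T (Suc k), (v (Suc k))(1 := int k), r (Suc k))) \<Longrightarrow>
    moves w wbar I (for_loop 1 2 c) (M * (C + B3 M) + B3 M) (T 0, v 0, r 0) (T n, v n, r n)"
    by (rule moves_for_loop[of 1 2 w wbar]) (rule that, assumption, blast)
  obtain B4 where B4: "pow_bounded B4" "\<And>M I T v r. bnd M I T v Me \<Longrightarrow>
    moves w wbar I (assign 3 Me) (B4 M) (T, v, r) (T, v(3 := eval I T v Me), r)"
    by (rule moves_assign[of Me w wbar 3]) (rule that, assumption, blast)
  obtain B5 where B5: "pow_bounded B5" "\<And>M I T v r. bnd M I T v Eb \<Longrightarrow>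
    moves w wbar I (assign 5 Eb) (B5 M) (T, v, r) (T, v(5 := eval I T v Eb), r)"
    by (rule moves_assign[of Eb w wbar 5]) (rule that, assumption, blast)
  obtain B6 where B6: "pow_bounded B6" "\<And>M I C n T v r c. n \<le> M \<Longrightarrow>
    (\<And>k. k \<le> n \<Longrightarrow> v k 4 = int k \<and> v k 5 = int n) \<Longrightarrow>
    (\<And>k. k < n \<Longrightarrow> moves w wbar I c C (T k, v k, r k) (T (Suc k), (v (Suc k))(4 := int k), r (Suc k))) \<Longrightarrow>
    moves w wbar I (for_loop 4 5 c) (M * (C + B6 M) + B6 M) (T 0, v 0, r 0) (T n, v n, r n)"
    by (rule moves_for_loop[of 4 5 w wbar]) (rule that, assumption, blast)
  obtain B7 where B7: "pow_bounded B7" and B7': "\<And>M I T v r kv Kv a s. r 0 = (a, s) \<Longrightarrow> v 6 = 0 \<Longrightarrow> bnd M I T v Co \<Longrightarrow>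
     \<forall>p<P. bnd M I T v (ks p) \<and> bnd M I T v (Ks p) \<and> eval I T v (ks p) = int (kv p) \<and> eval I T v (Ks p) = int (Kv p) \<Longrightarrow>
     (\<Sum>p<P. kv p + Kv p) \<le> M \<Longrightarrow> s \<le> M \<Longrightarrow>
     moves w wbar I (term_prog Co ks Ks P) (B7 M) (T, v, r)
       (T, v, add_term (of_int (eval I T v Co) * (\<Prod>p<P. w p ^ kv p * wbar p ^ Kv p))
         (len (eval I T v Co) + (\<Sum>p<P. kv p + Kv p)) r)"
    using moves_term_prog[where w = w and wbar = wbar and Co = Co and ks = ks and Ks = Ks and P = P] by (elim exE conjE) blast
  \<comment> \<open>A bound on the size of a term: about \<open>M\<close> bits for the integer
    coefficient and 1 for each of at most \<open>2 * P * M\<close> multiplications by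
    weights.\<close>
  define L where "L = (\<lambda>M. Suc (Suc M) + 2 * P * M)"
  define G where "G = (\<lambda>M. M + L M)"
  have G: "pow_bounded G" unfolding G_def L_def by simp
  define B where "B = (\<lambda>N. let M = D N in B1 M + ((M * (B2 M + B3 M) + B3 M) + (B4 M + (B5 M + (M * (B7 (G M) + B6 M) + B6 M)))))"
  have "pow_bounded B"
    unfolding B_def Let_def using pow_bounded_compose[OF B1(1) D] pow_bounded_compose[OF B2(1) D] pow_bounded_compose[OF B3(1) D]
      pow_bounded_compose[OF B4(1) D] pow_bounded_compose[OF B5(1) D] pow_bounded_compose[OF B6(1) D]
      pow_bounded_compose[OF B7 pow_bounded_compose[OF G D]] D by simp
  moreover have "\<exists>m' r'. runs w wbar (top_prog Tb St Me Eb Co ks Ks P) (m, \<lambda>_. (0, 1)) (B N) (m', r') \<and>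
      fst (r' 0) = (\<Sum>e<eb I. of_int (co I e) * (\<Prod>p<P. w p ^ kv I e p * wbar p ^ Kv I e p))"
    if S: "(N, I) \<in> S" and m: "inp_of m = I" "\<And>a. a < 0 \<Longrightarrow> m a = 0" for N I m
  proof -
    define M where "M = D N"
    note Tb = Tb[OF S, folded M_def] and St = St[OF S, folded M_def] and Me = Me[OF S, folded M_def]
      and Eb = Eb[OF S, folded M_def] and Co = Co[OF S, folded M_def] and Ks = Ks[OF S, folded M_def]
    let ?t = "tbn I" and ?E = "eb I" and ?T = "table_upto (tbl I) (tbn I)"
    let ?r0 = "\<lambda>_ :: int. (0 :: real, 1 :: nat)"
    let ?val = "\<lambda>e. of_int (co I e) * (\<Prod>p<P. w p ^ kv I e p * wbar p ^ Kv I e p)"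
    have kf: "fits M (int k)" if "k < M" for k
    proof -
      have "int k < int M" using that by simp
      also have "\<dots> < 2 ^ M" by (rule of_nat_less_two_power)
      finally show ?thesis by simp
    qed
    have s0: "state_is I (\<lambda>_. 0) (\<lambda>_. 0) m"
    proof -
      have "tb i < 0" if "i \<ge> 0" for i using that by (simp add: tb_def)
      moreover have "va x < 0" for x by (simp add: va_def)
      ultimately show ?thesis using m by (auto simp: state_is_def tab_of_def env_of_def fun_eq_iff)
    qed
    have 1: "moves w wbar I (assign 2 Tb) (B1 M) (\<lambda>_. 0, \<lambda>_. 0, ?r0) (table_upto (tbl I) 0, env1 ?t 0, ?r0)"
    proof -
      have "table_upto (tbl I) 0 = (\<lambda>_. 0)" by (auto simp: table_upto_def)
      moreover have "env1 ?t 0 = (\<lambda>_. 0)(2 := int ?t)" by (auto simp: env1_def)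
      ultimately show ?thesis using B1(2)[of M I "\<lambda>_. 0" "\<lambda>_. 0" ?r0] Tb by simp
    qed
    have 2: "moves w wbar I (for_loop 1 2 (store 1 St)) (M * (B2 M + B3 M) + B3 M)
        (table_upto (tbl I) 0, env1 ?t 0, ?r0) (?T, env1 ?t ?t, ?r0)"
    proof (rule B3(2)[where T = "table_upto (tbl I)" and v = "env1 ?t" and r = "\<lambda>_. ?r0"])
      show "?t \<le> M" using Tb by blast
      show "env1 ?t k 1 = int k \<and> env1 ?t k 2 = int ?t" if "k \<le> ?t" for k by (simp add: env1_def)
      fix k assume k: "k < ?t"
      have "(table_upto (tbl I) k)(int k := tbl I k) = table_upto (tbl I) (Suc k)"
        by (auto simp: table_upto_def fun_eq_iff less_Suc_eq)
      moreover have "(env1 ?t (Suc k))(1 := int k) = env1 ?t k" by (auto simp: env1_def)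
      moreover have "fits M (env1 ?t k 1)" "env1 ?t k 1 = int k" using kf[of k] k Tb by (auto simp: env1_def)
      ultimately show "moves w wbar I (store 1 St) (B2 M) (table_upto (tbl I) k, env1 ?t k, ?r0)
          (table_upto (tbl I) (Suc k), (env1 ?t (Suc k))(1 := int k), ?r0)"
        using B2(2)[of M I "table_upto (tbl I) k" "env1 ?t k" ?r0] St[OF k] by simp
    qed
    have 3: "moves w wbar I (assign 3 Me) (B4 M) (?T, env1 ?t ?t, ?r0) (?T, env2 ?t (me I) 0 0, ?r0)"
    proof -
      have "env2 ?t (me I) 0 0 = (env1 ?t ?t)(3 := me I)" by (auto simp: env1_def env2_def)
      then show ?thesis using B4(2)[of M I ?T "env1 ?t ?t" ?r0] Me by simp
    qed
    have 4: "moves w wbar I (assign 5 Eb) (B5 M) (?T, env2 ?t (me I) 0 0, ?r0) (?T, env2 ?t (me I) ?E 0, ?r0)"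
    proof -
      have "env2 ?t (me I) ?E 0 = (env2 ?t (me I) 0 0)(5 := int ?E)" by (auto simp: env2_def)
      then show ?thesis using B5(2)[of M I ?T "env2 ?t (me I) 0 0" ?r0] Eb by simp
    qed
    let ?sz = "\<lambda>e. len (co I e) + (\<Sum>p<P. kv I e p + Kv I e p)"
    define rr where "rr = rec_nat ?r0 (\<lambda>e. add_term (?val e) (?sz e))"
    have rr: "rr 0 = ?r0" "rr (Suc e) = add_term (?val e) (?sz e) (rr e)" for e by (simp_all add: rr_def)
    have val: "fst (rr e 0) = (\<Sum>i<e. ?val i)" for e
      by (induction e) (simp_all add: rr add_term_def)
    have sz: "?sz e \<le> Suc M + 2 * P * M" "(\<Sum>p<P. kv I e p + Kv I e p) \<le> 2 * P * M" if e: "e < ?E" for e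
    proof -
      have "(\<Sum>p<P. kv I e p + Kv I e p) \<le> (\<Sum>p<P. 2 * M)"
      proof (rule sum_mono)
        fix p assume "p \<in> {..<P}"
        then show "kv I e p + Kv I e p \<le> 2 * M" using Ks[OF e, of p] by simp
      qed
      then show *: "(\<Sum>p<P. kv I e p + Kv I e p) \<le> 2 * P * M" by (simp add: mult_ac)
      have "fits M (co I e)" using bnd_fits[of M I ?T _ Co] Co[OF e] by metis
      then show "?sz e \<le> Suc M + 2 * P * M" using len_le[of "co I e" M] * by simp
    qed
    \<comment> \<open>Addition has the size of its larger operand plus one, so the running sum grows
      by at most one per term beyond the largest term.\<close>
    have snd_rr: "snd (rr e 0) \<le> L M + e" if "e \<le> ?E" for e
      using that
    proof (induction e)
      case (Suc e)
      then show ?case using sz(1)[of e] by (simp add: rr add_term_def L_def)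
    qed (simp add: rr L_def)
    have 5: "moves w wbar I (for_loop 4 5 (term_prog Co ks Ks P)) (M * (B7 (G M) + B6 M) + B6 M)
       (?T, env2 ?t (me I) ?E 0, rr 0) (?T, env2 ?t (me I) ?E ?E, rr ?E)"
    proof (rule B6(2)[where T = "\<lambda>_. ?T" and v = "env2 ?t (me I) ?E" and r = rr])
      show "?E \<le> M" using Eb by blast
      show "env2 ?t (me I) ?E k 4 = int k \<and> env2 ?t (me I) ?E k 5 = int ?E" if "k \<le> ?E" for k by (simp add: env2_def)
      fix e assume e: "e < ?E"
      have HG: "M \<le> G M" by (simp add: G_def)
      have 1: "bnd (G M) I ?T (env2 ?t (me I) ?E e) Co" "eval I ?T (env2 ?t (me I) ?E e) Co = co I e"
        using Co[OF e] bnd_mono[OF _ HG] by auto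
      have 2: "\<forall>p<P. bnd (G M) I ?T (env2 ?t (me I) ?E e) (ks p) \<and> bnd (G M) I ?T (env2 ?t (me I) ?E e) (Ks p) \<and>
         eval I ?T (env2 ?t (me I) ?E e) (ks p) = int (kv I e p) \<and> eval I ?T (env2 ?t (me I) ?E e) (Ks p) = int (Kv I e p)"
        using Ks[OF e] bnd_mono[OF _ HG] by blast
      have 3: "(\<Sum>p<P. kv I e p + Kv I e p) \<le> G M" using sz(2)[OF e] by (simp add: G_def L_def)
      have v6: "env2 ?t (me I) ?E e 6 = 0" by (simp add: env2_def)
      have 4: "snd (rr e 0) \<le> G M" using snd_rr[of e] e Eb by (simp add: G_def)
      have "(env2 ?t (me I) ?E (Suc e))(4 := int e) = env2 ?t (me I) ?E e" by (auto simp: env2_def)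
      then show "moves w wbar I (term_prog Co ks Ks P) (B7 (G M)) (?T, env2 ?t (me I) ?E e, rr e)
          (?T, (env2 ?t (me I) ?E (Suc e))(4 := int e), rr (Suc e))"
        using B7'[where kv = "kv I e" and Kv = "Kv I e" and r = "rr e" and v = "env2 ?t (me I) ?E e" and M = "G M" and I = I and T = ?T, OF surjective_pairing[of "rr e 0"] v6 1(1) 2 3 4] unfolding 1(2) rr by simp
    qed
    have r0: "rr 0 = ?r0" by (simp add: rr)
    have "moves w wbar I (top_prog Tb St Me Eb Co ks Ks P) (B N) (\<lambda>_. 0, \<lambda>_. 0, ?r0) (?T, env2 ?t (me I) ?E ?E, rr ?E)"
      unfolding top_prog_def B_def Let_def M_def[symmetric]
      by (rule moves_Seq[OF 1 moves_Seq[OF 2 moves_Seq[OF 3 moves_Seq[OF 4 5[unfolded r0]]]]])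
    then obtain m' where "runs w wbar (top_prog Tb St Me Eb Co ks Ks P) (m, ?r0) (B N) (m', rr ?E)"
      unfolding moves_def using s0 by auto
    then show ?thesis using val[of ?E] by blast
  qed
  ultimately show thesis by (rule that)
qed

section \<open>Expressions for sums and products over finite sets\<close>

text \<open>An arbitrary enumeration is good enough: it only determines the text of the program,
  which may depend on everything that is fixed.\<close>

definition lst :: "'a set \<Rightarrow> 'a list" where
  "lst S = (SOME xs. set xs = S \<and> distinct xs)"

lemma lst: "finite S \<Longrightarrow> set (lst S) = S" "finite S \<Longrightarrow> distinct (lst S)"
proof -
  assume "finite S"
  then have "\<exists>xs. set xs = S \<and> distinct xs" by (rule finite_distinct_list)
  then have "set (lst S) = S \<and> distinct (lst S)" unfolding lst_def by (rule someI_ex)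
  then show "set (lst S) = S" "distinct (lst S)" by auto
qed

definition ESumS :: "'a set \<Rightarrow> ('a \<Rightarrow> ex) \<Rightarrow> ex" where
  "ESumS S f = foldr EAdd (map f (lst S)) (ELit 0)"

definition EProdS :: "'a set \<Rightarrow> ('a \<Rightarrow> ex) \<Rightarrow> ex" where
  "EProdS S f = foldr EMul (map f (lst S)) (ELit 1)"

lemma eval_ESumS [simp]: "finite S \<Longrightarrow> eval I T v (ESumS S f) = (\<Sum>s\<in>S. eval I T v (f s))"
proof -
  have "eval I T v (foldr EAdd (map f xs) (ELit 0)) = (\<Sum>s\<leftarrow>xs. eval I T v (f s))" for xs
    by (induction xs) auto
  then show "finite S \<Longrightarrow> ?thesis" by (simp add: ESumS_def lst sum_list_distinct_conv_sum_set)
qed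

lemma eval_EProdS [simp]: "finite S \<Longrightarrow> eval I T v (EProdS S f) = (\<Prod>s\<in>S. eval I T v (f s))"
proof -
  have "eval I T v (foldr EMul (map f xs) (ELit 1)) = (\<Prod>s\<leftarrow>xs. eval I T v (f s))" for xs
    by (induction xs) auto
  then show "finite S \<Longrightarrow> ?thesis" by (simp add: EProdS_def lst prod.distinct_set_conv_list[symmetric])
qed

lemma safe_ESumS [simp]: "finite S \<Longrightarrow> safe_ex A (ESumS S f) \<longleftrightarrow> (\<forall>s\<in>S. safe_ex A (f s))"
proof -
  have "safe_ex A (foldr EAdd (map f xs) (ELit 0)) \<longleftrightarrow> (\<forall>s\<in>set xs. safe_ex A (f s))" for xs
    by (induction xs) auto
  then show "finite S \<Longrightarrow> ?thesis" by (simp add: ESumS_def lst)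
qed

lemma safe_EProdS [simp]: "finite S \<Longrightarrow> safe_ex A (EProdS S f) \<longleftrightarrow> (\<forall>s\<in>S. safe_ex A (f s))"
proof -
  have "safe_ex A (foldr EMul (map f xs) (ELit 1)) \<longleftrightarrow> (\<forall>s\<in>set xs. safe_ex A (f s))" for xs
    by (induction xs) auto
  then show "finite S \<Longrightarrow> ?thesis" by (simp add: EProdS_def lst)
qed

definition EEq :: "ex \<Rightarrow> ex \<Rightarrow> ex" where
  "EEq a b = EIf (ESub a b) (ELit 0) (EIf (ESub b a) (ELit 0) (ELit 1))"

definition EPos :: "ex \<Rightarrow> ex" where
  "EPos a = EIf a (ELit 1) (ELit 0)"

definition EDig :: "ex \<Rightarrow> ex \<Rightarrow> ex \<Rightarrow> ex" where
  "EDig b e i = EMod (EDiv e (EPow b i)) b"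

lemma EEq_simps [simp]:
  "eval I T v (EEq a b) = (if eval I T v a = eval I T v b then 1 else 0)"
  "small_ex A (EEq a b)" "safe_ex A (EEq a b) \<longleftrightarrow> safe_ex A a \<and> safe_ex A b"
  by (auto simp: EEq_def)

lemma EPos_simps [simp]:
  "eval I T v (EPos a) = (if eval I T v a > 0 then 1 else 0)"
  "small_ex A (EPos a)" "safe_ex A (EPos a) \<longleftrightarrow> safe_ex A a"
  by (auto simp: EPos_def)

lemma EDig_simps [simp]:
  "small_ex A (EDig b e i) \<longleftrightarrow> small_ex A e \<and> small_ex A b"
  "safe_ex A (EDig b e i) \<longleftrightarrow> safe_ex A e \<and> safe_ex A b \<and> safe_ex A i \<and> small_ex A i"
  by (auto simp: EDig_def)

lemma eval_EDig:
  "eval I T v b = int b' \<Longrightarrow> eval I T v e = int e' \<Longrightarrow> eval I T v i = int i' \<Longrightarrow>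
   eval I T v (EDig b e i) = int (digit b' e' i')"
  by (simp add: EDig_def digit_def zdiv_int zmod_int)

section \<open>The program for a fixed sentence\<close>

locale sentence =
  fixes ar :: vocab and \<Phi> :: fm and R :: nat
  assumes wf: "well_formed ar \<Phi>" and closed: "free_vars \<Phi> = {}" and R: "R < length ar" "ar ! R = 2"
begin

abbreviation "P \<equiv> length ar"
abbreviation "cI \<equiv> card (qsubs \<Phi>)"
text \<open>A common threshold for all quantifiers; the sum avoids a maximum over a possibly empty
  set.\<close>

definition "K = (\<Sum>Q\<in>qsubs \<Phi>. qbound Q)"
definition "preds0 = {p. p < length ar \<and> ar ! p = 0}"
definition "oms = lst (Pow preds0)"
definition "W = length oms"
definition "lbl \<omega> = lst (labs ar \<Phi> R K \<omega>)"
definition "nlab \<omega> = length (lbl \<omega>)"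
text \<open>The same number of digits for every \<open>\<omega>\<close>, so that all codes live in
  one table. Codes with a nonzero digit beyond \<open>nlab \<omega>\<close> belong to no
  labelling.\<close>

definition "L = (\<Sum>\<omega>\<in>Pow preds0. nlab \<omega>)"

lemma finite_preds0 [simp]: "finite preds0" by (simp add: preds0_def)

lemma oms: "set oms = Pow preds0" "distinct oms" unfolding oms_def by (simp_all add: lst)

lemma W_pos: "W > 0"
proof -
  have "oms \<noteq> []" using oms(1) by (metis Pow_not_empty list.set(1))
  then show ?thesis by (simp add: W_def)
qed

lemma oms_nth: "i < W \<Longrightarrow> oms ! i \<subseteq> preds0" using oms(1) nth_mem[of i oms] by (auto simp: W_def)

lemma nlab_le: "\<omega> \<subseteq> preds0 \<Longrightarrow> nlab \<omega> \<le> L"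
  unfolding L_def by (rule member_le_sum) auto

lemma K: "Q \<in> qsubs \<Phi> \<Longrightarrow> qbound Q \<le> K"
  unfolding K_def by (rule member_le_sum) auto

text \<open>Every predicate has fewer than \<open>vM n\<close> true ground atoms, the vector of these numbers is coded in
  base \<open>vM n\<close> by a number below \<open>vE n\<close>, and there are fewer than \<open>vU n\<close> worlds.\<close>

definition "vM n = Suc n ^ sum_list ar + 1"
definition "vU n = (2::nat) ^ (P * vM n + 1)"
definition "vE n = vM n ^ P"
definition "vF n = (fact K :: nat) ^ (n * cI)"
text \<open>The value for the variable \<open>x\<close>. It exceeds \<open>vF n\<close> times the
  generating number of all good worlds, so the lowest coefficient can be read off as a
  digit.\<close>

definition "vX n = vF n * vU n ^ vE n"
text \<open>The integer in place of the weight of \<open>p\<close>. The product over the true atoms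
  of a world becomes \<open>vU n\<close> to the code of its count vector.\<close>

definition "vu n p = vU n ^ vM n ^ p"

text \<open>Names beginning with \<open>x\<close> denote expressions; \<open>xM\<close>,
  \<open>xU\<close>, \<open>xE\<close>, \<open>xF\<close>, \<open>xX\<close> and \<open>xu\<close>
  evaluate to the numbers \<open>vM\<close>, \<open>vU\<close>, \<open>vE\<close>,
  \<open>vF\<close>, \<open>vX\<close> and \<open>vu\<close>.\<close>

abbreviation "xN \<equiv> EInp (ELit 0)"
abbreviation "xG \<equiv> EInp (ELit 1)"
definition "xB = EAdd xN (ELit 1)"
definition "xM = EAdd (EPow xB (ELit (int (sum_list ar)))) (ELit 1)"
definition "xU = EPow (ELit 2) (EAdd (EMul (ELit (int P)) xM) (ELit 1))"
definition "xE = EPow xM (ELit (int P))"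
definition "xF = EPow (ELit (fact K)) (EMul xN (ELit (int cI)))"
definition "xX = EMul xF (EPow xU xE)"
definition "xu p = EPow xU (EPow xM (ELit (int p)))"

definition "xbase j = (if j \<le> K then EMul (ELit (int j)) xX else ELit 1)"
definition "xcoeff f j = (if j \<le> K
   then ESumS {j..K} (\<lambda>k. EMul (ELit ((of_bool (f k) - of_bool (f (Suc K))) *
       (fact K div fact k) * ((- 1) ^ (k - j) * int (k choose j)))) (EPow xX (ELit (int (K - k)))))
   else EMul (ELit (fact K * of_bool (f (Suc K)))) (EPow xX (ELit (int K))))"
definition "xlab \<omega> l = EMul (EProdS (fst (fst l)) xu)
   (EProdS (qsubs \<Phi>) (\<lambda>Q. xcoeff (deg_ok \<omega> (fst (fst l)) (snd (fst l)) Q) (snd l Q)))"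
definition "xpair \<omega> l l' s = EMul (EProdS s (\<lambda>a. xu (fst a))) (EProdS (qsubs \<Phi>) (\<lambda>Q. EMul
     (if edge \<omega> (vpair (fst (fst l)) (fst (fst l'))) (vpair (snd (fst l)) (snd (fst l'))) s Q X
      then xbase (snd l Q) else ELit 1)
     (if edge \<omega> (vpair (fst (fst l)) (fst (fst l'))) (vpair (snd (fst l)) (snd (fst l'))) s Q Y
      then xbase (snd l' Q) else ELit 1)))"
definition "xa \<omega> i j = ESumS (types_no_edge ar R) (xpair \<omega> (lbl \<omega> ! i) (lbl \<omega> ! j))"
definition "xb \<omega> i j = ESumS (types_edge ar R) (xpair \<omega> (lbl \<omega> ! i) (lbl \<omega> ! j))"
definition "va_wt n \<omega> i j = types_weight (types_no_edge ar R) K (int (vX n)) (\<lambda>p. int (vu n p)) \<Phi> \<omega> (lbl \<omega> ! i) (lbl \<omega> ! j)"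
definition "vb_wt n \<omega> i j = types_weight (types_edge ar R) K (int (vX n)) (\<lambda>p. int (vu n p)) \<Phi> \<omega> (lbl \<omega> ! i) (lbl \<omega> ! j)"

definition "xdig i e = EDig xB e (ELit (int i))"
definition "xinner \<omega> e = EProdS {..<L} (\<lambda>i. EMul
   (EPow (xa \<omega> i i) (EDiv (EMul (xdig i e) (ESub (xdig i e) (ELit 1))) (ELit 2)))
   (EProdS {..<i} (\<lambda>j. EPow (xa \<omega> i j) (EMul (xdig i e) (xdig j e)))))"
definition "xcross c e e' = EProdS {..<L} (\<lambda>i. EProdS {..<L} (\<lambda>j. EPow (c i j) (EMul (xdig i e) (xdig j e'))))"
text \<open>The value \<open>2 ^ Suc n\<close> exceeds the number of subsets of the domain, as
  \<open>sub_code_card\<close> requires.\<close>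

definition "xQ = EPow (ELit 2) xB"
definition "xsub e e' = EDig xQ (EProdS {..<L} (\<lambda>i. EPow (EAdd (ELit 1) (EPow xQ (EPow xB (ELit (int i))))) (xdig i e))) e'"
text \<open>Entry \<open>k * W + w\<close> of the table belongs to the label counts coded by \<open>k\<close> and the \<open>w\<close>-th set of
  true 0-ary predicates.\<close>

definition "xtab w e = ETab (EAdd (EMul e (ELit (int W))) (ELit (int w)))"
definition "xstep1 \<omega> e = ESum 10 (EAdd e (ELit 1)) (EMul (EMul (EMul (xsub e (EVar 10)) (xinner \<omega> (EVar 10)))
   (xinner \<omega> (ESub e (EVar 10)))) (xcross (\<lambda>i j. EAdd (xa \<omega> i j) (xb \<omega> i j)) (EVar 10) (ESub e (EVar 10))))"
definition "xstep2 w \<omega> e = ESum 10 (ESub e (ELit 1)) (let k = EAdd (EVar 10) (ELit 1) in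
   EMul (EMul (EMul (xsub e k) (xtab w k)) (xtab w (ESub e k))) (xcross (xa \<omega>) k (ESub e k)))"
definition "xidx = EDiv (EVar 1) (ELit (int W))"
text \<open>The labels and their weights are compiled into the program for each
  \<open>\<omega>\<close>, so the residue selecting \<open>\<omega>\<close> is dispatched by a case
  distinction in which a single summand survives.\<close>

definition "xSt = ESumS {..<W} (\<lambda>w. EIf (EEq (EMod (EVar 1) (ELit (int W))) (ELit (int w)))
   (EDiv (EAdd (ESub (xstep1 (oms ! w) xidx) (xstep2 w (oms ! w) xidx)) (ELit 1)) (ELit 2)) (ELit 0))"
definition "xTb = EMul (EPow xB (ELit (int L))) (ELit (int W))"

text \<open>The entries of the \<open>k\<close>-th constraint, for \<open>k\<close> the value of variable 13.\<close>

definition "xcon j = EInp (EAdd (ELit (2 + j)) (EMul (ELit 3) (EVar 13)))"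
text \<open>Codes 5 and 6 are the positive and negative literals. The loop counts elements from 0
  while the domain starts at 1, hence the added 1.\<close>

definition "xallow \<tau> v = EProd 13 xG (let q = ESumS \<tau> (\<lambda>p. EEq (xcon 1) (ELit (int p))) in
   EIf (EMul (EEq (xcon 0) (ELit 5)) (EEq (xcon 2) (EAdd v (ELit 1)))) q
   (EIf (EMul (EEq (xcon 0) (ELit 6)) (EEq (xcon 2) (EAdd v (ELit 1)))) (ESub (ELit 1) q) (ELit 1)))"
text \<open>The value \<open>Suc L ^ Suc n\<close> exceeds the number of labellings, so the
  coefficients extracted by \<open>xD\<close> do not overflow.\<close>

definition "xQd = EPow (ELit (int L + 1)) xB"
definition "xD \<omega> e = EDig xQd (EProd 12 xN (ESumS {..<nlab \<omega>} (\<lambda>i.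
   EMul (xallow (fst (fst (lbl \<omega> ! i))) (EVar 12)) (EPow xQd (EPow xB (ELit (int i))))))) e"
definition "xLS w \<omega> = ESum 11 (EPow xB (ELit (int L))) (EMul (EMul (xD \<omega> (EVar 11))
   (EProdS {..<nlab \<omega>} (\<lambda>i. EPow (xlab \<omega> (lbl \<omega> ! i)) (xdig i (EVar 11))))) (xtab w (EVar 11)))"
text \<open>The number of tuples with at least three distinct entries: all tuples, minus the
  constant ones, minus those with exactly two values, of which each pair of elements has
  \<open>2 ^ k - 2\<close>. The formula fails for arity 0.\<close>

definition "xfree p = (if ar ! p = 0 then ELit 0 else ESub (ESub (EPow xN (ELit (int (ar ! p)))) xN)
   (EMul (EDiv (EMul xN (ESub xN (ELit 1))) (ELit 2)) (ELit (2 ^ (ar ! p) - 2))))"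
definition "xZ w \<omega> = EMul (EMul (EProdS \<omega> xu) (EProdS {..<P} (\<lambda>p. EPow (EAdd (xu p) (ELit 1)) (xfree p)))) (xLS w \<omega>)"
text \<open>On the empty domain a world is just a set of true 0-ary atoms, and the truth of the
  sentence is a constant known when the program is written.\<close>

definition "sat0 \<omega> = sat 0 ((\<lambda>p. (p, [])) ` \<omega>) (\<lambda>_. 1) \<Phi>"
text \<open>Dividing by the power of \<open>xX\<close>, reducing modulo \<open>xX\<close> and
  dividing by the power of \<open>K!\<close> undoes \<open>lead_labelling_sum\<close>.\<close>

definition "xMe = EIf xN
   (ESumS {..<W} (\<lambda>w. EDiv (EMod (EDiv (xZ w (oms ! w)) (EPow xX (EMul xN (ELit (int (cI * K)))))) xX) xF))
   (ESumS {..<W} (\<lambda>w. EMul (ELit (of_bool (sat0 (oms ! w)))) (EProdS (oms ! w) xu)))"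
definition "xk p = EDig xM (EVar 4) (ELit (int p))"
text \<open>The number of false atoms, cut off at 0. The final loop also visits count vectors that
  exceed the number of atoms; their coefficient is 0, but an exponent is still needed.\<close>

definition "xKc p = (let d = ESub (EPow xN (ELit (int (ar ! p)))) (xk p) in EIf d d (ELit 0))"
definition "xkp = ESumS {..<P} (\<lambda>q. EMul (EEq (xcon 1) (ELit (int q))) (xk q))"
definition "xcard = EProd 13 xG (
   EIf (EEq (xcon 0) (ELit 0)) (EPos (ESub (xcon 2) xkp))
  (EIf (EEq (xcon 0) (ELit 1)) (EPos (EAdd (ESub (xcon 2) xkp) (ELit 1)))
  (EIf (EEq (xcon 0) (ELit 2)) (EEq xkp (xcon 2))
  (EIf (EEq (xcon 0) (ELit 3)) (EPos (EAdd (ESub xkp (xcon 2)) (ELit 1)))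
  (EIf (EEq (xcon 0) (ELit 4)) (EPos (ESub xkp (xcon 2))) (ELit 1))))))"
definition "xCo = EMul (EDig xU (EVar 3) (EVar 4)) xcard"

subsection \<open>Polynomial bounds\<close>

lemma small_consts [simp]: "small_ex A xB" "small_ex A xM" "small_ex A xE"
  by (simp_all add: xB_def xM_def xE_def)

text \<open>The values of \<open>xB\<close>, \<open>xM\<close> and \<open>xE\<close> are polynomial
  in \<open>n\<close>, their exponents being fixed, so they may serve as exponents. The others have
  polynomially many bits and occur only as bases and factors.\<close>

lemma safe_consts [simp]: "safe_ex A xB" "safe_ex A xM" "safe_ex A xE" "safe_ex A xU" "safe_ex A xF" "safe_ex A xX"
  "safe_ex A (xu p)" "safe_ex A xQ" "safe_ex A xQd" "safe_ex A xTb"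
  using small_consts by (simp_all add: xB_def xM_def xE_def xU_def xF_def xX_def xu_def xQ_def xQd_def xTb_def)

lemma safe_xbase [simp]: "safe_ex A (xbase j)" by (simp add: xbase_def)
lemma safe_xcoeff [simp]: "safe_ex A (xcoeff f j)" by (simp add: xcoeff_def)

lemma labs_finite:
  assumes "i < nlab \<omega>"
  shows "lbl \<omega> ! i \<in> labs ar \<Phi> R K \<omega>" "finite (fst (fst (lbl \<omega> ! i)))"
proof -
  show 1: "lbl \<omega> ! i \<in> labs ar \<Phi> R K \<omega>"
    using assms lst(1)[OF finite_labs] nth_mem[of i "lbl \<omega>"] unfolding nlab_def lbl_def by metis
  then have "fst (fst (lbl \<omega> ! i)) \<subseteq> preds1 ar" by (auto simp: labs_def vlabs_def)
  then show "finite (fst (fst (lbl \<omega> ! i)))" by (rule finite_subset) simp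
qed

lemma finite_type: "s \<in> types_no_edge ar R \<or> s \<in> types_edge ar R \<Longrightarrow> finite s"
  by (auto simp: types_no_edge_def types_edge_def intro: finite_subset[OF _ finite_atoms2])

lemma safe_xlab [simp]: "finite (fst (fst l)) \<Longrightarrow> safe_ex A (xlab \<omega> l)"
  by (simp add: xlab_def)

lemma safe_xpair [simp]: "finite s \<Longrightarrow> safe_ex A (xpair \<omega> l l' s)"
  by (simp add: xpair_def)

lemma safe_xab [simp]: "safe_ex A (xa \<omega> i j)" "safe_ex A (xb \<omega> i j)"
  by (simp_all add: xa_def xb_def finite_type)

lemma xdig_ok [simp]: "small_ex A (xdig i e) \<longleftrightarrow> small_ex A e" "safe_ex A (xdig i e) \<longleftrightarrow> safe_ex A e"
  by (simp_all add: xdig_def)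

lemma safe_xinner: "safe_ex A e \<Longrightarrow> small_ex A e \<Longrightarrow> safe_ex A (xinner \<omega> e)"
  by (simp add: xinner_def)

lemma safe_xcross: "safe_ex A e \<Longrightarrow> small_ex A e \<Longrightarrow> safe_ex A e' \<Longrightarrow> small_ex A e' \<Longrightarrow>
   (\<And>i j. safe_ex A (c i j)) \<Longrightarrow> safe_ex A (xcross c e e')"
  by (simp add: xcross_def)

lemma safe_xsub: "safe_ex A e \<Longrightarrow> small_ex A e \<Longrightarrow> safe_ex A e' \<Longrightarrow> small_ex A e' \<Longrightarrow> safe_ex A (xsub e e')"
  by (simp add: xsub_def)

lemma xidx_ok [simp]: "small_ex A xidx \<longleftrightarrow> 1 \<in> A" "safe_ex A xidx"
  by (simp_all add: xidx_def)

lemma safe_xtab [simp]: "safe_ex A (xtab w e) \<longleftrightarrow> safe_ex A e"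
  by (simp add: xtab_def)

lemma safe_xstep [simp]: "1 \<in> A \<Longrightarrow> safe_ex A (xstep1 \<omega> xidx)" "1 \<in> A \<Longrightarrow> safe_ex A (xstep2 w \<omega> xidx)"
  unfolding xstep1_def xstep2_def Let_def by (simp_all add: safe_xinner safe_xcross safe_xsub)

lemma safe_xSt: "safe_ex {1} xSt"
  by (simp add: xSt_def)

lemma safe_xcon [simp]: "safe_ex A (xcon j)"
  by (simp add: xcon_def)

lemma safe_xallow [simp]: "finite \<tau> \<Longrightarrow> safe_ex A (xallow \<tau> (EVar x))"
  by (simp add: xallow_def Let_def)

lemma safe_xLS [simp]: "safe_ex A (xLS w \<omega>)"
  by (simp add: xLS_def xD_def labs_finite)

lemma xfree_ok [simp]: "small_ex A (xfree p)" "safe_ex A (xfree p)"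
  by (simp_all add: xfree_def)

lemma safe_xMe: "safe_ex A xMe"
proof -
  have "finite (oms ! w)" if "w < W" for w using oms_nth[OF that] by (rule finite_subset) simp
  then show ?thesis by (simp add: xMe_def xZ_def)
qed

lemma xk_ok [simp]: "small_ex A (xk p) \<longleftrightarrow> 4 \<in> A" "safe_ex A (xk p)"
  by (simp_all add: xk_def)

lemma safe_xKc [simp]: "safe_ex A (xKc p)"
  by (simp add: xKc_def Let_def)

lemma safe_xCo: "safe_ex {4} xCo"
  by (simp add: xCo_def xcard_def xkp_def)

subsection \<open>Values of the expressions\<close>

context
  fixes I :: "int \<Rightarrow> int" and n :: nat
  assumes I0: "I 0 = int n"
begin

lemma eval_consts [simp]:
  "eval I T v xB = int (Suc n)" "eval I T v xM = int (vM n)" "eval I T v xE = int (vE n)" "eval I T v xU = int (vU n)"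
  "eval I T v xF = int (vF n)" "eval I T v xX = int (vX n)" "eval I T v (xu p) = int (vu n p)"
  "eval I T v xQ = int (2 ^ Suc n)" "eval I T v xQd = int (Suc L ^ Suc n)" "eval I T v xTb = int (Suc n ^ L * W)"
proof -
  show B: "eval I T v xB = int (Suc n)" by (simp add: xB_def I0)
  show M: "eval I T v xM = int (vM n)" by (simp add: xM_def B vM_def add.commute)
  show E: "eval I T v xE = int (vE n)" by (simp add: xE_def M vE_def)
  have e: "int P * int (vM n) + 1 = int (P * vM n + 1)" by simp
  show U: "eval I T v xU = int (vU n)" unfolding xU_def eval.simps M e nat_int vU_def by simp
  show F: "eval I T v xF = int (vF n)" by (simp add: xF_def vF_def I0 nat_mult_distrib)
  show "eval I T v xX = int (vX n)" by (simp add: xX_def vX_def F U E)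
  show "eval I T v (xu p) = int (vu n p)" by (simp add: xu_def vu_def U M nat_power_eq)
  show "eval I T v xQ = int (2 ^ Suc n)" by (simp add: xQ_def B del: power_Suc of_nat_Suc)
  show "eval I T v xQd = int (Suc L ^ Suc n)" by (simp add: xQd_def B del: power_Suc of_nat_Suc) (simp add: add.commute)
  show "eval I T v xTb = int (Suc n ^ L * W)" by (simp add: xTb_def B del: of_nat_Suc)
qed

end

end

text \<open>Each constraint is split into a condition on the one-types of single elements and one on
  the count vector, the latter being \<open>card_ok\<close>; one of the two is always
  trivial.\<close>

definition lit_ok :: "constr \<Rightarrow> nat \<Rightarrow> nat set \<Rightarrow> bool" where
  "lit_ok c a \<tau> = (case c of Card p r m \<Rightarrow> True | PosLit p b \<Rightarrow> b = a \<longrightarrow> p \<in> \<tau> | NegLit p b \<Rightarrow> b = a \<longrightarrow> p \<notin> \<tau>)"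

definition card_ok :: "constr \<Rightarrow> (nat \<Rightarrow> nat) \<Rightarrow> bool" where
  "card_ok c \<kappa> = (case c of Card p r m \<Rightarrow> cmp_holds r (\<kappa> p) m | _ \<Rightarrow> True)"

definition input_of :: "int list \<Rightarrow> int \<Rightarrow> int" where
  "input_of xs i = (if 0 \<le> i \<and> i < int (length xs) then xs ! nat i else 0)"

lemma length_constr_code [simp]: "length (constr_code c) = 3"
  by (cases c) auto

lemma concat_constr_nth:
  "k < length \<Gamma> \<Longrightarrow> j < 3 \<Longrightarrow> concat (map constr_code \<Gamma>) ! (3 * k + j) = constr_code (\<Gamma> ! k) ! j"
proof (induction \<Gamma> arbitrary: k)
  case (Cons c \<Gamma>)
  show ?case
  proof (cases k)
    case 0
    then show ?thesis using Cons.prems by (simp add: nth_append)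
  next
    case (Suc k')
    then have "3 * k + j - 3 = 3 * k' + j" by simp
    then show ?thesis using Cons Suc by (simp add: nth_append)
  qed
qed simp

lemma length_concat_constr: "length (concat (map constr_code \<Gamma>)) = 3 * length \<Gamma>"
  by (induction \<Gamma>) auto

lemma input_code_nth:
  "input_of (input_code n \<Gamma>) 0 = int n" "input_of (input_code n \<Gamma>) 1 = int (length \<Gamma>)"
  "k < length \<Gamma> \<Longrightarrow> j < 3 \<Longrightarrow> input_of (input_code n \<Gamma>) (2 + int j + 3 * int k) = constr_code (\<Gamma> ! k) ! j"
proof -
  show "input_of (input_code n \<Gamma>) 0 = int n" "input_of (input_code n \<Gamma>) 1 = int (length \<Gamma>)"
    by (simp_all add: input_of_def input_code_def)
  assume k: "k < length \<Gamma>" "j < 3"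
  have i: "2 + int j + 3 * int k = int (Suc (Suc (3 * k + j)))" by simp
  have "Suc (Suc (3 * k + j)) < length (input_code n \<Gamma>)"
    using k by (simp add: input_code_def length_concat_constr)
  then have "input_of (input_code n \<Gamma>) (int (Suc (Suc (3 * k + j)))) = input_code n \<Gamma> ! Suc (Suc (3 * k + j))"
    by (simp only: input_of_def nat_int of_nat_0_le_iff of_nat_less_iff simp_thms if_True)
  also have "\<dots> = concat (map constr_code \<Gamma>) ! (3 * k + j)" by (simp add: input_code_def)
  finally show "input_of (input_code n \<Gamma>) (2 + int j + 3 * int k) = constr_code (\<Gamma> ! k) ! j"
    unfolding i concat_constr_nth[OF k] .
qed

lemma prod_of_bool: "finite A \<Longrightarrow> (\<Prod>i\<in>A. of_bool (Q i)) = (of_bool (\<forall>i\<in>A. Q i) :: int)"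
  by (induction A rule: finite_induct) auto

context sentence
begin

context
  fixes I :: "int \<Rightarrow> int" and n :: nat
  assumes I0: "I 0 = int n"
begin

lemmas ec = eval_consts[where I = I and n = n, OF I0]

abbreviation "ux \<equiv> (\<lambda>p. int (vu n p))"

lemma eval_xbase [simp]: "eval I T v (xbase j) = base_wt K (int (vX n)) j"
  by (simp add: xbase_def base_wt_def I0)

lemma eval_xcoeff [simp]: "eval I T v (xcoeff f j) = coeff_wt K (int (vX n)) f j"
  by (cases "j \<le> K")
    (simp_all only: xcoeff_def coeff_wt_def if_True if_False eval_ESumS finite_atLeastAtMost eval.simps nat_int ec)

lemma eval_xlab [simp]: "finite (fst (fst l)) \<Longrightarrow> eval I T v (xlab \<omega> l) = lab_weight K (int (vX n)) ux \<Phi> \<omega> l"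
  by (simp add: xlab_def lab_weight_def I0)

lemma eval_xpair [simp]: "finite s \<Longrightarrow> eval I T v (xpair \<omega> l l' s) = pair_weight K (int (vX n)) ux \<Phi> \<omega> l l' s"
  by (simp add: xpair_def pair_weight_def ec if_distrib[where f = "eval I T v"] cong: if_cong)

lemma eval_xab [simp]: "eval I T v (xa \<omega> i j) = va_wt n \<omega> i j" "eval I T v (xb \<omega> i j) = vb_wt n \<omega> i j"
  by (simp_all add: xa_def xb_def va_wt_def vb_wt_def types_weight_def finite_type)

lemma eval_xdig: "eval I T v e = int k \<Longrightarrow> eval I T v (xdig i e) = int (digit (Suc n) k i)"
  unfolding xdig_def by (rule eval_EDig) (simp_all only: ec eval.simps)

text \<open>For \<open>d = 0\<close> integer and truncated subtraction differ, but the factor 0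
  conceals it.\<close>

lemma eval_half: "nat (int d * (int d - 1) div 2) = d * (d - 1) div 2"
proof (cases d)
  case (Suc d')
  then have "int d * (int d - 1) = int (d * (d - 1))" by (simp add: algebra_simps)
  moreover have "int (d * (d - 1)) div 2 = int (d * (d - 1) div 2)" by (simp only: zdiv_int of_nat_numeral)
  ultimately show ?thesis by (simp only: nat_int)
qed simp

lemma eval_xinner:
  assumes "eval I T v e = int k"
  shows "eval I T v (xinner \<omega> e) = inner_code (Suc n) L (va_wt n \<omega>) k"
proof -
  have h: "nat (int d * int d') = d * d'" for d d' by (simp add: nat_mult_distrib)
  show ?thesis
    by (simp only: xinner_def eval_EProdS finite_lessThan eval.simps eval_xab eval_xdig[OF assms] eval_half h inner_code_def)
qed

lemma eval_xcross:
  assumes "eval I T v e = int k" "eval I T v e' = int k'" "\<And>i j. eval I T v (c i j) = C i j"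
  shows "eval I T v (xcross c e e') = cross_code (Suc n) L C k k'"
proof -
  have h: "nat (int d * int d') = d * d'" for d d' by (simp add: nat_mult_distrib)
  show ?thesis
    by (simp only: xcross_def eval_EProdS finite_lessThan eval.simps assms(3) eval_xdig[OF assms(1)] eval_xdig[OF assms(2)] h cross_code_def)
qed

lemma eval_xsub:
  assumes "eval I T v e = int k" "eval I T v e' = int k'"
  shows "eval I T v (xsub e e') = int (sub_code (Suc n) L (2 ^ Suc n) k k')"
  unfolding xsub_def sub_code_def
proof (rule eval_EDig)
  have h: "nat (int a ^ b) = a ^ b" "1 + int a = int (1 + a)" for a b by (simp_all add: nat_power_eq)
  show "eval I T v (EProdS {..<L} (\<lambda>i. EPow (EAdd (ELit 1) (EPow xQ (EPow xB (ELit (int i))))) (xdig i e))) =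
    int (\<Prod>i<L. (1 + (2 ^ Suc n) ^ Suc n ^ i) ^ digit (Suc n) k i)"
    by (simp only: eval_EProdS finite_lessThan eval.simps ec eval_xdig[OF assms(1)] nat_int h
        of_nat_power[symmetric] of_nat_prod)
qed (use assms I0 in simp_all)

definition "bt \<omega> = bip_code (Suc n) L (2 ^ Suc n) (va_wt n \<omega>) (vb_wt n \<omega>)"
definition "table i = bt (oms ! (i mod W)) (i div W)"

lemma eval_xtab:
  assumes "eval I T v e = int k" "w < W"
  shows "eval I T v (xtab w e) = T (int (k * W + w))"
  by (simp add: xtab_def assms)

lemma eval_step:
  assumes v: "v 1 = int i" and w: "w = i mod W"
    and T: "\<And>j. j < i \<Longrightarrow> T (int j) = table j"
  shows "(eval I T v (xstep1 (oms ! w) xidx) - eval I T v (xstep2 w (oms ! w) xidx) + 1) div 2 = bt (oms ! w) (i div W)"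
proof -
  let ?\<omega> = "oms ! w" and ?e = "i div W"
  have wW: "w < W" using w W_pos by simp
  have ei: "eval I T (v(10 := z)) xidx = int ?e" "eval I T v xidx = int ?e" for z
    by (simp_all add: xidx_def v[unfolded One_nat_def] zdiv_int)
  have s1: "eval I T v (xstep1 ?\<omega> xidx) = (\<Sum>k<Suc ?e. int (sub_code (Suc n) L (2 ^ Suc n) ?e k) *
      inner_code (Suc n) L (va_wt n ?\<omega>) k * inner_code (Suc n) L (va_wt n ?\<omega>) (?e - k) *
      cross_code (Suc n) L (\<lambda>i j. va_wt n ?\<omega> i j + vb_wt n ?\<omega> i j) k (?e - k))"
  proof -
    have "nat (eval I T v (EAdd xidx (ELit 1))) = Suc ?e" by (simp add: ei nat_add_distrib)
    moreover have "eval I T (v(10 := int k)) (EMul (EMul (EMul (xsub xidx (EVar 10)) (xinner ?\<omega> (EVar 10)))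
       (xinner ?\<omega> (ESub xidx (EVar 10)))) (xcross (\<lambda>i j. EAdd (xa ?\<omega> i j) (xb ?\<omega> i j)) (EVar 10) (ESub xidx (EVar 10)))) =
      int (sub_code (Suc n) L (2 ^ Suc n) ?e k) *
      inner_code (Suc n) L (va_wt n ?\<omega>) k * inner_code (Suc n) L (va_wt n ?\<omega>) (?e - k) *
      cross_code (Suc n) L (\<lambda>i j. va_wt n ?\<omega> i j + vb_wt n ?\<omega> i j) k (?e - k)" if "k < Suc ?e" for k
    proof -
      let ?v = "v(10 := int k)"
      have k: "eval I T ?v (EVar 10) = int k" by simp
      have d: "eval I T ?v (ESub xidx (EVar 10)) = int (?e - k)" using that by (simp add: ei)
      have x: "eval I T ?v (xcross (\<lambda>i j. EAdd (xa ?\<omega> i j) (xb ?\<omega> i j)) (EVar 10) (ESub xidx (EVar 10))) =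
          cross_code (Suc n) L (\<lambda>i j. va_wt n ?\<omega> i j + vb_wt n ?\<omega> i j) k (?e - k)"
        by (rule eval_xcross[OF k d]) simp
      show ?thesis
        unfolding eval.simps(7) eval_xsub[OF ei(1) k] eval_xinner[OF k] eval_xinner[OF d] x ..
    qed
    ultimately show ?thesis unfolding xstep1_def eval.simps(12) by (simp only:) (rule sum.cong, simp_all)
  qed
  have s2: "eval I T v (xstep2 w ?\<omega> xidx) = (\<Sum>k<?e - 1. int (sub_code (Suc n) L (2 ^ Suc n) ?e (Suc k)) *
      bt ?\<omega> (Suc k) * bt ?\<omega> (?e - Suc k) * cross_code (Suc n) L (va_wt n ?\<omega>) (Suc k) (?e - Suc k))"
  proof -
    have "nat (eval I T v (ESub xidx (ELit 1))) = ?e - 1" by (simp add: ei nat_diff_distrib')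
    moreover have "eval I T (v(10 := int k)) (let k = EAdd (EVar 10) (ELit 1) in
       EMul (EMul (EMul (xsub xidx k) (xtab w k)) (xtab w (ESub xidx k))) (xcross (xa ?\<omega>) k (ESub xidx k))) =
      int (sub_code (Suc n) L (2 ^ Suc n) ?e (Suc k)) *
      bt ?\<omega> (Suc k) * bt ?\<omega> (?e - Suc k) * cross_code (Suc n) L (va_wt n ?\<omega>) (Suc k) (?e - Suc k)" if kl: "k < ?e - 1" for k
    proof -
      let ?v = "v(10 := int k)"
      have k: "eval I T ?v (EAdd (EVar 10) (ELit 1)) = int (Suc k)" by simp
      have d: "eval I T ?v (ESub xidx (EAdd (EVar 10) (ELit 1))) = int (?e - Suc k)" using kl by (simp add: ei)
      \<comment> \<open>An entry for the same \<open>w\<close> and a smaller code lies before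
        position \<open>i\<close>, hence it has already been computed.\<close>
      have tab: "T (int (j * W + w)) = bt ?\<omega> j" if "j < ?e" for j
      proof -
        have "j * W + w < Suc j * W" using wW by simp
        also have "\<dots> \<le> ?e * W" using that by (intro mult_le_mono1) simp
        also have "\<dots> \<le> i" by simp
        finally have "T (int (j * W + w)) = table (j * W + w)" by (rule T)
        then show ?thesis using wW by (simp add: table_def)
      qed
      have x: "eval I T ?v (xcross (xa ?\<omega>) (EAdd (EVar 10) (ELit 1)) (ESub xidx (EAdd (EVar 10) (ELit 1)))) =
          cross_code (Suc n) L (va_wt n ?\<omega>) (Suc k) (?e - Suc k)"
        by (rule eval_xcross[OF k d]) simp
      have t: "T (int (Suc k * W + w)) = bt ?\<omega> (Suc k)" "T (int ((?e - Suc k) * W + w)) = bt ?\<omega> (?e - Suc k)"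
        using kl by (intro tab; simp)+
      show ?thesis
        unfolding Let_def eval.simps(7) eval_xsub[OF ei(1) k] eval_xtab[OF k wW] eval_xtab[OF d wW] x t ..
    qed
    ultimately show ?thesis unfolding xstep2_def eval.simps(12) by (simp only:) (rule sum.cong, simp_all)
  qed
  show ?thesis unfolding s1 s2 unfolding bt_def by (rule bip_code.simps[symmetric])
qed

lemma eval_xSt:
  assumes v: "v 1 = int i" and T: "\<And>j. j < i \<Longrightarrow> T (int j) = table j"
  shows "eval I T v xSt = table i"
proof -
  have "eval I T v xSt = (\<Sum>w<W. if w = i mod W then bt (oms ! w) (i div W) else 0)"
  proof -
    have m: "eval I T v (EMod (EVar 1) (ELit (int W))) = int (i mod W)"
      by (simp add: v[unfolded One_nat_def] zmod_int)
    have "eval I T v xSt = (\<Sum>w<W. if i mod W = w then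
       (eval I T v (xstep1 (oms ! w) xidx) - eval I T v (xstep2 w (oms ! w) xidx) + 1) div 2 else 0)"
      unfolding xSt_def eval_ESumS[OF finite_lessThan]
      by (intro sum.cong refl) (simp only: eval.simps(1) eval.simps(11) EEq_simps(1) m of_nat_eq_iff, simp)
    also have "\<dots> = (\<Sum>w<W. if w = i mod W then bt (oms ! w) (i div W) else 0)"
      by (intro sum.cong refl) (use eval_step[where v = v and T = T and i = i, OF v _ T] in auto)
    finally show ?thesis .
  qed
  also have "\<dots> = table i" using W_pos by (simp add: table_def)
  finally show ?thesis .
qed

end

definition "al \<Gamma> a \<tau> \<longleftrightarrow> (\<forall>c\<in>set \<Gamma>. lit_ok c a \<tau>)" for \<Gamma> :: "constr list" and a :: nat and \<tau> :: "nat set"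

definition "label_count \<Gamma> n \<omega> k = digit (Suc L ^ Suc n) (\<Prod>b<n. \<Sum>i<nlab \<omega>.
   of_bool (al \<Gamma> (Suc b) (fst (fst (lbl \<omega> ! i)))) * (Suc L ^ Suc n) ^ Suc n ^ i) k"

context
  fixes \<Gamma> :: "constr list" and n :: nat
  assumes ok: "\<And>c. c \<in> set \<Gamma> \<Longrightarrow> constr_ok ar n c"
begin

abbreviation "I\<Gamma> \<equiv> input_of (input_code n \<Gamma>)"

lemma IG0: "I\<Gamma> 0 = int n"
  by (rule input_code_nth)

lemma eval_xG [simp]: "eval I\<Gamma> T v xG = int (length \<Gamma>)" "eval I\<Gamma> T v xN = int n"
  by (simp_all add: input_code_nth(1) input_code_nth(2)[unfolded One_nat_def])

lemma eval_xcon: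
  assumes "k < length \<Gamma>" "v 13 = int k"
  shows "eval I\<Gamma> T v (xcon 0) = constr_code (\<Gamma> ! k) ! 0" "eval I\<Gamma> T v (xcon 1) = constr_code (\<Gamma> ! k) ! 1"
    "eval I\<Gamma> T v (xcon 2) = constr_code (\<Gamma> ! k) ! 2"
  using input_code_nth(3)[OF assms(1), of 0 n] input_code_nth(3)[OF assms(1), of 1 n] input_code_nth(3)[OF assms(1), of 2 n]
  by (simp_all add: xcon_def assms(2))

lemma eval_xallow:
  assumes "finite \<tau>" "v x = int b" "x \<noteq> 13"
  shows "eval I\<Gamma> T v (xallow \<tau> (EVar x)) = of_bool (al \<Gamma> (Suc b) \<tau>)"
proof -
  have "eval I\<Gamma> T v (xallow \<tau> (EVar x)) = (\<Prod>k<length \<Gamma>. of_bool (lit_ok (\<Gamma> ! k) (Suc b) \<tau>))"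
    unfolding xallow_def eval.simps(13) eval_xG nat_int
  proof (rule prod.cong[OF refl])
    fix k assume "k \<in> {..<length \<Gamma>}"
    then have k: "k < length \<Gamma>" by simp
    let ?v = "v(13 := int k)"
    have v13: "?v 13 = int k" by simp
    note c = eval_xcon[where v = ?v and k = k and T = T, OF k v13]
    have vx: "eval I\<Gamma> T ?v (EVar x) = int b" using assms by simp
    have ob: "(\<Sum>p\<in>\<tau>. if p0 = p then 1 else 0 :: int) = of_bool (p0 \<in> \<tau>)" for p0
      using assms(1) by simp
    show "eval I\<Gamma> T ?v (let q = ESumS \<tau> (\<lambda>p. EEq (xcon 1) (ELit (int p))) in
       EIf (EMul (EEq (xcon 0) (ELit 5)) (EEq (xcon 2) (EAdd (EVar x) (ELit 1)))) q
       (EIf (EMul (EEq (xcon 0) (ELit 6)) (EEq (xcon 2) (EAdd (EVar x) (ELit 1)))) (ESub (ELit 1) q) (ELit 1))) =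
      of_bool (lit_ok (\<Gamma> ! k) (Suc b) \<tau>)"
    proof (cases "\<Gamma> ! k")
      case (Card p r m)
      then show ?thesis unfolding Let_def by (cases r) (simp_all add: c lit_ok_def)
    next
      case (PosLit p a)
      have "int a = int b + 1 \<longleftrightarrow> a = Suc b" by auto
      then show ?thesis unfolding Let_def using PosLit assms(1) vx
        by (simp add: c lit_ok_def ob del: fun_upd_apply)
    next
      case (NegLit p a)
      have "int a = int b + 1 \<longleftrightarrow> a = Suc b" by auto
      then show ?thesis unfolding Let_def using NegLit assms(1) vx
        by (simp add: c lit_ok_def ob del: fun_upd_apply)
    qed
  qed
  also have "\<dots> = of_bool (\<forall>k\<in>{..<length \<Gamma>}. lit_ok (\<Gamma> ! k) (Suc b) \<tau>)" by (rule prod_of_bool) simp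
  also have "\<dots> = of_bool (al \<Gamma> (Suc b) \<tau>)" by (auto simp: al_def all_set_conv_all_nth)
  finally show ?thesis .
qed

lemma eval_xD:
  assumes "eval I\<Gamma> T v e = int k"
  shows "eval I\<Gamma> T v (xD \<omega> e) = int (label_count \<Gamma> n \<omega> k)"
  unfolding xD_def label_count_def
proof (rule eval_EDig)
  let ?Q = "Suc L ^ Suc n"
  show "eval I\<Gamma> T v (EProd 12 xN (ESumS {..<nlab \<omega>} (\<lambda>i.
     EMul (xallow (fst (fst (lbl \<omega> ! i))) (EVar 12)) (EPow xQd (EPow xB (ELit (int i))))))) =
    int (\<Prod>b<n. \<Sum>i<nlab \<omega>. of_bool (al \<Gamma> (Suc b) (fst (fst (lbl \<omega> ! i)))) * ?Q ^ Suc n ^ i)"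
    unfolding eval.simps(13) eval_xG nat_int of_nat_prod
  proof (rule prod.cong[OF refl])
    fix b
    let ?v = "v(12 := int b)"
    have a: "eval I\<Gamma> T ?v (xallow (fst (fst (lbl \<omega> ! i))) (EVar 12)) = of_bool (al \<Gamma> (Suc b) (fst (fst (lbl \<omega> ! i))))"
      if "i < nlab \<omega>" for i
      by (rule eval_xallow[OF labs_finite(2)[OF that]]) simp_all
    have p: "eval I\<Gamma> T ?v (EPow xQd (EPow xB (ELit (int i)))) = int (?Q ^ Suc n ^ i)" for i
      by (simp only: eval.simps eval_consts[where I = "I\<Gamma>" and n = n, OF IG0] nat_int of_nat_power[symmetric])
    show "eval I\<Gamma> T ?v (ESumS {..<nlab \<omega>} (\<lambda>i.
     EMul (xallow (fst (fst (lbl \<omega> ! i))) (EVar 12)) (EPow xQd (EPow xB (ELit (int i)))))) =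
     int (\<Sum>i<nlab \<omega>. of_bool (al \<Gamma> (Suc b) (fst (fst (lbl \<omega> ! i)))) * ?Q ^ Suc n ^ i)"
      unfolding eval_ESumS[OF finite_lessThan] of_nat_sum eval.simps(7) p
      by (intro sum.cong refl) (simp add: a)
  qed
qed (use assms eval_consts[where I = "I\<Gamma>" and n = n, OF IG0] in simp_all)

lemma eval_xLS:
  assumes w: "w < W" and T: "\<And>j. j < Suc n ^ L * W \<Longrightarrow> T (int j) = table n j"
  shows "eval I\<Gamma> T v (xLS w (oms ! w)) = (\<Sum>k<Suc n ^ L. int (label_count \<Gamma> n (oms ! w) k) *
     (\<Prod>i<nlab (oms ! w). lab_weight K (int (vX n)) (\<lambda>p. int (vu n p)) \<Phi> (oms ! w) (lbl (oms ! w) ! i) ^ digit (Suc n) k i) *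
     bt n (oms ! w) k)"
proof -
  note ec = eval_consts[where I = "I\<Gamma>" and n = n, OF IG0]
  have e: "nat (eval I\<Gamma> T v (EPow xB (ELit (int L)))) = Suc n ^ L"
    by (simp only: eval.simps ec nat_int of_nat_power[symmetric])
  show ?thesis unfolding xLS_def eval.simps(12) e
  proof (rule sum.cong[OF refl])
    fix k assume "k \<in> {..<Suc n ^ L}"
    then have k: "k < Suc n ^ L" by simp
    let ?v = "v(11 := int k)"
    have ek: "eval I\<Gamma> T ?v (EVar 11) = int k" by simp
    have "k * W + w < Suc k * W" using w by simp
    also have "\<dots> \<le> Suc n ^ L * W" using k by (intro mult_le_mono1) simp
    finally have t: "T (int (k * W + w)) = bt n (oms ! w) k" using T[of "k * W + w"] w by (simp add: table_def)
    have p: "eval I\<Gamma> T ?v (EProdS {..<nlab (oms ! w)} (\<lambda>i. EPow (xlab (oms ! w) (lbl (oms ! w) ! i)) (xdig i (EVar 11)))) =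
      (\<Prod>i<nlab (oms ! w). lab_weight K (int (vX n)) (\<lambda>p. int (vu n p)) \<Phi> (oms ! w) (lbl (oms ! w) ! i) ^ digit (Suc n) k i)"
      unfolding eval_EProdS[OF finite_lessThan]
      by (intro prod.cong refl)
        (simp only: lessThan_iff eval.simps(10) eval_xlab[where I = "I\<Gamma>" and n = n, OF IG0 labs_finite(2)]
          eval_xdig[where I = "I\<Gamma>" and n = n, OF IG0 ek] nat_int)
    show "eval I\<Gamma> T ?v (EMul (EMul (xD (oms ! w) (EVar 11))
       (EProdS {..<nlab (oms ! w)} (\<lambda>i. EPow (xlab (oms ! w) (lbl (oms ! w) ! i)) (xdig i (EVar 11))))) (xtab w (EVar 11))) =
      int (label_count \<Gamma> n (oms ! w) k) *
      (\<Prod>i<nlab (oms ! w). lab_weight K (int (vX n)) (\<lambda>p. int (vu n p)) \<Phi> (oms ! w) (lbl (oms ! w) ! i) ^ digit (Suc n) k i) *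
      bt n (oms ! w) k"
      unfolding eval.simps(7) eval_xD[OF ek] eval_xtab[where I = "I\<Gamma>" and n = n, OF IG0 ek w] t p ..
  qed
qed

lemma eval_xcard:
  assumes v: "v 4 = int e"
  shows "eval I\<Gamma> T v xcard = of_bool (\<forall>c\<in>set \<Gamma>. card_ok c (digit (vM n) e))"
proof -
  note ec = eval_consts[where I = "I\<Gamma>" and n = n, OF IG0]
  have "eval I\<Gamma> T v xcard = (\<Prod>k<length \<Gamma>. of_bool (card_ok (\<Gamma> ! k) (digit (vM n) e)))"
    unfolding xcard_def eval.simps(13) eval_xG nat_int
  proof (rule prod.cong[OF refl])
    fix k assume "k \<in> {..<length \<Gamma>}"
    then have k: "k < length \<Gamma>" by simp
    let ?v = "v(13 := int k)"
    have v13: "?v 13 = int k" by simp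
    note c = eval_xcon[where v = ?v and k = k and T = T, OF k v13]
    have xk: "eval I\<Gamma> T ?v (xk q) = int (digit (vM n) e q)" for q
      unfolding xk_def by (rule eval_EDig) (simp_all add: ec v)
    show "eval I\<Gamma> T ?v (
       EIf (EEq (xcon 0) (ELit 0)) (EPos (ESub (xcon 2) xkp))
      (EIf (EEq (xcon 0) (ELit 1)) (EPos (EAdd (ESub (xcon 2) xkp) (ELit 1)))
      (EIf (EEq (xcon 0) (ELit 2)) (EEq xkp (xcon 2))
      (EIf (EEq (xcon 0) (ELit 3)) (EPos (EAdd (ESub xkp (xcon 2)) (ELit 1)))
      (EIf (EEq (xcon 0) (ELit 4)) (EPos (ESub xkp (xcon 2))) (ELit 1)))))) =
      of_bool (card_ok (\<Gamma> ! k) (digit (vM n) e))"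
    proof (cases "\<Gamma> ! k")
      case (Card p r m)
      have "\<Gamma> ! k \<in> set \<Gamma>" using k by simp
      then have "p < P" using ok[of "\<Gamma> ! k"] by (simp add: Card)
      have "eval I\<Gamma> T ?v xkp = (\<Sum>q<P. (if int p = int q then 1 else 0) * int (digit (vM n) e q))"
        unfolding xkp_def eval_ESumS[OF finite_lessThan]
        by (intro sum.cong refl) (simp only: eval.simps(1) eval.simps(7) EEq_simps(1) c xk Card constr_code.simps, simp)
      also have "\<dots> = (\<Sum>q<P. if p = q then int (digit (vM n) e q) else 0)" by (intro sum.cong) auto
      also have "\<dots> = int (digit (vM n) e p)" using \<open>p < P\<close> by simp
      finally have "eval I\<Gamma> T ?v xkp = int (digit (vM n) e p)" .
      then show ?thesis using Card by (cases r) (simp_all add: c card_ok_def del: fun_upd_apply)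
    qed (simp_all add: c card_ok_def)
  qed
  also have "\<dots> = of_bool (\<forall>k\<in>{..<length \<Gamma>}. card_ok (\<Gamma> ! k) (digit (vM n) e))" by (rule prod_of_bool) simp
  also have "\<dots> = of_bool (\<forall>c\<in>set \<Gamma>. card_ok c (digit (vM n) e))" by (auto simp: all_set_conv_all_nth)
  finally show ?thesis .
qed

end

end

section \<open>Evaluating the sum over labellings\<close>

text \<open>Of the \<open>2 ^ k\<close> lists over two letters, exactly the two constant ones miss a
  letter.\<close>

lemma card_two_lists:
  assumes "a \<noteq> b" "k \<ge> 1"
  shows "card {vs. length vs = k \<and> set vs = {a, b}} + 2 = 2 ^ k"
proof -
  let ?S = "{vs. set vs \<subseteq> {a, b} \<and> length vs = k}"
  let ?T = "{vs. length vs = k \<and> set vs = {a, b}}"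
  have fin: "finite ?S" by (rule finite_lists_length_eq) simp
  have split: "?S = ?T \<union> {replicate k a, replicate k b}"
  proof (intro subset_antisym subsetI)
    fix vs assume vs: "vs \<in> ?S"
    then have "vs \<noteq> []" using assms by auto
    then have "set vs = {a} \<or> set vs = {b} \<or> set vs = {a, b}" using vs by (cases vs) auto
    then show "vs \<in> ?T \<union> {replicate k a, replicate k b}"
      using vs replicate_eqI[of vs k a] replicate_eqI[of vs k b] by auto
  next
    fix vs assume "vs \<in> ?T \<union> {replicate k a, replicate k b}"
    then show "vs \<in> ?S" using assms by auto
  qed
  have "card ?S = card ?T + card {replicate k a, replicate k b}"
    unfolding split by (rule card_Un_disjoint) (use fin assms in \<open>auto simp: split\<close>)
  moreover have "card {replicate k a, replicate k b} = 2" using assms by (cases k) auto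
  moreover have "card ?S = card {a, b} ^ k" by (rule card_lists_length_eq) simp
  moreover have "card {a, b} = 2" using assms(1) by simp
  ultimately show ?thesis by (simp only:)
qed

definition free_tuples :: "nat \<Rightarrow> nat \<Rightarrow> nat list set" where
  "free_tuples n k = {vs. length vs = k \<and> set vs \<subseteq> {1..n} \<and> 3 \<le> card (set vs)}"

lemma finite_tuples: "finite {vs. length vs = k \<and> set vs \<subseteq> {1..n :: nat}}"
  and card_tuples: "card {vs. length vs = k \<and> set vs \<subseteq> {1..n :: nat}} = n ^ k"
proof -
  have e: "{vs. length vs = k \<and> set vs \<subseteq> {1..n}} = {vs. set vs \<subseteq> {1..n} \<and> length vs = k}" by auto
  show "finite {vs. length vs = k \<and> set vs \<subseteq> {1..n :: nat}}" "card {vs. length vs = k \<and> set vs \<subseteq> {1..n :: nat}} = n ^ k"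
    unfolding e by (simp_all add: finite_lists_length_eq card_lists_length_eq)
qed

lemma card_free_tuples:
  assumes "k \<ge> 1"
  shows "card (free_tuples n k) + n + card (prs {1..n}) * (2 ^ k - 2) = n ^ k"
proof -
  let ?L = "{vs. length vs = k \<and> set vs \<subseteq> {1..n}}"
  let ?S = "(\<lambda>a. replicate k a) ` {1..n}"
  let ?D = "\<lambda>q :: nat \<times> nat. {vs. length vs = k \<and> set vs = {fst q, snd q}}"
  have ne: "fst q \<noteq> snd q" "{fst q, snd q} \<subseteq> {1..n}" if "q \<in> prs {1..n}" for q
    using that by (auto simp: prs_def)
  have S: "card (set vs) = 1" if "vs \<in> ?S" for vs using that assms by auto
  have D: "card (set vs) = 2" if "q \<in> prs {1..n}" "vs \<in> ?D q" for q vs using that ne(1) by (auto simp: card_insert_if)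
  have split: "?L = (free_tuples n k \<union> ?S) \<union> (\<Union>q\<in>prs {1..n}. ?D q)"
  proof (intro subset_antisym subsetI)
    fix vs assume vs: "vs \<in> ?L"
    then have "vs \<noteq> []" using assms by auto
    then have c: "card (set vs) > 0" by (simp add: card_gt_0_iff)
    consider "card (set vs) = 1" | "card (set vs) = 2" | "card (set vs) \<ge> 3" using c by linarith
    then show "vs \<in> (free_tuples n k \<union> ?S) \<union> (\<Union>q\<in>prs {1..n}. ?D q)"
    proof cases
      case 1
      then obtain a where a: "set vs = {a}" by (auto simp: card_1_singleton_iff)
      then have "vs = replicate k a" "a \<in> {1..n}" using vs replicate_eqI[of vs k a] by auto
      then show ?thesis by blast
    next
      case 2
      then obtain a b where ab: "set vs = {a, b}" "a \<noteq> b" by (auto simp: card_2_iff)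
      then have m: "(min a b, max a b) \<in> prs {1..n}" using vs by (auto simp: prs_def min_def max_def)
      have "vs \<in> ?D (min a b, max a b)" using ab vs by (auto simp: min_def max_def)
      then show ?thesis using m by blast
    next
      case 3
      then show ?thesis using vs by (auto simp: free_tuples_def)
    qed
  next
    fix vs assume "vs \<in> (free_tuples n k \<union> ?S) \<union> (\<Union>q\<in>prs {1..n}. ?D q)"
    then consider "vs \<in> free_tuples n k" | "vs \<in> ?S" | q where "q \<in> prs {1..n}" "vs \<in> ?D q" by blast
    then show "vs \<in> ?L"
    proof cases
      case 1
      then show ?thesis by (simp add: free_tuples_def)
    next
      case 2
      then show ?thesis using assms by auto
    next
      case 3
      then show ?thesis using ne(2)[OF 3(1)] by auto
    qed
  qed
  have fin: "finite ?L" by (rule finite_tuples)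
  have "free_tuples n k \<subseteq> ?L" by (auto simp: free_tuples_def)
  then have "finite (free_tuples n k)" using fin by (rule finite_subset)
  moreover have "finite (?D q)" if "q \<in> prs {1..n}" for q
  proof (rule finite_subset[OF _ fin])
    show "?D q \<subseteq> ?L" using ne(2)[OF that] by auto
  qed
  ultimately have f: "finite (free_tuples n k)" "finite ?S" "\<And>q. q \<in> prs {1..n} \<Longrightarrow> finite (?D q)" "finite (\<Union>q\<in>prs {1..n}. ?D q)"
    by simp_all
  have c2: "card (?D q) = 2 ^ k - 2" if "q \<in> prs {1..n}" for q
    using card_two_lists[OF ne(1)[OF that] assms] by linarith
  have "card (\<Union>q\<in>prs {1..n}. ?D q) = (\<Sum>q\<in>prs {1..n}. card (?D q))"
  proof (rule card_UN_disjoint)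
    show "\<forall>q\<in>prs {1..n}. \<forall>q'\<in>prs {1..n}. q \<noteq> q' \<longrightarrow> ?D q \<inter> ?D q' = {}"
      by (auto simp: prs_def doubleton_eq_iff)
  qed (use f in auto)
  also have "\<dots> = card (prs {1..n}) * (2 ^ k - 2)" using c2 by simp
  finally have d: "card (\<Union>q\<in>prs {1..n}. ?D q) = card (prs {1..n}) * (2 ^ k - 2)" .
  have s: "card ?S = n" using assms by (subst card_image) (auto simp: inj_on_def)
  have fc: "3 \<le> card (set vs)" if "vs \<in> free_tuples n k" for vs using that by (simp add: free_tuples_def)
  have "card ((free_tuples n k \<union> ?S) \<union> (\<Union>q\<in>prs {1..n}. ?D q)) = card (free_tuples n k \<union> ?S) + card (\<Union>q\<in>prs {1..n}. ?D q)"
    by (rule card_Un_disjoint) (use f S D fc in fastforce)+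
  moreover have "card (free_tuples n k \<union> ?S) = card (free_tuples n k) + card ?S"
    by (rule card_Un_disjoint) (use f S fc in fastforce)+
  ultimately show ?thesis using d s card_tuples[of k n] unfolding split by simp
qed

lemma prod_free_atoms:
  fixes u :: "nat \<Rightarrow> int"
  shows "(\<Prod>ga\<in>free_atoms ar n. u (fst ga) + 1) = (\<Prod>p<length ar. (u p + 1) ^ card (free_tuples n (ar ! p)))"
proof -
  have e: "free_atoms ar n = Sigma {..<length ar} (\<lambda>p. free_tuples n (ar ! p))"
    by (auto simp: free_atoms_def ground_atoms_def free_tuples_def)
  have f: "finite (free_tuples n k)" for k
    by (rule finite_subset[OF _ finite_tuples[of k n]]) (auto simp: free_tuples_def)
  have "(\<Prod>p<length ar. \<Prod>vs\<in>free_tuples n (ar ! p). u p + 1) =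
     (\<Prod>(p, vs)\<in>Sigma {..<length ar} (\<lambda>p. free_tuples n (ar ! p)). u p + 1)"
    by (rule prod.Sigma) (use f in auto)
  then show ?thesis unfolding e by (simp add: split_beta)
qed

context sentence
begin

lemma eval_xfree:
  assumes I0: "I 0 = int n"
  shows "eval I T v (xfree p) = int (card (free_tuples n (ar ! p)))"
proof (cases "ar ! p = 0")
  case True
  have "free_tuples n 0 = {}" by (auto simp: free_tuples_def)
  then show ?thesis using True by (simp add: xfree_def)
next
  case False
  then have k: "ar ! p \<ge> 1" by simp
  have h: "int n * (int n - 1) div 2 = int (card (prs {1..n}))"
  proof (cases n)
    case (Suc m)
    have "int n * (int n - 1) = int (n * (n - 1))" unfolding Suc by (simp add: algebra_simps)
    moreover have "card (prs {1..n}) = n * (n - 1) div 2" using card_prs[of "{1..n}"] by simp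
    ultimately show ?thesis by (simp only: zdiv_int of_nat_numeral)
  qed simp
  have "(2::nat) ^ 1 \<le> 2 ^ (ar ! p)" by (rule power_increasing[OF k]) simp
  then have "(2::nat) \<le> 2 ^ (ar ! p)" by (simp only: power_one_right)
  then have "int (2 ^ (ar ! p) - 2) = int (2 ^ (ar ! p)) - int 2" by (rule of_nat_diff)
  then have t: "(2::int) ^ (ar ! p) - 2 = int (2 ^ (ar ! p) - 2)" by (simp only: of_nat_power of_nat_numeral)
  have c: "int (card (free_tuples n (ar ! p))) + int n + int (card (prs {1..n})) * int (2 ^ (ar ! p) - 2) = int n ^ (ar ! p)"
    by (simp only: of_nat_add[symmetric] of_nat_mult[symmetric] of_nat_power[symmetric] card_free_tuples[OF k])
  have "eval I T v (xfree p) = int n ^ (ar ! p) - int n - int (card (prs {1..n})) * int (2 ^ (ar ! p) - 2)"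
  proof -
    have "eval I T v xN = int n" by (simp add: I0)
    then show ?thesis unfolding xfree_def if_not_P[OF False] eval.simps(1) eval.simps(6-8) eval.simps(10) by (simp only: nat_int h t)
  qed
  moreover have "z = f" if "f + a + b = y" "z = y - a - b" for z f a b y :: int using that by simp
  ultimately show ?thesis using c by blast
qed

lemma bip_weight_cong:
  assumes "\<And>q. q \<in> prs V \<Longrightarrow> a q = a' q" "\<And>q. q \<in> prs V \<Longrightarrow> b q = b' q"
  shows "bip_weight a b V = bip_weight a' b' V"
  unfolding bip_weight_def graph_weight_def using assms by (intro sum.cong prod.cong refl) auto

abbreviation "index_maps \<Gamma> n \<omega> \<equiv> PiE {1..n} (\<lambda>v. {i. i < nlab \<omega> \<and> al \<Gamma> v (fst (fst (lbl \<omega> ! i)))})"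

lemma index_map_image: "f \<in> index_maps \<Gamma> n \<omega> \<Longrightarrow> f ` {1..n} \<subseteq> {..<nlab \<omega>}"
  by (auto simp: PiE_iff)

lemma index_map_image_L:
  assumes "\<omega> \<subseteq> preds0" "f \<in> index_maps \<Gamma> n \<omega>"
  shows "f ` {1..n} \<subseteq> {..<L}"
  by (rule subset_trans[OF index_map_image[OF assms(2)]]) (use nlab_le[OF assms(1)] in simp)

lemma bt_eq: "bt n \<omega> = bip_code (Suc n) L (2 ^ Suc n) (va_wt n \<omega>) (vb_wt n \<omega>)"
  by (rule bt_def[where I = "\<lambda>_. int n"]) simp

text \<open>Multiplying out over the elements chooses an admissible label for each and yields the
  base to the code of the choice.\<close>

lemma label_count:
  assumes om: "\<omega> \<subseteq> preds0" and n: "n \<ge> 1" and k: "k < Suc n ^ L"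
  shows "label_count \<Gamma> n \<omega> k = card {f\<in>index_maps \<Gamma> n \<omega>. code (Suc n) f {1..n} = k}"
proof -
  let ?A = "\<lambda>v. {i. i < nlab \<omega> \<and> al \<Gamma> v (fst (fst (lbl \<omega> ! i)))}"
  let ?Q = "Suc L ^ Suc n"
  have A: "finite (?A v)" "card (?A v) \<le> L" for v
  proof -
    show "finite (?A v)" by simp
    have "card (?A v) \<le> card {..<nlab \<omega>}" by (rule card_mono) auto
    then show "card (?A v) \<le> L" using nlab_le[OF om] by simp
  qed
  have "card (index_maps \<Gamma> n \<omega>) = (\<Prod>v\<in>{1..n}. card (?A v))" by (rule card_PiE) simp
  also have "\<dots> \<le> (\<Prod>v\<in>{1..n}. L)" by (rule prod_mono) (use A in auto)
  also have "\<dots> = L ^ n" by simp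
  \<comment> \<open>A nonempty domain makes the inequality strict.\<close>
  also have "\<dots> < Suc L ^ n" using n by (intro power_strict_mono) auto
  also have "\<dots> \<le> ?Q" by (rule power_increasing) auto
  finally have c: "card (index_maps \<Gamma> n \<omega>) < ?Q" .
  have "(\<Prod>b<n. \<Sum>i<nlab \<omega>. of_bool (al \<Gamma> (Suc b) (fst (fst (lbl \<omega> ! i)))) * ?Q ^ Suc n ^ i) =
     (\<Prod>v\<in>{1..n}. \<Sum>i\<in>?A v. ?Q ^ Suc n ^ i)"
  proof -
    have "(\<Sum>i<nlab \<omega>. of_bool (al \<Gamma> v (fst (fst (lbl \<omega> ! i)))) * ?Q ^ Suc n ^ i) = (\<Sum>i\<in>?A v. ?Q ^ Suc n ^ i)" for v
      by (rule sum.mono_neutral_cong_right) auto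
    then show ?thesis by (simp only: One_nat_def prod.atLeast1_atMost_eq)
  qed
  also have "\<dots> = (\<Sum>f\<in>index_maps \<Gamma> n \<omega>. \<Prod>v\<in>{1..n}. ?Q ^ Suc n ^ f v)"
    by (rule prod_sum_PiE) (use A in auto)
  also have "\<dots> = (\<Sum>f\<in>index_maps \<Gamma> n \<omega>. ?Q ^ code (Suc n) f {1..n})"
    by (simp only: code_def power_sum)
  finally have e: "(\<Prod>b<n. \<Sum>i<nlab \<omega>. of_bool (al \<Gamma> (Suc b) (fst (fst (lbl \<omega> ! i)))) * ?Q ^ Suc n ^ i) =
    (\<Sum>f\<in>index_maps \<Gamma> n \<omega>. ?Q ^ code (Suc n) f {1..n})" .
  show ?thesis unfolding label_count_def e
  proof (rule digit_gen_fun[OF _ _ c k])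
    show "finite (index_maps \<Gamma> n \<omega>)" by (rule finite_PiE) simp_all
    fix f assume "f \<in> index_maps \<Gamma> n \<omega>"
    then have "f ` {1..n} \<subseteq> {..<L}" by (rule index_map_image_L[OF om])
    then show "code (Suc n) f {1..n} < Suc n ^ L" by (intro code_less) auto
  qed
qed

lemma lbl_bij: "bij_betw ((!) (lbl \<omega>)) {..<nlab \<omega>} (labs ar \<Phi> R K \<omega>)"
  by (rule bij_betw_nth) (simp_all add: lbl_def nlab_def lst)

text \<open>Labels are replaced by their positions in \<open>lbl \<omega>\<close>. The summand then
  depends on the code of the index map only, and \<open>label_count\<close> says how many maps share
  a code.\<close>

lemma labelling_sum_code:
  assumes om: "\<omega> \<subseteq> preds0" and n: "n \<ge> 1"
  shows "setting.labelling_sum ar \<Phi> R (al \<Gamma>) n \<omega> K (int (vX n)) (\<lambda>p. int (vu n p)) =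
    (\<Sum>k<Suc n ^ L. int (label_count \<Gamma> n \<omega> k) *
     (\<Prod>i<nlab \<omega>. lab_weight K (int (vX n)) (\<lambda>p. int (vu n p)) \<Phi> \<omega> (lbl \<omega> ! i) ^ digit (Suc n) k i) * bt n \<omega> k)"
proof -
  interpret S: setting ar \<Phi> R "al \<Gamma>" n \<omega>
    by standard (use wf closed R n om in \<open>auto simp: preds0_def\<close>)
  let ?V = "{1..n}" and ?x = "int (vX n)" and ?u = "\<lambda>p. int (vu n p)"
  let ?T = "index_maps \<Gamma> n \<omega>"
  let ?S = "PiE ?V (\<lambda>v. {l\<in>labs ar \<Phi> R K \<omega>. al \<Gamma> v (fst (fst l))})"
  let ?g = "\<lambda>i. lab_weight K ?x ?u \<Phi> \<omega> (lbl \<omega> ! i)"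
  let ?G = "\<lambda>k. (\<Prod>i<nlab \<omega>. ?g i ^ digit (Suc n) k i) * bt n \<omega> k"
  let ?H = "\<lambda>f. (\<Prod>v\<in>?V. ?g (f v)) * bip_weight (lab_pair (va_wt n \<omega>) f) (lab_pair (vb_wt n \<omega>) f) ?V"
  define ix where "ix = the_inv_into {..<nlab \<omega>} ((!) (lbl \<omega>))"
  have ix: "ix l < nlab \<omega>" "lbl \<omega> ! ix l = l" if "l \<in> labs ar \<Phi> R K \<omega>" for l
    using bij_betw_apply[OF bij_betw_the_inv_into[OF lbl_bij[of \<omega>]] that] f_the_inv_into_f_bij_betw[OF lbl_bij[of \<omega>], of l] that
    by (auto simp: ix_def)
  have ix': "ix (lbl \<omega> ! i) = i" if "i < nlab \<omega>" for i
    unfolding ix_def by (rule the_inv_into_f_f[OF bij_betw_imp_inj_on[OF lbl_bij]]) (use that in simp)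
  have "S.labelling_sum K ?x ?u = (\<Sum>f\<in>?T. ?H f)"
    unfolding S.labelling_sum_def
  proof (rule sum.reindex_bij_witness[where i = "\<lambda>f. \<lambda>v\<in>?V. lbl \<omega> ! f v" and j = "\<lambda>f. \<lambda>v\<in>?V. ix (f v)"])
    fix f assume f: "f \<in> ?S"
    then have fv: "f v \<in> labs ar \<Phi> R K \<omega>" "al \<Gamma> v (fst (fst (f v)))" if "v \<in> ?V" for v using that by (auto simp: PiE_iff)
    show "(\<lambda>v\<in>?V. lbl \<omega> ! (\<lambda>v\<in>?V. ix (f v)) v) = f"
      using f fv ix by (intro ext) (auto simp: PiE_iff extensional_def)
    show "(\<lambda>v\<in>?V. ix (f v)) \<in> ?T" using fv ix by (auto simp: PiE_iff)
    have l: "lbl \<omega> ! (\<lambda>v\<in>?V. ix (f v)) v = f v" if "v \<in> ?V" for v using fv ix that by simp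
    have "(\<Prod>v\<in>?V. ?g ((\<lambda>v\<in>?V. ix (f v)) v)) = (\<Prod>v\<in>?V. lab_weight K ?x ?u \<Phi> \<omega> (f v))"
      by (intro prod.cong refl) (simp only: l)
    moreover have "bip_weight (lab_pair (va_wt n \<omega>) (\<lambda>v\<in>?V. ix (f v))) (lab_pair (vb_wt n \<omega>) (\<lambda>v\<in>?V. ix (f v))) ?V =
      bip_weight (\<lambda>q. types_weight (types_no_edge ar R) K ?x ?u \<Phi> \<omega> (f (fst q)) (f (snd q)))
       (\<lambda>q. types_weight (types_edge ar R) K ?x ?u \<Phi> \<omega> (f (fst q)) (f (snd q))) ?V"
    proof (rule bip_weight_cong)
      fix q assume "q \<in> prs ?V"
      then have "fst q \<in> ?V" "snd q \<in> ?V" by (auto simp: prs_def)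
      note l = l[OF this(1)] l[OF this(2)]
      show "lab_pair (va_wt n \<omega>) (\<lambda>v\<in>?V. ix (f v)) q = types_weight (types_no_edge ar R) K ?x ?u \<Phi> \<omega> (f (fst q)) (f (snd q))"
        "lab_pair (vb_wt n \<omega>) (\<lambda>v\<in>?V. ix (f v)) q = types_weight (types_edge ar R) K ?x ?u \<Phi> \<omega> (f (fst q)) (f (snd q))"
        by (simp_all only: lab_pair_def va_wt_def vb_wt_def l)
    qed
    ultimately show "?H (\<lambda>v\<in>?V. ix (f v)) = (\<Prod>v\<in>?V. lab_weight K ?x ?u \<Phi> \<omega> (f v)) *
      bip_weight (\<lambda>q. types_weight (types_no_edge ar R) K ?x ?u \<Phi> \<omega> (f (fst q)) (f (snd q)))
       (\<lambda>q. types_weight (types_edge ar R) K ?x ?u \<Phi> \<omega> (f (fst q)) (f (snd q))) ?V" by (simp only:)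
  next
    fix f assume f: "f \<in> ?T"
    then have fv: "f v < nlab \<omega>" "al \<Gamma> v (fst (fst (lbl \<omega> ! f v)))" if "v \<in> ?V" for v using that by (auto simp: PiE_iff)
    show "(\<lambda>v\<in>?V. ix ((\<lambda>v\<in>?V. lbl \<omega> ! f v) v)) = f"
      using f fv ix' by (intro ext) (auto simp: PiE_iff extensional_def)
    show "(\<lambda>v\<in>?V. lbl \<omega> ! f v) \<in> ?S" using fv labs_finite(1) by (auto simp: PiE_iff)
  qed
  also have "\<dots> = (\<Sum>f\<in>?T. ?G (code (Suc n) f ?V))"
  proof (rule sum.cong[OF refl])
    fix f assume fT: "f \<in> ?T"
    have f: "f ` ?V \<subseteq> {..<nlab \<omega>}" by (rule index_map_image[OF fT])
    have fL: "f ` ?V \<subseteq> {..<L}" by (rule index_map_image_L[OF om fT])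
    have "(\<Prod>v\<in>?V. ?g (f v)) = (\<Prod>i<nlab \<omega>. ?g i ^ digit (Suc n) (code (Suc n) f ?V) i)"
      by (rule prod_by_code[where g = ?g]) (use f in auto)
    moreover have "bip_weight (lab_pair (va_wt n \<omega>) f) (lab_pair (vb_wt n \<omega>) f) ?V = bt n \<omega> (code (Suc n) f ?V)"
      unfolding bt_eq
    proof (rule bip_weight_code)
      show "va_wt n \<omega> i j = va_wt n \<omega> j i" for i j unfolding va_wt_def by (rule types_weight_no_edge_sym)
      show "vb_wt n \<omega> i j = vb_wt n \<omega> j i" for i j unfolding vb_wt_def by (rule types_weight_edge_sym)
    qed (use fL in auto)
    ultimately show "?H f = ?G (code (Suc n) f ?V)" by simp
  qed
  also have "\<dots> = (\<Sum>k<Suc n ^ L. \<Sum>f\<in>{f\<in>?T. code (Suc n) f ?V = k}. ?G (code (Suc n) f ?V))"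
  proof (rule sum.group[symmetric])
    show "finite ?T" by (rule finite_PiE) simp_all
    show "(\<lambda>f. code (Suc n) f ?V) ` ?T \<subseteq> {..<Suc n ^ L}"
    proof (rule image_subsetI)
      fix f assume "f \<in> ?T"
      then have "f ` {1..n} \<subseteq> {..<L}" by (rule index_map_image_L[OF om])
      then have "code (Suc n) f ?V < Suc n ^ L" by (intro code_less) auto
      then show "code (Suc n) f ?V \<in> {..<Suc n ^ L}" by simp
    qed
  qed simp
  also have "\<dots> = (\<Sum>k<Suc n ^ L. int (label_count \<Gamma> n \<omega> k) * ?G k)"
    by (intro sum.cong refl) (simp add: label_count[OF om n] del: power_Suc)
  finally show ?thesis by (simp only: mult.assoc)
qed

end

context sentence
begin

subsection \<open>Model counts as digits\<close>

definition kc :: "world \<Rightarrow> nat \<Rightarrow> nat" where "kc \<mu> p = card {as. (p, as) \<in> \<mu>}"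
definition ccode :: "nat \<Rightarrow> world \<Rightarrow> nat" where "ccode n \<mu> = (\<Sum>p<P. kc \<mu> p * vM n ^ p)"
definition "good_worlds \<Gamma> n = {\<mu>\<in>worlds ar n. good ar \<Phi> R (al \<Gamma>) n \<mu>}" for \<Gamma> n
text \<open>A number whose digits in base \<open>vU n\<close> are the numbers of good worlds with
  given count vector.\<close>

definition gen :: "constr list \<Rightarrow> nat \<Rightarrow> nat" where "gen \<Gamma> n = (\<Sum>\<mu>\<in>good_worlds \<Gamma> n. vU n ^ ccode n \<mu>)"

abbreviation "atoms_for n p \<equiv> {as. length as = ar ! p \<and> set as \<subseteq> {1..n}}"

lemma atoms_for: "finite (atoms_for n p)" "card (atoms_for n p) = n ^ (ar ! p)"
  by (rule finite_tuples, rule card_tuples)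

lemma ground_atoms_Sigma: "ground_atoms ar n = Sigma {..<P} (atoms_for n)"
  by (auto simp: ground_atoms_def)

lemma world_Sigma:
  assumes "\<mu> \<in> worlds ar n"
  shows "\<mu> = Sigma {..<P} (\<lambda>p. {as. (p, as) \<in> \<mu>})" "p < P \<Longrightarrow> {as. (p, as) \<in> \<mu>} \<subseteq> atoms_for n p"
  using assms by (auto simp: worlds_def ground_atoms_def)

lemma finite_slice: "\<mu> \<in> worlds ar n \<Longrightarrow> p < P \<Longrightarrow> finite {as. (p, as) \<in> \<mu>}"
  by (rule finite_subset[OF world_Sigma(2) atoms_for(1)])

lemma pow_less_vM:
  assumes "p < P"
  shows "n ^ (ar ! p) < vM n"
proof -
  have "ar ! p \<le> sum_list ar" using assms by (rule elem_le_sum_list)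
  then have "Suc n ^ (ar ! p) \<le> Suc n ^ sum_list ar" by (rule power_increasing) simp
  moreover have "n ^ (ar ! p) \<le> Suc n ^ (ar ! p)" by (rule power_mono) simp_all
  ultimately show ?thesis unfolding vM_def by simp
qed

lemma kc_le:
  assumes "\<mu> \<in> worlds ar n" "p < P"
  shows "kc \<mu> p \<le> n ^ (ar ! p)"
proof -
  have "kc \<mu> p \<le> card (atoms_for n p)"
    unfolding kc_def by (rule card_mono[OF atoms_for(1) world_Sigma(2)[OF assms]])
  then show ?thesis by (simp only: atoms_for(2))
qed

lemma kc_less: "\<mu> \<in> worlds ar n \<Longrightarrow> p < P \<Longrightarrow> kc \<mu> p < vM n"
  using kc_le pow_less_vM by (meson le_less_trans)

lemma ccode_less: "\<mu> \<in> worlds ar n \<Longrightarrow> ccode n \<mu> < vE n"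
  unfolding ccode_def vE_def by (rule sum_digits_less) (rule kc_less)

lemma digit_ccode: "\<mu> \<in> worlds ar n \<Longrightarrow> p < P \<Longrightarrow> digit (vM n) (ccode n \<mu>) p = kc \<mu> p"
  unfolding ccode_def by (rule digit_sum) (auto intro: kc_less)

lemma prod_vu:
  assumes "\<mu> \<in> worlds ar n"
  shows "(\<Prod>ga\<in>\<mu>. vu n (fst ga)) = vU n ^ ccode n \<mu>"
proof -
  have "(\<Prod>ga\<in>\<mu>. vu n (fst ga)) = (\<Prod>(p, as)\<in>Sigma {..<P} (\<lambda>p. {as. (p, as) \<in> \<mu>}). vu n p)"
    using world_Sigma(1)[OF assms] by (metis (mono_tags, lifting) prod.cong split_beta)
  also have "\<dots> = (\<Prod>p<P. \<Prod>as\<in>{as. (p, as) \<in> \<mu>}. vu n p)"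
    by (rule prod.Sigma[symmetric]) (use finite_slice[OF assms] in auto)
  also have "\<dots> = (\<Prod>p<P. vU n ^ (kc \<mu> p * vM n ^ p))"
    by (intro prod.cong refl) (simp add: vu_def kc_def power_mult[symmetric] mult.commute)
  finally show ?thesis by (simp add: ccode_def power_sum)
qed

lemma card_worlds: "card (worlds ar n) < vU n"
proof -
  have "card (ground_atoms ar n) = (\<Sum>p<P. card (atoms_for n p))"
    unfolding ground_atoms_Sigma by (rule card_SigmaI) (auto simp: atoms_for[unfolded One_nat_def])
  also have "\<dots> \<le> (\<Sum>p<P. vM n)"
    by (rule sum_mono) (use pow_less_vM atoms_for(2) in \<open>fastforce intro: less_imp_le\<close>)
  finally have "card (ground_atoms ar n) \<le> P * vM n" by simp
  then have "(2::nat) ^ card (ground_atoms ar n) < 2 ^ (P * vM n + 1)" by (intro power_strict_increasing) auto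
  then show ?thesis unfolding worlds_def vU_def by (simp only: card_Pow finite_ground_atoms)
qed

lemma finite_worlds: "finite (worlds ar n)"
  by (simp add: worlds_def)

lemma good_worlds: "finite (good_worlds \<Gamma> n)" "good_worlds \<Gamma> n \<subseteq> worlds ar n" "card (good_worlds \<Gamma> n) < vU n"
proof -
  show s: "good_worlds \<Gamma> n \<subseteq> worlds ar n" by (auto simp: good_worlds_def)
  then show "finite (good_worlds \<Gamma> n)" using finite_worlds by (rule finite_subset)
  show "card (good_worlds \<Gamma> n) < vU n" using card_mono[OF finite_worlds s] card_worlds by (rule le_less_trans)
qed

lemma good_worldsD: "\<mu> \<in> good_worlds \<Gamma> n \<Longrightarrow> \<mu> \<in> worlds ar n"
  by (simp add: good_worlds_def)

text \<open>There are fewer than \<open>vU n\<close> worlds, and each contributes at most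
  \<open>vU n ^ (vE n - 1)\<close>.\<close>

lemma gen_less: "gen \<Gamma> n < vU n ^ vE n"
proof -
  have U: "vU n > 0" by (simp add: vU_def)
  have "vE n > 0" by (simp add: vE_def vM_def)
  then obtain E where E: "vE n = Suc E" by (cases "vE n") auto
  have "gen \<Gamma> n \<le> (\<Sum>\<mu>\<in>good_worlds \<Gamma> n. vU n ^ E)" unfolding gen_def
  proof (rule sum_mono)
    fix \<mu> assume "\<mu> \<in> good_worlds \<Gamma> n"
    then have "ccode n \<mu> < vE n" using good_worlds(2) by (intro ccode_less) auto
    then show "vU n ^ ccode n \<mu> \<le> vU n ^ E" using U E by (intro power_increasing) auto
  qed
  also have "\<dots> = card (good_worlds \<Gamma> n) * vU n ^ E" by simp
  also have "\<dots> < vU n * vU n ^ E" using good_worlds(3) U by (intro mult_strict_right_mono) auto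
  finally show ?thesis by (simp add: E)
qed

lemma digit_gen: "e < vE n \<Longrightarrow> digit (vU n) (gen \<Gamma> n) e = card {\<mu>\<in>good_worlds \<Gamma> n. ccode n \<mu> = e}"
  unfolding gen_def by (rule digit_gen_fun) (use good_worlds(1,3) in \<open>auto intro: ccode_less good_worldsD\<close>)

lemma weight_eq:
  assumes "\<mu> \<in> worlds ar n"
  shows "weight ar n w wbar \<mu> = (\<Prod>p<P. w p ^ kc \<mu> p * wbar p ^ (n ^ (ar ! p) - kc \<mu> p))"
proof -
  have "weight ar n w wbar \<mu> = (\<Prod>(p, as)\<in>Sigma {..<P} (atoms_for n). if (p, as) \<in> \<mu> then w p else wbar p)"
    unfolding weight_def ground_atoms_Sigma by (intro prod.cong refl) auto
  also have "\<dots> = (\<Prod>p<P. \<Prod>as\<in>atoms_for n p. if (p, as) \<in> \<mu> then w p else wbar p)"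
    by (rule prod.Sigma[symmetric]) (auto simp: atoms_for[unfolded One_nat_def])
  also have "\<dots> = (\<Prod>p<P. w p ^ kc \<mu> p * wbar p ^ (n ^ (ar ! p) - kc \<mu> p))"
  proof (rule prod.cong[OF refl])
    fix p assume p: "p \<in> {..<P}"
    let ?A = "{as. (p, as) \<in> \<mu>}"
    have sub: "?A \<subseteq> atoms_for n p" using world_Sigma(2)[OF assms] p by auto
    have "(\<Prod>as\<in>atoms_for n p. if as \<in> ?A then w p else wbar p) =
      (\<Prod>as\<in>atoms_for n p \<inter> ?A. w p) * (\<Prod>as\<in>atoms_for n p \<inter> - ?A. wbar p)"
      by (subst prod.If_cases) (simp_all add: atoms_for[unfolded One_nat_def] Collect_mem_eq)
    moreover have "atoms_for n p \<inter> ?A = ?A" "atoms_for n p \<inter> - ?A = atoms_for n p - ?A" using sub by auto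
    moreover have "card (atoms_for n p - ?A) = n ^ (ar ! p) - kc \<mu> p"
      unfolding kc_def using card_Diff_subset[OF finite_subset[OF sub atoms_for(1)] sub] atoms_for(2) by simp
    ultimately have "(\<Prod>as\<in>atoms_for n p. if as \<in> ?A then w p else wbar p) = w p ^ kc \<mu> p * wbar p ^ (n ^ (ar ! p) - kc \<mu> p)"
      by (simp only: prod_constant kc_def)
    then show "(\<Prod>as\<in>atoms_for n p. if (p, as) \<in> \<mu> then w p else wbar p) = w p ^ kc \<mu> p * wbar p ^ (n ^ (ar ! p) - kc \<mu> p)"
      by simp
  qed
  finally show ?thesis .
qed

lemma conj_iff:
  assumes \<mu>: "\<mu> \<in> worlds ar n" and ok: "\<And>c. c \<in> set \<Gamma> \<Longrightarrow> constr_ok ar n c"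
  shows "conj_with_axiom \<Phi> \<Gamma> bipartite R n \<mu> \<longleftrightarrow>
    good ar \<Phi> R (al \<Gamma>) n \<mu> \<and> (\<forall>c\<in>set \<Gamma>. card_ok c (digit (vM n) (ccode n \<mu>)))"
proof -
  have "constr_holds \<mu> c \<longleftrightarrow> (\<forall>a\<in>{1..n}. lit_ok c a (one_type ar \<mu> a)) \<and> card_ok c (digit (vM n) (ccode n \<mu>))"
    if "c \<in> set \<Gamma>" for c
  proof (cases c)
    case (Card p r m)
    then have "p < P" using ok[OF that] by simp
    then show ?thesis using digit_ccode[OF \<mu>] Card by (simp add: lit_ok_def card_ok_def kc_def)
  next
    case (PosLit p a)
    then have "p < P" "ar ! p = 1" "a \<in> {1..n}" using ok[OF that] by auto
    then show ?thesis using PosLit by (auto simp: lit_ok_def card_ok_def one_type_def)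
  next
    case (NegLit p a)
    then have "p < P" "ar ! p = 1" "a \<in> {1..n}" using ok[OF that] by auto
    then show ?thesis using NegLit by (auto simp: lit_ok_def card_ok_def one_type_def)
  qed
  then have "(\<forall>c\<in>set \<Gamma>. constr_holds \<mu> c) \<longleftrightarrow>
    (\<forall>a\<in>{1..n}. al \<Gamma> a (one_type ar \<mu> a)) \<and> (\<forall>c\<in>set \<Gamma>. card_ok c (digit (vM n) (ccode n \<mu>)))"
    unfolding al_def by blast
  then show ?thesis unfolding conj_with_axiom_def good_def by blast
qed

text \<open>Weight and cardinality constraints depend on the count vector alone, so worlds are
  grouped by its code. Numbers below \<open>vE n\<close> that code no good world have digit
  0.\<close>

lemma wfomc_eq:
  assumes ok: "\<And>c. c \<in> set \<Gamma> \<Longrightarrow> constr_ok ar n c"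
  shows "wfomc ar (conj_with_axiom \<Phi> \<Gamma> bipartite R n) n w wbar =
    (\<Sum>e<vE n. of_int (int (digit (vU n) (gen \<Gamma> n) e) * of_bool (\<forall>c\<in>set \<Gamma>. card_ok c (digit (vM n) e))) *
       (\<Prod>p<P. w p ^ digit (vM n) e p * wbar p ^ (n ^ (ar ! p) - digit (vM n) e p)))"
proof -
  let ?c = "\<lambda>e. \<forall>c\<in>set \<Gamma>. card_ok c (digit (vM n) e)"
  let ?p = "\<lambda>e. \<Prod>p<P. w p ^ digit (vM n) e p * wbar p ^ (n ^ (ar ! p) - digit (vM n) e p)"
  have "{\<mu>\<in>worlds ar n. conj_with_axiom \<Phi> \<Gamma> bipartite R n \<mu>} = {\<mu>\<in>good_worlds \<Gamma> n. ?c (ccode n \<mu>)}"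
    using conj_iff[OF _ ok] by (auto simp: good_worlds_def)
  then have "wfomc ar (conj_with_axiom \<Phi> \<Gamma> bipartite R n) n w wbar =
    (\<Sum>\<mu>\<in>{\<mu>\<in>good_worlds \<Gamma> n. ?c (ccode n \<mu>)}. weight ar n w wbar \<mu>)" by (simp add: wfomc_def)
  also have "\<dots> = (\<Sum>\<mu>\<in>{\<mu>\<in>good_worlds \<Gamma> n. ?c (ccode n \<mu>)}. ?p (ccode n \<mu>))"
  proof (rule sum.cong[OF refl])
    fix \<mu> assume "\<mu> \<in> {\<mu>\<in>good_worlds \<Gamma> n. ?c (ccode n \<mu>)}"
    then have "\<mu> \<in> worlds ar n" using good_worlds(2) by auto
    then show "weight ar n w wbar \<mu> = ?p (ccode n \<mu>)" by (simp add: weight_eq digit_ccode)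
  qed
  also have "\<dots> = (\<Sum>\<mu>\<in>good_worlds \<Gamma> n. of_bool (?c (ccode n \<mu>)) * ?p (ccode n \<mu>))"
    by (rule sum.mono_neutral_cong_left) (use good_worlds(1) in auto)
  also have "\<dots> = (\<Sum>e<vE n. \<Sum>\<mu>\<in>{\<mu>\<in>good_worlds \<Gamma> n. ccode n \<mu> = e}. of_bool (?c (ccode n \<mu>)) * ?p (ccode n \<mu>))"
    by (rule sum.group[symmetric]) (use good_worlds(1,3) in \<open>auto intro: ccode_less good_worldsD\<close>)
  also have "\<dots> = (\<Sum>e<vE n. of_int (int (digit (vU n) (gen \<Gamma> n) e) * of_bool (?c e)) * ?p e)"
  proof (rule sum.cong[OF refl])
    fix e assume "e \<in> {..<vE n}"
    then have "digit (vU n) (gen \<Gamma> n) e = card {\<mu>\<in>good_worlds \<Gamma> n. ccode n \<mu> = e}" by (simp add: digit_gen)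
    moreover have "(\<Sum>\<mu>\<in>{\<mu>\<in>good_worlds \<Gamma> n. ccode n \<mu> = e}. of_bool (?c (ccode n \<mu>)) * ?p (ccode n \<mu>)) =
      (\<Sum>\<mu>\<in>{\<mu>\<in>good_worlds \<Gamma> n. ccode n \<mu> = e}. of_bool (?c e) * ?p e)" by (rule sum.cong) auto
    ultimately show "(\<Sum>\<mu>\<in>{\<mu>\<in>good_worlds \<Gamma> n. ccode n \<mu> = e}. of_bool (?c (ccode n \<mu>)) * ?p (ccode n \<mu>)) =
      of_int (int (digit (vU n) (gen \<Gamma> n) e) * of_bool (?c e)) * ?p e"
      by simp
  qed
  finally show ?thesis .
qed

lemma gen_split:
  "int (gen \<Gamma> n) = (\<Sum>w<W. \<Sum>\<mu>\<in>{\<mu>\<in>worlds ar n. good ar \<Phi> R (al \<Gamma>) n \<mu> \<and> nullary_of ar \<mu> = oms ! w}. \<Prod>ga\<in>\<mu>. int (vu n (fst ga)))"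
proof -
  let ?f = "\<lambda>\<mu>. \<Prod>ga\<in>\<mu>. int (vu n (fst ga))"
  have "int (gen \<Gamma> n) = (\<Sum>\<mu>\<in>good_worlds \<Gamma> n. ?f \<mu>)"
    unfolding gen_def of_nat_sum
  proof (rule sum.cong[OF refl])
    fix \<mu> assume "\<mu> \<in> good_worlds \<Gamma> n"
    then have "\<mu> \<in> worlds ar n" using good_worlds(2) by auto
    then show "int (vU n ^ ccode n \<mu>) = ?f \<mu>" using prod_vu[of \<mu> n] by (simp only: of_nat_prod[symmetric])
  qed
  also have "\<dots> = (\<Sum>\<omega>\<in>Pow preds0. \<Sum>\<mu>\<in>{\<mu>\<in>good_worlds \<Gamma> n. nullary_of ar \<mu> = \<omega>}. ?f \<mu>)"
    by (rule sum.group[symmetric]) (use good_worlds in \<open>auto simp: nullary_of_def preds0_def\<close>)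
  also have "\<dots> = (\<Sum>w<W. \<Sum>\<mu>\<in>{\<mu>\<in>good_worlds \<Gamma> n. nullary_of ar \<mu> = oms ! w}. ?f \<mu>)"
    by (rule sum.reindex_bij_betw[symmetric, OF bij_betw_nth]) (simp_all add: oms W_def)
  finally show ?thesis by (simp add: good_worlds_def conj_ac)
qed

lemma worlds_0: "worlds ar 0 = (\<lambda>\<omega>. (\<lambda>p. (p, [])) ` \<omega>) ` Pow preds0"
proof -
  have "ground_atoms ar 0 = (\<lambda>p. (p, [])) ` preds0" by (auto simp: ground_atoms_def preds0_def)
  then show ?thesis by (simp add: worlds_def image_Pow_surj)
qed

text \<open>Over the empty domain each set of true 0-ary atoms is one world, the graph is empty, and
  no literal can be violated.\<close>

lemma gen_0: "int (gen \<Gamma> 0) = (\<Sum>w<W. of_bool (sat0 (oms ! w)) * (\<Prod>p\<in>oms ! w. int (vu 0 p)))"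
  unfolding gen_split
proof (rule sum.cong[OF refl])
  fix w assume "w \<in> {..<W}"
  then have w: "oms ! w \<subseteq> preds0" using oms_nth by simp
  let ?m = "(\<lambda>p. (p, [])) ` (oms ! w) :: world"
  have m: "?m \<in> worlds ar 0" using w by (auto simp: worlds_0)
  have nul: "nullary_of ar ((\<lambda>p. (p, [])) ` \<omega>) = \<omega>" if "\<omega> \<subseteq> preds0" for \<omega>
    using that by (auto simp: nullary_of_def preds0_def)
  have bip: "bipartite {1..0} (graph_of ?m R)"
  proof -
    have "graph_of ?m R = {}" by (auto simp: graph_of_def)
    then show ?thesis by (auto simp: bipartite_def bipartite_graph_def sym_def irrefl_def)
  qed
  have g: "good ar \<Phi> R (al \<Gamma>) 0 ?m \<longleftrightarrow> sat0 (oms ! w)"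
    using bip by (simp add: good_def is_model_def sat0_def)
  have "{\<mu>\<in>worlds ar 0. good ar \<Phi> R (al \<Gamma>) 0 \<mu> \<and> nullary_of ar \<mu> = oms ! w} = (if sat0 (oms ! w) then {?m} else {})"
  proof -
    have "\<mu> = ?m" if "\<mu> \<in> worlds ar 0" "nullary_of ar \<mu> = oms ! w" for \<mu>
      using that nul by (auto simp: worlds_0)
    then have sub: "{\<mu>\<in>worlds ar 0. good ar \<Phi> R (al \<Gamma>) 0 \<mu> \<and> nullary_of ar \<mu> = oms ! w} \<subseteq> {?m}" by blast
    have mem: "?m \<in> {\<mu>\<in>worlds ar 0. good ar \<Phi> R (al \<Gamma>) 0 \<mu> \<and> nullary_of ar \<mu> = oms ! w} \<longleftrightarrow> sat0 (oms ! w)"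
      unfolding mem_Collect_eq g nul[OF w] using m by blast
    have "A = (if q then {x} else {})" if "x \<in> A \<longleftrightarrow> q" "A \<subseteq> {x}" for A :: "world set" and x q
      using that by auto
    then show ?thesis using mem sub .
  qed
  then show "(\<Sum>\<mu>\<in>{\<mu>\<in>worlds ar 0. good ar \<Phi> R (al \<Gamma>) 0 \<mu> \<and> nullary_of ar \<mu> = oms ! w}. \<Prod>ga\<in>\<mu>. int (vu 0 (fst ga))) =
      of_bool (sat0 (oms ! w)) * (\<Prod>p\<in>oms ! w. int (vu 0 p))"
    by (simp add: prod.reindex inj_on_def)
qed

end

context sentence
begin

lemma table_eq: "table n i = bt n (oms ! (i mod W)) (i div W)"
  by (rule table_def[where I = "\<lambda>_. int n"]) simp

abbreviation "inp n \<Gamma> \<equiv> input_of (input_code n \<Gamma>)"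

text \<open>The labelling sum has lowest coefficient \<open>?F * ?M\<close> after multiplication
  with the factors of the 0-ary and free atoms. This number is nonnegative and below
  \<open>?x\<close>, so it is found exactly.\<close>

lemma eval_summand:
  assumes ok: "\<And>c. c \<in> set \<Gamma> \<Longrightarrow> constr_ok ar n c" and n: "n \<ge> 1" and w: "w < W"
    and T: "\<And>j. j < Suc n ^ L * W \<Longrightarrow> T (int j) = table n j"
  shows "eval (inp n \<Gamma>) T v (EDiv (EMod (EDiv (xZ w (oms ! w)) (EPow xX (EMul xN (ELit (int (cI * K)))))) xX) xF) =
    (\<Sum>\<mu>\<in>{\<mu>\<in>worlds ar n. good ar \<Phi> R (al \<Gamma>) n \<mu> \<and> nullary_of ar \<mu> = oms ! w}. \<Prod>ga\<in>\<mu>. int (vu n (fst ga)))"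
proof -
  let ?\<omega> = "oms ! w" and ?u = "\<lambda>p. int (vu n p)" and ?x = "int (vX n)" and ?F = "int (vF n)"
  have om: "?\<omega> \<subseteq> preds0" using w by (rule oms_nth)
  have fom: "finite ?\<omega>" using om by (rule finite_subset) simp
  interpret S: setting ar \<Phi> R "al \<Gamma>" n ?\<omega>
    by standard (use wf closed R n om in \<open>auto simp: preds0_def\<close>)
  note ec = eval_consts[where I = "inp n \<Gamma>" and n = n, OF input_code_nth(1)]
  have xN: "eval (inp n \<Gamma>) T v xN = int n" by (simp add: input_code_nth(1))
  let ?A = "(\<Prod>p\<in>?\<omega>. ?u p) * (\<Prod>ga\<in>free_atoms ar n. ?u (fst ga) + 1)"
  let ?C = "\<Sum>(\<sigma>, t)\<in>S.CF. (\<Prod>v\<in>S.V. \<Prod>p\<in>fst (\<sigma> v). ?u p) * (\<Prod>q\<in>prs S.V. \<Prod>s\<in>t q. ?u (fst s))"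
  let ?M = "\<Sum>\<mu>\<in>S.WS. \<Prod>ga\<in>\<mu>. ?u (fst ga)"
  let ?Z = "?A * S.labelling_sum K ?x ?u"
  have M: "?M = ?A * ?C" by (rule S.sum_worlds)
  have F: "fact K ^ (n * cI) = ?F" by (simp add: vF_def)
  have Z: "eval (inp n \<Gamma>) T v (xZ w ?\<omega>) = ?Z"
  proof -
    have "eval (inp n \<Gamma>) T v (xLS w ?\<omega>) = S.labelling_sum K ?x ?u"
      unfolding labelling_sum_code[OF om n] by (rule eval_xLS[where \<Gamma> = \<Gamma> and n = n, OF ok w T])
    moreover have "eval (inp n \<Gamma>) T v (EProdS {..<P} (\<lambda>p. EPow (EAdd (xu p) (ELit 1)) (xfree p))) =
        (\<Prod>ga\<in>free_atoms ar n. ?u (fst ga) + 1)"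
      unfolding prod_free_atoms[where u = ?u] eval_EProdS[OF finite_lessThan]
      by (intro prod.cong refl) (simp only: eval.simps ec eval_xfree[where I = "inp n \<Gamma>", OF input_code_nth(1)] nat_int)
    ultimately show ?thesis unfolding xZ_def eval.simps(7) eval_EProdS[OF fom] ec by (simp only:)
  qed
  have k: "eval (inp n \<Gamma>) T v (EPow xX (EMul xN (ELit (int (cI * K))))) = ?x ^ (n * (cI * K))"
  proof -
    have "nat (int n * int (cI * K)) = n * (cI * K)" by (simp only: of_nat_mult[symmetric] nat_int)
    then show ?thesis unfolding eval.simps(10) eval.simps(7) eval.simps(1) ec xN by (simp only:)
  qed
  have "lead ?x (n * (cI * K)) (S.labelling_sum K ?x ?u) (?F * ?C)"
    using S.lead_labelling_sum[of K ?x ?u] K unfolding F by blast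
  then have l: "lead ?x (n * (cI * K)) ?Z (?A * (?F * ?C))" by (rule lead_cmult)
  have m: "?A * (?F * ?C) = ?F * ?M" unfolding M by (simp only: mult.left_commute)
  have lead: "lead ?x (n * (cI * K)) ?Z (?F * ?M)" using l unfolding m .
  have nonneg: "0 \<le> (\<Sum>\<mu>\<in>{\<mu>\<in>worlds ar n. good ar \<Phi> R (al \<Gamma>) n \<mu> \<and> nullary_of ar \<mu> = oms ! w}. \<Prod>ga\<in>\<mu>. ?u (fst ga))" for w
    by (intro sum_nonneg prod_nonneg) simp
  \<comment> \<open>The count for one \<open>\<omega>\<close> is a summand of the total, and the
    other summands are nonnegative.\<close>
  have "?M \<le> int (gen \<Gamma> n)" unfolding gen_split
    by (rule member_le_sum[where f = "\<lambda>w. \<Sum>\<mu>\<in>{\<mu>\<in>worlds ar n. good ar \<Phi> R (al \<Gamma>) n \<mu> \<and> nullary_of ar \<mu> = oms ! w}. \<Prod>ga\<in>\<mu>. ?u (fst ga)"])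
      (use w nonneg in auto)
  also have "\<dots> < int (vU n ^ vE n)" using gen_less by (simp only: of_nat_less_iff)
  finally have less: "?M < int (vU n ^ vE n)" .
  have Fpos: "0 < ?F" by (simp add: vF_def)
  have "?F * ?M < ?F * int (vU n ^ vE n)" using less Fpos by (rule mult_strict_left_mono)
  also have "\<dots> = ?x" unfolding vX_def by (simp only: of_nat_mult)
  finally have "?F * ?M < ?x" .
  moreover have "0 \<le> ?F * ?M" using nonneg[of w] Fpos by simp
  ultimately have "?Z div ?x ^ (n * (cI * K)) mod ?x = ?F * ?M" using lead by (intro lead_digit)
  then have "?Z div ?x ^ (n * (cI * K)) mod ?x div ?F = ?M" using Fpos by simp
  then show ?thesis unfolding eval.simps(8) eval.simps(9) Z k ec .
qed

lemma eval_xMe: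
  assumes ok: "\<And>c. c \<in> set \<Gamma> \<Longrightarrow> constr_ok ar n c"
    and T: "\<And>j. j < Suc n ^ L * W \<Longrightarrow> T (int j) = table n j"
  shows "eval (inp n \<Gamma>) T v xMe = int (gen \<Gamma> n)"
proof (cases "n = 0")
  case True
  have fom: "finite (oms ! w)" if "w < W" for w using oms_nth[OF that] by (rule finite_subset) simp
  note ec = eval_consts[where I = "inp n \<Gamma>" and n = n, OF input_code_nth(1)]
  have "eval (inp n \<Gamma>) T v xN = 0" using True by (simp add: input_code_nth(1))
  then have "eval (inp n \<Gamma>) T v xMe = (\<Sum>w<W. of_bool (sat0 (oms ! w)) * eval (inp n \<Gamma>) T v (EProdS (oms ! w) xu))"
    unfolding xMe_def eval.simps(11) by simp
  also have "\<dots> = (\<Sum>w<W. of_bool (sat0 (oms ! w)) * (\<Prod>p\<in>oms ! w. int (vu n p)))"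
    by (intro sum.cong refl) (simp add: fom ec)
  finally show ?thesis using gen_0 True by simp
next
  case False
  then have n: "n \<ge> 1" by simp
  have "eval (inp n \<Gamma>) T v xN > 0" using n by (simp add: input_code_nth(1))
  then show ?thesis unfolding xMe_def eval.simps(11) gen_split eval_ESumS[OF finite_lessThan]
    by (simp only: if_True) (intro sum.cong refl eval_summand[OF ok n _ T]; simp)
qed

end

section \<open>Bit lengths\<close>

text \<open>A bound for all codes below \<open>m\<close>, whether or not they come from a labelling.
  The exponents \<open>2 * k - 1\<close> and \<open>2 * (e - k) - 1\<close> add up to
  \<open>2 * e - 2\<close>, which leaves one factor to absorb the summation over \<open>k\<close>
  and the first sum.\<close>

lemma bip_code_bound:
  fixes H :: int
  assumes Q: "Q > 1" and H: "H \<ge> 1"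
    and s: "\<And>e k. e < m \<Longrightarrow> k \<le> e \<Longrightarrow> \<bar>int (sub_code B L Q e k) * inner_code B L a k * inner_code B L a (e - k) *
        cross_code B L (\<lambda>i j. a i j + b i j) k (e - k)\<bar> \<le> H"
    and c: "\<And>e k. e < m \<Longrightarrow> k \<le> e \<Longrightarrow> \<bar>int (sub_code B L Q e k) * cross_code B L a k (e - k)\<bar> \<le> H"
  shows "e < m \<Longrightarrow> e \<ge> 1 \<Longrightarrow> \<bar>bip_code B L Q a b e\<bar> \<le> (2 * (int m * H + 1)) ^ (2 * e - 1)"
proof (induction e rule: less_induct)
  case (less e)
  let ?b = "bip_code B L Q a b" and ?J = "int m * H + 1"
  let ?h = "2 * ?J"
  let ?t = "\<lambda>k. int (sub_code B L Q e k) * inner_code B L a k * inner_code B L a (e - k) *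
        cross_code B L (\<lambda>i j. a i j + b i j) k (e - k)"
  let ?r = "\<lambda>k. int (sub_code B L Q e (Suc k)) * ?b (Suc k) * ?b (e - Suc k) * cross_code B L a (Suc k) (e - Suc k)"
  let ?p = "?h ^ (2 * e - 2)"
  have mH: "0 \<le> int m * H" using H by simp
  have "1 \<le> 2 * (z + 1)" if "0 \<le> z" for z :: int using that by simp
  from this[OF mH] have h: "?h \<ge> 1" .
  then have p: "?p \<ge> 1" by (rule one_le_power)
  have "\<bar>\<Sum>k<Suc e. ?t k\<bar> \<le> (\<Sum>k<Suc e. \<bar>?t k\<bar>)" by (rule sum_abs)
  also have "\<dots> \<le> (\<Sum>k<Suc e. H)" by (rule sum_mono, rule s) (use less.prems in auto)
  also have "\<dots> \<le> int m * H" using less.prems H by (simp add: mult_right_mono)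
  finally have S: "\<bar>\<Sum>k<Suc e. ?t k\<bar> \<le> int m * H" .
  have r: "\<bar>?r k\<bar> \<le> H * ?p" if k: "k < e - 1" for k
  proof -
    have b1: "\<bar>?b (Suc k)\<bar> \<le> ?h ^ (2 * Suc k - 1)" by (rule less.IH) (use k less.prems in auto)
    have b2: "\<bar>?b (e - Suc k)\<bar> \<le> ?h ^ (2 * (e - Suc k) - 1)" by (rule less.IH) (use k less.prems in auto)
    have b: "\<bar>?b (Suc k)\<bar> * \<bar>?b (e - Suc k)\<bar> \<le> ?h ^ (2 * Suc k - 1) * ?h ^ (2 * (e - Suc k) - 1)"
      by (rule mult_mono[OF b1 b2]) (use h in auto)
    have e: "2 * Suc k - 1 + (2 * (e - Suc k) - 1) = 2 * e - 2" using k by simp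
    have "\<bar>?r k\<bar> = \<bar>int (sub_code B L Q e (Suc k)) * cross_code B L a (Suc k) (e - Suc k)\<bar> * (\<bar>?b (Suc k)\<bar> * \<bar>?b (e - Suc k)\<bar>)"
      by (simp only: abs_mult mult_ac)
    also have "\<dots> \<le> H * (?h ^ (2 * Suc k - 1) * ?h ^ (2 * (e - Suc k) - 1))"
    proof (rule mult_mono)
      show "\<bar>int (sub_code B L Q e (Suc k)) * cross_code B L a (Suc k) (e - Suc k)\<bar> \<le> H"
        by (rule c) (use k less.prems in auto)
    qed (use b H in auto)
    also have "\<dots> = H * ?p" by (simp only: power_add[symmetric] e)
    finally show ?thesis .
  qed
  have "\<bar>\<Sum>k<e - 1. ?r k\<bar> \<le> (\<Sum>k<e - 1. \<bar>?r k\<bar>)" by (rule sum_abs)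
  also have "\<dots> \<le> (\<Sum>k<e - 1. H * ?p)" by (rule sum_mono, rule r) simp
  also have "\<dots> = int (e - 1) * (H * ?p)" by simp
  also have "\<dots> \<le> int m * (H * ?p)" by (rule mult_right_mono) (use less.prems H p in auto)
  also have "\<dots> = int m * H * ?p" by (simp only: mult.assoc)
  finally have C: "\<bar>\<Sum>k<e - 1. ?r k\<bar> \<le> int m * H * ?p" .
  have "\<bar>?b e\<bar> \<le> \<bar>(\<Sum>k<Suc e. ?t k) - (\<Sum>k<e - 1. ?r k) + 1\<bar>"
    unfolding bip_code.simps[of B L Q a b e] by (rule abs_div_le)
  also have "\<dots> \<le> int m * H + int m * H * ?p + 1" using S C by linarith
  also have "\<dots> \<le> ?J * ?p + ?J * ?p"
  proof -
    have "int m * H + 1 \<le> ?J * ?p" using p mH by (simp add: mult_le_cancel_left1)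
    moreover have "int m * H * ?p \<le> ?J * ?p" using p by (intro mult_right_mono) auto
    ultimately show ?thesis by linarith
  qed
  also have "\<dots> = ?h ^ Suc (2 * e - 2)" by (simp only: power_Suc mult_2 distrib_right)
  also have "Suc (2 * e - 2) = 2 * e - 1" using less.prems by simp
  finally show ?case .
qed

lemma base_okI:
  "pow_bounded B \<Longrightarrow> (\<And>N I T v. (N, I, T, v) \<in> S \<Longrightarrow>
      \<bar>I 0\<bar> \<le> int (B N) \<and> \<bar>I 1\<bar> \<le> int (B N) \<and> (\<forall>a\<ge>0. fits (B N) (I a)) \<and>
      (\<forall>i\<ge>0. fits (B N) (T i)) \<and> (\<forall>x. fits (B N) (v x)) \<and> (\<forall>x\<in>A. \<bar>v x\<bar> \<le> int (B N))) \<Longrightarrow> base_ok A S"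
  unfolding base_ok_def by (rule exI[of _ B]) (auto split: prod.splits)

lemma bnd_ESumS:
  assumes "finite S" "bnd M I T v (ESumS S f)" "s \<in> S"
  shows "bnd M I T v (f s)"
proof -
  have "bnd M I T v (foldr EAdd (map f xs) (ELit 0)) \<Longrightarrow> s \<in> set xs \<Longrightarrow> bnd M I T v (f s)" for xs
    by (induction xs) auto
  from this[of "lst S"] show ?thesis using assms by (simp add: ESumS_def lst)
qed

lemma input_bounds:
  assumes "N = input_size n \<Gamma>"
  shows "n \<le> N" "length \<Gamma> \<le> N" "a \<ge> 0 \<Longrightarrow> fits (N + 1) (input_of (input_code n \<Gamma>) a)"
proof -
  let ?xs = "concat (map constr_code \<Gamma>)"
  show n: "n \<le> N" by (simp add: assms input_size_def)
  have "length xs \<le> sum_list (map len xs)" for xs by (induction xs) (auto simp: len_def)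
  from this[of ?xs] show \<Gamma>: "length \<Gamma> \<le> N" by (simp add: assms input_size_def length_concat_constr)
  have fl: "fits (len z) z" for z
  proof (cases "z = 0")
    case False
    then have "\<bar>z\<bar> < 2 ^ nat (bitlen \<bar>z\<bar>)" using bitlen_bounds[of "\<bar>z\<bar>"] by simp
    also have "\<dots> \<le> 2 ^ len z" unfolding len_def by (rule power_increasing) auto
    finally show ?thesis .
  qed simp
  have "fits (N + 1) z" if "z \<in> set (input_code n \<Gamma>)" for z
  proof -
    consider "z = int n" | "z = int (length \<Gamma>)" | "z \<in> set ?xs" using \<open>z \<in> _\<close> unfolding input_code_def by auto
    moreover have "fits (N + 1) (int k)" if "k \<le> N" for k using that by (intro le_fits) simp
    ultimately show ?thesis
    proof cases
      case 3
      then have "len z \<le> sum_list (map len ?xs)" by (intro member_le_sum_list) simp_all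
      then have "len z \<le> N + 1" unfolding assms input_size_def by simp
      then show ?thesis by (rule fits_mono[OF fl])
    qed (use n \<Gamma> in blast)+
  qed
  then show "fits (N + 1) (input_of (input_code n \<Gamma>) a)" if "a \<ge> 0"
    using that unfolding input_of_def by auto
qed

context sentence
begin

text \<open>The bound \<open>H\<close> on the nonrecursive factors needs no explicit estimate: these
  factors are values of expressions to which \<open>safe_ex_sound\<close> applies, with variables 1,
  10 and 11 set to \<open>e\<close>, \<open>k\<close> and \<open>e - k\<close>. The table does not
  depend on the constraints, so an input without any will do.\<close>

lemma table_bits:
  obtains G where "pow_bounded G" "\<And>n j. j < Suc n ^ L * W \<Longrightarrow> fits (G n) (table n j)"
proof -
  let ?v = "\<lambda>e k l. (\<lambda>_. 0)(1 := int e, 10 := int k, 11 := int l) :: nat \<Rightarrow> int"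
  let ?S = "{(n, inp n [], \<lambda>_. 0, ?v e k l) | n e k l. e \<le> Suc n ^ L \<and> k \<le> Suc n ^ L \<and> l \<le> Suc n ^ L} :: ctxt set"
  let ?E1 = "\<lambda>w. EMul (EMul (EMul (xsub (EVar 1) (EVar 10)) (xinner (oms ! w) (EVar 10))) (xinner (oms ! w) (EVar 11)))
     (xcross (\<lambda>i j. EAdd (xa (oms ! w) i j) (xb (oms ! w) i j)) (EVar 10) (EVar 11))"
  let ?E2 = "\<lambda>w. EMul (xsub (EVar 1) (EVar 10)) (xcross (xa (oms ! w)) (EVar 10) (EVar 11))"
  let ?E = "ESumS {..<W} (\<lambda>w. EAdd (?E1 w) (?E2 w))"
  have base: "base_ok {1, 10, 11} ?S"
  proof (rule base_okI)
    show "pow_bounded (\<lambda>N. N + 1 + Suc N ^ L)" by simp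
    fix N I T v assume "(N, I, T, v) \<in> ?S"
    then obtain n e k l where eq: "N = n" "I = inp n []" "T = (\<lambda>_. 0)" "v = ?v e k l"
      and le: "e \<le> Suc n ^ L" "k \<le> Suc n ^ L" "l \<le> Suc n ^ L" by blast
    have N: "N = input_size n []" by (simp add: eq input_size_def)
    have v: "\<bar>v x\<bar> \<le> int (N + 1 + Suc N ^ L)" for x
    proof -
      have "\<bar>v x\<bar> \<le> int (Suc n ^ L)" using le unfolding eq(4) by (auto simp del: of_nat_power of_nat_Suc power_Suc)
      then show ?thesis unfolding eq(1) by simp
    qed
    have "fits (N + 1 + Suc N ^ L) (I a)" if "a \<ge> 0" for a
      by (rule fits_mono[OF input_bounds(3)[OF N that, folded eq(2)]]) simp
    then show "\<bar>I 0\<bar> \<le> int (N + 1 + Suc N ^ L) \<and> \<bar>I 1\<bar> \<le> int (N + 1 + Suc N ^ L) \<and> (\<forall>a\<ge>0. fits (N + 1 + Suc N ^ L) (I a)) \<and>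
      (\<forall>i\<ge>0. fits (N + 1 + Suc N ^ L) (T i)) \<and> (\<forall>x. fits (N + 1 + Suc N ^ L) (v x)) \<and>
      (\<forall>x\<in>{1, 10, 11}. \<bar>v x\<bar> \<le> int (N + 1 + Suc N ^ L))"
      using v le_fits[OF v] by (simp add: eq(1-3) input_code_nth(1) input_code_nth(2)[unfolded One_nat_def])
  qed
  have safe: "safe_ex {1, 10, 11} ?E"
    by (simp add: safe_xsub safe_xinner safe_xcross)
  obtain D where D: "pow_bounded D" "\<And>N I T v. (N, I, T, v) \<in> ?S \<Longrightarrow> bnd (D N) I T v ?E"
    using safe_ex_sound[OF base safe] by (rule safe_exE) (rule that)
  define H where "H n = (2 :: int) ^ D n" for n
  have H1: "H n \<ge> 1" for n by (simp add: H_def)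
  have terms: "\<bar>int (sub_code (Suc n) L (2 ^ Suc n) e k) * inner_code (Suc n) L (va_wt n (oms ! w)) k *
      inner_code (Suc n) L (va_wt n (oms ! w)) (e - k) *
      cross_code (Suc n) L (\<lambda>i j. va_wt n (oms ! w) i j + vb_wt n (oms ! w) i j) k (e - k)\<bar> \<le> H n"
    "\<bar>int (sub_code (Suc n) L (2 ^ Suc n) e k) * cross_code (Suc n) L (va_wt n (oms ! w)) k (e - k)\<bar> \<le> H n"
    if "w < W" "e < Suc n ^ L" "k \<le> e" for n w e k
  proof -
    let ?I = "inp n []" and ?T = "\<lambda>_ :: int. 0 :: int" and ?w = "?v e k (e - k)"
    have "(n, ?I, ?T, ?w) \<in> ?S"
    proof -
      have "e \<le> Suc n ^ L" "k \<le> Suc n ^ L" "e - k \<le> Suc n ^ L" using that by linarith+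
      then show ?thesis by blast
    qed
    from D(2)[OF this] have "bnd (D n) ?I ?T ?w ?E" .
    then have "bnd (D n) ?I ?T ?w (EAdd (?E1 w) (?E2 w))" using that(1) by (rule bnd_ESumS[OF finite_lessThan _ lessThan_iff[THEN iffD2]])
    then have f: "fits (D n) (eval ?I ?T ?w (?E1 w))" "fits (D n) (eval ?I ?T ?w (?E2 w))"
      unfolding bnd.simps(5) using bnd_fits by blast+
    have I0: "?I 0 = int n" by (rule input_code_nth(1))
    have v: "eval ?I ?T ?w (EVar 1) = int e" "eval ?I ?T ?w (EVar 10) = int k" "eval ?I ?T ?w (EVar 11) = int (e - k)"
      by simp_all
    have c1: "eval ?I ?T ?w (xcross (\<lambda>i j. EAdd (xa (oms ! w) i j) (xb (oms ! w) i j)) (EVar 10) (EVar 11)) =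
       cross_code (Suc n) L (\<lambda>i j. va_wt n (oms ! w) i j + vb_wt n (oms ! w) i j) k (e - k)"
      by (rule eval_xcross[OF I0 v(2,3)]) (simp only: eval.simps eval_xab[where I = ?I, OF I0])
    have c2: "eval ?I ?T ?w (xcross (xa (oms ! w)) (EVar 10) (EVar 11)) = cross_code (Suc n) L (va_wt n (oms ! w)) k (e - k)"
      by (rule eval_xcross[OF I0 v(2,3)]) (rule eval_xab[where I = ?I, OF I0])
    show "\<bar>int (sub_code (Suc n) L (2 ^ Suc n) e k) * inner_code (Suc n) L (va_wt n (oms ! w)) k *
      inner_code (Suc n) L (va_wt n (oms ! w)) (e - k) *
      cross_code (Suc n) L (\<lambda>i j. va_wt n (oms ! w) i j + vb_wt n (oms ! w) i j) k (e - k)\<bar> \<le> H n"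
      using f(1) unfolding eval.simps(7) c1 eval_xsub[where I = ?I, OF I0 v(1,2)] eval_xinner[where I = ?I, OF I0 v(2)] eval_xinner[where I = ?I, OF I0 v(3)] H_def
      by (rule less_imp_le)
    show "\<bar>int (sub_code (Suc n) L (2 ^ Suc n) e k) * cross_code (Suc n) L (va_wt n (oms ! w)) k (e - k)\<bar> \<le> H n"
      using f(2) unfolding eval.simps(7) c2 eval_xsub[where I = ?I, OF I0 v(1,2)] H_def
      by (rule less_imp_le)
  qed
  \<comment> \<open>The base in \<open>bip_code_bound\<close> is at most
    \<open>2 ^ (Suc n ^ L + D n + 2)\<close> and its exponent below
    \<open>2 * Suc n ^ L\<close>.\<close>
  let ?G = "\<lambda>n. (Suc n ^ L + D n + 2) * (2 * Suc n ^ L) + 1"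
  have "fits (?G n) (table n j)" if j: "j < Suc n ^ L * W" for n j
  proof -
    define e where "e = j div W"
    have e: "e < Suc n ^ L" unfolding e_def using j by (rule less_mult_imp_div_less)
    have w: "j mod W < W" using W_pos by simp
    have Q: "(1 :: nat) < 2 ^ Suc n" by (rule one_less_power) simp_all
    show ?thesis
    proof (cases "e = 0")
      case True
      have "table n j = 1" unfolding table_eq bt_eq e_def[symmetric] True by (rule bip_code_0[OF Q])
      then show ?thesis using fits_1[of "(Suc n ^ L + D n + 2) * (2 * Suc n ^ L)"] by (simp only: Suc_eq_plus1)
    next
      case False
      let ?m = "Suc n ^ L"
      have "\<bar>table n j\<bar> \<le> (2 * (int ?m * H n + 1)) ^ (2 * e - 1)"
        unfolding table_eq bt_eq e_def[symmetric]
        by (rule bip_code_bound[OF Q H1 terms(1)[OF w] terms(2)[OF w] e]) (use False in auto)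
      also have "\<dots> \<le> (2 ^ (?m + D n + 2)) ^ (2 * e - 1)"
      proof (rule power_mono)
        have "int ?m < 2 ^ ?m" by (rule of_nat_less_two_power)
        then have "int ?m * H n \<le> 2 ^ ?m * H n" using H1[of n] by (intro mult_right_mono) auto
        moreover have "(1 :: int) \<le> 2 ^ ?m * H n" unfolding H_def power_add[symmetric] by (rule one_le_power) simp
        moreover have "2 * (a + 1) \<le> 4 * z" if "a \<le> z" "1 \<le> z" for a z :: int using that by simp
        ultimately have "2 * (int ?m * H n + 1) \<le> 4 * (2 ^ ?m * H n)" by blast
        also have "\<dots> = 2 ^ (?m + D n + 2)" unfolding H_def by (simp add: power_add)
        finally show "2 * (int ?m * H n + 1) \<le> 2 ^ (?m + D n + 2)" .
        show "0 \<le> 2 * (int ?m * H n + 1)" using H1[of n] by simp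
      qed
      also have "\<dots> = 2 ^ ((?m + D n + 2) * (2 * e - 1))" by (simp only: power_mult)
      also have "\<dots> \<le> 2 ^ ((?m + D n + 2) * (2 * ?m))" using e by (intro power_increasing mult_le_mono2) auto
      also have "\<dots> < 2 ^ ?G n" by (rule power_strict_increasing) auto
      finally show ?thesis .
    qed
  qed
  moreover have "pow_bounded ?G" using D(1) by simp
  ultimately show thesis using that by blast
qed

definition "instance_ok n \<Gamma> \<longleftrightarrow> (\<forall>c\<in>set \<Gamma>. constr_ok ar n c)" for n \<Gamma>
definition "tsize n = Suc n ^ L * W"

lemma table_upto: "j < i \<Longrightarrow> table_upto t i (int j) = t j"
  by (simp add: table_upto_def)

lemma env_simps: "env1 N i 1 = int i" "env2 N z E e 3 = z" "env2 N z E e 4 = int e"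
  by (simp_all add: env1_def env2_def)

text \<open>The contexts while the table is filled and during the final loop. The case
  \<open>i = tsize n\<close> is the complete table, with which \<open>xMe\<close> is evaluated; in
  \<open>ctxts2\<close> the value \<open>E = 0\<close> occurs while the loop bound is still being
  computed.\<close>

abbreviation "ctxts1 \<equiv> {(input_size n \<Gamma>, inp n \<Gamma>, table_upto (table n) i, env1 (tsize n) i) | n \<Gamma> i.
  instance_ok n \<Gamma> \<and> i \<le> tsize n} :: ctxt set"
abbreviation "ctxts2 \<equiv> {(input_size n \<Gamma>, inp n \<Gamma>, table_upto (table n) (tsize n), env2 (tsize n) (int (gen \<Gamma> n)) E e) | n \<Gamma> E e.
  instance_ok n \<Gamma> \<and> E \<le> vE n \<and> e \<le> vE n} :: ctxt set"

lemma ctxt_base: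
  assumes G: "pow_bounded G" "\<And>N I T v x. (N, I, T, v) \<in> S \<Longrightarrow> fits (G N) (v x)"
    and A: "\<And>N I T v x. (N, I, T, v) \<in> S \<Longrightarrow> x \<in> A \<Longrightarrow> \<bar>v x\<bar> \<le> int (G N)"
    and S: "\<And>N I T v. (N, I, T, v) \<in> S \<Longrightarrow> \<exists>n \<Gamma> i. N = input_size n \<Gamma> \<and> I = inp n \<Gamma> \<and> i \<le> tsize n \<and> T = table_upto (table n) i"
  shows "base_ok A S"
proof -
  obtain B where B: "pow_bounded B" "\<And>n j. j < Suc n ^ L * W \<Longrightarrow> fits (B n) (table n j)" by (rule table_bits) blast
  then obtain c where c: "\<And>n. B n \<le> (n + 2) ^ c" unfolding pow_bounded_def by blast
  let ?B = "\<lambda>N. G N + (N + 1 + (N + 2) ^ c)"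
  show ?thesis
  proof (rule base_okI[of ?B])
    show "pow_bounded ?B" using G(1) by simp
    fix N I T v assume s: "(N, I, T, v) \<in> S"
    from S[OF this] obtain n \<Gamma> i where N: "N = input_size n \<Gamma>" and I: "I = inp n \<Gamma>" and i: "i \<le> tsize n" and T: "T = table_upto (table n) i"
      by blast
    note ib = input_bounds[OF N]
    have "fits (?B N) (I a)" if "a \<ge> 0" for a unfolding I by (rule fits_mono[OF ib(3)[OF that]]) simp
    moreover have "fits (?B N) (T a)" for a
    proof (cases "0 \<le> a \<and> a < int i")
      case True
      then have "nat a < Suc n ^ L * W" using i unfolding tsize_def by linarith
      then have "fits (B n) (T a)" using B(2) True by (simp add: T table_upto_def)
      moreover have "B n \<le> ?B N"
      proof -
        have "(n + 2) ^ c \<le> (N + 2) ^ c" using ib(1) by (intro power_mono) auto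
        then show ?thesis using c[of n] by linarith
      qed
      ultimately show ?thesis by (rule fits_mono)
    qed (auto simp: T table_upto_def)
    moreover have "\<bar>I 0\<bar> \<le> int (?B N)" "\<bar>I 1\<bar> \<le> int (?B N)"
    proof -
      have "n \<le> ?B N" "length \<Gamma> \<le> ?B N" using ib(1,2) by linarith+
      then show "\<bar>I 0\<bar> \<le> int (?B N)" "\<bar>I 1\<bar> \<le> int (?B N)"
        unfolding I input_code_nth(1,2) by (simp_all only: abs_of_nat of_nat_le_iff)
    qed
    moreover have "fits (?B N) (v x)" for x by (rule fits_mono[OF G(2)[OF s]]) simp
    moreover have "\<bar>v x\<bar> \<le> int (?B N)" if "x \<in> A" for x
      by (rule order_trans[OF A[OF s that]]) (simp only: of_nat_le_iff le_add1)
    ultimately show "\<bar>I 0\<bar> \<le> int (?B N) \<and> \<bar>I 1\<bar> \<le> int (?B N) \<and> (\<forall>a\<ge>0. fits (?B N) (I a)) \<and>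
      (\<forall>i\<ge>0. fits (?B N) (T i)) \<and> (\<forall>x. fits (?B N) (v x)) \<and> (\<forall>x\<in>A. \<bar>v x\<bar> \<le> int (?B N))" by blast
  qed
qed

lemma size_bounds:
  assumes "n \<le> N"
  shows "tsize n \<le> Suc N ^ L * W" "vM n \<le> Suc N ^ sum_list ar + 1" "vE n \<le> (Suc N ^ sum_list ar + 1) ^ P"
proof -
  have p: "Suc n ^ k \<le> Suc N ^ k" for k using assms by (intro power_mono) auto
  show "tsize n \<le> Suc N ^ L * W" unfolding tsize_def by (rule mult_le_mono1[OF p])
  show M: "vM n \<le> Suc N ^ sum_list ar + 1" unfolding vM_def using p by simp
  show "vE n \<le> (Suc N ^ sum_list ar + 1) ^ P" unfolding vE_def using M by (rule power_mono) simp
qed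

lemma base1: "base_ok {1} ctxts1"
proof -
  have v: "\<bar>v x\<bar> \<le> int (Suc N ^ L * W)" if s: "(N, I, T, v) \<in> ctxts1" for N I T v x
  proof -
    from s obtain n \<Gamma> i where eq: "N = input_size n \<Gamma>" "v = env1 (tsize n) i" and i: "i \<le> tsize n" by blast
    have "\<bar>v x\<bar> \<le> int (tsize n)" unfolding eq env1_def using i by simp
    also have "\<dots> \<le> int (Suc N ^ L * W)" using size_bounds(1)[OF input_bounds(1)[OF eq(1)]] by (simp only: of_nat_le_iff)
    finally show ?thesis .
  qed
  show ?thesis
  proof (rule ctxt_base[of "\<lambda>N. Suc N ^ L * W"])
    show "\<exists>n \<Gamma> i. N = input_size n \<Gamma> \<and> I = inp n \<Gamma> \<and> i \<le> tsize n \<and> T = table_upto (table n) i"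
      if "(N, I, T, v) \<in> ctxts1" for N I T v using that by blast
  qed (simp, rule le_fits[OF v], assumption, rule v, assumption)
qed

lemma eval_me:
  assumes "instance_ok n \<Gamma>"
  shows "eval (inp n \<Gamma>) (table_upto (table n) (tsize n)) v xMe = int (gen \<Gamma> n)"
  by (rule eval_xMe) (use assms in \<open>auto simp: instance_ok_def tsize_def intro: table_upto\<close>)

lemma safe1:
  obtains D where "pow_bounded D" "\<And>N I T v. (N, I, T, v) \<in> ctxts1 \<Longrightarrow> bnd (D N) I T v (EAdd xSt xMe)"
proof (rule safe_exE[OF safe_ex_sound[OF base1]])
  show "safe_ex {1} (EAdd xSt xMe)" using safe_xSt safe_xMe by simp
qed (rule that)

text \<open>Variable 3 holds the value of \<open>xMe\<close>, whose bit length is already bounded by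
  \<open>safe1\<close>. Only the loop index, variable 4, has to be small.\<close>

lemma base2: "base_ok {4} ctxts2"
proof -
  obtain D where D: "pow_bounded D" "\<And>N I T v. (N, I, T, v) \<in> ctxts1 \<Longrightarrow> bnd (D N) I T v (EAdd xSt xMe)" by (rule safe1) blast
  let ?G = "\<lambda>N. Suc N ^ L * W + (Suc N ^ sum_list ar + 1) ^ P + D N"
  have b: "fits (?G N) (v x) \<and> (x = 4 \<longrightarrow> \<bar>v x\<bar> \<le> int (?G N))" if s: "(N, I, T, v) \<in> ctxts2" for N I T v x
  proof -
    from s obtain n \<Gamma> E e where eq: "N = input_size n \<Gamma>" "v = env2 (tsize n) (int (gen \<Gamma> n)) E e"
      and ok: "instance_ok n \<Gamma>" and e: "E \<le> vE n" "e \<le> vE n" by blast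
    note sb = size_bounds[OF input_bounds(1)[OF eq(1)]]
    have "(N, inp n \<Gamma>, table_upto (table n) (tsize n), env1 (tsize n) (tsize n)) \<in> ctxts1" using eq(1) ok by blast
    from D(2)[OF this] have "fits (D N) (eval (inp n \<Gamma>) (table_upto (table n) (tsize n)) (env1 (tsize n) (tsize n)) xMe)"
      unfolding bnd.simps(5) using bnd_fits by blast
    then have "fits (D N) (int (gen \<Gamma> n))" unfolding eval_me[OF ok] .
    then have g: "fits (?G N) (int (gen \<Gamma> n))" by (rule fits_mono) simp
    have t: "fits (?G N) (int k)" if "k \<le> ?G N" for k using that by (intro le_fits) (simp only: abs_of_nat of_nat_le_iff)
    have "fits (?G N) (int (tsize n))" "fits (?G N) (int E)" "fits (?G N) (int e)" "fits (?G N) 0" by (rule t, use sb e in linarith)+ simp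
    moreover have "\<bar>int e\<bar> \<le> int (?G N)" using sb e by linarith
    ultimately show ?thesis unfolding eq(2) env2_def using g by (simp only: fun_upd_apply split: if_splits) auto
  qed
  show ?thesis
  proof (rule ctxt_base[of ?G])
    show "pow_bounded ?G" using D(1) by simp
    show "\<exists>n \<Gamma> i. N = input_size n \<Gamma> \<and> I = inp n \<Gamma> \<and> i \<le> tsize n \<and> T = table_upto (table n) i"
      if "(N, I, T, v) \<in> ctxts2" for N I T v using that by blast
    show "fits (?G N) (v x)" if "(N, I, T, v) \<in> ctxts2" for N I T v x using b[OF that] by blast
    show "\<bar>v x\<bar> \<le> int (?G N)" if "(N, I, T, v) \<in> ctxts2" "x \<in> {4}" for N I T v x using b[OF that(1), of x] that(2) by blast
  qed
qed

text \<open>All expressions of the final stage are bundled into one, so that a single application of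
  \<open>safe_ex_sound\<close> bounds each of them.\<close>

abbreviation "xall \<equiv> EAdd (EAdd xE xCo) (ESumS {..<P} (\<lambda>p. EAdd (xk p) (xKc p)))"

lemma safe2:
  obtains D where "pow_bounded D" "\<And>N I T v. (N, I, T, v) \<in> ctxts2 \<Longrightarrow> bnd (D N) I T v xall"
proof (rule safe_exE[OF safe_ex_sound[OF base2]])
  show "safe_ex {4} xall" using safe_xCo by simp
qed (rule that)

lemma safe0:
  obtains D where "pow_bounded D" "\<And>n \<Gamma>. bnd (D (input_size n \<Gamma>)) (inp n \<Gamma>) (\<lambda>_. 0) (\<lambda>_. 0) xTb"
proof -
  let ?S = "{(input_size n \<Gamma>, inp n \<Gamma>, \<lambda>_. 0, \<lambda>_. 0) | n \<Gamma>. True} :: ctxt set"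
  have z: "table_upto (table n) 0 = (\<lambda>_. 0)" for n by (auto simp: table_upto_def)
  have "base_ok {} ?S"
  proof (rule ctxt_base[of "\<lambda>_. 0"])
    show "\<exists>n \<Gamma> i. N = input_size n \<Gamma> \<and> I = inp n \<Gamma> \<and> i \<le> tsize n \<and> T = table_upto (table n) i"
      if s: "(N, I, T, v) \<in> ?S" for N I T v
    proof -
      from s obtain n \<Gamma> where "N = input_size n \<Gamma>" "I = inp n \<Gamma>" "T = (\<lambda>_. 0)" by blast
      then show ?thesis using z[of n] by (intro exI[of _ n] exI[of _ \<Gamma>] exI[of _ "0::nat"]) simp
    qed
  qed auto
  from safe_ex_sound[OF this safe_consts(10)] obtain D where D: "pow_bounded D" "\<And>N I T v. (N, I, T, v) \<in> ?S \<Longrightarrow> bnd (D N) I T v xTb"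
    by (rule safe_exE) (rule that, assumption, blast)
  have "bnd (D (input_size n \<Gamma>)) (inp n \<Gamma>) (\<lambda>_. 0) (\<lambda>_. 0) xTb" for n \<Gamma> by (rule D(2)) blast
  then show thesis using D(1) that by blast
qed

lemma eval_xCo:
  assumes "instance_ok n \<Gamma>"
  shows "eval (inp n \<Gamma>) T (env2 z (int (gen \<Gamma> n)) E e) xCo =
    int (digit (vU n) (gen \<Gamma> n) e) * of_bool (\<forall>c\<in>set \<Gamma>. card_ok c (digit (vM n) e))"
proof -
  let ?v = "env2 z (int (gen \<Gamma> n)) E e"
  have "eval (inp n \<Gamma>) T ?v (EDig xU (EVar 3) (EVar 4)) = int (digit (vU n) (gen \<Gamma> n) e)"
    by (rule eval_EDig[OF eval_consts(4)[where I = "inp n \<Gamma>" and n = n, OF input_code_nth(1)]]) (simp_all only: eval.simps env_simps)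
  moreover have "eval (inp n \<Gamma>) T ?v xcard = of_bool (\<forall>c\<in>set \<Gamma>. card_ok c (digit (vM n) e))"
    by (rule eval_xcard) (use assms in \<open>auto simp: instance_ok_def env_simps\<close>)
  ultimately show ?thesis unfolding xCo_def eval.simps(7) by (simp only:)
qed

lemma eval_xk:
  assumes I0: "I 0 = int n" and v: "v 4 = int e"
  shows "eval I T v (xk p) = int (digit (vM n) e p)" "eval I T v (xKc p) = int (n ^ (ar ! p) - digit (vM n) e p)"
proof -
  show k: "eval I T v (xk p) = int (digit (vM n) e p)"
    unfolding xk_def by (rule eval_EDig[OF eval_consts(2)[where I = I and n = n, OF I0]]) (simp_all add: v)
  have "eval I T v (ESub (EPow xN (ELit (int (ar ! p)))) (xk p)) = int (n ^ (ar ! p)) - int (digit (vM n) e p)"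
    by (simp add: k I0)
  then show "eval I T v (xKc p) = int (n ^ (ar ! p) - digit (vM n) e p)"
    unfolding xKc_def Let_def eval.simps(11) eval.simps(1) by (simp only:) auto
qed

lemma program:
  fixes w wbar :: "nat \<Rightarrow> real"
  obtains c :: com and B where "pow_bounded B" "\<And>n \<Gamma>. instance_ok n \<Gamma> \<Longrightarrow>
    \<exists>m r. runs w wbar c (initial_state (input_code n \<Gamma>)) (B (input_size n \<Gamma>)) (m, r) \<and>
      fst (r 0) = wfomc ar (conj_with_axiom \<Phi> \<Gamma> bipartite R n) n w wbar"
proof -
  obtain D0 where D0: "pow_bounded D0" "\<And>n \<Gamma>. bnd (D0 (input_size n \<Gamma>)) (inp n \<Gamma>) (\<lambda>_. 0) (\<lambda>_. 0) xTb"
    by (rule safe0) (rule that)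
  obtain D1 where D1: "pow_bounded D1" "\<And>N I T v. (N, I, T, v) \<in> ctxts1 \<Longrightarrow> bnd (D1 N) I T v (EAdd xSt xMe)"
    by (rule safe1) (rule that)
  obtain D2 where D2: "pow_bounded D2" "\<And>N I T v. (N, I, T, v) \<in> ctxts2 \<Longrightarrow> bnd (D2 N) I T v xall"
    by (rule safe2) (rule that)
  define D where "D N = D0 N + D1 N + D2 N + Suc N ^ L * W + (Suc N ^ sum_list ar + 1) ^ P + (Suc N ^ sum_list ar + 1)" for N
  have D: "pow_bounded D" unfolding D_def using D0 D1 D2 by simp
  have Dle: "D0 N \<le> D N" "D1 N \<le> D N" "D2 N \<le> D N" for N unfolding D_def by simp_all
  define S where "S = {(input_size n \<Gamma>, inp n \<Gamma>) | n \<Gamma>. instance_ok n \<Gamma>}"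
  \<comment> \<open>The parameters of \<open>top_prog_correct\<close> are functions of the input, so
    \<open>n\<close> is recovered from its first cell.\<close>
  define nn where "nn I = nat (I 0)" for I :: "int \<Rightarrow> int"
  define me where "me I = eval I (table_upto (table (nn I)) (tsize (nn I))) (env1 (tsize (nn I)) (tsize (nn I))) xMe" for I
  define co where "co I e = eval I (table_upto (table (nn I)) (tsize (nn I))) (env2 (tsize (nn I)) (me I) (vE (nn I)) e) xCo" for I e
  define kv where "kv I e p = digit (vM (nn I)) e p" for I e p
  define Kv where "Kv I e p = nn I ^ (ar ! p) - digit (vM (nn I)) e p" for I e p
  have SE: "\<exists>n \<Gamma>. instance_ok n \<Gamma> \<and> N = input_size n \<Gamma> \<and> I = inp n \<Gamma>" if "(N, I) \<in> S" for N I
    using that unfolding S_def by blast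
  have nn: "nn (inp n \<Gamma>) = n" for n \<Gamma> by (simp add: nn_def input_code_nth(1))
  have me: "me (inp n \<Gamma>) = int (gen \<Gamma> n)" if "instance_ok n \<Gamma>" for n \<Gamma>
    unfolding me_def nn by (rule eval_me[OF that])
  have two: "bnd (D (input_size n \<Gamma>)) (inp n \<Gamma>) (table_upto (table n) (tsize n)) (env2 (tsize n) (int (gen \<Gamma> n)) E e) xall"
    if "instance_ok n \<Gamma>" "E \<le> vE n" "e \<le> vE n" for n \<Gamma> E e
    by (rule bnd_mono[OF D2(2) Dle(3)]) (use that in blast)
  have one: "bnd (D (input_size n \<Gamma>)) (inp n \<Gamma>) (table_upto (table n) i) (env1 (tsize n) i) (EAdd xSt xMe)"
    if "instance_ok n \<Gamma>" "i \<le> tsize n" for n \<Gamma> i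
    by (rule bnd_mono[OF D1(2) Dle(2)]) (use that in blast)
  let ?R = "\<lambda>B N I m. \<exists>m' r'. runs w wbar (top_prog xTb xSt xMe xE xCo xk xKc P) (m, \<lambda>_. (0, 1)) (B N) (m', r') \<and>
      fst (r' 0) = (\<Sum>e<vE (nn I). of_int (co I e) * (\<Prod>p<P. w p ^ kv I e p * wbar p ^ Kv I e p))"
  have "\<exists>B. pow_bounded B \<and> (\<forall>N I m. (N, I) \<in> S \<longrightarrow> inp_of m = I \<longrightarrow> (\<forall>a<0. m a = 0) \<longrightarrow> ?R B N I m)"
  proof (rule top_prog_correct[where w = w and wbar = wbar and D = D and S = S and tbn = "\<lambda>I. tsize (nn I)" and
        eb = "\<lambda>I. vE (nn I)" and tbl = "\<lambda>I. table (nn I)" and me = me and co = co and kv = kv and Kv = Kv and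
        Tb = xTb and St = xSt and Me = xMe and Eb = xE and Co = xCo and ks = xk and Ks = xKc and P = P])
    fix N I assume "(N, I) \<in> S"
    from SE[OF this] obtain n \<Gamma> where ok: "instance_ok n \<Gamma>" and N: "N = input_size n \<Gamma>" and I: "I = inp n \<Gamma>" by blast
    have I0: "I 0 = int n" unfolding I by (rule input_code_nth(1))
    have nI: "nn I = n" unfolding I by (rule nn)
    have mI: "me I = int (gen \<Gamma> n)" unfolding I by (rule me[OF ok])
    note sb = size_bounds[OF input_bounds(1)[OF N]]
    have sz: "tsize n \<le> D N" "vE n \<le> D N" "vM n \<le> D N" unfolding D_def using sb by linarith+
    have "bnd (D N) I (\<lambda>_. 0) (\<lambda>_. 0) xTb" unfolding N I by (rule bnd_mono[OF D0(2) Dle(1)])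
    moreover have "eval I (\<lambda>_. 0) (\<lambda>_. 0) xTb = int (tsize n)"
      unfolding tsize_def by (rule eval_consts(10)[where I = I and n = n, OF I0])
    ultimately show "bnd (D N) I (\<lambda>_. 0) (\<lambda>_. 0) xTb \<and> eval I (\<lambda>_. 0) (\<lambda>_. 0) xTb = int (tsize (nn I)) \<and> tsize (nn I) \<le> D N"
      using sz(1) unfolding nI by blast
    note one' = one[OF ok, folded N I] and two' = two[OF ok, folded N I]
    show "bnd (D N) I (table_upto (table (nn I)) (tsize (nn I))) (env1 (tsize (nn I)) (tsize (nn I))) xMe \<and>
      eval I (table_upto (table (nn I)) (tsize (nn I))) (env1 (tsize (nn I)) (tsize (nn I))) xMe = me I"
      using one'[OF order_refl] unfolding bnd.simps(5) me_def nI by blast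
    show "bnd (D N) I (table_upto (table (nn I)) (tsize (nn I))) (env2 (tsize (nn I)) (me I) 0 0) xE \<and>
      eval I (table_upto (table (nn I)) (tsize (nn I))) (env2 (tsize (nn I)) (me I) 0 0) xE = int (vE (nn I)) \<and> vE (nn I) \<le> D N"
      using two'[OF le0 le0] sz(2) eval_consts(3)[where I = I and n = n, OF I0] unfolding bnd.simps(5) nI mI by simp
    show "bnd (D N) I (table_upto (table (nn I)) i) (env1 (tsize (nn I)) i) xSt \<and>
      eval I (table_upto (table (nn I)) i) (env1 (tsize (nn I)) i) xSt = table (nn I) i" if "i < tsize (nn I)" for i
    proof -
      have "eval I (table_upto (table n) i) (env1 (tsize n) i) xSt = table n i"
        by (rule eval_xSt[where I = I and n = n and i = i and v = "env1 (tsize n) i", OF I0 env_simps(1)]) (rule table_upto)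
      then show ?thesis using one'[of i] that unfolding bnd.simps(5) nI by simp
    qed
    fix e assume e: "e < vE (nn I)"
    have xa: "bnd (D N) I (table_upto (table n) (tsize n)) (env2 (tsize n) (int (gen \<Gamma> n)) (vE n) e) xall"
      by (rule two'[OF order_refl]) (use e nI in simp)
    show "bnd (D N) I (table_upto (table (nn I)) (tsize (nn I))) (env2 (tsize (nn I)) (me I) (vE (nn I)) e) xCo \<and>
      eval I (table_upto (table (nn I)) (tsize (nn I))) (env2 (tsize (nn I)) (me I) (vE (nn I)) e) xCo = co I e"
      using xa unfolding bnd.simps(5) co_def nI mI by blast
    fix p assume p: "p < P"
    have "bnd (D N) I (table_upto (table n) (tsize n)) (env2 (tsize n) (int (gen \<Gamma> n)) (vE n) e) (EAdd (xk p) (xKc p))"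
      by (rule bnd_ESumS[of "{..<P}" _ _ _ _ "\<lambda>p. EAdd (xk p) (xKc p)" p]) (use xa p in \<open>simp_all only: bnd.simps(5) finite_lessThan lessThan_iff\<close>)
    moreover have "digit (vM n) e p < vM n" by (rule digit_less) (simp add: vM_def)
    moreover have "n ^ (ar ! p) < vM n" by (rule pow_less_vM[OF p])
    ultimately show "bnd (D N) I (table_upto (table (nn I)) (tsize (nn I))) (env2 (tsize (nn I)) (me I) (vE (nn I)) e) (xk p) \<and>
      eval I (table_upto (table (nn I)) (tsize (nn I))) (env2 (tsize (nn I)) (me I) (vE (nn I)) e) (xk p) = int (kv I e p) \<and> kv I e p \<le> D N \<and>
      bnd (D N) I (table_upto (table (nn I)) (tsize (nn I))) (env2 (tsize (nn I)) (me I) (vE (nn I)) e) (xKc p) \<and>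
      eval I (table_upto (table (nn I)) (tsize (nn I))) (env2 (tsize (nn I)) (me I) (vE (nn I)) e) (xKc p) = int (Kv I e p) \<and> Kv I e p \<le> D N"
      using eval_xk[where I = I and n = n and e = e and v = "env2 (tsize n) (int (gen \<Gamma> n)) (vE n) e", OF I0 env_simps(3)] sz(3) unfolding bnd.simps(5) kv_def Kv_def nI mI by simp
  qed (rule D, blast)
  then obtain B where B: "pow_bounded B"
    "\<And>N I m. (N, I) \<in> S \<Longrightarrow> inp_of m = I \<Longrightarrow> \<forall>a<0. m a = 0 \<Longrightarrow> ?R B N I m" by blast
  have "\<exists>m r. runs w wbar (top_prog xTb xSt xMe xE xCo xk xKc P) (initial_state (input_code n \<Gamma>)) (B (input_size n \<Gamma>)) (m, r) \<and>
      fst (r 0) = wfomc ar (conj_with_axiom \<Phi> \<Gamma> bipartite R n) n w wbar" if ok: "instance_ok n \<Gamma>" for n \<Gamma>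
  proof -
    have S: "(input_size n \<Gamma>, inp n \<Gamma>) \<in> S" unfolding S_def using ok by blast
    have i: "inp_of (input_of xs) = input_of xs" "\<forall>a<0. input_of xs a = 0" for xs
      by (auto simp: inp_of_def input_of_def)
    have init: "initial_state xs = (input_of xs, \<lambda>_. (0, 1))" for xs
      by (simp add: initial_state_def input_of_def[abs_def])
    have "(\<Sum>e<vE n. of_int (co (inp n \<Gamma>) e) * (\<Prod>p<P. w p ^ kv (inp n \<Gamma>) e p * wbar p ^ Kv (inp n \<Gamma>) e p)) =
      wfomc ar (conj_with_axiom \<Phi> \<Gamma> bipartite R n) n w wbar"
      unfolding co_def kv_def Kv_def nn me[OF ok] eval_xCo[OF ok]
      by (rule wfomc_eq[symmetric]) (use ok in \<open>simp add: instance_ok_def\<close>)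
    then show ?thesis using B(2)[OF S i(1) i(2)] unfolding init nn by simp
  qed
  then show thesis using B(1) that by blast
qed

end

theorem theorem3p7:
  shows "domain_liftable_with_axiom bipartite"
  unfolding domain_liftable_with_axiom_def
proof (intro allI impI)
  fix ar :: vocab and \<Phi> :: fm and w wbar :: "nat \<Rightarrow> real" and R :: nat
  assume c2: "C2_sentence ar \<Phi>" and R: "R < length ar" "ar ! R = 2"
  interpret sentence ar \<Phi> R
    by standard (use c2 R in \<open>simp_all add: C2_sentence_def\<close>)
  obtain c :: com and B where B: "pow_bounded B" and c: "\<And>n \<Gamma>. instance_ok n \<Gamma> \<Longrightarrow>
    \<exists>m r. runs w wbar c (initial_state (input_code n \<Gamma>)) (B (input_size n \<Gamma>)) (m, r) \<and>
      fst (r 0) = wfomc ar (conj_with_axiom \<Phi> \<Gamma> bipartite R n) n w wbar"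
    by (rule program[where w = w and wbar = wbar]) (rule that)
  obtain q :: "nat poly" where q: "\<And>N. B N \<le> poly q N" using pow_bounded_poly[OF B] by blast
  show "\<exists>(c :: com) (q :: nat poly). \<forall>(n :: nat) (\<Gamma> :: constr list).
           (\<forall>\<gamma>\<in>set \<Gamma>. constr_ok ar n \<gamma>) \<longrightarrow>
           (\<exists>t m r. exec w wbar c (initial_state (input_code n \<Gamma>)) t (m, r) \<and>
              t \<le> poly q (input_size n \<Gamma>) \<and>
              fst (r 0) = wfomc ar (conj_with_axiom \<Phi> \<Gamma> bipartite R n) n w wbar)"
  proof (rule exI[of _ c], rule exI[of _ q], intro allI impI)
    fix n \<Gamma> assume "\<forall>\<gamma>\<in>set \<Gamma>. constr_ok ar n \<gamma>"
    then have "instance_ok n \<Gamma>" by (simp add: instance_ok_def)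
    from c[OF this] obtain m r t where "t \<le> B (input_size n \<Gamma>)"
      "exec w wbar c (initial_state (input_code n \<Gamma>)) t (m, r)"
      "fst (r 0) = wfomc ar (conj_with_axiom \<Phi> \<Gamma> bipartite R n) n w wbar" unfolding runs_def by blast
    moreover from this(1) have "t \<le> poly q (input_size n \<Gamma>)" using q by (rule le_trans)
    ultimately show "\<exists>t m r. exec w wbar c (initial_state (input_code n \<Gamma>)) t (m, r) \<and>
              t \<le> poly q (input_size n \<Gamma>) \<and>
              fst (r 0) = wfomc ar (conj_with_axiom \<Phi> \<Gamma> bipartite R n) n w wbar" by blast
  qed
qed

end
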